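(* Let $(V_h,I_h)$ be one of $(\mathrm M(\mathcal T),\mathrm{id})$, $(P_2(\mathcal T),\mathrm{id})$, $(S^2_0(\mathcal T),I_{\mathrm C})$. Let $u\in V=H^2_0(\Omega)$ solve $a(u,v)=F(v)$ for all $v\in V$ with right-hand side $F=\widehat F|_V\in V^*$, $\widehat F$ of the form (S) in the context, and let $u_h\in V_h$. If the data approximations $G_0,G_1$ are edgewise polynomials of degree at most $k$ and $(F_\alpha)_{|\alpha|\le2}\in P_k(\mathcal T)^6$ are piecewise polynomials of degree at most $k\in\mathbb N_0$, then $$C^{-1}\mu(\mathcal T)\le|||u-u_h|||_{\mathrm{pw}}+\mathrm{apx}(F,\mathcal T)$$ with a constant $C>0$ that depends exclusively on the shape-regularity of $\mathcal T$ and on $k$.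
   Context: Mesh and spaces. $\Omega\subset\mathbb R^2$ is a bounded polygonal Lipschitz domain, $\mathcal T$ a shape-regular conforming triangulation into triangles with vertices $\mathcal V=\mathcal V(\Omega)\cup\mathcal V(\partial\Omega)$ and edges $\mathcal E=\mathcal E(\Omega)\cup\mathcal E(\partial\Omega)$ (interior/boundary); $\mathcal E(T)$ edges of $T$, $\mathcal T(z)$ triangles containing $z$; $h_T=\mathrm{diam}(T)$, $h_E=|E|$, $h_{\mathcal T}|_T=h_T$; $\|\cdot\|$ is the $L^2(\Omega)$ norm. $P_k(\mathcal T)$: piecewise polynomials of degree $\le k$; $H^m(\mathcal T)=\prod_TH^m(T)$; subscript pw: piecewise differential operators. Each edge has a fixed unit normal $\nu_E$ (pointing outward on $\partial\Omega$) and unit tangent $\tau_E$. For $E=\partial T_+\cap\partial T_-$ with $\nu_E=\pm\nu_{T_\pm}$: $[v]_E=v|_{T_+}-v|_{T_-}$, $\langle v\rangle_E=\frac12(v|_{T_+}+v|_{T_-})$; on boundary edges $[v]_E=\langle v\rangle_E=v|_E$. $V=H^2_0(\Omega)$; $a_{\mathrm{pw}}(v,w)=\int_\Omega D^2_{\mathrm{pw}}v:D^2_{\mathrm{pw}}w\,dx$, $a=a_{\mathrm{pw}}|_{V\times V}$, $|||v|||_{\mathrm{pw}}=\|D^2_{\mathrm{pw}}v\|$. Morley space $\mathrm M(\mathcal T)$: all $p\in P_2(\mathcal T)$ continuous at interior vertices, zero at boundary vertices, with $[\partial p/\partial\nu_E]_E(\mathrm{mid}\,E)=0$ for all $E\in\mathcal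 E$. $S^2_0(\mathcal T)=P_2(\mathcal T)\cap H^1_0(\Omega)$. $I_{\mathrm C}:\mathrm M(\mathcal T)\to S^2_0(\mathcal T)$ is the $P_2$ Lagrange interpolation with vertex values $v(z)$, midpoint values $\langle v\rangle_E(\mathrm{mid}\,E)$ on interior edges and $0$ on boundary edges (here it only serves to distinguish the cases of $\mu_3$). Source (S). With $f_\alpha\in L^2(\Omega)$ ($|\alpha|\le2$, $\alpha\in\mathbb N_0^2$), $\Gamma_0,\Gamma_1$ unions of sets $\mathcal E(\Gamma_0),\mathcal E(\Gamma_1)\subset\mathcal E(\Omega)$ of interior edges, $g_j\in L^2(\Gamma_j)$, a finite set $A\subset\mathcal V(\Omega)$ and $\beta_{T,z}\in\mathbb R$, for $\widehat v\in H^2(\mathcal T)$, $$\widehat F(\widehat v)=\sum_{|\alpha|\le2}(f_\alpha,\partial^\alpha_{\mathrm{pw}}\widehat v)_{L^2(\Omega)}+\sum_{j=0,1}\sum_{E\in\mathcal E(\Gamma_j)}(g_j,\langle\partial_{\nu}^j\widehat v\rangle_E)_{L^2(E)}+\sum_{z\in A}\sum_{T\in\mathcal T(z)}\beta_{T,z}\widehat v|_T(z),$$ where $\partial_\nu^0v=v$ and $\partial_\nu^1v=\partial v/\partial\nu_E$. With approximations $F_\alpha$ of $f_\alpha$ and $G_j$ of $g_j$ on $\Gamma_j$ (extended by zero to all edges), the data approximation error is $\mathrm{apx}(F,\mathcal T)=(\sum_{T\in\mathcal T}\mathrm{apx}^2(F,T))^{1/2}$, $$\mathrm{apx}^2(F,T)=\sum_{|\alpha|\le2}\|h_T^{2-|\alpha|}(f_\alpha-F_\alpha)\|_{L^2(T)}^2+\sum_{j=0,1}\sum_{E\in\mathcal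 E(\Gamma_j)\cap\mathcal E(T)}\|h_E^{3/2-j}(g_j-G_j)\|_{L^2(E)}^2.$$ Estimator. $\mathbf F_0=F_{(0,0)}$, $\mathbf F_1=(F_{(1,0)},F_{(0,1)})^\top$, $\mathbf F_2=\begin{pmatrix}F_{(2,0)}&\frac12F_{(1,1)}\\\frac12F_{(1,1)}&F_{(0,2)}\end{pmatrix}$, row-wise divergence, $\Pi_{E,0}$ the $L^2(E)$ projection onto constants; $\mu(\mathcal T)=(\mu_1^2+\mu_2^2+\mu_3^2)^{1/2}$ with $\mu_1^2=\|h_{\mathcal T}^2(\mathbf F_0-\mathrm{div}_{\mathrm{pw}}\mathbf F_1+\mathrm{div}^2_{\mathrm{pw}}\mathbf F_2)\|^2$, $\mu_2^2=\sum_{E\in\mathcal E(\Omega)}h_E^3\|G_0+[\mathbf F_1-\mathrm{div}_{\mathrm{pw}}\mathbf F_2-\partial(\mathbf F_2\tau_E)/\partial s]_E\cdot\nu_E\|_{L^2(E)}^2$, $\mu_3^2=\sum_{E\in\mathcal E(\Omega)}h_E\|(1-\Pi_{E,0})(G_1+[\mathbf F_2\nu_E]_E\cdot\nu_E)\|_{L^2(E)}^2$ if $I_h=\mathrm{id}$, and $\mu_3^2=\sum_{E\in\mathcal E(\Omega)}h_E\|G_1+[(\mathbf F_2-D^2_{\mathrm{pw}}u_h)\nu_E]_E\cdot\nu_E\|_{L^2(E)}^2$ if $I_h=I_{\mathrm C}$ ($\partial/\partial s$ is the tangential derivative along $E$). *)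

theory Defs
  imports "HOL-Analysis.Analysis"
begin

type_synonym plane = "real^2"

text \<open>
  A piecewise function with respect to a triangulation is a family \<open>q :: plane set \<Rightarrow> plane \<Rightarrow> 'b\<close>,
  where \<open>q T\<close> is the restriction to the triangle \<open>T\<close>. This is the product space
  reading of \<open>H\<^sup>m(\<T>)\<close> and \<open>P\<^sub>k(\<T>)\<close>, and it keeps the one-sided
  values on edges and at vertices apart. Multi-indices are pairs of natural numbers.
\<close>

type_synonym 'b pw_fun = "plane set \<Rightarrow> plane \<Rightarrow> 'b"

abbreviation multi_upto :: "nat \<Rightarrow> (nat \<times> nat) set" where
  "multi_upto m \<equiv> {\<alpha>. fst \<alpha> + snd \<alpha> \<le> m}"


section \<open>Classical derivatives\<close>

definition partial :: "2 \<Rightarrow> (plane \<Rightarrow> real) \<Rightarrow> plane \<Rightarrow> real" where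
  "partial i \<phi> x = frechet_derivative \<phi> (at x) (axis i 1)"

definition multi_partial :: "nat \<times> nat \<Rightarrow> (plane \<Rightarrow> real) \<Rightarrow> plane \<Rightarrow> real" where
  "multi_partial \<alpha> \<phi> = (partial 1 ^^ fst \<alpha>) ((partial 2 ^^ snd \<alpha>) \<phi>)"

definition smooth :: "(plane \<Rightarrow> real) \<Rightarrow> bool" where
  "smooth \<phi> \<longleftrightarrow> (\<forall>is :: 2 list. foldr partial is \<phi> differentiable_on UNIV)"

definition test_funs :: "plane set \<Rightarrow> (plane \<Rightarrow> real) set" where
  "test_funs U = {\<phi>. smooth \<phi> \<and> compact (closure {x. \<phi> x \<noteq> 0}) \<and> closure {x. \<phi> x \<noteq> 0} \<subseteq> U}"

definition divergence :: "(plane \<Rightarrow> real^2) \<Rightarrow> plane \<Rightarrow> real" where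
  "divergence q x = (\<Sum>i\<in>UNIV. partial i (\<lambda>y. q y $ i) x)"

definition row_divergence :: "(plane \<Rightarrow> real^2^2) \<Rightarrow> plane \<Rightarrow> real^2" where
  "row_divergence M x = (\<chi> i. divergence (\<lambda>y. M y $ i) x)"

definition hessian :: "(plane \<Rightarrow> real) \<Rightarrow> plane \<Rightarrow> real^2^2" where
  "hessian p x = (\<chi> i j. partial i (partial j p) x)"


section \<open>Lebesgue and Sobolev spaces\<close>

text \<open>Elements of these spaces are representatives, not equivalence classes.\<close>

definition L2 :: "'a measure \<Rightarrow> ('a \<Rightarrow> real) set" where
  "L2 M = {f \<in> borel_measurable M. integrable M (\<lambda>x. (f x)\<^sup>2)}"

definition L2_nrm :: "'a measure \<Rightarrow> ('a \<Rightarrow> 'b::real_normed_vector) \<Rightarrow> real" where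
  "L2_nrm M f = sqrt (LINT x|M. (norm (f x))\<^sup>2)"

definition is_weak_deriv ::
  "plane set \<Rightarrow> nat \<times> nat \<Rightarrow> (plane \<Rightarrow> real) \<Rightarrow> (plane \<Rightarrow> real) \<Rightarrow> bool" where
  "is_weak_deriv U \<alpha> v w \<longleftrightarrow>
     (\<forall>\<phi>\<in>test_funs U. (LINT x|lebesgue_on U. v x * multi_partial \<alpha> \<phi> x) =
        (- 1) ^ (fst \<alpha> + snd \<alpha>) * (LINT x|lebesgue_on U. w x * \<phi> x))"

definition weak_deriv :: "plane set \<Rightarrow> nat \<times> nat \<Rightarrow> (plane \<Rightarrow> real) \<Rightarrow> plane \<Rightarrow> real" where
  "weak_deriv U \<alpha> v = (SOME w. w \<in> L2 (lebesgue_on U) \<and> is_weak_deriv U \<alpha> v w)"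

definition H_space :: "nat \<Rightarrow> plane set \<Rightarrow> (plane \<Rightarrow> real) set" where
  "H_space m U = {v \<in> L2 (lebesgue_on U).
     \<forall>\<alpha>\<in>multi_upto m. \<exists>w\<in>L2 (lebesgue_on U). is_weak_deriv U \<alpha> v w}"

definition H_nrm :: "nat \<Rightarrow> plane set \<Rightarrow> (plane \<Rightarrow> real) \<Rightarrow> real" where
  "H_nrm m U v = sqrt (\<Sum>\<alpha>\<in>multi_upto m. (L2_nrm (lebesgue_on U) (weak_deriv U \<alpha> v))\<^sup>2)"

definition H0_space :: "nat \<Rightarrow> plane set \<Rightarrow> (plane \<Rightarrow> real) set" where
  "H0_space m U = {v \<in> H_space m U. \<exists>\<phi> :: nat \<Rightarrow> plane \<Rightarrow> real.
     (\<forall>n. \<phi> n \<in> test_funs U) \<and> (\<lambda>n. H_nrm m U (\<lambda>x. v x - \<phi> n x)) \<longlonglongrightarrow> 0}"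

definition unit_multi :: "2 \<Rightarrow> nat \<times> nat" where
  "unit_multi i = (if i = 1 then (1, 0) else (0, 1))"

definition weak_grad :: "plane set \<Rightarrow> (plane \<Rightarrow> real) \<Rightarrow> plane \<Rightarrow> real^2" where
  "weak_grad U v x = (\<chi> i. weak_deriv U (unit_multi i) v x)"

definition weak_hessian :: "plane set \<Rightarrow> (plane \<Rightarrow> real) \<Rightarrow> plane \<Rightarrow> real^2^2" where
  "weak_hessian U v x = (\<chi> i j. weak_deriv U (unit_multi i + unit_multi j) v x)"


section \<open>Domain and triangulation\<close>

text \<open>Near each boundary point, \<open>\<Omega>\<close> is the strict epigraph of a Lipschitz
  function in a rotated coordinate system.\<close>

definition Lipschitz_domain :: "plane set \<Rightarrow> bool" where
  "Lipschitz_domain \<Omega> \<longleftrightarrow> open \<Omega> \<and> connected \<Omega> \<and> \<Omega> \<noteq> {} \<and>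
     (\<forall>z\<in>frontier \<Omega>. \<exists>r>0. \<exists>e1 e2 L \<gamma>.
        norm e1 = 1 \<and> norm e2 = 1 \<and> e1 \<bullet> e2 = 0 \<and> L-lipschitz_on UNIV \<gamma> \<and>
        (\<forall>y\<in>ball z r. y \<in> \<Omega> \<longleftrightarrow> \<gamma> ((y - z) \<bullet> e1) < (y - z) \<bullet> e2))"

definition polygonal :: "plane set \<Rightarrow> bool" where
  "polygonal \<Omega> \<longleftrightarrow>
     (\<exists>S. finite S \<and> (\<forall>s\<in>S. \<exists>a b. s = closed_segment a b) \<and> frontier \<Omega> = \<Union>S)"

definition conforming_triangulation :: "plane set \<Rightarrow> plane set set \<Rightarrow> bool" where
  "conforming_triangulation \<Omega> \<T> \<longleftrightarrow>
     triangulation \<T> \<and> (\<forall>T\<in>\<T>. 2 simplex T) \<and> \<Union>\<T> = closure \<Omega>"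

definition inball_diameter :: "plane set \<Rightarrow> real" where
  "inball_diameter T = Sup {2 * r |r. r \<ge> 0 \<and> (\<exists>x. cball x r \<subseteq> T)}"

definition shape_regular :: "real \<Rightarrow> plane set set \<Rightarrow> bool" where
  "shape_regular \<kappa> \<T> \<longleftrightarrow> (\<forall>T\<in>\<T>. diameter T \<le> \<kappa> * inball_diameter T)"

definition tri_vertices :: "plane set \<Rightarrow> plane set" where
  "tri_vertices T = {z. z extreme_point_of T}"

definition vertices :: "plane set set \<Rightarrow> plane set" where
  "vertices \<T> = (\<Union>T\<in>\<T>. tri_vertices T)"

definition interior_vertices :: "plane set \<Rightarrow> plane set set \<Rightarrow> plane set" where
  "interior_vertices \<Omega> \<T> = vertices \<T> \<inter> \<Omega>"

definition boundary_vertices :: "plane set \<Rightarrow> plane set set \<Rightarrow> plane set" where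
  "boundary_vertices \<Omega> \<T> = vertices \<T> \<inter> frontier \<Omega>"

definition vertex_patch :: "plane set set \<Rightarrow> plane \<Rightarrow> plane set set" where
  "vertex_patch \<T> z = {T \<in> \<T>. z \<in> T}"

definition edges :: "plane set set \<Rightarrow> plane set set" where
  "edges \<T> = {E. \<exists>T\<in>\<T>. E edge_of T}"

definition boundary_edges :: "plane set \<Rightarrow> plane set set \<Rightarrow> plane set set" where
  "boundary_edges \<Omega> \<T> = {E \<in> edges \<T>. E \<subseteq> frontier \<Omega>}"

definition interior_edges :: "plane set \<Rightarrow> plane set set \<Rightarrow> plane set set" where
  "interior_edges \<Omega> \<T> = edges \<T> - boundary_edges \<Omega> \<T>"

definition edge_ends :: "plane set \<Rightarrow> plane \<times> plane" where
  "edge_ends E = (SOME p. E = closed_segment (fst p) (snd p))"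

definition edge_mid :: "plane set \<Rightarrow> plane" where
  "edge_mid E = midpoint (fst (edge_ends E)) (snd (edge_ends E))"

text \<open>Arc length on \<open>E\<close>, as the image of the Lebesgue measure under an arc length
  parametrization; it does not depend on the order of the end points chosen above.\<close>

definition edge_measure :: "plane set \<Rightarrow> plane measure" where
  "edge_measure E = (case edge_ends E of (a, b) \<Rightarrow>
     embed_measure (lebesgue_on {0..dist a b}) (\<lambda>s. a + (s / dist a b) *\<^sub>R (b - a)))"

definition outward :: "plane set \<Rightarrow> plane set \<Rightarrow> plane \<Rightarrow> bool" where
  "outward T E n \<longleftrightarrow> (\<forall>x\<in>T. \<forall>y\<in>E. n \<bullet> (x - y) \<le> 0)"

definition edge_frames ::
  "plane set \<Rightarrow> plane set set \<Rightarrow> (plane set \<Rightarrow> plane) \<Rightarrow> (plane set \<Rightarrow> plane) \<Rightarrow> bool" where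
  "edge_frames \<Omega> \<T> \<nu> \<tau> \<longleftrightarrow>
     (\<forall>E\<in>edges \<T>. norm (\<nu> E) = 1 \<and> (\<forall>x\<in>E. \<forall>y\<in>E. \<nu> E \<bullet> (x - y) = 0) \<and>
        norm (\<tau> E) = 1 \<and> \<tau> E \<bullet> \<nu> E = 0) \<and>
     (\<forall>E\<in>boundary_edges \<Omega> \<T>. \<forall>T\<in>\<T>. E edge_of T \<longrightarrow> outward T E (\<nu> E))"

text \<open>\<open>\<nu>\<^sub>E\<close> is the outer normal of \<open>T\<^sub>+\<close> and the inner normal of
  \<open>T\<^sub>-\<close>. On a boundary edge, only \<open>T\<^sub>+\<close> exists.\<close>

definition T_plus :: "plane set set \<Rightarrow> (plane set \<Rightarrow> plane) \<Rightarrow> plane set \<Rightarrow> plane set" where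
  "T_plus \<T> \<nu> E = (THE T. T \<in> \<T> \<and> E edge_of T \<and> outward T E (\<nu> E))"

definition T_minus :: "plane set set \<Rightarrow> (plane set \<Rightarrow> plane) \<Rightarrow> plane set \<Rightarrow> plane set" where
  "T_minus \<T> \<nu> E = (THE T. T \<in> \<T> \<and> E edge_of T \<and> outward T E (- \<nu> E))"

definition jump :: "plane set \<Rightarrow> plane set set \<Rightarrow> (plane set \<Rightarrow> plane) \<Rightarrow> plane set \<Rightarrow>
    'b::real_vector pw_fun \<Rightarrow> plane \<Rightarrow> 'b" where
  "jump \<Omega> \<T> \<nu> E q x =
     (if E \<in> interior_edges \<Omega> \<T> then q (T_plus \<T> \<nu> E) x - q (T_minus \<T> \<nu> E) x
      else q (T_plus \<T> \<nu> E) x)"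

definition avg :: "plane set \<Rightarrow> plane set set \<Rightarrow> (plane set \<Rightarrow> plane) \<Rightarrow> plane set \<Rightarrow>
    'b::real_vector pw_fun \<Rightarrow> plane \<Rightarrow> 'b" where
  "avg \<Omega> \<T> \<nu> E q x =
     (if E \<in> interior_edges \<Omega> \<T> then (1/2) *\<^sub>R (q (T_plus \<T> \<nu> E) x + q (T_minus \<T> \<nu> E) x)
      else q (T_plus \<T> \<nu> E) x)"

text \<open>The function on the domain, defined up to a null set, that a piecewise function represents.\<close>

definition pw :: "plane set set \<Rightarrow> 'b::real_vector pw_fun \<Rightarrow> plane \<Rightarrow> 'b" where
  "pw \<T> q x = (\<Sum>T\<in>\<T>. indicat_real (interior T) x *\<^sub>R q T x)"


section \<open>Energy product and discrete spaces\<close>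

text \<open>The inner product and norm of \<open>real^2^2\<close> are those of Frobenius.\<close>

definition a_pw :: "plane set \<Rightarrow> plane set set \<Rightarrow> real pw_fun \<Rightarrow> real pw_fun \<Rightarrow> real" where
  "a_pw \<Omega> \<T> v w = (LINT x|lebesgue_on \<Omega>.
     pw \<T> (\<lambda>T. weak_hessian (interior T) (v T)) x \<bullet> pw \<T> (\<lambda>T. weak_hessian (interior T) (w T)) x)"

definition energy_nrm :: "plane set \<Rightarrow> plane set set \<Rightarrow> real pw_fun \<Rightarrow> real" where
  "energy_nrm \<Omega> \<T> v = L2_nrm (lebesgue_on \<Omega>) (pw \<T> (\<lambda>T. weak_hessian (interior T) (v T)))"

definition poly_funs :: "nat \<Rightarrow> (plane \<Rightarrow> real) set" where
  "poly_funs k = {p. \<exists>c :: nat \<times> nat \<Rightarrow> real.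
     p = (\<lambda>x. \<Sum>\<alpha>\<in>multi_upto k. c \<alpha> * (x $ 1) ^ fst \<alpha> * (x $ 2) ^ snd \<alpha>)}"

definition pw_poly :: "nat \<Rightarrow> plane set set \<Rightarrow> real pw_fun set" where
  "pw_poly k \<T> = {p. \<forall>T\<in>\<T>. p T \<in> poly_funs k}"

definition edgewise_poly :: "nat \<Rightarrow> plane set set \<Rightarrow> (plane \<Rightarrow> real) \<Rightarrow> bool" where
  "edgewise_poly k S G \<longleftrightarrow> (\<forall>E\<in>S. \<exists>p\<in>poly_funs k. \<forall>x\<in>rel_interior E. G x = p x)"

definition Morley :: "plane set \<Rightarrow> plane set set \<Rightarrow> (plane set \<Rightarrow> plane) \<Rightarrow> real pw_fun set" where
  "Morley \<Omega> \<T> \<nu> = {p \<in> pw_poly 2 \<T>.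
     (\<forall>z\<in>interior_vertices \<Omega> \<T>. \<forall>T\<in>vertex_patch \<T> z. \<forall>T'\<in>vertex_patch \<T> z. p T z = p T' z) \<and>
     (\<forall>z\<in>boundary_vertices \<Omega> \<T>. \<forall>T\<in>vertex_patch \<T> z. p T z = 0) \<and>
     (\<forall>E\<in>edges \<T>.
        jump \<Omega> \<T> \<nu> E (\<lambda>T x. frechet_derivative (p T) (at x) (\<nu> E)) (edge_mid E) = 0)}"

definition S20 :: "plane set \<Rightarrow> plane set set \<Rightarrow> real pw_fun set" where
  "S20 \<Omega> \<T> = {p \<in> pw_poly 2 \<T>. pw \<T> p \<in> H0_space 1 \<Omega>}"

text \<open>The vertex value of a Morley function does not depend on the triangle, so that
  \<open>v T z\<close> is the value at the vertex \<open>z\<close>.\<close>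

definition I_C :: "plane set \<Rightarrow> plane set set \<Rightarrow> (plane set \<Rightarrow> plane) \<Rightarrow> real pw_fun \<Rightarrow> real pw_fun"
  where "I_C \<Omega> \<T> \<nu> v T = (THE p. p \<in> poly_funs 2 \<and> (\<forall>z\<in>tri_vertices T. p z = v T z) \<and>
     (\<forall>E. E edge_of T \<longrightarrow> p (edge_mid E) =
        (if E \<in> interior_edges \<Omega> \<T> then avg \<Omega> \<T> \<nu> E v (edge_mid E) else 0)))"


section \<open>Source term\<close>

text \<open>\<open>g\<close> is the trace on \<open>E\<close> of \<open>w \<in> H\<^sup>1(T)\<close>, by density of functions that are
  smooth up to the boundary. The trace is unique almost everywhere on \<open>E\<close>.\<close>

definition is_trace ::
  "plane set \<Rightarrow> plane set \<Rightarrow> (plane \<Rightarrow> real) \<Rightarrow> (plane \<Rightarrow> real) \<Rightarrow> bool" where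
  "is_trace T E w g \<longleftrightarrow> g \<in> L2 (edge_measure E) \<and>
     (\<exists>\<phi> :: nat \<Rightarrow> plane \<Rightarrow> real. (\<forall>n. smooth (\<phi> n)) \<and>
        (\<lambda>n. H_nrm 1 (interior T) (\<lambda>x. w x - \<phi> n x)) \<longlonglongrightarrow> 0 \<and>
        (\<lambda>n. L2_nrm (edge_measure E) (\<lambda>x. g x - \<phi> n x)) \<longlonglongrightarrow> 0)"

definition trace_on :: "plane set \<Rightarrow> plane set \<Rightarrow> (plane \<Rightarrow> real) \<Rightarrow> plane \<Rightarrow> real" where
  "trace_on T E w = (SOME g. is_trace T E w g)"

text \<open>The value at \<open>z\<close> of the continuous representative of \<open>v \<in> H\<^sup>2(T)\<close>.\<close>

definition point_value :: "plane set \<Rightarrow> (plane \<Rightarrow> real) \<Rightarrow> plane \<Rightarrow> real" where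
  "point_value T v z =
     (THE c. \<exists>w. continuous_on T w \<and> (AE x in lebesgue_on T. w x = v x) \<and> w z = c)"

definition normal_deriv :: "nat \<Rightarrow> plane \<Rightarrow> plane set \<Rightarrow> (plane \<Rightarrow> real) \<Rightarrow> plane \<Rightarrow> real" where
  "normal_deriv j n U v x = (if j = 0 then v x else weak_grad U v x \<bullet> n)"

text \<open>\<open>E\<Gamma> j\<close> is the set of edges whose union is \<open>\<Gamma>\<^sub>j\<close>.\<close>

definition F_hat :: "plane set \<Rightarrow> plane set set \<Rightarrow> (plane set \<Rightarrow> plane) \<Rightarrow>
    (nat \<times> nat \<Rightarrow> plane \<Rightarrow> real) \<Rightarrow> (nat \<Rightarrow> plane set set) \<Rightarrow> (nat \<Rightarrow> plane \<Rightarrow> real) \<Rightarrow>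
    plane set \<Rightarrow> (plane set \<Rightarrow> plane \<Rightarrow> real) \<Rightarrow> real pw_fun \<Rightarrow> real" where
  "F_hat \<Omega> \<T> \<nu> f E\<Gamma> g A \<beta> v =
     (\<Sum>\<alpha>\<in>multi_upto 2. LINT x|lebesgue_on \<Omega>.
        f \<alpha> x * pw \<T> (\<lambda>T. weak_deriv (interior T) \<alpha> (v T)) x) +
     (\<Sum>j\<in>{0, 1}. \<Sum>E\<in>E\<Gamma> j. LINT x|edge_measure E.
        g j x * avg \<Omega> \<T> \<nu> E (\<lambda>T. trace_on T E (normal_deriv j (\<nu> E) (interior T) (v T))) x) +
     (\<Sum>z\<in>A. \<Sum>T\<in>vertex_patch \<T> z. \<beta> T z * point_value T (v T) z)"

definition apx_sq :: "(nat \<times> nat \<Rightarrow> plane \<Rightarrow> real) \<Rightarrow> (nat \<Rightarrow> plane set set) \<Rightarrow>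
    (nat \<Rightarrow> plane \<Rightarrow> real) \<Rightarrow> (nat \<times> nat \<Rightarrow> real pw_fun) \<Rightarrow> (nat \<Rightarrow> plane \<Rightarrow> real) \<Rightarrow>
    plane set \<Rightarrow> real" where
  "apx_sq f E\<Gamma> g F G T =
     (\<Sum>\<alpha>\<in>multi_upto 2. (L2_nrm (lebesgue_on T)
        (\<lambda>x. diameter T ^ (2 - (fst \<alpha> + snd \<alpha>)) * (f \<alpha> x - F \<alpha> T x)))\<^sup>2) +
     (\<Sum>j\<in>{0, 1}. \<Sum>E\<in>{E \<in> E\<Gamma> j. E edge_of T}. (L2_nrm (edge_measure E)
        (\<lambda>x. diameter E powr (3/2 - real j) * (g j x - G j x)))\<^sup>2)"

definition apx :: "plane set set \<Rightarrow> (nat \<times> nat \<Rightarrow> plane \<Rightarrow> real) \<Rightarrow> (nat \<Rightarrow> plane set set) \<Rightarrow>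
    (nat \<Rightarrow> plane \<Rightarrow> real) \<Rightarrow> (nat \<times> nat \<Rightarrow> real pw_fun) \<Rightarrow> (nat \<Rightarrow> plane \<Rightarrow> real) \<Rightarrow> real" where
  "apx \<T> f E\<Gamma> g F G = sqrt (\<Sum>T\<in>\<T>. apx_sq f E\<Gamma> g F G T)"


section \<open>Error estimator\<close>

text \<open>The derivatives below are classical: they act on the polynomial \<open>F \<alpha> T\<close> or \<open>uh T\<close>
  of each triangle, so that one-sided values on edges make sense.\<close>

definition vec_F1 :: "(nat \<times> nat \<Rightarrow> real pw_fun) \<Rightarrow> (real^2) pw_fun" where
  "vec_F1 F T x = vector [F (1,0) T x, F (0,1) T x]"

definition mat_F2 :: "(nat \<times> nat \<Rightarrow> real pw_fun) \<Rightarrow> (real^2^2) pw_fun" where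
  "mat_F2 F T x = vector [vector [F (2,0) T x, F (1,1) T x / 2],
                          vector [F (1,1) T x / 2, F (0,2) T x]]"

definition ext_zero :: "plane set set \<Rightarrow> (plane \<Rightarrow> real) \<Rightarrow> plane set \<Rightarrow> plane \<Rightarrow> real" where
  "ext_zero S G E x = (if E \<in> S then G x else 0)"

definition edge_proj0 :: "plane set \<Rightarrow> (plane \<Rightarrow> real) \<Rightarrow> real" where
  "edge_proj0 E w = (THE c. \<forall>d. (LINT x|edge_measure E. (w x - c) * d) = 0)"

definition mu1_sq :: "plane set \<Rightarrow> plane set set \<Rightarrow> (nat \<times> nat \<Rightarrow> real pw_fun) \<Rightarrow> real" where
  "mu1_sq \<Omega> \<T> F = (L2_nrm (lebesgue_on \<Omega>) (pw \<T> (\<lambda>T x. (diameter T)\<^sup>2 *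
     (F (0,0) T x - divergence (vec_F1 F T) x + divergence (row_divergence (mat_F2 F T)) x))))\<^sup>2"

definition mu2_sq :: "plane set \<Rightarrow> plane set set \<Rightarrow> (plane set \<Rightarrow> plane) \<Rightarrow> (plane set \<Rightarrow> plane) \<Rightarrow>
    (nat \<Rightarrow> plane set set) \<Rightarrow> (nat \<times> nat \<Rightarrow> real pw_fun) \<Rightarrow> (nat \<Rightarrow> plane \<Rightarrow> real) \<Rightarrow> real" where
  "mu2_sq \<Omega> \<T> \<nu> \<tau> E\<Gamma> F G = (\<Sum>E\<in>interior_edges \<Omega> \<T>. diameter E ^ 3 *
     (L2_nrm (edge_measure E) (\<lambda>x. ext_zero (E\<Gamma> 0) (G 0) E x +
        jump \<Omega> \<T> \<nu> E (\<lambda>T y. vec_F1 F T y - row_divergence (mat_F2 F T) y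
          - frechet_derivative (\<lambda>y'. mat_F2 F T y' *v \<tau> E) (at y) (\<tau> E)) x \<bullet> \<nu> E))\<^sup>2)"

definition mu3_sq :: "plane set \<Rightarrow> plane set set \<Rightarrow> (plane set \<Rightarrow> plane) \<Rightarrow>
    (nat \<Rightarrow> plane set set) \<Rightarrow> (nat \<times> nat \<Rightarrow> real pw_fun) \<Rightarrow> (nat \<Rightarrow> plane \<Rightarrow> real) \<Rightarrow>
    (real pw_fun \<Rightarrow> real pw_fun) \<Rightarrow> real pw_fun \<Rightarrow> real" where
  "mu3_sq \<Omega> \<T> \<nu> E\<Gamma> F G Ih uh =
     (if Ih = id then
        (\<Sum>E\<in>interior_edges \<Omega> \<T>. diameter E *
          (let w = (\<lambda>x. ext_zero (E\<Gamma> 1) (G 1) E x +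
                 jump \<Omega> \<T> \<nu> E (\<lambda>T y. mat_F2 F T y *v \<nu> E) x \<bullet> \<nu> E)
           in L2_nrm (edge_measure E) (\<lambda>x. w x - edge_proj0 E w))\<^sup>2)
      else
        (\<Sum>E\<in>interior_edges \<Omega> \<T>. diameter E *
          (L2_nrm (edge_measure E) (\<lambda>x. ext_zero (E\<Gamma> 1) (G 1) E x +
             jump \<Omega> \<T> \<nu> E (\<lambda>T y. (mat_F2 F T y - hessian (uh T) y) *v \<nu> E) x \<bullet> \<nu> E))\<^sup>2))"

definition estimator :: "plane set \<Rightarrow> plane set set \<Rightarrow> (plane set \<Rightarrow> plane) \<Rightarrow>
    (plane set \<Rightarrow> plane) \<Rightarrow> (nat \<Rightarrow> plane set set) \<Rightarrow> (nat \<times> nat \<Rightarrow> real pw_fun) \<Rightarrow>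
    (nat \<Rightarrow> plane \<Rightarrow> real) \<Rightarrow> (real pw_fun \<Rightarrow> real pw_fun) \<Rightarrow> real pw_fun \<Rightarrow> real" where
  "estimator \<Omega> \<T> \<nu> \<tau> E\<Gamma> F G Ih uh =
     sqrt (mu1_sq \<Omega> \<T> F + mu2_sq \<Omega> \<T> \<nu> \<tau> E\<Gamma> F G + mu3_sq \<Omega> \<T> \<nu> E\<Gamma> F G Ih uh)"

end

theory Submission
  imports Defs "HOL-Computational_Algebra.Polynomial"
begin

text \<open>
  Each residual is a polynomial on a triangle or on an interior edge. It is tested with
  \<open>v \<in> C\<^sub>c\<^sup>\<infinity>\<close>, the product of the residual in scaled coordinates and a tensor product of
  smooth bump functions, supported in a square of the size of the triangle: inside the triangle
  for \<open>\<mu>\<^sub>1\<close>, and centred at the edge midpoint for \<open>\<mu>\<^sub>2\<close> and \<open>\<mu>\<^sub>3\<close>. The square is kept away from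
  all vertices, so that the point evaluations of the source vanish. For \<open>\<mu>\<^sub>2\<close> the function \<open>v\<close> has
  zero normal derivative on the edge; for \<open>\<mu>\<^sub>3\<close> an additional factor \<open>(x - mid E) \<bullet> \<nu>\<close> makes \<open>v\<close>
  vanish on the edge, while its normal derivative is the moment residual times a bump.

  Testing the weak equation with \<open>v\<close> and integrating the discrete terms by parts bounds the
  weighted square integral of the residual by the energy and data errors times second derivatives
  of \<open>v\<close>; since \<open>D\<^sup>2 u\<^sub>h\<close> is constant on each triangle, \<open>u\<^sub>h\<close> enters only the moment residual.
  By compactness, the weighted square integral dominates the squared coefficients of the polynomial
  in scaled coordinates, and these dominate its \<open>L\<^sup>2\<close> norm and, after scaling, the derivatives of
  \<open>v\<close>. The projection in the case \<open>I\<^sub>h = id\<close> removes the constant contribution of \<open>u\<^sub>h\<close> to the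
  moment residual.
\<close>

section \<open>Smooth functions of one variable\<close>

text \<open>Weak derivatives, traces and point values are defined through choice or description
  operators, so even for smooth \<open>v\<close> nothing can be evaluated before uniqueness is
  known; the fundamental lemma and a weighted trace inequality serve this purpose. Smooth test
  functions, in place of polynomial bubbles, lie in \<open>H0_space\<close> by a constant sequence
  and vanish on all edges but one, so that Green's formula on a half-plane suffices. The role of an
  affine reference triangle is taken by the variables (x - m) / \<rho>: a polynomial is measured by
  the sum \<open>S\<close> of its coefficients in modulus. The tested integral is at least a
  constant times a power of \<rho> times \<open>S\<close> squared, the derivatives of
  \<open>v\<close> are at most a constant times \<open>S\<close> over a power of \<rho>, and one
  factor \<open>S\<close> cancels; shape regularity makes \<rho> comparable to the diameter. The
  volume bound precedes the edge bounds, because the volume residual reappears when \<open>v\<close>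
  crosses an edge.\<close>

definition smooth1 :: "(real \<Rightarrow> real) \<Rightarrow> bool" where
  "smooth1 h \<longleftrightarrow> (\<forall>n x. (deriv ^^ n) h field_differentiable at x)"

text \<open>A class of differentiable functions that is closed under \<open>deriv\<close> contains
  every iterated derivative of its members. Closure of a class is easier to exhibit than a formula
  for the n-th derivative of a product or of exp(-1/t).\<close>

lemma smooth1_coinduct:
  assumes "h \<in> S" "\<And>f x. f \<in> S \<Longrightarrow> f field_differentiable at x" "\<And>f. f \<in> S \<Longrightarrow> deriv f \<in> S"
  shows "smooth1 h"
proof -
  have "(deriv ^^ n) h \<in> S" for n by (induction n) (auto intro: assms)
  then show ?thesis unfolding smooth1_def using assms(2) by blast
qed

lemma smooth1_deriv: "smooth1 h \<Longrightarrow> smooth1 (deriv h)"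
  unfolding smooth1_def by (metis comp_apply funpow_Suc_right)

lemma smooth1_derivs: "smooth1 h \<Longrightarrow> smooth1 ((deriv ^^ n) h)"
  by (induction n) (auto intro: smooth1_deriv)

lemma smooth1_differentiable: "smooth1 h \<Longrightarrow> h field_differentiable at x"
  unfolding smooth1_def by (metis funpow_0)

lemma smooth1_DERIV: "smooth1 h \<Longrightarrow> (h has_real_derivative deriv h x) (at x)"
  using smooth1_differentiable field_differentiable_derivI by blast

lemma smooth1_continuous: "smooth1 h \<Longrightarrow> continuous_on A h"
  by (meson smooth1_DERIV DERIV_continuous continuous_at_imp_continuous_on)

text \<open>The derivative of a product is a sum of products, so products alone are not closed under
  \<open>deriv\<close>; with sums and affine substitutions the class meets the hypotheses of
  \<open>smooth1_coinduct\<close>.\<close>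

inductive_set smooth1_algebra :: "(real \<Rightarrow> real) set" where
  base: "smooth1 f \<Longrightarrow> f \<in> smooth1_algebra"
| add: "f \<in> smooth1_algebra \<Longrightarrow> g \<in> smooth1_algebra \<Longrightarrow> (\<lambda>x. f x + g x) \<in> smooth1_algebra"
| mult: "f \<in> smooth1_algebra \<Longrightarrow> g \<in> smooth1_algebra \<Longrightarrow> (\<lambda>x. f x * g x) \<in> smooth1_algebra"
| lin: "f \<in> smooth1_algebra \<Longrightarrow> (\<lambda>x. c * f (a * x + b)) \<in> smooth1_algebra"

lemma smooth1_algebra_deriv:
  "f \<in> smooth1_algebra \<Longrightarrow> (\<forall>x. (f has_real_derivative deriv f x) (at x)) \<and> deriv f \<in> smooth1_algebra"
proof (induction rule: smooth1_algebra.induct)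
  case (base f)
  then show ?case by (auto intro: smooth1_DERIV smooth1_algebra.base smooth1_deriv)
next
  case (add f g)
  have D: "((\<lambda>x. f x + g x) has_real_derivative deriv f x + deriv g x) (at x)" for x
    using add by (auto intro!: derivative_eq_intros)
  then have "deriv (\<lambda>x. f x + g x) = (\<lambda>x. deriv f x + deriv g x)"
    by (auto intro!: ext DERIV_imp_deriv)
  with D show ?case using add by (auto intro: smooth1_algebra.add)
next
  case (mult f g)
  have D: "((\<lambda>x. f x * g x) has_real_derivative deriv f x * g x + f x * deriv g x) (at x)" for x
    using mult by (auto intro!: derivative_eq_intros simp: algebra_simps)
  then have "deriv (\<lambda>x. f x * g x) = (\<lambda>x. deriv f x * g x + f x * deriv g x)"
    by (auto intro!: ext DERIV_imp_deriv)
  with D show ?case using mult by (auto intro: smooth1_algebra.add smooth1_algebra.mult)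
next
  case (lin f c a b)
  have D: "((\<lambda>x. c * f (a * x + b)) has_real_derivative (c * a) * deriv f (a * x + b)) (at x)" for x
  proof -
    have "((\<lambda>x. f (a * x + b)) has_real_derivative deriv f (a * x + b) * a) (at x)"
      by (rule DERIV_chain2[of f]) (use lin in \<open>auto intro!: derivative_eq_intros\<close>)
    from DERIV_cmult[OF this, of c] show ?thesis by (simp add: mult_ac)
  qed
  then have "deriv (\<lambda>x. c * f (a * x + b)) = (\<lambda>x. (c * a) * deriv f (a * x + b))"
    by (auto intro!: ext DERIV_imp_deriv)
  with D show ?case using lin by (auto intro: smooth1_algebra.lin)
qed

lemma smooth1_algebra_smooth1: "f \<in> smooth1_algebra \<Longrightarrow> smooth1 f"
  by (rule smooth1_coinduct[of _ smooth1_algebra])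
     (use smooth1_algebra_deriv in \<open>auto simp: field_differentiable_def\<close>)

lemma smooth1_mult: "smooth1 f \<Longrightarrow> smooth1 g \<Longrightarrow> smooth1 (\<lambda>x. f x * g x)"
  by (rule smooth1_algebra_smooth1[OF smooth1_algebra.mult[OF smooth1_algebra.base smooth1_algebra.base]])

lemma smooth1_affine: "smooth1 f \<Longrightarrow> smooth1 (\<lambda>x. c * f (a * x + b))"
  by (rule smooth1_algebra_smooth1[OF smooth1_algebra.lin[OF smooth1_algebra.base]])

lemma smooth1_poly: "smooth1 (poly p)"
proof (rule smooth1_coinduct[of _ "range poly"])
  fix f :: "real \<Rightarrow> real" assume "f \<in> range poly"
  then obtain q where q: "f = poly q" by auto
  then show "f field_differentiable at x" for x
    unfolding field_differentiable_def by (metis poly_DERIV)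
  have "deriv f = poly (pderiv q)" unfolding q by (auto intro!: ext DERIV_imp_deriv poly_DERIV)
  then show "deriv f \<in> range poly" by auto
qed auto

text \<open>The derivatives of exp(-1/t) have the form p(1/t) exp(-1/t). Carrying the polynomial
  \<open>p\<close> as a parameter makes the family closed under differentiation.\<close>

definition flat_exp :: "real poly \<Rightarrow> real \<Rightarrow> real" where
  "flat_exp p t = (if t > 0 then poly p (1 / t) * exp (- (1 / t)) else 0)"

lemma poly_exp_tendsto_0: "((\<lambda>y. poly p y * exp (- y)) \<longlongrightarrow> 0) (at_top :: real filter)"
proof -
  have "((\<lambda>y::real. \<Sum>i\<le>degree p. coeff p i * (y ^ i / exp y)) \<longlongrightarrow> (\<Sum>i\<le>degree p. coeff p i * 0)) at_top"
    by (intro tendsto_intros tendsto_power_div_exp_0)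
  then show ?thesis
    by (simp add: poly_altdef sum_distrib_left exp_minus divide_inverse mult_ac)
qed

text \<open>For t > 0 the product rule gives (1/t)^2 (p - p')(1/t) exp(-1/t), the member of the
  family that belongs to X^2 (p - p'). At 0 the right difference quotient is of the same type, with
  X p in place of p, and tends to 0 because the exponential beats every polynomial.\<close>

lemma flat_exp_DERIV:
  "(flat_exp p has_real_derivative flat_exp (monom 1 2 * (p - pderiv p)) x) (at x)"
proof (cases x "0::real" rule: linorder_cases)
  case less
  have "((\<lambda>t. 0) has_real_derivative 0) (at x)" by simp
  then have "(flat_exp p has_real_derivative 0) (at x)"
    by (rule DERIV_cong_ev[THEN iffD1, rotated -1])
       (use less in \<open>auto simp: flat_exp_def intro!: eventually_mono[OF eventually_nhds_in_open[of "{..<0}"]]\<close>)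
  then show ?thesis using less by (simp add: flat_exp_def)
next
  case greater
  have *: "((\<lambda>t. poly p (1 / t) * exp (- (1 / t))) has_real_derivative
     (poly (pderiv p) (1/x) * (- (1 / x^2))) * exp (- (1/x)) + poly p (1/x) * (exp (- (1/x)) * (1 / x^2))) (at x)"
    using greater
    by (auto intro!: derivative_eq_intros DERIV_chain2[OF poly_DERIV] simp: power2_eq_square field_simps)
  have "(flat_exp p has_real_derivative
     (poly (pderiv p) (1/x) * (- (1 / x^2))) * exp (- (1/x)) + poly p (1/x) * (exp (- (1/x)) * (1 / x^2))) (at x)"
    by (rule DERIV_cong_ev[THEN iffD1, rotated -1, OF *])
       (use greater in \<open>auto simp: flat_exp_def intro!: eventually_mono[OF eventually_nhds_in_open[of "{0<..}"]]\<close>)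
  then show ?thesis using greater
    by (simp add: flat_exp_def poly_monom field_simps power2_eq_square)
next
  case equal
  have "((\<lambda>h. (flat_exp p (0 + h) - flat_exp p 0) / h) \<longlongrightarrow> 0) (at_right 0)"
  proof -
    have "((\<lambda>h::real. poly (monom 1 1 * p) (inverse h) * exp (- inverse h)) \<longlongrightarrow> 0) (at_right 0)"
      by (rule filterlim_compose[OF poly_exp_tendsto_0 filterlim_inverse_at_top_right])
    then show ?thesis
      by (rule Lim_transform_eventually)
         (auto simp: flat_exp_def eventually_at_filter poly_monom field_simps)
  qed
  moreover have "((\<lambda>h. (flat_exp p (0 + h) - flat_exp p 0) / h) \<longlongrightarrow> 0) (at_left 0)"
    by (rule Lim_transform_eventually[OF tendsto_const])
       (auto simp: flat_exp_def eventually_at_filter)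
  ultimately have "((\<lambda>h. (flat_exp p (0 + h) - flat_exp p 0) / h) \<longlongrightarrow> 0) (at 0)"
    by (simp add: filterlim_split_at)
  then show ?thesis using equal by (simp add: DERIV_def flat_exp_def)
qed

lemma smooth1_flat_exp: "smooth1 (flat_exp p)"
proof (rule smooth1_coinduct[of _ "range flat_exp"])
  fix f :: "real \<Rightarrow> real" assume "f \<in> range flat_exp"
  then obtain q where q: "f = flat_exp q" by auto
  then show "f field_differentiable at x" for x
    using flat_exp_DERIV by (auto simp: field_differentiable_def)
  have "deriv f = flat_exp (monom 1 2 * (q - pderiv q))"
    unfolding q by (auto intro!: ext DERIV_imp_deriv flat_exp_DERIV)
  then show "deriv f \<in> range flat_exp" by auto
qed auto

definition flat :: "real \<Rightarrow> real" where "flat = flat_exp 1"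

lemma smooth1_flat: "smooth1 flat"
  unfolding flat_def by (rule smooth1_flat_exp)

lemma flat_pos: "t > 0 \<Longrightarrow> flat t > 0" and flat_zero: "t \<le> 0 \<Longrightarrow> flat t = 0"
  and flat_nonneg: "flat t \<ge> 0" and flat_le_1: "flat t \<le> 1"
  by (auto simp: flat_def flat_exp_def)

text \<open>For positive t and n the value is exp(-1/(n t)). Together with \<open>flat_zero\<close>
  this yields smooth approximations of the indicator of the positive half-line, and from them those
  of boxes.\<close>

lemma flat_scaled_tendsto: "t > 0 \<Longrightarrow> (\<lambda>n. flat (real n * t)) \<longlonglongrightarrow> 1"
proof -
  assume t: "t > 0"
  have "(\<lambda>n. exp (- ((1 / t) * (1 / real n)))) \<longlonglongrightarrow> exp (- ((1/t) * 0))"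
    by (intro tendsto_intros lim_1_over_n)
  then have "(\<lambda>n. exp (- (1 / (real n * t)))) \<longlonglongrightarrow> 1" by (simp add: mult_ac)
  then show ?thesis
    by (rule Lim_transform_eventually)
       (use t in \<open>auto simp: flat_def flat_exp_def eventually_sequentially intro!: exI[of _ 1]\<close>)
qed

text \<open>The symmetric form matters: evenness forces a critical point at 0, which gives the test
  functions for the shear residual zero normal derivative on the edge.\<close>

definition bump :: "real \<Rightarrow> real" where "bump t = flat (1 - t) * flat (1 + t)"

lemma smooth1_bump: "smooth1 bump"
proof -
  have "smooth1 (\<lambda>t. (1 * flat ((-1) * t + 1)) * (1 * flat (1 * t + 1)))"
    by (intro smooth1_mult smooth1_affine smooth1_flat)
  then show ?thesis unfolding bump_def by (simp add: add.commute)
qed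

lemma bump_pos: "\<bar>t\<bar> < 1 \<Longrightarrow> bump t > 0" and bump_zero: "\<bar>t\<bar> \<ge> 1 \<Longrightarrow> bump t = 0"
  and bump_nonneg: "bump t \<ge> 0" and bump_even: "bump (- t) = bump t"
  by (auto simp: bump_def flat_pos flat_nonneg intro: flat_zero) (cases "t \<ge> 0"; simp add: flat_zero)

text \<open>A monomial times the weight. Sums of tensor products of these functions are polynomials
  times a product weight, so that a test function is described by coefficients alone.\<close>

definition bump_pow :: "nat \<Rightarrow> real \<Rightarrow> real" where "bump_pow i y = y ^ i * bump y"

lemma smooth1_bump_pow: "smooth1 (bump_pow i)"
proof -
  have "smooth1 (\<lambda>y. poly (monom 1 i) y * bump y)"
    by (intro smooth1_mult smooth1_poly smooth1_bump)
  then show ?thesis by (simp add: bump_pow_def[abs_def] poly_monom)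
qed

text \<open>On the open set |y| > 1 the function is locally zero, hence so are its derivatives; the
  end points follow by continuity. They are included because test functions must vanish on the
  boundary of their square as well.\<close>

lemma bump_pow_derivs_zero: "\<bar>y\<bar> \<ge> 1 \<Longrightarrow> (deriv ^^ n) (bump_pow i) y = 0"
proof -
  have out: "(deriv ^^ n) (bump_pow i) y = 0" if "\<bar>y\<bar> > 1" for y
    using that
  proof (induction n arbitrary: y)
    case 0
    then show ?case by (simp add: bump_pow_def bump_zero)
  next
    case (Suc n)
    have "open {z::real. \<bar>z\<bar> > 1}" by (intro open_Collect_less continuous_intros)
    then have "eventually (\<lambda>z. z \<in> {z. \<bar>z\<bar> > 1}) (nhds y)"
      using Suc.prems by (intro eventually_nhds_in_open) auto
    then have "eventually (\<lambda>z. (deriv ^^ n) (bump_pow i) z = (\<lambda>z. 0) z) (nhds y)"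
      by (rule eventually_mono) (use Suc.IH in auto)
    then have "deriv ((deriv ^^ n) (bump_pow i)) y = deriv (\<lambda>z. 0) y"
      by (rule deriv_cong_ev) simp
    then show ?case by simp
  qed
  assume y: "\<bar>y\<bar> \<ge> 1"
  define f where "f = (deriv ^^ n) (bump_pow i)"
  have cf: "continuous_on UNIV f"
    unfolding f_def by (intro smooth1_continuous smooth1_derivs smooth1_bump_pow)
  have "y \<in> closure {z. \<bar>z\<bar> > 1}"
  proof (rule closure_sequential[THEN iffD2], intro exI conjI allI)
    show "(\<lambda>k. y * (1 + 1 / real (Suc k))) \<longlonglongrightarrow> y"
      using tendsto_mult_left[OF tendsto_add[OF tendsto_const[of 1] LIMSEQ_Suc[OF lim_1_over_n]], of y]
      by simp
    fix k
    have "1 < 1 + 1 / real (Suc k)" by simp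
    also have "\<dots> \<le> \<bar>y\<bar> * (1 + 1 / real (Suc k))"
      using mult_right_mono[OF y, of "1 + 1 / real (Suc k)"] by simp
    finally have "1 < \<bar>y\<bar> * (1 + 1 / real (Suc k))" .
    then show "y * (1 + 1 / real (Suc k)) \<in> {z. \<bar>z\<bar> > 1}" by (simp add: abs_mult)
  qed
  moreover have "closed {z. f z = 0}" by (intro closed_Collect_eq cf continuous_intros)
  moreover have "{z. \<bar>z\<bar> > 1} \<subseteq> {z. f z = 0}" using out by (auto simp: f_def)
  ultimately have "y \<in> {z. f z = 0}" by (meson closure_minimal subsetD)
  then show ?thesis by (simp add: f_def)
qed

text \<open>Each derivative is continuous and vanishes off [-1, 1], hence is bounded; finitely many
  indices give one constant that depends on \<open>N\<close> only. The summand 1 in the witness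
  secures the lower bound for \<open>B\<close>.\<close>

lemma bump_pow_derivs_bounded:
  "\<exists>B\<ge>1. \<forall>i\<le>N. \<forall>n\<le>N. \<forall>y. \<bar>(deriv ^^ n) (bump_pow i) y\<bar> \<le> B"
proof -
  have "\<exists>B. \<forall>y. \<bar>(deriv ^^ n) (bump_pow i) y\<bar> \<le> B" for i n
  proof -
    have "compact ((deriv ^^ n) (bump_pow i) ` {-1..1})"
      by (intro compact_continuous_image smooth1_continuous smooth1_derivs smooth1_bump_pow) simp
    then obtain B where B: "\<forall>y\<in>{-1..1}. \<bar>(deriv ^^ n) (bump_pow i) y\<bar> \<le> B"
      by (auto dest!: compact_imp_bounded simp: bounded_iff)
    have "\<bar>(deriv ^^ n) (bump_pow i) y\<bar> \<le> \<bar>B\<bar>" for y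
      using B[rule_format, of y] bump_pow_derivs_zero[of y n i]
      by (cases "\<bar>y\<bar> \<le> 1") (auto simp: abs_le_iff)
    then show ?thesis by blast
  qed
  then have "\<forall>i n. \<exists>B. \<forall>y. \<bar>(deriv ^^ n) (bump_pow i) y\<bar> \<le> B" by blast
  then obtain B where B: "\<And>i n y. \<bar>(deriv ^^ n) (bump_pow i) y\<bar> \<le> B i n"
    unfolding choice_iff by blast
  let ?B = "1 + (\<Sum>i\<le>N. \<Sum>n\<le>N. \<bar>B i n\<bar>)"
  have "\<bar>(deriv ^^ n) (bump_pow i) y\<bar> \<le> ?B" if "i \<le> N" "n \<le> N" for i n y
  proof -
    have "\<bar>B i n\<bar> \<le> (\<Sum>n\<le>N. \<bar>B i n\<bar>)" using that by (intro member_le_sum) auto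
    also have "\<dots> \<le> (\<Sum>i\<le>N. \<Sum>n\<le>N. \<bar>B i n\<bar>)"
      using that by (intro member_le_sum[where f = "\<lambda>i. \<Sum>n\<le>N. \<bar>B i n\<bar>"] sum_nonneg) auto
    finally show ?thesis using B[of n i y] by linarith
  qed
  then show ?thesis
    by (intro exI[of _ ?B] conjI) (auto intro!: sum_nonneg)
qed

lemma deriv_bump_0: "deriv bump 0 = 0"
proof -
  have "((\<lambda>t. bump (- t)) has_real_derivative deriv bump 0 * (-1)) (at 0)"
    by (rule DERIV_chain2[of bump]) (auto intro!: derivative_eq_intros smooth1_DERIV[OF smooth1_bump, of 0, simplified])
  then have "(bump has_real_derivative - deriv bump 0) (at 0)" by (simp add: bump_even)
  then have "- deriv bump 0 = deriv bump 0"
    using DERIV_unique smooth1_DERIV[OF smooth1_bump] by blast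
  then show ?thesis by simp
qed

text \<open>As a factor in the normal direction, index 0 has value \<open>bump 0\<close> and slope
  0, index 1 has value 0 and slope \<open>bump 0\<close>. The choice of the index isolates either
  the trace or the normal derivative on the edge.\<close>

lemma bump_pow_at_0:
  "bump_pow 0 0 = bump 0" "deriv (bump_pow 0) 0 = 0"
  "bump_pow (Suc 0) 0 = 0" "deriv (bump_pow (Suc 0)) 0 = bump 0"
proof -
  show "deriv (bump_pow 0) 0 = 0" using deriv_bump_0 by (simp add: bump_pow_def[abs_def])
  have "((\<lambda>y. y * bump y) has_real_derivative bump 0) (at 0)"
    using smooth1_DERIV[OF smooth1_bump, of 0] by (auto intro!: derivative_eq_intros)
  then show "deriv (bump_pow (Suc 0)) 0 = bump 0"
    by (simp add: bump_pow_def[abs_def] DERIV_imp_deriv)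
qed (auto simp: bump_pow_def)


section \<open>Smooth functions on the plane\<close>

lemma smooth_coinduct:
  assumes "\<phi> \<in> S" "\<And>f x. f \<in> S \<Longrightarrow> f differentiable at x" "\<And>f i. f \<in> S \<Longrightarrow> partial i f \<in> S"
  shows "smooth \<phi>"
proof -
  have "foldr partial is \<phi> \<in> S" for "is" by (induction "is") (auto intro: assms)
  then show ?thesis unfolding smooth_def using assms(2)
    by (auto simp: differentiable_on_def)
qed

lemma smooth_partial: "smooth \<phi> \<Longrightarrow> smooth (partial i \<phi>)"
  unfolding smooth_def
proof
  fix "is" assume "\<forall>is. foldr partial is \<phi> differentiable_on UNIV"
  then have "foldr partial (is @ [i]) \<phi> differentiable_on UNIV" by blast
  then show "foldr partial is (partial i \<phi>) differentiable_on UNIV" by simp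
qed

lemma smooth_differentiable: "smooth \<phi> \<Longrightarrow> \<phi> differentiable at x"
  unfolding smooth_def differentiable_on_def by (metis UNIV_I foldr_Nil id_apply)

lemma smooth_continuous: "smooth \<phi> \<Longrightarrow> continuous_on A \<phi>"
  using smooth_differentiable differentiable_imp_continuous_within
    continuous_at_imp_continuous_on by blast

lemma smooth_measurable: "smooth \<phi> \<Longrightarrow> \<phi> \<in> borel_measurable borel"
  by (intro borel_measurable_continuous_onI smooth_continuous)

lemma partial_eqI: "(f has_derivative f') (at x) \<Longrightarrow> partial i f x = f' (axis i 1)"
  unfolding partial_def using frechet_derivative_at by metis

lemma frechet_expand:
  assumes "f differentiable at (x::plane)"
  shows "frechet_derivative f (at x) h = (\<Sum>i\<in>UNIV. h $ i * partial i f x)"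
proof -
  have lin: "linear (frechet_derivative f (at x))"
    using assms linear_frechet_derivative by blast
  have "frechet_derivative f (at x) h = frechet_derivative f (at x) (\<Sum>i\<in>UNIV. (h $ i) *\<^sub>R axis i 1)"
    by (simp add: basis_expansion flip: scalar_mult_eq_scaleR)
  then show ?thesis
    by (simp add: linear_sum[OF lin] linear_scale[OF lin] partial_def)
qed

lemma smooth_has_derivative:
  "smooth f \<Longrightarrow> (f has_derivative (\<lambda>h. h $ 1 * partial 1 f x + h $ 2 * partial 2 f x)) (at x)"
proof -
  assume "smooth f"
  then have d: "f differentiable at x" by (rule smooth_differentiable)
  then have "frechet_derivative f (at x) = (\<lambda>h. h $ 1 * partial 1 f x + h $ 2 * partial 2 f x)"
    by (auto simp: frechet_expand sum_2)
  then show ?thesis using d by (metis frechet_derivative_works)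
qed

text \<open>Bumps in rotated coordinates are ridge functions, and the test functions are sums of
  products of them. A partial derivative of a ridge is again a ridge up to a factor, so the class is
  closed under \<open>partial\<close>.\<close>

inductive_set smooth_algebra :: "(plane \<Rightarrow> real) set" where
  base: "smooth f \<Longrightarrow> f \<in> smooth_algebra"
| add: "f \<in> smooth_algebra \<Longrightarrow> g \<in> smooth_algebra \<Longrightarrow> (\<lambda>x. f x + g x) \<in> smooth_algebra"
| mult: "f \<in> smooth_algebra \<Longrightarrow> g \<in> smooth_algebra \<Longrightarrow> (\<lambda>x. f x * g x) \<in> smooth_algebra"
| ridge: "smooth1 h \<Longrightarrow> (\<lambda>x. c * h (n \<bullet> x + b)) \<in> smooth_algebra"

lemma partial_add:
  assumes "f differentiable at x" "g differentiable at x"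
  shows "partial i (\<lambda>x. f x + g x) x = partial i f x + partial i g x"
  using partial_eqI[OF has_derivative_add[OF assms[THEN frechet_derivative_works[THEN iffD1]]]]
  by (simp add: partial_def)

lemma partial_mult:
  assumes "f differentiable at x" "g differentiable at x"
  shows "partial i (\<lambda>x. f x * g x) x = partial i f x * g x + f x * partial i g x"
  using partial_eqI[OF has_derivative_mult[OF assms[THEN frechet_derivative_works[THEN iffD1]]]]
  by (simp add: partial_def)

lemma partial_cmult:
  assumes "f differentiable at x"
  shows "partial i (\<lambda>x. c * f x) x = c * partial i f x"
  using partial_eqI[OF has_derivative_mult_right[OF assms[THEN frechet_derivative_works[THEN iffD1]]]]
  by (simp add: partial_def)

lemma has_derivative_ridge:
  assumes "(h has_real_derivative h') (at (n \<bullet> x + b))"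
  shows "((\<lambda>x::plane. h (n \<bullet> x + b)) has_derivative (\<lambda>v. h' * (n \<bullet> v))) (at x)"
proof -
  have "((\<lambda>x. n \<bullet> x + b) has_derivative (\<lambda>v. n \<bullet> v)) (at x)"
    by (auto intro!: derivative_eq_intros)
  from has_derivative_compose[OF this assms[unfolded has_field_derivative_def]]
  show ?thesis by simp
qed

lemma smooth_algebra_partial:
  "f \<in> smooth_algebra \<Longrightarrow> (\<forall>x. f differentiable at x) \<and> (\<forall>i. partial i f \<in> smooth_algebra)"
proof (induction rule: smooth_algebra.induct)
  case (base f)
  then show ?case by (auto intro: smooth_differentiable smooth_partial smooth_algebra.base)
next
  case (add f g)
  then have "partial i (\<lambda>x. f x + g x) = (\<lambda>x. partial i f x + partial i g x)" for i
    by (auto intro!: partial_add)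
  then show ?case using add by (auto intro: smooth_algebra.add differentiable_add)
next
  case (mult f g)
  then have "partial i (\<lambda>x. f x * g x) = (\<lambda>x. partial i f x * g x + f x * partial i g x)" for i
    by (auto intro!: partial_mult)
  then show ?case using mult by (auto intro!: smooth_algebra.add smooth_algebra.mult differentiable_mult)
next
  case (ridge h c n b)
  have D: "((\<lambda>x. c * h (n \<bullet> x + b)) has_derivative (\<lambda>v. c * (deriv h (n \<bullet> x + b) * (n \<bullet> v)))) (at x)" for x
    by (intro has_derivative_mult_right has_derivative_ridge smooth1_DERIV ridge)
  have "partial i (\<lambda>x. c * h (n \<bullet> x + b)) = (\<lambda>x. (c * n $ i) * deriv h (n \<bullet> x + b))" for i
    by (rule ext, subst partial_eqI[OF D]) (simp add: inner_axis mult_ac)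
  with D show ?case using ridge
    by (auto intro: smooth_algebra.ridge smooth1_deriv simp: differentiable_def)
qed

lemma smooth_algebra_smooth: "f \<in> smooth_algebra \<Longrightarrow> smooth f"
  by (rule smooth_coinduct[of _ smooth_algebra]) (use smooth_algebra_partial in auto)

lemma smooth_add: "smooth f \<Longrightarrow> smooth g \<Longrightarrow> smooth (\<lambda>x. f x + g x)"
  by (rule smooth_algebra_smooth[OF smooth_algebra.add[OF smooth_algebra.base smooth_algebra.base]])

lemma smooth_mult: "smooth f \<Longrightarrow> smooth g \<Longrightarrow> smooth (\<lambda>x. f x * g x)"
  by (rule smooth_algebra_smooth[OF smooth_algebra.mult[OF smooth_algebra.base smooth_algebra.base]])

lemma smooth_ridge: "smooth1 h \<Longrightarrow> smooth (\<lambda>x. h (n \<bullet> x + b))"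
  using smooth_algebra_smooth[OF smooth_algebra.ridge[of h 1]] by simp

lemma smooth_const: "smooth (\<lambda>x. c)"
  using smooth_ridge[OF smooth1_poly[of "[:c:]"]] by simp

lemma smooth_sum: "(\<And>i. i \<in> I \<Longrightarrow> smooth (f i)) \<Longrightarrow> smooth (\<lambda>x. \<Sum>i\<in>I. f i x)"
  by (induction I rule: infinite_finite_induct) (auto intro: smooth_const smooth_add)

lemma smooth_cmult: "smooth f \<Longrightarrow> smooth (\<lambda>x. c * f x)"
  by (intro smooth_mult smooth_const)

lemma smooth_diff: "smooth f \<Longrightarrow> smooth g \<Longrightarrow> smooth (\<lambda>x. f x - g x)"
  using smooth_add[OF _ smooth_cmult[of g "-1"]] by simp

lemma smooth_multi_partial: "smooth f \<Longrightarrow> smooth (multi_partial \<alpha> f)"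
proof -
  have "smooth f \<Longrightarrow> smooth ((partial i ^^ n) f)" for i n f
    by (induction n) (auto intro: smooth_partial)
  then show "smooth f \<Longrightarrow> smooth (multi_partial \<alpha> f)" by (simp add: multi_partial_def)
qed

lemma partial_zero_open:
  assumes "open U" "\<And>x. x \<in> U \<Longrightarrow> f x = 0" "x \<in> U"
  shows "partial i f x = 0"
proof -
  have "((\<lambda>x. 0) has_derivative (\<lambda>h. 0)) (at x)" by simp
  then have "(f has_derivative (\<lambda>h. 0)) (at x)"
    by (rule has_derivative_transform_within_open[OF _ assms(1,3)]) (use assms(2) in auto)
  then show ?thesis by (rule partial_eqI)
qed

lemma multi_partial_zero_open:
  assumes "open U" "\<And>x. x \<in> U \<Longrightarrow> f x = 0" "x \<in> U"
  shows "multi_partial \<alpha> f x = 0"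
proof -
  have *: "(partial i ^^ n) f x = 0" if "\<And>x. x \<in> U \<Longrightarrow> f x = 0" "x \<in> U" for f i n x
    using that(2) by (induction n arbitrary: x) (auto intro: that(1) partial_zero_open[OF assms(1)])
  show ?thesis unfolding multi_partial_def by (rule *) (auto intro: * assms)
qed


section \<open>Integration in orthonormal coordinates\<close>

text \<open>Tangential and normal coordinates about \<open>m\<close>. The domain consists of pairs
  rather than vectors so that Fubini's theorem for product measures applies.\<close>

definition chart :: "plane \<Rightarrow> plane \<Rightarrow> plane \<Rightarrow> real \<times> real \<Rightarrow> plane" where
  "chart m \<tau> \<nu> p = m + fst p *\<^sub>R \<tau> + snd p *\<^sub>R \<nu>"

lemma inner_plane: "(x::plane) \<bullet> y = x $ 1 * y $ 1 + x $ 2 * y $ 2"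
  by (simp add: inner_vec_def sum_2)

lemma norm_plane_1: "norm (x::plane) = 1 \<longleftrightarrow> x $ 1 * x $ 1 + x $ 2 * x $ 2 = 1"
  by (simp add: norm_eq_sqrt_inner inner_plane)

lemma plane_eq_iff: "(x::plane) = y \<longleftrightarrow> x $ 1 = y $ 1 \<and> x $ 2 = y $ 2"
  by (simp add: vec_eq_iff forall_2)

locale frame =
  fixes \<tau> \<nu> :: plane
  assumes norm_tau: "norm \<tau> = 1" and norm_nu: "norm \<nu> = 1" and orthogonal: "\<tau> \<bullet> \<nu> = 0"
begin

text \<open>Orthonormal rows imply orthonormal columns: for rows (a, b) and (c, d) with determinant
  e, one has e^2 = 1 and (c, d) = e (-b, a).\<close>

lemma components:
  "\<tau> $ 1 * \<tau> $ 1 + \<nu> $ 1 * \<nu> $ 1 = 1" "\<tau> $ 2 * \<tau> $ 2 + \<nu> $ 2 * \<nu> $ 2 = 1"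
  "\<tau> $ 1 * \<tau> $ 2 + \<nu> $ 1 * \<nu> $ 2 = 0"
proof -
  have *: "a * a + c * c = 1 \<and> b * b + d * d = 1 \<and> a * b + c * d = 0"
    if "a * a + b * b = 1" "c * c + d * d = 1" "a * c + b * d = 0" for a b c d :: real
  proof -
    have "(a * d - b * c) * (a * d - b * c) = 1" using that by algebra
    moreover have "c = - b * (a * d - b * c)" "d = a * (a * d - b * c)" using that by algebra+
    ultimately show ?thesis using that by algebra
  qed
  show "\<tau> $ 1 * \<tau> $ 1 + \<nu> $ 1 * \<nu> $ 1 = 1" "\<tau> $ 2 * \<tau> $ 2 + \<nu> $ 2 * \<nu> $ 2 = 1"
    "\<tau> $ 1 * \<tau> $ 2 + \<nu> $ 1 * \<nu> $ 2 = 0"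
    using *[OF norm_tau[unfolded norm_plane_1] norm_nu[unfolded norm_plane_1] orthogonal[unfolded inner_plane]]
    by auto
qed

lemma expand: "x = (x \<bullet> \<tau>) *\<^sub>R \<tau> + (x \<bullet> \<nu>) *\<^sub>R \<nu>"
proof -
  have "x $ 1 = (x $ 1 * \<tau> $ 1 + x $ 2 * \<tau> $ 2) * \<tau> $ 1 + (x $ 1 * \<nu> $ 1 + x $ 2 * \<nu> $ 2) * \<nu> $ 1"
    "x $ 2 = (x $ 1 * \<tau> $ 1 + x $ 2 * \<tau> $ 2) * \<tau> $ 2 + (x $ 1 * \<nu> $ 1 + x $ 2 * \<nu> $ 2) * \<nu> $ 2"
    using components by algebra+
  then show ?thesis by (simp add: plane_eq_iff inner_plane)
qed

lemma inner_frame [simp]: "\<tau> \<bullet> \<tau> = 1" "\<nu> \<bullet> \<nu> = 1" "\<tau> \<bullet> \<nu> = 0" "\<nu> \<bullet> \<tau> = 0"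
  using norm_tau norm_nu orthogonal by (auto simp: norm_eq_1 inner_commute)

lemma chart_inner:
  "(chart m \<tau> \<nu> p - m) \<bullet> \<tau> = fst p" "(chart m \<tau> \<nu> p - m) \<bullet> \<nu> = snd p"
  by (simp_all add: chart_def inner_add_left)

lemma chart_collapse: "chart m \<tau> \<nu> ((x - m) \<bullet> \<tau>, (x - m) \<bullet> \<nu>) = x"
  using expand[of "x - m"] by (simp add: chart_def algebra_simps)

lemma norm_chart: "norm (chart m \<tau> \<nu> p - m) = norm p"
proof -
  have "(chart m \<tau> \<nu> p - m) \<bullet> (chart m \<tau> \<nu> p - m) = p \<bullet> p"
    by (simp add: chart_def inner_add_left inner_add_right inner_prod_def)
  then show ?thesis by (simp add: norm_eq_sqrt_inner)
qed

lemma chart_continuous: "continuous_on A (chart m \<tau> \<nu>)"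
  unfolding chart_def by (intro continuous_intros)

lemma chart_measurable [measurable]: "chart m \<tau> \<nu> \<in> borel_measurable borel"
  by (intro borel_measurable_continuous_onI chart_continuous)

lemma distr_pair_lborel: "distr (lborel :: (real \<times> real) measure) borel (\<lambda>p. vector [fst p, snd p] :: plane) = lborel"
proof (rule lborel_eqI[symmetric])
  let ?J = "\<lambda>p::real \<times> real. vector [fst p, snd p] :: plane"
  have J[measurable]: "?J \<in> borel_measurable borel"
  proof (rule borel_measurable_continuous_onI)
    have "?J = chart 0 (axis 1 1) (axis 2 1)"
      by (auto simp: chart_def plane_eq_iff vector_2 axis_def)
    then show "continuous_on UNIV ?J" by (simp only: chart_def[abs_def]) (intro continuous_intros)
  qed
  fix l u :: plane assume lu: "\<And>b. b \<in> Basis \<Longrightarrow> l \<bullet> b \<le> u \<bullet> b"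
  have le: "l $ i \<le> u $ i" for i using lu[of "axis i 1"] by (simp add: inner_axis axis_in_Basis_iff)
  have "?J -` box l u = box (l $ 1, l $ 2) (u $ 1, u $ 2)"
    by (auto simp: mem_box Basis_vec_def Basis_prod_def inner_axis forall_2 vector_2)
  then have "emeasure (distr lborel borel ?J) (box l u) = emeasure lborel (box (l $ 1, l $ 2) (u $ 1, u $ 2))"
    by (subst emeasure_distr) auto
  also have "\<dots> = ennreal ((u $ 2 - l $ 2) * (u $ 1 - l $ 1))"
    using le by (subst emeasure_lborel_box) (auto simp: Basis_prod_def)
  also have "\<dots> = (\<Prod>b\<in>Basis. (u - l) \<bullet> b)"
    by (simp add: Basis_vec_def UNIV_2 axis_eq_axis inner_axis mult.commute)
  finally show "emeasure (distr lborel borel ?J) (box l u) = (\<Prod>b\<in>Basis. (u - l) \<bullet> b)" .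
qed simp

text \<open>Lebesgue measure is determined by its values on boxes. The preimage of a box under the
  motion is an orthogonal image of a translated box, and orthogonal maps preserve measure; the
  passage from pairs to vectors is \<open>distr_pair_lborel\<close>.\<close>

lemma distr_chart: "distr lborel borel (chart m \<tau> \<nu>) = lborel"
proof -
  define A where "A = (\<lambda>y::plane. y $ 1 *\<^sub>R \<tau> + y $ 2 *\<^sub>R \<nu>)"
  have linA: "linear A" unfolding A_def
    by (intro linearI) (simp_all add: algebra_simps)
  define A' where "A' = (\<lambda>x::plane. vector [x \<bullet> \<tau>, x \<bullet> \<nu>] :: plane)"
  have AA': "A (A' x) = x" for x using expand[of x] by (simp add: A_def A'_def vector_2)
  have A'A: "A' (A y) = y" for y
    by (simp add: A_def A'_def plane_eq_iff vector_2 inner_add_left)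
  have ort: "orthogonal_transformation A'" unfolding orthogonal_transformation_def
  proof (intro conjI allI)
    show "linear A'" by (intro linearI) (simp_all add: A'_def plane_eq_iff vector_2 inner_add_left)
    fix v w
    have "v \<bullet> w = A (A' v) \<bullet> A (A' w)" by (simp add: AA')
    also have "\<dots> = A' v \<bullet> A' w"
      by (simp add: A_def inner_add_left inner_add_right) (simp add: inner_plane)
    finally show "A' v \<bullet> A' w = v \<bullet> w" by simp
  qed
  have Am[measurable]: "A \<in> borel_measurable borel"
    unfolding A_def by measurable
  have "distr lborel borel (\<lambda>y. m + A y) = lborel"
  proof (rule lborel_eqI[symmetric])
    fix l u :: plane assume lu: "\<And>b. b \<in> Basis \<Longrightarrow> l \<bullet> b \<le> u \<bullet> b"
    have pre: "(\<lambda>y. m + A y) -` box l u = A' ` box (l - m) (u - m)"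
    proof -
      have "m + A y \<in> box l u \<longleftrightarrow> A y \<in> box (l - m) (u - m)" for y
        by (auto simp: mem_box inner_add_left inner_diff_left algebra_simps)
      then show ?thesis using AA' A'A by (auto simp: AA' simp del: mem_box) (metis image_eqI, metis AA')
    qed
    have bx: "box (l - m) (u - m) \<in> lmeasurable" by simp
    have m1: "A' ` box (l - m) (u - m) \<in> lmeasurable"
      using measurable_orthogonal_image[OF ort bx] .
    have bo: "A' ` box (l - m) (u - m) \<in> sets borel"
      using measurable_sets[of "\<lambda>y. m + A y" borel borel "box l u"] by (simp add: pre)
    have "emeasure (distr lborel borel (\<lambda>y. m + A y)) (box l u) = emeasure lborel (A' ` box (l - m) (u - m))"
      by (subst emeasure_distr) (auto simp: pre)
    also have "\<dots> = emeasure lebesgue (A' ` box (l - m) (u - m))" using bo by simp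
    also have "\<dots> = emeasure lebesgue (box (l - m) (u - m))"
      using emeasure_eq_measure2[OF m1] emeasure_eq_measure2[OF bx] measure_orthogonal_image[OF ort bx] by simp
    also have "\<dots> = (\<Prod>b\<in>Basis. (u - l) \<bullet> b)"
      using lu by (simp add: emeasure_lborel_box_eq inner_diff_left)
    finally show "emeasure (distr lborel borel (\<lambda>y. m + A y)) (box l u) = (\<Prod>b\<in>Basis. (u - l) \<bullet> b)" .
  qed simp
  moreover have "chart m \<tau> \<nu> = (\<lambda>y. m + A y) \<circ> (\<lambda>p. vector [fst p, snd p])"
    by (auto simp: chart_def A_def vector_2 fun_eq_iff)
  moreover have "distr lborel borel ((\<lambda>y. m + A y) \<circ> (\<lambda>p::real \<times> real. vector [fst p, snd p] :: plane))
     = distr (distr lborel borel (\<lambda>p::real \<times> real. vector [fst p, snd p] :: plane)) borel (\<lambda>y. m + A y)"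
  proof (rule distr_distr[symmetric])
    have "(\<lambda>p::real \<times> real. vector [fst p, snd p] :: plane) = chart 0 (axis 1 1) (axis 2 1)"
      by (auto simp: chart_def plane_eq_iff vector_2 axis_def)
    then show "(\<lambda>p::real \<times> real. vector [fst p, snd p] :: plane) \<in> borel_measurable lborel"
      by (auto simp: chart_def[abs_def] intro!: borel_measurable_continuous_onI continuous_intros)
  qed simp
  ultimately show ?thesis by (simp add: distr_pair_lborel)
qed

text \<open>Boundedness and bounded support make the pulled-back function integrable, so that both
  orders of integration are available. Green's formula uses one order for the tangential and the
  other for the normal derivative.\<close>

lemma chart_integral_iterated:
  fixes f :: "plane \<Rightarrow> real"
  assumes f[measurable]: "f \<in> borel_measurable borel" and bd: "\<And>x. \<bar>f x\<bar> \<le> B" and supp: "\<And>x. norm (x - m) > R \<Longrightarrow> f x = 0"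
  shows "(LINT x|lborel. f x) = (LINT s|lborel. LINT t|lborel. f (chart m \<tau> \<nu> (s, t)))" (is ?th1)
    and "(LINT x|lborel. f x) = (LINT t|lborel. LINT s|lborel. f (chart m \<tau> \<nu> (s, t)))" (is ?th2)
    and "integrable lborel (\<lambda>p. f (chart m \<tau> \<nu> p))" (is ?th3)
proof -
  show int: ?th3
  proof (rule Bochner_Integration.integrable_bound)
    show "integrable lborel (\<lambda>p. B * indicator (cball 0 R) p :: real)"
      by (intro integrable_mult_right integrable_real_indicator emeasure_lborel_cball_finite) simp
    show "AE p in lborel. norm (f (chart m \<tau> \<nu> p)) \<le> norm (B * indicat_real (cball 0 R) p)"
      using bd supp norm_chart[of m]
      by (intro AE_I2) (auto simp: indicator_def dist_norm not_le intro: order_trans[OF bd])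
  qed measurable
  have "(LINT x|lborel. f x) = (LINT x|distr lborel borel (chart m \<tau> \<nu>). f x)" by (simp add: distr_chart)
  also have "\<dots> = (LINT p|lborel. f (chart m \<tau> \<nu> p))" by (subst integral_distr) auto
  finally have 1: "(LINT x|lborel. f x) = (LINT p|(lborel \<Otimes>\<^sub>M lborel). f (chart m \<tau> \<nu> p))"
    by (simp add: lborel_prod)
  have int': "integrable (lborel \<Otimes>\<^sub>M lborel) (\<lambda>(s, t). f (chart m \<tau> \<nu> (s, t)))"
    using int by (simp add: lborel_prod split_beta')
  show ?th1 unfolding 1 using lborel_pair.integral_fst[OF int'] by (simp add: split_beta')
  show ?th2 unfolding 1 using lborel_pair.integral_snd[OF int'] by (simp add: split_beta')
qed

end


section \<open>Green's formula on a half-plane\<close>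

definition dderiv :: "plane \<Rightarrow> (plane \<Rightarrow> real) \<Rightarrow> plane \<Rightarrow> real" where
  "dderiv v f x = v $ 1 * partial 1 f x + v $ 2 * partial 2 f x"

lemma smooth_dderiv: "smooth f \<Longrightarrow> smooth (dderiv v f)"
  unfolding dderiv_def[abs_def] by (intro smooth_add smooth_cmult smooth_partial)

lemma smooth_DERIV_line:
  assumes "smooth f"
  shows "((\<lambda>t. f (a + t *\<^sub>R v)) has_real_derivative dderiv v f (a + t *\<^sub>R v)) (at t)"
proof -
  have "((\<lambda>t. a + t *\<^sub>R v) has_derivative (\<lambda>h. h *\<^sub>R v)) (at t)"
    by (auto intro!: derivative_eq_intros)
  from has_derivative_compose[OF this smooth_has_derivative[OF assms]]
  show ?thesis
    by (rule has_derivative_imp_has_field_derivative) (auto simp: dderiv_def algebra_simps)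
qed

lemma smooth_isCont_line: "smooth f \<Longrightarrow> isCont (\<lambda>t. f (a + t *\<^sub>R v)) t"
  using smooth_DERIV_line DERIV_isCont by blast

lemma dderiv_zero_outside:
  assumes "\<And>x. norm x > R \<Longrightarrow> f x = 0" "norm x > R"
  shows "partial i f x = 0" "dderiv v f x = 0"
proof -
  have "open {x::plane. norm x > R}" by (intro open_Collect_less continuous_intros)
  then have "partial i f x = 0" for i using assms by (intro partial_zero_open[of "{x. norm x > R}"]) auto
  then show "partial i f x = 0" "dderiv v f x = 0" by (auto simp: dderiv_def)
qed

lemma
  assumes f: "smooth f" and v: "norm v = 1" and supp: "\<And>x. norm x > R \<Longrightarrow> f x = 0"
  shows integral_dderiv_line: "(LINT t|lborel. dderiv v f (a + t *\<^sub>R v)) = 0"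
    and integral_dderiv_half_line: "(LINT t|lborel. indicator {..0} t * dderiv v f (a + t *\<^sub>R v)) = f a"
proof -
  \<comment> \<open>As \<open>v\<close> is a unit vector, the line through \<open>a\<close> has left
    the ball of radius \<open>R\<close> once |t| reaches this value.\<close>
  define N where "N = \<bar>R\<bar> + norm a + 1"
  have out: "norm (a + t *\<^sub>R v) > R" if "\<bar>t\<bar> \<ge> N" for t
  proof -
    have "\<bar>t\<bar> = norm (t *\<^sub>R v)" by (simp add: v)
    also have "\<dots> \<le> norm (a + t *\<^sub>R v) + norm a"
      using norm_triangle_ineq4[of "a + t *\<^sub>R v" a] by simp
    finally show ?thesis using that by (simp add: N_def)
  qed
  have zero: "dderiv v f (a + t *\<^sub>R v) = 0" "f (a + t *\<^sub>R v) = 0" if "\<bar>t\<bar> \<ge> N" for t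
    using out[OF that] supp dderiv_zero_outside[OF supp] by auto
  have N: "0 \<le> N" by (simp add: N_def)
  have FTC: "(LINT t|lborel. dderiv v f (a + t *\<^sub>R v) * indicator {- N..b} t) = f (a + b *\<^sub>R v) - f (a + (- N) *\<^sub>R v)"
    if "b \<ge> - N" for b
    using that by (intro integral_FTC_Icc_real smooth_DERIV_line smooth_isCont_line f smooth_dderiv)
  have "(LINT t|lborel. dderiv v f (a + t *\<^sub>R v)) = (LINT t|lborel. dderiv v f (a + t *\<^sub>R v) * indicator {- N..N} t)"
    by (intro Bochner_Integration.integral_cong) (auto simp: indicator_def intro: zero)
  then show "(LINT t|lborel. dderiv v f (a + t *\<^sub>R v)) = 0"
    using FTC[of N] zero(2)[of N] zero(2)[of "- N"] N by simp
  have "(LINT t|lborel. indicator {..0} t * dderiv v f (a + t *\<^sub>R v)) = (LINT t|lborel. dderiv v f (a + t *\<^sub>R v) * indicator {- N..0} t)"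
    by (intro Bochner_Integration.integral_cong) (auto simp: indicator_def intro: zero)
  then show "(LINT t|lborel. indicator {..0} t * dderiv v f (a + t *\<^sub>R v)) = f a"
    using FTC[of 0] zero(2)[of "- N"] N by simp
qed

lemma bounded_support_bounded:
  assumes "continuous_on UNIV f" and supp: "\<And>x::plane. norm x > R \<Longrightarrow> f x = (0::real)"
  obtains B where "\<And>x. \<bar>f x\<bar> \<le> B"
proof -
  have "compact (f ` cball 0 R)"
    using assms(1) by (intro compact_continuous_image) (auto intro: continuous_on_subset)
  then obtain B where B: "\<forall>x\<in>cball 0 R. \<bar>f x\<bar> \<le> B"
    by (auto dest!: compact_imp_bounded simp: bounded_iff)
  have "\<bar>f x\<bar> \<le> \<bar>B\<bar>" for x
  proof (cases "norm x \<le> R")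
    case True
    then show ?thesis using B[rule_format, of x] by (simp add: dist_norm)
  qed (use supp in simp)
  then show ?thesis using that by blast
qed

definition half_plane :: "plane \<Rightarrow> plane \<Rightarrow> plane set" where
  "half_plane \<nu> m = {x. (x - m) \<bullet> \<nu> \<le> 0}"

lemma half_plane_borel [measurable]: "half_plane \<nu> m \<in> sets borel"
  unfolding half_plane_def by measurable

context frame
begin

lemma partial_decompose: "partial i f x = \<tau> $ i * dderiv \<tau> f x + \<nu> $ i * dderiv \<nu> f x"
proof -
  have "i = 1 \<or> i = 2" using exhaust_2 by blast
  then show ?thesis
  proof
    assume i: "i = 1"
    have "partial 1 f x = \<tau> $ 1 * (\<tau> $ 1 * partial 1 f x + \<tau> $ 2 * partial 2 f x) + \<nu> $ 1 * (\<nu> $ 1 * partial 1 f x + \<nu> $ 2 * partial 2 f x)"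
      using components by algebra
    then show ?thesis by (simp add: i dderiv_def)
  next
    assume i: "i = 2"
    have "partial 2 f x = \<tau> $ 2 * (\<tau> $ 1 * partial 1 f x + \<tau> $ 2 * partial 2 f x) + \<nu> $ 2 * (\<nu> $ 1 * partial 1 f x + \<nu> $ 2 * partial 2 f x)"
      using components by algebra
    then show ?thesis by (simp add: i dderiv_def)
  qed
qed

text \<open>In the coordinates of the frame the half-plane is t \<le> 0. Tangential derivatives
  integrate to 0 along full lines, normal derivatives integrate over a half-line to the value on the
  boundary line, and a partial derivative is a combination of the two.\<close>

theorem
  assumes f: "smooth f" and supp: "\<And>x. norm x > R \<Longrightarrow> f x = 0"
  shows green_normal: "(LINT x|lborel. indicator (half_plane \<nu> m) x * dderiv \<nu> f x) = (LINT s|lborel. f (m + s *\<^sub>R \<tau>))"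
    and green_integrable: "integrable lborel (\<lambda>x. indicator (half_plane \<nu> m) x * dderiv v f x)"
    and green_half_plane: "(LINT x|lborel. indicator (half_plane \<nu> m) x * partial i f x) = \<nu> $ i * (LINT s|lborel. f (m + s *\<^sub>R \<tau>))"
proof -
  have supp': "norm (x - m) > R + norm m \<Longrightarrow> norm x > R" for x
    using norm_triangle_ineq4[of x m] by linarith
  have bd: "\<exists>B. \<forall>x. \<bar>dderiv v f x\<bar> \<le> B" for v
  proof -
    obtain B where "\<And>x. \<bar>dderiv v f x\<bar> \<le> B"
      by (rule bounded_support_bounded[OF smooth_continuous[OF smooth_dderiv[OF f]], of R v])
         (auto intro: dderiv_zero_outside(2)[OF supp])
    then show ?thesis by blast
  qed
  have meas[measurable]: "dderiv v f \<in> borel_measurable borel" for v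
    by (intro smooth_measurable smooth_dderiv f)
  have int: "(LINT x|lborel. indicator (half_plane \<nu> m) x * dderiv v f x) =
       (LINT s|lborel. LINT t|lborel. indicator (half_plane \<nu> m) (chart m \<tau> \<nu> (s, t)) * dderiv v f (chart m \<tau> \<nu> (s, t)))"
    "(LINT x|lborel. indicator (half_plane \<nu> m) x * dderiv v f x) =
       (LINT t|lborel. LINT s|lborel. indicator (half_plane \<nu> m) (chart m \<tau> \<nu> (s, t)) * dderiv v f (chart m \<tau> \<nu> (s, t)))"
    "integrable lborel (\<lambda>x. indicator (half_plane \<nu> m) x * dderiv v f x)" for v
  proof -
    obtain B where "\<And>x. \<bar>dderiv v f x\<bar> \<le> B" using bd by blast
    then have B: "\<bar>indicator (half_plane \<nu> m) x * dderiv v f x\<bar> \<le> \<bar>B\<bar>" for x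
      by (simp add: indicator_def) (meson abs_ge_self order_trans)
    have z: "indicator (half_plane \<nu> m) x * dderiv v f x = 0" if "norm (x - m) > R + norm m" for x
      using dderiv_zero_outside(2)[OF supp supp'[OF that]] by simp
    show "(LINT x|lborel. indicator (half_plane \<nu> m) x * dderiv v f x) =
       (LINT s|lborel. LINT t|lborel. indicator (half_plane \<nu> m) (chart m \<tau> \<nu> (s, t)) * dderiv v f (chart m \<tau> \<nu> (s, t)))"
      by (rule chart_integral_iterated(1)[OF _ B z]) auto
    show "(LINT x|lborel. indicator (half_plane \<nu> m) x * dderiv v f x) =
       (LINT t|lborel. LINT s|lborel. indicator (half_plane \<nu> m) (chart m \<tau> \<nu> (s, t)) * dderiv v f (chart m \<tau> \<nu> (s, t)))"
      by (rule chart_integral_iterated(2)[OF _ B z]) auto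
    have "integrable lborel (\<lambda>p. indicator (half_plane \<nu> m) (chart m \<tau> \<nu> p) * dderiv v f (chart m \<tau> \<nu> p))"
      by (rule chart_integral_iterated(3)[OF _ B z]) auto
    then have "integrable (distr lborel borel (chart m \<tau> \<nu>)) (\<lambda>x. indicator (half_plane \<nu> m) x * dderiv v f x)"
      by (subst integrable_distr_eq) auto
    then show "integrable lborel (\<lambda>x. indicator (half_plane \<nu> m) x * dderiv v f x)" by (simp add: distr_chart)
  qed
  have ind: "indicator (half_plane \<nu> m) (chart m \<tau> \<nu> (s, t)) = (indicator {..0} t :: real)" for s t
    by (simp add: half_plane_def chart_inner indicator_def)
  have tau: "(LINT x|lborel. indicator (half_plane \<nu> m) x * dderiv \<tau> f x) = 0"
  proof -
    have "(LINT s|lborel. dderiv \<tau> f (chart m \<tau> \<nu> (s, t))) = 0" for t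
      using integral_dderiv_line[OF f norm_tau supp, where a = "m + t *\<^sub>R \<nu>"] by (simp add: chart_def algebra_simps)
    then show ?thesis unfolding int(2) ind by simp
  qed
  show nu: "(LINT x|lborel. indicator (half_plane \<nu> m) x * dderiv \<nu> f x) = (LINT s|lborel. f (m + s *\<^sub>R \<tau>))"
    unfolding int(1) ind
    using integral_dderiv_half_line[OF f norm_nu supp] by (simp add: chart_def)
  have "(LINT x|lborel. indicator (half_plane \<nu> m) x * partial i f x) =
     (LINT x|lborel. \<tau> $ i * (indicator (half_plane \<nu> m) x * dderiv \<tau> f x) + \<nu> $ i * (indicator (half_plane \<nu> m) x * dderiv \<nu> f x))"
    by (simp add: partial_decompose[of i f] algebra_simps)
  also have "\<dots> = \<nu> $ i * (LINT s|lborel. f (m + s *\<^sub>R \<tau>))"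
    using int(3) by (simp add: tau nu)
  finally show "(LINT x|lborel. indicator (half_plane \<nu> m) x * partial i f x) = \<nu> $ i * (LINT s|lborel. f (m + s *\<^sub>R \<tau>))" .
  show "integrable lborel (\<lambda>x. indicator (half_plane \<nu> m) x * dderiv v f x)" by (rule int(3))
qed

text \<open>The boundary line of the half-plane is moved beyond the support; then the half-plane
  contains the support and the boundary term is 0.\<close>

corollary integral_partial_zero:
  assumes f: "smooth f" and supp: "\<And>x. norm x > R \<Longrightarrow> f x = 0"
  shows "(LINT x|lborel. partial i f x) = 0"
proof -
  have out: "norm ((\<bar>R\<bar> + 1) *\<^sub>R \<nu> + s *\<^sub>R \<tau>) > R" for s
  proof -
    have "((\<bar>R\<bar> + 1) *\<^sub>R \<nu> + s *\<^sub>R \<tau>) \<bullet> \<nu> = \<bar>R\<bar> + 1" by (simp add: inner_add_left)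
    moreover have "((\<bar>R\<bar> + 1) *\<^sub>R \<nu> + s *\<^sub>R \<tau>) \<bullet> \<nu> \<le> norm ((\<bar>R\<bar> + 1) *\<^sub>R \<nu> + s *\<^sub>R \<tau>)"
      using norm_cauchy_schwarz[of "(\<bar>R\<bar> + 1) *\<^sub>R \<nu> + s *\<^sub>R \<tau>" \<nu>] by (simp add: norm_nu)
    ultimately show ?thesis by linarith
  qed
  have eq: "indicator (half_plane \<nu> ((\<bar>R\<bar> + 1) *\<^sub>R \<nu>)) x * partial i f x = partial i f x" for x
  proof (cases "norm x > R")
    case True
    then show ?thesis using dderiv_zero_outside(1)[OF supp] by simp
  next
    case False
    then have "x \<bullet> \<nu> \<le> \<bar>R\<bar> + 1"
      using norm_cauchy_schwarz[of x \<nu>] by (simp add: norm_nu)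
    then show ?thesis by (simp add: half_plane_def inner_diff_left indicator_def)
  qed
  then show ?thesis
    using green_half_plane[OF f supp, where m = "(\<bar>R\<bar> + 1) *\<^sub>R \<nu>" and i = i] supp out unfolding eq by simp
qed

end

interpretation standard_frame: frame "axis 1 1" "axis 2 1"
  by unfold_locales (auto simp: inner_axis_axis)


section \<open>Square-integrable functions\<close>

lemma L2_measurable: "f \<in> L2 M \<Longrightarrow> f \<in> borel_measurable M"
  and L2_integrable: "f \<in> L2 M \<Longrightarrow> integrable M (\<lambda>x. (f x)\<^sup>2)"
  by (auto simp: L2_def)

lemma L2_mult_integrable:
  assumes "f \<in> L2 M" "g \<in> L2 M"
  shows "integrable M (\<lambda>x. f x * g x)"
proof (rule Bochner_Integration.integrable_bound)
  show "integrable M (\<lambda>x. (f x)\<^sup>2 + (g x)\<^sup>2)" using assms by (auto intro: L2_integrable)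
  show "(\<lambda>x. f x * g x) \<in> borel_measurable M" using assms by (auto simp: L2_def)
  have "\<bar>a * b\<bar> \<le> a\<^sup>2 + b\<^sup>2" for a b :: real
  proof -
    have "0 \<le> (\<bar>a\<bar> - \<bar>b\<bar>)\<^sup>2" by simp
    then have "2 * (\<bar>a\<bar> * \<bar>b\<bar>) \<le> a\<^sup>2 + b\<^sup>2" by (simp add: power2_diff)
    moreover have "0 \<le> \<bar>a\<bar> * \<bar>b\<bar>" by simp
    ultimately show ?thesis unfolding abs_mult by linarith
  qed
  then show "AE x in M. norm (f x * g x) \<le> norm ((f x)\<^sup>2 + (g x)\<^sup>2)" by simp
qed

lemma L2_add: "f \<in> L2 M \<Longrightarrow> g \<in> L2 M \<Longrightarrow> (\<lambda>x. f x + g x) \<in> L2 M"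
proof -
  assume a: "f \<in> L2 M" "g \<in> L2 M"
  have "integrable M (\<lambda>x. (f x)\<^sup>2 + (g x)\<^sup>2 + 2 * (f x * g x))"
    using a by (intro Bochner_Integration.integrable_add integrable_mult_right L2_integrable L2_mult_integrable)
  with a show ?thesis by (auto simp: L2_def power2_sum algebra_simps)
qed

lemma L2_cmult: "f \<in> L2 M \<Longrightarrow> (\<lambda>x. c * f x) \<in> L2 M"
  by (auto simp: L2_def power_mult_distrib)

lemma L2_diff: "f \<in> L2 M \<Longrightarrow> g \<in> L2 M \<Longrightarrow> (\<lambda>x. f x - g x) \<in> L2 M"
  using L2_add[OF _ L2_cmult[of g M "-1"]] by simp

lemma L2_cong_AE:
  assumes "f \<in> L2 M" "AE x in M. f x = g x" "g \<in> borel_measurable M"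
  shows "g \<in> L2 M"
  using assms unfolding L2_def
  by (auto elim!: integrable_cong_AE_imp)

lemma L2_nrm_nonneg: "0 \<le> L2_nrm M f"
  by (simp add: L2_nrm_def)

lemma L2_nrm_real_sq: "(L2_nrm M f)\<^sup>2 = (LINT x|M. (f x)\<^sup>2)" for f :: "_ \<Rightarrow> real"
  by (simp add: L2_nrm_def)

lemma L2_nrm_cong_AE:
  assumes "AE x in M. f x = g x" "f \<in> borel_measurable M" "g \<in> borel_measurable M"
  shows "L2_nrm M f = L2_nrm M g"
  unfolding L2_nrm_def using assms
  by (intro arg_cong[of _ _ sqrt] integral_cong_AE) auto

text \<open>The integral of (s f + t g)^2 is a nonnegative quadratic form in (s, t), and a suitable
  pair (s, t) yields the discriminant inequality.\<close>

lemma L2_CS: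
  assumes f: "f \<in> L2 M" and g: "g \<in> L2 M"
  shows "\<bar>LINT x|M. f x * g x\<bar> \<le> L2_nrm M f * L2_nrm M g"
proof -
  define A where "A = (LINT x|M. (f x)\<^sup>2)"
  define B where "B = (LINT x|M. (g x)\<^sup>2)"
  define P where "P = (LINT x|M. f x * g x)"
  have quad: "0 \<le> s\<^sup>2 * A + 2 * s * t * P + t\<^sup>2 * B" for s t
  proof -
    have "0 \<le> (LINT x|M. (s * f x + t * g x)\<^sup>2)" by simp
    also have "\<dots> = (LINT x|M. s\<^sup>2 * (f x)\<^sup>2 + (2 * s * t) * (f x * g x) + t\<^sup>2 * (g x)\<^sup>2)"
      by (simp add: power2_sum power_mult_distrib mult_ac add_ac)
    also have "\<dots> = s\<^sup>2 * A + 2 * s * t * P + t\<^sup>2 * B"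
      using L2_integrable[OF f] L2_integrable[OF g] L2_mult_integrable[OF f g]
      by (simp add: A_def B_def P_def)
    finally show ?thesis .
  qed
  have B: "0 \<le> B" by (simp add: B_def)
  have "P\<^sup>2 \<le> A * B"
  proof (cases "B = 0")
    case True
    show ?thesis
    proof (cases "P = 0")
      case False
      \<comment> \<open>For B = 0 the form at s = 1 is linear in t, and this choice of t would make
        its value -1.\<close>
      have "0 \<le> A + 2 * (- (A + 1) / (2 * P)) * P"
        using quad[of 1 "- (A + 1) / (2 * P)"] True by simp
      also have "\<dots> = -1" using False by (simp add: field_simps)
      finally show ?thesis by simp
    qed (use True in simp)
  next
    case False
    then have "B > 0" using B by simp
    have "0 \<le> B * (A * B - P\<^sup>2)"
      using quad[of B "- P"] by (simp add: power2_eq_square algebra_simps)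
    then show ?thesis using \<open>B > 0\<close> by (simp add: zero_le_mult_iff)
  qed
  then have "\<bar>P\<bar> \<le> sqrt (A * B)" by (simp add: real_le_rsqrt)
  then show ?thesis by (simp add: A_def B_def P_def L2_nrm_def real_sqrt_mult)
qed

lemma L2_bounded:
  assumes "f \<in> borel_measurable M" "emeasure M (space M) < \<infinity>" "\<And>x. x \<in> space M \<Longrightarrow> \<bar>f x\<bar> \<le> B"
  shows "f \<in> L2 M" "L2_nrm M f \<le> B * sqrt (measure M (space M))"
proof -
  interpret finite_measure M by (rule finite_measureI) (use assms in auto)
  have sq: "(f x)\<^sup>2 \<le> B\<^sup>2" if "x \<in> space M" for x
    using power_mono[OF assms(3)[OF that], of 2] by simp
  have int: "integrable M (\<lambda>x. (f x)\<^sup>2)"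
    using assms sq by (intro integrable_const_bound[where B = "B\<^sup>2"]) auto
  then show "f \<in> L2 M" using assms by (simp add: L2_def)
  show "L2_nrm M f \<le> B * sqrt (measure M (space M))"
  proof (cases "space M = {}")
    case True
    then have "(LINT x|M. (norm (f x))\<^sup>2) = (LINT x|M. 0)"
      by (intro Bochner_Integration.integral_cong) auto
    then show ?thesis using True by (simp add: L2_nrm_def)
  next
    case False
    then have "0 \<le> B" using assms(3) by fastforce
    have "(LINT x|M. (f x)\<^sup>2) \<le> (LINT x|M. B\<^sup>2)"
      by (intro integral_mono int) (use sq in auto)
    then have "sqrt (LINT x|M. (norm (f x))\<^sup>2) \<le> sqrt (B\<^sup>2 * measure M (space M))"
      by (intro real_sqrt_le_mono) (simp add: mult.commute)
    then show ?thesis using \<open>0 \<le> B\<close> by (simp add: L2_nrm_def real_sqrt_mult)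
  qed
qed

lemma lebesgue_on_measurable:
  fixes f :: "'a::euclidean_space \<Rightarrow> 'b::topological_space"
  shows "f \<in> borel_measurable borel \<Longrightarrow> f \<in> borel_measurable (lebesgue_on S)"
  by (intro measurable_restrict_space1 measurable_completion) simp

lemma smooth_L2:
  assumes "smooth f" "bounded S" "S \<in> sets lebesgue"
  shows "f \<in> L2 (lebesgue_on S)"
proof -
  have "compact (f ` closure S)"
    using assms compact_closure[of S] by (intro compact_continuous_image smooth_continuous) auto
  then obtain B where B: "\<forall>x\<in>closure S. \<bar>f x\<bar> \<le> B"
    by (auto dest!: compact_imp_bounded simp: bounded_iff)
  show ?thesis
  proof (rule L2_bounded)
    show "f \<in> borel_measurable (lebesgue_on S)"
      by (intro lebesgue_on_measurable smooth_measurable assms)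
    have "emeasure lebesgue S < \<infinity>"
      using bounded_set_imp_lmeasurable[OF assms(2,3)] unfolding fmeasurable_def by blast
    then show "emeasure (lebesgue_on S) (space (lebesgue_on S)) < \<infinity>"
      using assms(3) by (simp add: emeasure_restrict_space)
    show "\<bar>f x\<bar> \<le> B" if "x \<in> space (lebesgue_on S)" for x
      using B that closure_subset[of S] by (auto simp: space_restrict_space)
  qed
qed

lemma lebesgue_on_integral_extend:
  fixes f :: "plane \<Rightarrow> real"
  assumes "S \<in> sets lebesgue"
  shows "(LINT x|lebesgue_on S. f x) = (LINT x|lebesgue. indicator S x * f x)"
    "integrable (lebesgue_on S) f \<longleftrightarrow> integrable lebesgue (\<lambda>x. indicator S x * f x)"
  using assms by (simp_all add: integral_restrict_space integrable_restrict_space)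

lemma lebesgue_on_integral_lborel:
  fixes f :: "plane \<Rightarrow> real"
  assumes "S \<in> sets lebesgue" "f \<in> borel_measurable borel" "\<And>x. x \<notin> S \<Longrightarrow> f x = 0"
  shows "(LINT x|lebesgue_on S. f x) = (LINT x|lborel. f x)"
proof -
  have "(\<lambda>x. indicator S x * f x) = f" using assms(3) by (auto simp: indicator_def fun_eq_iff)
  then show ?thesis using assms by (simp add: lebesgue_on_integral_extend integral_completion)
qed

lemma lebesgue_on_integral_subset:
  fixes f g :: "plane \<Rightarrow> real"
  assumes "S \<in> sets lebesgue" "T \<in> sets lebesgue" "S \<subseteq> T" "\<And>x. x \<in> T - S \<Longrightarrow> f x = 0"
  shows "(LINT x|lebesgue_on T. f x) = (LINT x|lebesgue_on S. f x)"
proof -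
  have "(\<lambda>x. indicator T x * f x) = (\<lambda>x. indicator S x * f x)"
    using assms(3,4) by (auto simp: indicator_def fun_eq_iff)
  then show ?thesis using assms by (simp add: lebesgue_on_integral_extend)
qed


section \<open>The fundamental lemma of the calculus of variations\<close>

lemma test_funs_outside: "\<phi> \<in> test_funs U \<Longrightarrow> x \<notin> U \<Longrightarrow> \<phi> x = 0"
  using closure_subset[of "{x. \<phi> x \<noteq> 0}"] by (auto simp: test_funs_def)

lemma test_funs_smooth: "\<phi> \<in> test_funs U \<Longrightarrow> smooth \<phi>"
  by (simp add: test_funs_def)

lemma test_funs_mono: "\<phi> \<in> test_funs U \<Longrightarrow> U \<subseteq> V \<Longrightarrow> \<phi> \<in> test_funs V"
  by (auto simp: test_funs_def)

lemma test_funs_bounded_support: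
  assumes "\<phi> \<in> test_funs U" obtains R where "\<And>x. norm x > R \<Longrightarrow> \<phi> x = 0"
proof -
  have "bounded {x. \<phi> x \<noteq> 0}"
    using assms closure_subset[of "{x. \<phi> x \<noteq> 0}"] unfolding test_funs_def
    by (auto intro: bounded_subset dest: compact_imp_bounded)
  then obtain R where "\<forall>x\<in>{x. \<phi> x \<noteq> 0}. norm x \<le> R" by (auto simp: bounded_iff)
  then show ?thesis using that[of R] by force
qed

lemma test_funsI:
  assumes "smooth \<phi>" "compact K" "K \<subseteq> U" "\<And>x. x \<notin> K \<Longrightarrow> \<phi> x = 0"
  shows "\<phi> \<in> test_funs U"
proof -
  have "closure {x. \<phi> x \<noteq> 0} \<subseteq> K"
    using assms(4) by (intro closure_minimal compact_imp_closed[OF assms(2)]) auto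
  then have "K \<inter> closure {x. \<phi> x \<noteq> 0} = closure {x. \<phi> x \<noteq> 0}" by blast
  then have "compact (closure {x. \<phi> x \<noteq> 0})"
    using compact_Int_closed[OF assms(2) closed_closure, of "{x. \<phi> x \<noteq> 0}"] by simp
  then show ?thesis using \<open>closure {x. \<phi> x \<noteq> 0} \<subseteq> K\<close> assms(1,3) by (auto simp: test_funs_def)
qed

lemma test_funs_partial: "\<phi> \<in> test_funs U \<Longrightarrow> partial i \<phi> \<in> test_funs U"
proof -
  assume a: "\<phi> \<in> test_funs U"
  let ?S = "closure {x. \<phi> x \<noteq> 0}"
  have "partial i \<phi> x = 0" if "x \<notin> ?S" for x
    by (rule partial_zero_open[of "- ?S"]) (use that closure_subset[of "{x. \<phi> x \<noteq> 0}"] in auto)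
  then show ?thesis using a by (intro test_funsI[where K = ?S]) (auto simp: test_funs_def intro: smooth_partial)
qed

lemma test_funs_multi_partial: "\<phi> \<in> test_funs U \<Longrightarrow> multi_partial \<alpha> \<phi> \<in> test_funs U"
proof -
  have "\<phi> \<in> test_funs U \<Longrightarrow> (partial i ^^ n) \<phi> \<in> test_funs U" for i n \<phi>
    by (induction n) (auto intro: test_funs_partial)
  then show "\<phi> \<in> test_funs U \<Longrightarrow> ?thesis" by (simp add: multi_partial_def)
qed

text \<open>Smooth functions between 0 and 1 that vanish off the open box and converge pointwise to
  its indicator. They take the place of mollifiers in the fundamental lemma.\<close>

definition box_fun :: "plane \<Rightarrow> plane \<Rightarrow> nat \<Rightarrow> plane \<Rightarrow> real" where
  "box_fun a b n x = (flat (real n * (x $ 1 - a $ 1)) * flat (real n * (b $ 1 - x $ 1))) *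
     (flat (real n * (x $ 2 - a $ 2)) * flat (real n * (b $ 2 - x $ 2)))"

lemma mem_box_plane: "x \<in> box a b \<longleftrightarrow> a $ 1 < x $ 1 \<and> x $ 1 < b $ 1 \<and> a $ 2 < x $ 2 \<and> x $ 2 < b $ 2"
  "x \<in> cbox a b \<longleftrightarrow> a $ 1 \<le> x $ 1 \<and> x $ 1 \<le> b $ 1 \<and> a $ 2 \<le> x $ 2 \<and> x $ 2 \<le> b $ 2" for x :: plane
  by (auto simp: mem_box_cart forall_2)

lemma smooth_box_fun: "smooth (box_fun a b n)"
proof -
  have *: "smooth (\<lambda>x. flat ((c *\<^sub>R axis i 1) \<bullet> x + d))" for c d and i :: 2
    by (intro smooth_ridge smooth1_flat)
  have 1: "smooth (\<lambda>x. flat (real n * (x $ i - a $ i)))" for i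
    using *[of "real n" i "- (real n * a $ i)"] by (simp add: inner_axis' algebra_simps)
  have 2: "smooth (\<lambda>x. flat (real n * (b $ i - x $ i)))" for i
    using *[of "- real n" i "real n * b $ i"] by (simp add: inner_axis' algebra_simps)
  show ?thesis unfolding box_fun_def[abs_def] by (intro smooth_mult 1 2)
qed

lemma box_fun_zero: "x \<notin> box a b \<Longrightarrow> box_fun a b n x = 0"
proof -
  assume "x \<notin> box a b"
  then have "x $ 1 - a $ 1 \<le> 0 \<or> b $ 1 - x $ 1 \<le> 0 \<or> x $ 2 - a $ 2 \<le> 0 \<or> b $ 2 - x $ 2 \<le> 0"
    by (auto simp: mem_box_plane)
  then show ?thesis unfolding box_fun_def
    by (elim disjE) (auto intro!: flat_zero simp: mult_nonneg_nonpos)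
qed

lemma box_fun_bounds: "0 \<le> box_fun a b n x" "box_fun a b n x \<le> 1"
  unfolding box_fun_def by (auto intro!: mult_nonneg_nonneg mult_le_one flat_nonneg flat_le_1)

lemma box_fun_tendsto: "(\<lambda>n. box_fun a b n x) \<longlonglongrightarrow> indicator (box a b) x"
proof (cases "x \<in> box a b")
  case True
  then have "(\<lambda>n. box_fun a b n x) \<longlonglongrightarrow> (1 * 1) * (1 * 1)"
    unfolding box_fun_def by (intro tendsto_mult flat_scaled_tendsto) (auto simp: mem_box_plane)
  with True show ?thesis by simp
next
  case False
  then show ?thesis by (simp add: box_fun_zero)
qed

text \<open>The Borel sets over which \<open>f\<close> integrates to 0 form a Dynkin system;
  complements require the integral over the whole plane, which is a limit over growing boxes. Boxes
  are stable under intersection and generate the Borel sets, and Lebesgue sets differ from Borel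
  sets by null sets.\<close>

lemma AE_zero_if_box_integrals_zero:
  fixes f :: "plane \<Rightarrow> real"
  assumes f: "integrable lebesgue f" and zero: "\<And>a b. (LINT x|lebesgue. indicator (box a b) x * f x) = 0"
  shows "AE x in lebesgue. f x = 0"
proof -
  have ind: "integrable lebesgue (\<lambda>x. indicator A x * f x)" if "A \<in> sets lebesgue" for A
    using integrable_mult_indicator[OF that f] by simp
  have whole: "(LINT x|lebesgue. f x) = 0"
  proof -
    have "(\<lambda>n. LINT x|lebesgue. indicator (box (- (real n *\<^sub>R One)) (real n *\<^sub>R One)) x * f x) \<longlonglongrightarrow> (LINT x|lebesgue. f x)"
    proof (rule integral_dominated_convergence[where w = "\<lambda>x. \<bar>f x\<bar>"])
      show "AE x in lebesgue. (\<lambda>n. indicator (box (- (real n *\<^sub>R One)) (real n *\<^sub>R One)) x * f x) \<longlonglongrightarrow> f x"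
      proof (intro AE_I2 tendsto_eventually)
        fix x :: plane
        obtain N where N: "x \<in> box (- (real N *\<^sub>R One)) (real N *\<^sub>R One)"
          using UN_box_eq_UNIV[where 'a = plane] by blast
        have "x \<in> box (- (real n *\<^sub>R One)) (real n *\<^sub>R One)" if "n \<ge> N" for n
          using N that by (fastforce simp: mem_box)
        then show "eventually (\<lambda>n. indicator (box (- (real n *\<^sub>R One)) (real n *\<^sub>R One)) x * f x = f x) sequentially"
          by (auto simp: eventually_sequentially intro!: exI[of _ N])
      qed
      show "AE x in lebesgue. norm (indicator (box (- (real n *\<^sub>R One)) (real n *\<^sub>R One)) x * f x) \<le> \<bar>f x\<bar>" for n
        by (auto simp: indicator_def)
    qed (use f ind in \<open>auto intro: borel_measurable_integrable\<close>)
    then show ?thesis by (simp add: zero LIMSEQ_const_iff)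
  qed
  have borel: "(LINT x|lebesgue. indicator A x * f x) = 0" if "A \<in> sets borel" for A
  proof -
    let ?E = "range (\<lambda>(a, b). box a b :: plane set)"
    have A: "A \<in> sigma_sets UNIV ?E" using that by (simp add: borel_eq_box sets_measure_of)
    have "Int_stable ?E" "?E \<subseteq> Pow UNIV" by (auto simp: Int_stable_def box_Int_box)
    from this A show ?thesis
    proof (induction rule: sigma_sets_induct_disjoint)
      case (compl A)
      then have A: "A \<in> sets borel" by (simp add: borel_eq_box sets_measure_of)
      have "(LINT x|lebesgue. indicator (UNIV - A) x * f x) = (LINT x|lebesgue. f x - indicator A x * f x)"
        by (intro Bochner_Integration.integral_cong) (auto simp: indicator_def)
      also have "\<dots> = 0" using ind[of A] A f compl whole by simp
      finally show ?case .
    next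
      case (union A)
      then have "A i \<in> sets borel" for i by (simp add: borel_eq_box sets_measure_of subset_eq)
      then have A: "A i \<in> sets lebesgue" for i by simp
      have "(LINT x|lebesgue. indicator (\<Union>(range A)) x *\<^sub>R f x) = (\<Sum>i. LINT x|lebesgue. indicator (A i) x *\<^sub>R f x)"
      proof -
        have "set_lebesgue_integral lebesgue (\<Union>i. A i) f = (\<Sum>i. set_lebesgue_integral lebesgue (A i) f)"
          using A union(1) ind[of "\<Union>i. A i"]
          by (intro lebesgue_integral_countable_add) (auto simp: disjoint_family_on_def set_integrable_def)
        then show ?thesis by (simp add: set_lebesgue_integral_def)
      qed
      then show ?case using union by simp
    qed (auto simp: zero)
  qed
  show ?thesis
  proof (rule density_unique_real[OF f integrable_zero])
    fix A :: "plane set" assume "A \<in> sets lebesgue"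
    then obtain S N N' where A: "A = S \<union> N" "N \<subseteq> N'" "N' \<in> null_sets lborel" "S \<in> sets lborel"
      by (rule sets_completionE)
    have "AE x in lebesgue. x \<notin> N'" using A(3) by (intro AE_not_in null_sets_completionI)
    then have "(LINT x|lebesgue. indicator A x * f x) = (LINT x|lebesgue. indicator S x * f x)"
      using ind[of A] ind[of S] A \<open>A \<in> sets lebesgue\<close>
      by (intro integral_cong_AE) (auto elim!: eventually_mono simp: indicator_def intro: borel_measurable_integrable)
    then show "(LINT x:A|lebesgue. f x) = (LINT x:A|lebesgue. 0)"
      using borel[of S] A(4) by (simp add: set_lebesgue_integral_def)
  qed
qed

text \<open>Dominated convergence along \<open>box_fun\<close> turns the hypothesis into vanishing
  integrals over all boxes whose closure lies in U. Hence \<open>w\<close> is 0 almost everywhere on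
  every closed box in U, and countably many of these exhaust U.\<close>

theorem fundamental_lemma:
  assumes U: "open U" and w: "w \<in> L2 (lebesgue_on U)"
    and zero: "\<And>\<phi>. \<phi> \<in> test_funs U \<Longrightarrow> (LINT x|lebesgue_on U. w x * \<phi> x) = 0"
  shows "AE x in lebesgue_on U. w x = 0"
proof -
  have Ul: "U \<in> sets lebesgue" using U by auto
  define w0 where "w0 x = indicator U x * w x" for x
  have w0m: "w0 \<in> borel_measurable lebesgue"
    using L2_measurable[OF w] Ul unfolding w0_def by (simp add: borel_measurable_restrict_space_iff)
  have w0sq: "integrable lebesgue (\<lambda>x. (w0 x)\<^sup>2)"
  proof -
    have "(\<lambda>x. indicator U x * (w x)\<^sup>2) = (\<lambda>x. (w0 x)\<^sup>2)"
      by (auto simp: w0_def power_mult_distrib indicator_def fun_eq_iff)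
    then show ?thesis using L2_integrable[OF w] lebesgue_on_integral_extend(2)[OF Ul] by metis
  qed
  \<comment> \<open>Square integrability gives integrability on sets of finite measure through |a|
    \<le> 1 + a^2.\<close>
  have loc: "integrable lebesgue (\<lambda>x. indicator S x * w0 x)" if "S \<in> lmeasurable" for S
  proof (rule Bochner_Integration.integrable_bound)
    show "integrable lebesgue (\<lambda>x. indicator S x + (w0 x)\<^sup>2)"
      using that w0sq by (intro Bochner_Integration.integrable_add integrable_real_indicator) (auto simp: fmeasurable_def)
    have *: "\<bar>a\<bar> \<le> 1 + a\<^sup>2" for a :: real
    proof -
      have "0 \<le> (\<bar>a\<bar> - 1)\<^sup>2" by simp
      then show ?thesis unfolding power2_diff by simp
    qed
    show "AE x in lebesgue. norm (indicator S x * w0 x) \<le> norm (indicator S x + (w0 x)\<^sup>2)"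
      using * by (auto simp: indicator_def)
  qed (use w0m that in \<open>auto simp: fmeasurable_def\<close>)
  have box0: "(LINT x|lebesgue. indicator (box a b) x * w0 x) = 0" if "cbox a b \<subseteq> U" for a b
  proof -
    have "(\<lambda>n. LINT x|lebesgue. box_fun a b n x * w0 x) \<longlonglongrightarrow> (LINT x|lebesgue. indicator (box a b) x * w0 x)"
    proof (rule integral_dominated_convergence[where w = "\<lambda>x. \<bar>indicator (box a b) x * w0 x\<bar>"])
      show "integrable lebesgue (\<lambda>x. \<bar>indicator (box a b) x * w0 x\<bar>)" by (intro integrable_abs loc) simp
      show "AE x in lebesgue. (\<lambda>n. box_fun a b n x * w0 x) \<longlonglongrightarrow> indicator (box a b) x * w0 x"
        by (intro AE_I2 tendsto_mult tendsto_const box_fun_tendsto)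
      show "AE x in lebesgue. norm (box_fun a b n x * w0 x) \<le> \<bar>indicator (box a b) x * w0 x\<bar>" for n
        using box_fun_bounds[of a b n] box_fun_zero[of _ a b n]
        by (intro AE_I2) (auto simp: indicator_def abs_mult intro!: mult_left_le_one_le)
      show "(\<lambda>x. box_fun a b n x * w0 x) \<in> borel_measurable lebesgue" for n
        using smooth_measurable[OF smooth_box_fun, of a b n]
        by (intro borel_measurable_times w0m measurable_completion) simp
    qed (intro borel_measurable_integrable loc, simp)
    moreover have "(LINT x|lebesgue. box_fun a b n x * w0 x) = 0" for n
    proof -
      have "box_fun a b n \<in> test_funs U"
        by (rule test_funsI[OF smooth_box_fun _ that])
           (use box_subset_cbox[of a b] box_fun_zero[of _ a b n] in auto)
      from zero[OF this] show ?thesis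
        by (simp add: lebesgue_on_integral_extend[OF Ul] w0_def mult_ac)
    qed
    ultimately show ?thesis by (simp add: LIMSEQ_const_iff)
  qed
  have AEbox: "AE x in lebesgue. x \<in> cbox a b \<longrightarrow> w0 x = 0" if "cbox a b \<subseteq> U" for a b
  proof -
    have "AE x in lebesgue. indicator (box a b) x * w0 x = 0"
    proof (rule AE_zero_if_box_integrals_zero)
      show "integrable lebesgue (\<lambda>x. indicator (box a b) x * w0 x)" by (rule loc) simp
      fix c d
      \<comment> \<open>The box (c, d) is arbitrary, but its intersection with
        \<open>box a b\<close> is a box whose closure stays inside \<open>cbox a b\<close>, so that
        \<open>box0\<close> applies.\<close>
      obtain p q where pq: "box c d \<inter> box a b = box p q" using box_Int_box by blast
      have "(LINT x|lebesgue. indicator (box p q) x * w0 x) = 0"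
      proof (cases "box p q = {}")
        case False
        then have "cbox p q = closure (box p q)" by (simp add: closure_box)
        also have "\<dots> \<subseteq> closure (box a b)" using pq by (intro closure_mono) auto
        also have "\<dots> \<subseteq> cbox a b" by (intro closure_minimal box_subset_cbox) auto
        finally show ?thesis using that by (intro box0) auto
      qed simp
      moreover have "indicator (box c d) x * (indicator (box a b) x * w0 x) = indicator (box p q) x * w0 x" for x
        by (auto simp: pq[symmetric] indicator_def)
      ultimately show "(LINT x|lebesgue. indicator (box c d) x * (indicator (box a b) x * w0 x)) = 0"
        by (simp only:)
    qed
    moreover have "AE x in lebesgue. x \<notin> cbox a b - box a b"
      using negligible_frontier_interval[of a b] by (intro AE_not_in) (simp add: negligible_iff_null_sets)
    ultimately show ?thesis by eventually_elim (auto simp: indicator_def split: if_splits)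
  qed
  obtain \<D> where D: "countable \<D>" "\<D> \<subseteq> Pow U" "\<And>X. X \<in> \<D> \<Longrightarrow> \<exists>a b. X = cbox a b" "\<Union>\<D> = U"
    using open_countable_Union_open_cbox[OF U] by metis
  have "AE x in lebesgue. \<forall>X\<in>\<D>. x \<in> X \<longrightarrow> w0 x = 0"
  proof (intro AE_ball_countable[OF D(1), THEN iffD2] ballI)
    fix X assume "X \<in> \<D>"
    then obtain a b where "X = cbox a b" "cbox a b \<subseteq> U" using D(2,3) by blast
    then show "AE x in lebesgue. x \<in> X \<longrightarrow> w0 x = 0" using AEbox by simp
  qed
  then have "AE x in lebesgue. x \<in> U \<longrightarrow> w x = 0"
  proof eventually_elim
    case (elim x)
    then show ?case using D(4) by (metis UnionE indicator_simps(1) mult_1 w0_def)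
  qed
  then show ?thesis using Ul by (simp add: AE_restrict_space_iff)
qed


section \<open>Weak derivatives\<close>

lemma test_funs_L2:
  assumes "\<phi> \<in> test_funs U" "V \<in> sets lebesgue"
  shows "\<phi> \<in> L2 (lebesgue_on V)"
proof -
  obtain R where R: "\<And>x. norm x > R \<Longrightarrow> \<phi> x = 0" using test_funs_bounded_support[OF assms(1)] by blast
  have "\<phi> \<in> L2 (lebesgue_on (cball 0 R))"
    using assms by (intro smooth_L2 test_funs_smooth) auto
  then have "integrable lebesgue (\<lambda>x. indicator (cball 0 R) x * (\<phi> x)\<^sup>2)"
    by (simp add: L2_def lebesgue_on_integral_extend)
  moreover have "(\<lambda>x. indicator (cball 0 R) x * (\<phi> x)\<^sup>2) = (\<lambda>x. (\<phi> x)\<^sup>2)"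
  proof
    show "indicator (cball 0 R) x * (\<phi> x)\<^sup>2 = (\<phi> x)\<^sup>2" for x
      using R[of x] by (cases "norm x \<le> R") (auto simp: indicator_def dist_norm)
  qed
  ultimately have "integrable lebesgue (\<lambda>x. (\<phi> x)\<^sup>2)" by simp
  then have "integrable lebesgue (\<lambda>x. indicator V x * (\<phi> x)\<^sup>2)"
    using integrable_mult_indicator[OF assms(2), of "\<lambda>x. (\<phi> x)\<^sup>2"] by simp
  then show ?thesis using assms
    by (auto simp: L2_def lebesgue_on_integral_extend intro!: lebesgue_on_measurable smooth_measurable test_funs_smooth)
qed

lemma weak_deriv_unique:
  assumes U: "open U" and w: "w \<in> L2 (lebesgue_on U)" "w' \<in> L2 (lebesgue_on U)"
    and d: "is_weak_deriv U \<alpha> v w" "is_weak_deriv U \<alpha> v w'"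
  shows "AE x in lebesgue_on U. w x = w' x"
proof -
  have "AE x in lebesgue_on U. w x - w' x = 0"
  proof (rule fundamental_lemma[OF U])
    fix \<phi> assume \<phi>: "\<phi> \<in> test_funs U"
    have \<phi>2: "\<phi> \<in> L2 (lebesgue_on U)" using \<phi> U by (intro test_funs_L2) auto
    have "(- 1) ^ (fst \<alpha> + snd \<alpha>) * (LINT x|lebesgue_on U. w x * \<phi> x) = (- 1) ^ (fst \<alpha> + snd \<alpha>) * (LINT x|lebesgue_on U. w' x * \<phi> x)"
      using bspec[OF d(1)[unfolded is_weak_deriv_def] \<phi>] bspec[OF d(2)[unfolded is_weak_deriv_def] \<phi>]
      by (rule trans[OF sym])
    then have "(LINT x|lebesgue_on U. w x * \<phi> x) = (LINT x|lebesgue_on U. w' x * \<phi> x)" by simp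
    then show "(LINT x|lebesgue_on U. (w x - w' x) * \<phi> x) = 0"
      using L2_mult_integrable[OF w(1) \<phi>2] L2_mult_integrable[OF w(2) \<phi>2]
      by (simp add: left_diff_distrib)
  qed (intro L2_diff w)
  then show ?thesis by simp
qed

text \<open>\<open>weak_deriv\<close> is an unspecified representative; by uniqueness it agrees
  almost everywhere with any square-integrable weak derivative at hand. The evaluations of weak
  derivatives below rest on this fact.\<close>

lemma weak_deriv_props:
  assumes U: "open U" and w: "w \<in> L2 (lebesgue_on U)" "is_weak_deriv U \<alpha> v w"
  shows "weak_deriv U \<alpha> v \<in> L2 (lebesgue_on U)" "is_weak_deriv U \<alpha> v (weak_deriv U \<alpha> v)"
    "AE x in lebesgue_on U. weak_deriv U \<alpha> v x = w x"
proof -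
  have "weak_deriv U \<alpha> v \<in> L2 (lebesgue_on U) \<and> is_weak_deriv U \<alpha> v (weak_deriv U \<alpha> v)"
    unfolding weak_deriv_def by (rule someI[of _ w]) (use w in auto)
  then show "weak_deriv U \<alpha> v \<in> L2 (lebesgue_on U)" "is_weak_deriv U \<alpha> v (weak_deriv U \<alpha> v)"
    "AE x in lebesgue_on U. weak_deriv U \<alpha> v x = w x"
    using weak_deriv_unique[OF U _ w(1) _ w(2)] by auto
qed

lemma is_weak_deriv_subset:
  assumes "is_weak_deriv \<Omega> \<alpha> v w" "U \<subseteq> \<Omega>" "open U" "open \<Omega>"
  shows "is_weak_deriv U \<alpha> v w"
  unfolding is_weak_deriv_def
proof
  fix \<phi> assume \<phi>: "\<phi> \<in> test_funs U"
  have *: "(LINT x|lebesgue_on \<Omega>. f x * \<psi> x) = (LINT x|lebesgue_on U. f x * \<psi> x)" if "\<psi> \<in> test_funs U" for \<psi> f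
    using assms test_funs_outside[OF that] by (intro lebesgue_on_integral_subset) auto
  show "(LINT x|lebesgue_on U. v x * multi_partial \<alpha> \<phi> x) = (- 1) ^ (fst \<alpha> + snd \<alpha>) * (LINT x|lebesgue_on U. w x * \<phi> x)"
    using bspec[OF assms(1)[unfolded is_weak_deriv_def] test_funs_mono[OF \<phi> assms(2)]]
    by (simp only: *[OF \<phi>] *[OF test_funs_multi_partial[OF \<phi>]])
qed

lemma is_weak_deriv_diff:
  assumes "open U" "is_weak_deriv U \<alpha> v w" "is_weak_deriv U \<alpha> v' w'"
    "v \<in> L2 (lebesgue_on U)" "w \<in> L2 (lebesgue_on U)" "v' \<in> L2 (lebesgue_on U)" "w' \<in> L2 (lebesgue_on U)"
  shows "is_weak_deriv U \<alpha> (\<lambda>x. v x - v' x) (\<lambda>x. w x - w' x)"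
  unfolding is_weak_deriv_def
proof
  fix \<phi> assume \<phi>: "\<phi> \<in> test_funs U"
  have U: "U \<in> sets lebesgue" using assms by auto
  have *: "(LINT x|lebesgue_on U. (f x - g x) * \<psi> x) = (LINT x|lebesgue_on U. f x * \<psi> x) - (LINT x|lebesgue_on U. g x * \<psi> x)"
    if "\<psi> \<in> test_funs U" "f \<in> L2 (lebesgue_on U)" "g \<in> L2 (lebesgue_on U)" for \<psi> f g
    using L2_mult_integrable[OF that(2) test_funs_L2[OF that(1) U]] L2_mult_integrable[OF that(3) test_funs_L2[OF that(1) U]]
    by (simp add: left_diff_distrib)
  show "(LINT x|lebesgue_on U. (v x - v' x) * multi_partial \<alpha> \<phi> x) = (- 1) ^ (fst \<alpha> + snd \<alpha>) * (LINT x|lebesgue_on U. (w x - w' x) * \<phi> x)"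
    using assms \<phi> *[OF \<phi> assms(5,7)] *[OF test_funs_multi_partial[OF \<phi>] assms(4,6)]
    unfolding is_weak_deriv_def by (simp add: right_diff_distrib)
qed

lemma is_weak_deriv_cong_AE:
  assumes "AE x in lebesgue_on U. v x = v' x" "v \<in> borel_measurable (lebesgue_on U)" "v' \<in> borel_measurable (lebesgue_on U)"
  shows "is_weak_deriv U \<alpha> v w \<longleftrightarrow> is_weak_deriv U \<alpha> v' w"
proof -
  have "(LINT x|lebesgue_on U. v x * multi_partial \<alpha> \<phi> x) = (LINT x|lebesgue_on U. v' x * multi_partial \<alpha> \<phi> x)"
    if "\<phi> \<in> test_funs U" for \<phi>
  proof (rule integral_cong_AE)
    have [measurable]: "multi_partial \<alpha> \<phi> \<in> borel_measurable (lebesgue_on U)"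
      by (intro lebesgue_on_measurable smooth_measurable test_funs_smooth[OF test_funs_multi_partial[OF that]])
    show "(\<lambda>x. v x * multi_partial \<alpha> \<phi> x) \<in> borel_measurable (lebesgue_on U)"
      "(\<lambda>x. v' x * multi_partial \<alpha> \<phi> x) \<in> borel_measurable (lebesgue_on U)"
      using assms by measurable
  qed (use assms in auto)
  then show ?thesis by (auto simp: is_weak_deriv_def)
qed

text \<open>The product is smooth with compact support in U, so its partial derivative integrates to
  0 over the plane.\<close>

lemma integral_by_parts:
  assumes v: "smooth v" and \<phi>: "\<phi> \<in> test_funs U" and U: "open U"
  shows "(LINT x|lebesgue_on U. v x * partial i \<phi> x) = - (LINT x|lebesgue_on U. partial i v x * \<phi> x)"
proof -
  obtain R where R: "\<And>x. norm x > R \<Longrightarrow> \<phi> x = 0" using test_funs_bounded_support[OF \<phi>] by blast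
  have Ul: "U \<in> sets lebesgue" using U by auto
  note s\<phi> = test_funs_smooth[OF \<phi>]
  have int: "integrable lborel (\<lambda>x. f x * \<psi> x)" if "smooth f" and psi: "\<psi> \<in> test_funs U" for f \<psi>
  proof -
    obtain R where R: "\<And>x. norm x > R \<Longrightarrow> \<psi> x = 0" using test_funs_bounded_support[OF psi] by blast
    have 1: "f \<in> L2 (lebesgue_on (cball 0 R))" "\<psi> \<in> L2 (lebesgue_on (cball 0 R))"
      using that by (auto intro!: smooth_L2 test_funs_smooth)
    have eq: "(\<lambda>x. indicator (cball 0 R) x * (f x * \<psi> x)) = (\<lambda>x. f x * \<psi> x)"
    proof
      show "indicator (cball 0 R) x * (f x * \<psi> x) = f x * \<psi> x" for x
        using R[of x] by (cases "norm x \<le> R") (auto simp: indicator_def dist_norm)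
    qed
    have "integrable lebesgue (\<lambda>x. f x * \<psi> x)"
      using L2_mult_integrable[OF 1] by (simp add: lebesgue_on_integral_extend eq)
    moreover have "(\<lambda>x. f x * \<psi> x) \<in> borel_measurable lborel"
      using smooth_measurable[OF smooth_mult[OF that(1) test_funs_smooth[OF that(2)]]] by simp
    ultimately show ?thesis by (simp add: integrable_completion)
  qed
  have out: "f x * \<psi> x = 0" if "\<psi> \<in> test_funs U" "x \<notin> U" for f \<psi> and x :: plane
    using test_funs_outside[OF that] by simp
  have tr: "(LINT x|lebesgue_on U. f x * \<psi> x) = (LINT x|lborel. f x * \<psi> x)" if "smooth f" "\<psi> \<in> test_funs U" for f \<psi>
    by (rule lebesgue_on_integral_lborel[OF Ul])
       (use smooth_measurable[OF smooth_mult[OF that(1) test_funs_smooth[OF that(2)]]] out[OF that(2)] in auto)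
  have "0 = (LINT x|lborel. partial i (\<lambda>x. v x * \<phi> x) x)"
    using R by (intro standard_frame.integral_partial_zero[of _ R, symmetric] smooth_mult v s\<phi>) auto
  also have "\<dots> = (LINT x|lborel. partial i v x * \<phi> x + v x * partial i \<phi> x)"
    using v s\<phi> by (simp add: partial_mult smooth_differentiable)
  also have "\<dots> = (LINT x|lborel. partial i v x * \<phi> x) + (LINT x|lborel. v x * partial i \<phi> x)"
    using v \<phi> by (intro Bochner_Integration.integral_add int smooth_partial test_funs_partial)
  finally show ?thesis using v \<phi> by (simp add: tr smooth_partial test_funs_partial)
qed

text \<open>Two integrations by parts reverse the order of differentiation, while the multi-index
  (1, 1) fixes one order. The commutation is carried along as a property; polynomials and sums of
  tensor products have it by direct computation.\<close>

definition smooth_sym :: "(plane \<Rightarrow> real) \<Rightarrow> bool" where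
  "smooth_sym f \<longleftrightarrow> smooth f \<and> partial 1 (partial 2 f) = partial 2 (partial 1 f)"

lemma multi_partial_simps:
  "multi_partial (0, 0) f = f" "multi_partial (1, 0) f = partial 1 f" "multi_partial (0, 1) f = partial 2 f"
  "multi_partial (Suc 0, 0) f = partial 1 f" "multi_partial (0, Suc 0) f = partial 2 f"
  "multi_partial (Suc 0, Suc 0) f = partial 1 (partial 2 f)"
  "multi_partial (2, 0) f = partial 1 (partial 1 f)" "multi_partial (0, 2) f = partial 2 (partial 2 f)"
  "multi_partial (1, 1) f = partial 1 (partial 2 f)"
  by (simp_all add: multi_partial_def numeral_2_eq_2)

lemma multi_upto_1: "multi_upto 1 = {(0, 0), (1, 0), (0, 1)}"
  and multi_upto_2: "multi_upto 2 = {(0, 0), (1, 0), (0, 1), (2, 0), (1, 1), (0, 2)}"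
  by (force simp: )+

lemma smooth_is_weak_deriv:
  assumes v: "smooth v" and U: "open U" and \<alpha>: "\<alpha> \<in> multi_upto 2" and sym: "\<alpha> = (1, 1) \<Longrightarrow> smooth_sym v"
  shows "is_weak_deriv U \<alpha> v (multi_partial \<alpha> v)"
  unfolding is_weak_deriv_def
proof
  fix \<phi> assume \<phi>: "\<phi> \<in> test_funs U"
  note ibp = integral_by_parts[OF _ _ U]
  have "(LINT x|lebesgue_on U. v x * partial i (partial j \<phi>) x) = (LINT x|lebesgue_on U. partial j (partial i v) x * \<phi> x)" for i j
    using ibp[OF v test_funs_partial[OF \<phi>], of i j] ibp[OF smooth_partial[OF v] \<phi>, of i j] by simp
  moreover have "(LINT x|lebesgue_on U. v x * partial i \<phi> x) = - (LINT x|lebesgue_on U. partial i v x * \<phi> x)" for i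
    using ibp[OF v \<phi>] .
  ultimately show "(LINT x|lebesgue_on U. v x * multi_partial \<alpha> \<phi> x) =
      (- 1) ^ (fst \<alpha> + snd \<alpha>) * (LINT x|lebesgue_on U. multi_partial \<alpha> v x * \<phi> x)"
    using \<alpha> sym unfolding multi_upto_2
    by (auto simp: multi_partial_simps smooth_sym_def simp flip: One_nat_def)
qed

lemma smooth_weak_deriv:
  assumes "smooth v" "open U" "bounded U" "\<alpha> \<in> multi_upto 2" "\<alpha> = (1, 1) \<Longrightarrow> smooth_sym v"
  shows "AE x in lebesgue_on U. weak_deriv U \<alpha> v x = multi_partial \<alpha> v x"
    "weak_deriv U \<alpha> v \<in> L2 (lebesgue_on U)"
  using weak_deriv_props[OF assms(2) _ smooth_is_weak_deriv[OF assms(1,2,4,5)]]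
    smooth_L2[OF smooth_multi_partial[OF assms(1)] assms(3)] assms(2) by auto

lemma weak_deriv_AE_zero:
  assumes "open U" "v = (\<lambda>x. 0)"
  shows "AE x in lebesgue_on U. weak_deriv U \<alpha> v x = 0" "weak_deriv U \<alpha> v \<in> L2 (lebesgue_on U)"
proof -
  have 1: "(\<lambda>x. 0) \<in> L2 (lebesgue_on U)" by (simp add: L2_def)
  have 2: "is_weak_deriv U \<alpha> v (\<lambda>x. 0)" using assms(2) by (simp add: is_weak_deriv_def)
  show "AE x in lebesgue_on U. weak_deriv U \<alpha> v x = 0" "weak_deriv U \<alpha> v \<in> L2 (lebesgue_on U)"
    using weak_deriv_props[OF assms(1) 1 2] by auto
qed

lemma H_nrm_zero: "open U \<Longrightarrow> H_nrm m U (\<lambda>x. 0) = 0"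
proof -
  assume U: "open U"
  have "L2_nrm (lebesgue_on U) (weak_deriv U \<alpha> (\<lambda>x. 0)) = 0" for \<alpha>
  proof -
    have "L2_nrm (lebesgue_on U) (weak_deriv U \<alpha> (\<lambda>x. 0)) = L2_nrm (lebesgue_on U) (\<lambda>x. 0 :: real)"
      by (intro L2_nrm_cong_AE weak_deriv_AE_zero(1) L2_measurable[OF weak_deriv_AE_zero(2)] U refl) simp
    then show ?thesis by (simp add: L2_nrm_def)
  qed
  then show ?thesis by (simp add: H_nrm_def)
qed

text \<open>The constant sequence \<open>v\<close> approximates, since the norm of the zero function
  is 0 for any choice of its weak derivatives.\<close>

lemma test_funs_H0_space:
  assumes "open \<Omega>" "bounded \<Omega>" "v \<in> test_funs \<Omega>" "smooth_sym v"
  shows "v \<in> H0_space 2 \<Omega>"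
proof -
  have "\<exists>w\<in>L2 (lebesgue_on \<Omega>). is_weak_deriv \<Omega> \<alpha> v w" if "\<alpha> \<in> multi_upto 2" for \<alpha>
  proof
    show "is_weak_deriv \<Omega> \<alpha> v (multi_partial \<alpha> v)"
      using smooth_is_weak_deriv[OF test_funs_smooth[OF assms(3)] assms(1) that assms(4)] .
    show "multi_partial \<alpha> v \<in> L2 (lebesgue_on \<Omega>)"
      using assms by (intro smooth_L2 smooth_multi_partial test_funs_smooth[OF assms(3)]) auto
  qed
  then have "v \<in> H_space 2 \<Omega>"
    using test_funs_L2[OF assms(3)] assms(1) by (auto simp: H_space_def)
  then show ?thesis unfolding H0_space_def
    using assms(3) H_nrm_zero[OF assms(1)] by (auto intro!: exI[of _ "\<lambda>n. v"])
qed


section \<open>Geometry of triangles and edges\<close>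

lemma triangle_props:
  assumes "2 simplex (T :: plane set)"
  shows "convex T" "compact T" "closed T" "bounded T" "interior T \<noteq> {}" "closure (interior T) = T"
    "rel_interior T = interior T" "aff_dim T = 2"
proof -
  show c: "convex T" "compact T" and cl: "closed T" using assms by (auto intro: convex_simplex compact_simplex closed_simplex)
  then show "bounded T" by (simp add: compact_imp_bounded)
  show a: "aff_dim T = 2" using assms by (rule aff_dim_simplex)
  then show ri: "rel_interior T = interior T" by (intro interior_rel_interior) simp
  show i: "interior T \<noteq> {}" using a ri rel_interior_eq_empty[OF c(1)] by auto
  show "closure (interior T) = T" using convex_closure_interior[OF c(1) i] cl by simp
qed

text \<open>Faces of a simplex are hulls of subsets of its affinely independent vertices, and affine
  dimension 1 leaves the pairs.\<close>

lemma triangle_edge_cases: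
  assumes "2 simplex T" "E edge_of T"
  obtains a b c where "a \<noteq> b" "E = closed_segment a b" "T = convex hull {a, b, c}"
proof -
  obtain C where C: "\<not> affine_dependent C" "int (card C) = 3" "T = convex hull C"
    using assms(1) by (auto simp: simplex_def)
  have E: "E face_of T" "aff_dim E = 1" using assms(2) by (auto simp: edge_of_def)
  then obtain c where c: "c \<subseteq> C" "E = convex hull c"
    using face_of_convex_hull_affine_independent[OF C(1)] C(3) by auto
  have fin: "finite C" using C(1) by (rule aff_independent_finite)
  have "\<not> affine_dependent c" using C(1) c(1) affine_independent_subset by blast
  then have "aff_dim c = int (card c) - 1" by (simp add: aff_dim_affine_independent)
  then have "card c = 2" using E(2) c(2) by (simp add: aff_dim_convex_hull)
  then obtain a b where ab: "c = {a, b}" "a \<noteq> b" by (auto simp: card_2_iff)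
  have "card (C - c) = 1" using C(2) \<open>card c = 2\<close> c(1) fin by (simp add: card_Diff_subset finite_subset)
  then obtain z where "C - c = {z}" by (auto simp: card_1_singleton_iff)
  then have "C = {a, b, z}" using c(1) ab by auto
  then show ?thesis using that[of a b z] ab c(2) C(3) by (simp add: segment_convex_hull)
qed

text \<open>Every edge is the hull of a subset of the three vertices, which leaves 8 candidates. The
  crude count suffices as an overlap constant.\<close>

lemma edges_of_triangle_card:
  assumes "2 simplex T" shows "finite {E. E edge_of T}" "card {E. E edge_of T} \<le> 8"
proof -
  obtain C where C: "\<not> affine_dependent C" "int (card C) = 3" "T = convex hull C"
    using assms(1) by (auto simp: simplex_def)
  have fin: "finite C" using C(1) by (rule aff_independent_finite)
  have sub: "{E. E edge_of T} \<subseteq> (hull) convex ` Pow C"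
    using face_of_convex_hull_affine_independent[OF C(1)] C(3) by (auto simp: edge_of_def)
  show "finite {E. E edge_of T}" using sub fin by (meson finite_Pow_iff finite_imageI finite_subset)
  have "card {E. E edge_of T} \<le> card ((hull) convex ` Pow C)" using sub fin by (intro card_mono) auto
  also have "\<dots> \<le> card (Pow C)" using fin by (intro card_image_le) auto
  also have "\<dots> = 8" using C(2) fin by (simp add: card_Pow)
  finally show "card {E. E edge_of T} \<le> 8" .
qed

text \<open>Here \<open>m\<close> is the midpoint and \<open>d\<close> the length of the edge, and
  \<nu> is the outer normal of T. The normal is a parameter, so that both triangles at an interior
  edge are instances, with normals of opposite sign.\<close>

locale oriented_edge = frame +
  fixes T E :: "plane set" and m :: plane and d :: real
  assumes triangle: "2 simplex T" and edge: "E edge_of T" and length_pos: "d > 0"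
    and segment: "E = closed_segment (m - (d/2) *\<^sub>R \<tau>) (m + (d/2) *\<^sub>R \<tau>)"
    and side: "T \<subseteq> half_plane \<nu> m"
begin

lemmas T_props = triangle_props[OF triangle]

lemma mem_edge: "m + s *\<^sub>R \<tau> \<in> E \<longleftrightarrow> \<bar>s\<bar> \<le> d / 2"
proof
  assume "m + s *\<^sub>R \<tau> \<in> E"
  then obtain u where u: "0 \<le> u" "u \<le> 1"
    "m + s *\<^sub>R \<tau> = (1 - u) *\<^sub>R (m - (d/2) *\<^sub>R \<tau>) + u *\<^sub>R (m + (d/2) *\<^sub>R \<tau>)"
    by (auto simp: segment in_segment)
  have "(m + s *\<^sub>R \<tau>) \<bullet> \<tau> = m \<bullet> \<tau> + (u - 1/2) * d"
    unfolding u(3) by (simp add: inner_simps) (simp add: field_simps)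
  then have s: "s = (u - 1/2) * d" by (simp add: inner_add_left)
  have "\<bar>u - 1/2\<bar> \<le> 1/2" using u(1,2) by (auto simp: abs_if)
  then have "\<bar>u - 1/2\<bar> * d \<le> (1/2) * d" using length_pos by (intro mult_right_mono) auto
  then show "\<bar>s\<bar> \<le> d / 2" using length_pos by (simp add: s abs_mult)
next
  assume s: "\<bar>s\<bar> \<le> d / 2"
  show "m + s *\<^sub>R \<tau> \<in> E" unfolding segment in_segment
  proof (intro exI[of _ "s / d + 1/2"] conjI)
    show "0 \<le> s / d + 1/2" "s / d + 1/2 \<le> 1" using s length_pos by (auto simp: field_simps abs_le_iff)
    have *: "m' + s * t = (1 - (s / d + 1 / 2)) * (m' - (d / 2) * t) + (s / d + 1 / 2) * (m' + (d / 2) * t)" for m' t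
      using length_pos by (simp add: field_simps)
    show "m + s *\<^sub>R \<tau> = (1 - (s / d + 1 / 2)) *\<^sub>R (m - (d / 2) *\<^sub>R \<tau>) + (s / d + 1 / 2) *\<^sub>R (m + (d / 2) *\<^sub>R \<tau>)"
      using *[of "m $ 1" "\<tau> $ 1"] *[of "m $ 2" "\<tau> $ 2"] by (simp add: plane_eq_iff)
  qed
qed

lemma edge_chart: "x \<in> E \<Longrightarrow> x = m + ((x - m) \<bullet> \<tau>) *\<^sub>R \<tau> \<and> (x - m) \<bullet> \<nu> = 0"
proof -
  assume "x \<in> E"
  then obtain u where u: "x = (1 - u) *\<^sub>R (m - (d/2) *\<^sub>R \<tau>) + u *\<^sub>R (m + (d/2) *\<^sub>R \<tau>)"
    by (auto simp: segment in_segment)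
  have "(x - m) \<bullet> \<nu> = 0" unfolding u by (simp add: inner_simps algebra_simps)
  then show ?thesis using chart_collapse[of m x] by (simp add: chart_def)
qed

lemma E_ends: "m - (d/2) *\<^sub>R \<tau> \<in> E" "m + (d/2) *\<^sub>R \<tau> \<in> E" "m \<in> E"
  using mem_edge[of "-(d/2)"] mem_edge[of "d/2"] mem_edge[of 0] length_pos by auto

lemma E_subset: "E \<subseteq> T" using edge by (rule edge_of_imp_subset)

lemma length_le_diameter: "d \<le> diameter T"
proof -
  have "dist (m - (d/2) *\<^sub>R \<tau>) (m + (d/2) *\<^sub>R \<tau>) \<le> diameter T"
    using E_ends E_subset T_props(4) by (intro diameter_bounded_bound) auto
  also have "dist (m - (d/2) *\<^sub>R \<tau>) (m + (d/2) *\<^sub>R \<tau>) = norm (- (d *\<^sub>R \<tau>))"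
    unfolding dist_norm by (rule arg_cong[of _ _ norm]) (simp add: plane_eq_iff)
  finally show ?thesis using length_pos by (simp add: norm_tau)
qed

lemma mem_rel_interior_edge: "x \<in> rel_interior E \<longleftrightarrow> (x - m) \<bullet> \<nu> = 0 \<and> \<bar>(x - m) \<bullet> \<tau>\<bar> < d / 2"
proof -
  let ?a = "m - (d/2) *\<^sub>R \<tau>" and ?b = "m + (d/2) *\<^sub>R \<tau>"
  have ne: "?a \<noteq> ?b"
  proof
    assume "?a = ?b"
    then have "?a \<bullet> \<tau> = ?b \<bullet> \<tau>" by (rule arg_cong)
    then show False using length_pos by (simp add: inner_add_left inner_diff_left)
  qed
  then have ri: "rel_interior E = E - {?a, ?b}"
    unfolding segment by (auto simp: rel_interior_closed_segment open_segment_def)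
  have eq: "x = m + s *\<^sub>R \<tau> \<longleftrightarrow> (x - m) \<bullet> \<nu> = 0 \<and> (x - m) \<bullet> \<tau> = s" for s
    using chart_collapse[of m x] by (auto simp: chart_def inner_simps)
  have ends: "x = ?a \<longleftrightarrow> (x - m) \<bullet> \<nu> = 0 \<and> (x - m) \<bullet> \<tau> = - (d / 2)" using eq[of "- (d/2)"] by simp
  have xE: "x \<in> E \<longleftrightarrow> (x - m) \<bullet> \<nu> = 0 \<and> \<bar>(x - m) \<bullet> \<tau>\<bar> \<le> d / 2"
    using edge_chart[of x] mem_edge eq[of "(x - m) \<bullet> \<tau>"] by metis
  show ?thesis unfolding ri using xE ends eq[of "d/2"] by auto
qed

text \<open>A triangle is the cone over its edge with the opposite vertex as apex. The apex lies
  strictly on the inner side, since otherwise T would be contained in a line and have no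
  interior.\<close>

lemma opposite_vertex:
  obtains c where "(c - m) \<bullet> \<nu> < 0"
    "\<And>x. x \<in> T \<Longrightarrow> \<exists>u e. 0 \<le> u \<and> u \<le> 1 \<and> e \<in> E \<and> x = u *\<^sub>R c + (1 - u) *\<^sub>R e"
proof -
  obtain a b c where abc: "a \<noteq> b" "E = closed_segment a b" "T = convex hull {a, b, c}"
    using triangle_edge_cases[OF triangle edge] by metis
  have dec: "\<exists>u e. 0 \<le> u \<and> u \<le> 1 \<and> e \<in> E \<and> x = u *\<^sub>R c + (1 - u) *\<^sub>R e" if "x \<in> T" for x
  proof -
    have "x \<in> convex hull (insert c {a, b})" using that abc(3) by (simp add: insert_commute)
    then obtain u v e where "u \<ge> 0" "v \<ge> 0" "u + v = 1" "e \<in> convex hull {a, b}" "x = u *\<^sub>R c + v *\<^sub>R e"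
      using convex_hull_insert[of "{a, b}" c] by blast
    then show ?thesis
      by (intro exI[of _ u] exI[of _ e]) (auto simp: abc(2) segment_convex_hull eq_diff_eq)
  qed
  have "c \<in> T" using abc(3) by (simp add: hull_inc)
  then have "(c - m) \<bullet> \<nu> \<le> 0" using side by (auto simp: half_plane_def)
  moreover have "(c - m) \<bullet> \<nu> \<noteq> 0"
  proof
    assume c0: "(c - m) \<bullet> \<nu> = 0"
    have "T \<subseteq> {x. \<nu> \<bullet> x = \<nu> \<bullet> m}"
    proof
      fix x assume "x \<in> T"
      then obtain u e where xe: "e \<in> E" "x = u *\<^sub>R c + (1 - u) *\<^sub>R e" using dec by blast
      have ce: "c \<bullet> \<nu> = m \<bullet> \<nu>" "e \<bullet> \<nu> = m \<bullet> \<nu>"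
        using c0 edge_chart[OF \<open>e \<in> E\<close>] by (simp_all add: inner_diff_left)
      have "x \<bullet> \<nu> = u * (m \<bullet> \<nu>) + (1 - u) * (m \<bullet> \<nu>)"
        by (simp only: xe(2) inner_add_left inner_scaleR_left ce)
      then have "x \<bullet> \<nu> = m \<bullet> \<nu>" by (simp add: algebra_simps)
      then show "x \<in> {x. \<nu> \<bullet> x = \<nu> \<bullet> m}" by (simp add: inner_commute)
    qed
    moreover have "\<nu> \<noteq> 0" using norm_nu by auto
    ultimately have "interior T = {}" using interior_hyperplane interior_mono by blast
    then show False using T_props by simp
  qed
  ultimately show ?thesis using that[of c] dec by force
qed

text \<open>Take the diameter of the ball parallel to the edge. Its two ends have equal distance
  from the edge line, hence the same weight u at the apex, so this chord is 1 - u times a difference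
  of two edge points. With shape regularity, the diameter of T is then bounded by the length of each
  of its edges.\<close>

lemma inball_le_length:
  assumes "cball x r \<subseteq> T" "0 \<le> r"
  shows "2 * r \<le> d"
proof -
  obtain c where c: "(c - m) \<bullet> \<nu> < 0"
    "\<And>x. x \<in> T \<Longrightarrow> \<exists>u e. 0 \<le> u \<and> u \<le> 1 \<and> e \<in> E \<and> x = u *\<^sub>R c + (1 - u) *\<^sub>R e"
    using opposite_vertex by blast
  have "x + r *\<^sub>R \<tau> \<in> T" "x - r *\<^sub>R \<tau> \<in> T"
    using assms by (auto intro!: subsetD[OF assms(1)] simp: dist_norm norm_tau)
  then obtain u e u' e' where p: "0 \<le> u" "u \<le> 1" "e \<in> E" "x + r *\<^sub>R \<tau> = u *\<^sub>R c + (1 - u) *\<^sub>R e"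
     "0 \<le> u'" "u' \<le> 1" "e' \<in> E" "x - r *\<^sub>R \<tau> = u' *\<^sub>R c + (1 - u') *\<^sub>R e'"
    using c(2) by metis
  have e: "e \<bullet> \<nu> = m \<bullet> \<nu>" "e' \<bullet> \<nu> = m \<bullet> \<nu>"
    using edge_chart p(3,7) by (auto simp: inner_diff_left)
  have "(x + r *\<^sub>R \<tau>) \<bullet> \<nu> = u * ((c - m) \<bullet> \<nu>) + m \<bullet> \<nu>" "(x - r *\<^sub>R \<tau>) \<bullet> \<nu> = u' * ((c - m) \<bullet> \<nu>) + m \<bullet> \<nu>"
    unfolding p(4) p(8) by (simp_all add: inner_simps e) (simp_all add: algebra_simps)
  moreover have "(x + r *\<^sub>R \<tau>) \<bullet> \<nu> = (x - r *\<^sub>R \<tau>) \<bullet> \<nu>" by (simp add: inner_simps)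
  ultimately have "u * ((c - m) \<bullet> \<nu>) = u' * ((c - m) \<bullet> \<nu>)" by linarith
  then have "u = u'" using c(1) by simp
  have "2 * r = (x + r *\<^sub>R \<tau>) \<bullet> \<tau> - (x - r *\<^sub>R \<tau>) \<bullet> \<tau>" by (simp add: inner_add_left inner_diff_left)
  also have "\<dots> = (1 - u) * ((e - m) \<bullet> \<tau> - (e' - m) \<bullet> \<tau>)"
    unfolding p(4) p(8) \<open>u = u'\<close> by (simp add: inner_simps algebra_simps)
  also have "\<dots> \<le> (1 - u) * d"
  proof -
    have "\<bar>(e - m) \<bullet> \<tau>\<bar> \<le> d / 2" "\<bar>(e' - m) \<bullet> \<tau>\<bar> \<le> d / 2"
      using edge_chart[OF p(3)] edge_chart[OF p(7)] p(3,7) mem_edge by metis+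
    then show ?thesis using p(2) by (intro mult_left_mono) auto
  qed
  also have "\<dots> \<le> 1 * d" using p(1) length_pos by (intro mult_right_mono) auto
  finally show ?thesis by simp
qed

text \<open>The apex of the kite is a convex combination of a point of the edge and the centre of the
  ball, chosen so that it lies on the perpendicular bisector of the edge.\<close>

lemma kite_subset:
  assumes ball: "cball x0 r \<subseteq> T" "0 < r" and K: "diameter T \<le> K * r"
    and t: "0 \<le> t" "t \<le> (1 / (2 * K)) * (d / 2 - \<bar>s\<bar>)"
  shows "m + s *\<^sub>R \<tau> - t *\<^sub>R \<nu> \<in> T"
proof -
  define h where "h = diameter T"
  have dh: "0 < d" "d \<le> h" using length_le_diameter length_pos by (auto simp: h_def)
  have "0 < K * r" using dh K unfolding h_def by linarith
  then have Kpos: "K > 0" using ball(2) by (simp add: zero_less_mult_iff)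
  define s0 where "s0 = (x0 - m) \<bullet> \<tau>"
  define t0 where "t0 = - ((x0 - m) \<bullet> \<nu>)"
  have x0: "x0 = m + s0 *\<^sub>R \<tau> - t0 *\<^sub>R \<nu>" using chart_collapse[of m x0] by (simp add: chart_def s0_def t0_def)
  have "x0 + r *\<^sub>R \<nu> \<in> T" using ball by (auto intro!: subsetD[OF ball(1)] simp: dist_norm norm_nu)
  then have "t0 \<ge> r" using side by (auto simp: half_plane_def t0_def inner_simps)
  have "x0 \<in> T" using ball by auto
  then have "dist x0 m \<le> h" unfolding h_def using E_ends E_subset T_props(4) by (intro diameter_bounded_bound) auto
  then have s0h: "\<bar>s0\<bar> \<le> h"
    using Cauchy_Schwarz_ineq2[of "x0 - m" \<tau>] by (simp add: s0_def norm_tau dist_norm)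
  \<comment> \<open>The centre \<open>x0\<close> has tangential offset \<open>s0\<close>; the edge
    point that cancels it in the combination has offset -l s0 / (1 - l). As |s0| \<le> h and l / (1
    - l) = d / (2 h + d), this weight keeps that point on the edge.\<close>
  define l where "l = d / (2 * (h + d))"
  have l: "0 < l" "l < 1" using dh by (auto simp: l_def field_simps)
  define q where "q = l * t0"
  have apex: "m - q *\<^sub>R \<nu> \<in> T"
  proof -
    have "\<bar>- l * s0 / (1 - l)\<bar> \<le> d / 2"
    proof -
      have "\<bar>- l * s0 / (1 - l)\<bar> = l / (1 - l) * \<bar>s0\<bar>" using l by (simp add: abs_mult)
      also have "\<dots> \<le> l / (1 - l) * h" using l s0h by (intro mult_left_mono) auto
      also have "l / (1 - l) = d / (2 * h + d)"
      proof -
        have "1 - l = (2 * h + d) / (2 * (h + d))" using dh by (simp add: l_def field_simps)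
        then show ?thesis using dh by (simp add: l_def)
      qed
      also have "d / (2 * h + d) * h \<le> d / 2" using dh by (simp add: field_simps)
      finally show ?thesis .
    qed
    then have y: "m + (- l * s0 / (1 - l)) *\<^sub>R \<tau> \<in> T" using mem_edge E_subset by blast
    have "(1 - l) *\<^sub>R (m + (- l * s0 / (1 - l)) *\<^sub>R \<tau>) + l *\<^sub>R x0 \<in> T"
      using l by (intro convexD[OF T_props(1) y \<open>x0 \<in> T\<close>]) auto
    also have "(1 - l) *\<^sub>R (m + (- l * s0 / (1 - l)) *\<^sub>R \<tau>) + l *\<^sub>R x0
        = m + ((1 - l) * (- l * s0 / (1 - l)) + l * s0) *\<^sub>R \<tau> - (l * t0) *\<^sub>R \<nu>"
      unfolding x0 by (simp add: algebra_simps)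
    also have "(1 - l) * (- l * s0 / (1 - l)) + l * s0 = 0" using l by simp
    finally show ?thesis by (simp add: q_def)
  qed
  \<comment> \<open>The apex height satisfies q = l t0 \<ge> l r \<ge> d r / (4 h) \<ge> d / (4 K),
    by d \<le> h and h \<le> K r. Divided by half the edge length, this is the slope 1 / (2 K) of
    the claim.\<close>
  have q: "d / (4 * K) \<le> q"
  proof -
    have "d / (4 * K) \<le> d * r / (4 * h)"
      using dh K Kpos ball(2) by (simp add: h_def field_simps mult_left_mono)
    also have "\<dots> \<le> l * r" using dh ball(2) by (simp add: l_def field_simps)
    also have "\<dots> \<le> q" using \<open>t0 \<ge> r\<close> l by (simp add: q_def)
    finally show ?thesis .
  qed
  have qpos: "q > 0" using q Kpos dh by (smt (verit) divide_pos_pos zero_less_mult_iff)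
  have tK: "2 * K * t \<le> d / 2 - \<bar>s\<bar>" using t Kpos by (simp add: field_simps)
  have "2 * K * t \<le> d / 2" using tK by linarith
  then have "t \<le> d / (4 * K)" using Kpos by (simp add: field_simps)
  then have tq: "t \<le> q" using q by linarith
  \<comment> \<open>The point is a combination of an edge point and the apex; its height t forces
    the weight t / q at the apex.\<close>
  define \<mu> where "\<mu> = t / q"
  have \<mu>: "0 \<le> \<mu>" "\<mu> \<le> 1" using tq qpos t(1) by (auto simp: \<mu>_def)
  have "d / 2 * \<mu> \<le> 2 * K * t"
  proof -
    have "d \<le> 4 * K * q" using q Kpos by (simp add: field_simps)
    then have "d * t \<le> 4 * K * q * t" using t(1) by (rule mult_right_mono)
    then show ?thesis using qpos by (simp add: \<mu>_def field_simps)
  qed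
  then have s: "\<bar>s\<bar> \<le> d / 2 * (1 - \<mu>)" using tK by (simp add: algebra_simps)
  show ?thesis
  proof (cases "\<mu> = 1")
    case True
    then have "s = 0" "t = q" using s qpos by (auto simp: \<mu>_def)
    then show ?thesis using apex by simp
  next
    case False
    then have "\<mu> < 1" using \<mu> by simp
    then have "\<bar>s / (1 - \<mu>)\<bar> \<le> d / 2" using s by (simp add: field_simps)
    then have y: "m + (s / (1 - \<mu>)) *\<^sub>R \<tau> \<in> T" using mem_edge E_subset by blast
    have "(1 - \<mu>) *\<^sub>R (m + (s / (1 - \<mu>)) *\<^sub>R \<tau>) + \<mu> *\<^sub>R (m - q *\<^sub>R \<nu>) \<in> T"
      using \<mu> by (intro convexD[OF T_props(1) y apex]) auto
    also have "(1 - \<mu>) *\<^sub>R (m + (s / (1 - \<mu>)) *\<^sub>R \<tau>) + \<mu> *\<^sub>R (m - q *\<^sub>R \<nu>)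
        = m + ((1 - \<mu>) * (s / (1 - \<mu>))) *\<^sub>R \<tau> - (\<mu> * q) *\<^sub>R \<nu>"
      by (simp add: algebra_simps)
    also have "(1 - \<mu>) * (s / (1 - \<mu>)) = s" using \<open>\<mu> < 1\<close> by simp
    also have "\<mu> * q = t" using qpos by (simp add: \<mu>_def)
    finally show ?thesis .
  qed
qed

lemma kite:
  assumes ball: "cball x0 r \<subseteq> T" "0 < r" and K: "diameter T \<le> K * r" "0 < K"
    and x: "- (x - m) \<bullet> \<nu> \<le> (1 / (2 * K)) * (d / 2 - \<bar>(x - m) \<bullet> \<tau>\<bar>)" "(x - m) \<bullet> \<nu> \<le> 0"
  shows "x \<in> T"
proof -
  have "m + ((x - m) \<bullet> \<tau>) *\<^sub>R \<tau> - (- (x - m) \<bullet> \<nu>) *\<^sub>R \<nu> \<in> T"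
    using x by (intro kite_subset[OF ball K(1)]) (auto simp: inner_simps)
  moreover have "m + ((x - m) \<bullet> \<tau>) *\<^sub>R \<tau> - (- (x - m) \<bullet> \<nu>) *\<^sub>R \<nu> = x"
    using chart_collapse[of m x] by (simp add: chart_def del: minus_diff_eq)
  ultimately show ?thesis by (simp only:)
qed

lemma kite_interior:
  assumes ball: "cball x0 r \<subseteq> T" "0 < r" and K: "diameter T \<le> K * r" "0 < K"
    and x: "- (x - m) \<bullet> \<nu> < (1 / (2 * K)) * (d / 2 - \<bar>(x - m) \<bullet> \<tau>\<bar>)" "(x - m) \<bullet> \<nu> < 0"
  shows "x \<in> interior T"
proof (rule interiorI)
  let ?U = "{x. - (x - m) \<bullet> \<nu> < (1 / (2 * K)) * (d / 2 - \<bar>(x - m) \<bullet> \<tau>\<bar>)} \<inter> {x. (x - m) \<bullet> \<nu> < 0}"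
  show "open ?U" by (intro open_Int open_Collect_less continuous_intros)
  show "x \<in> ?U" using x by simp
  show "?U \<subseteq> T" using kite[OF ball K] by auto
qed

text \<open>A kite of unspecified slope, for arguments that require only some neighbourhood of the
  open edge within T.\<close>

lemma some_kite:
  obtains c where "c > 0"
    "\<And>x. - (x - m) \<bullet> \<nu> \<le> c * (d / 2 - \<bar>(x - m) \<bullet> \<tau>\<bar>) \<Longrightarrow> (x - m) \<bullet> \<nu> \<le> 0 \<Longrightarrow> x \<in> T"
    "\<And>x. - (x - m) \<bullet> \<nu> < c * (d / 2 - \<bar>(x - m) \<bullet> \<tau>\<bar>) \<Longrightarrow> (x - m) \<bullet> \<nu> < 0 \<Longrightarrow> x \<in> interior T"
proof -
  obtain x0 where "x0 \<in> interior T" using T_props by auto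
  then obtain r where r: "r > 0" "cball x0 r \<subseteq> T" using mem_interior_cball by blast
  define K where "K = diameter T / r"
  have K: "0 < K" "diameter T \<le> K * r"
    using r length_le_diameter length_pos by (auto simp: K_def)
  show ?thesis
    by (rule that[of "1 / (2 * K)"]) (use K kite[OF r(2,1) K(2,1)] kite_interior[OF r(2,1) K(2,1)] in auto)
qed

end

text \<open>A ball whose diameter exceeds half of the supremum \<open>inball_diameter T\<close> is
  taken; this half and the passage from diameter to radius give the factor 4. The maximum with 1
  provides a constant that is at least 1, as the later geometry wants it.\<close>

lemma shape_regular_ball:
  assumes "2 simplex T" "diameter T \<le> \<kappa> * inball_diameter T"
  obtains x r where "r > 0" "cball x r \<subseteq> T" "diameter T \<le> max 1 (4 * \<kappa>) * r"
proof -
  obtain x0 where "x0 \<in> interior T" using triangle_props[OF assms(1)] by auto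
  then obtain r0 where r0: "r0 > 0" "cball x0 r0 \<subseteq> T" using mem_interior_cball by blast
  let ?X = "{2 * r |r. r \<ge> 0 \<and> (\<exists>x. cball x r \<subseteq> T)}"
  have bT: "bounded T" using triangle_props[OF assms(1)] by simp
  have le: "2 * r \<le> diameter T" if "r \<ge> 0" "cball x r \<subseteq> T" for x r
  proof -
    have "dist (x + r *\<^sub>R axis 1 1) (x - r *\<^sub>R axis 1 1) \<le> diameter T"
      using that by (intro diameter_bounded_bound bT) (auto intro!: subsetD[OF that(2)] simp: dist_norm)
    also have "dist (x + r *\<^sub>R axis 1 1) (x - r *\<^sub>R axis 1 1) = norm ((2 * r) *\<^sub>R (axis 1 1 :: plane))"
      unfolding dist_norm by (rule arg_cong[of _ _ norm]) (simp add: plane_eq_iff)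
    finally show ?thesis using that by simp
  qed
  have bdd: "bdd_above ?X" using le by (auto intro!: bdd_aboveI[of _ "diameter T"])
  have in0: "2 * r0 \<in> ?X" using r0 less_imp_le by blast
  have pos: "0 < inball_diameter T"
    using cSup_upper[OF in0 bdd] r0(1) by (simp add: inball_diameter_def)
  then have "inball_diameter T / 2 < Sup ?X" by (simp add: inball_diameter_def)
  then obtain y where "y \<in> ?X" "inball_diameter T / 2 < y"
    using less_cSupD[of ?X "inball_diameter T / 2"] in0 by blast
  then obtain r x where r: "r \<ge> 0" "cball x r \<subseteq> T" "inball_diameter T / 2 < 2 * r" by auto
  have "diameter T > 0" using le[OF less_imp_le[OF r0(1)] r0(2)] r0(1) by linarith
  then have "0 < \<kappa> * inball_diameter T" using assms(2) by linarith
  then have \<kappa>: "\<kappa> > 0" using pos by (simp add: zero_less_mult_iff)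
  show ?thesis
  proof (rule that[OF _ r(2)])
    show "r > 0" using r pos by auto
    have "\<kappa> * inball_diameter T \<le> \<kappa> * (4 * r)" using r(3) \<kappa> by (intro mult_left_mono) auto
    also have "\<dots> = 4 * \<kappa> * r" by simp
    also have "\<dots> \<le> max 1 (4 * \<kappa>) * r" using r(1) by (intro mult_right_mono) auto
    finally show "diameter T \<le> max 1 (4 * \<kappa>) * r" using assms(2) by linarith
  qed
qed

lemma edge_ends_segment:
  assumes "2 simplex T" "E edge_of T"
  shows "E = closed_segment (fst (edge_ends E)) (snd (edge_ends E))" "fst (edge_ends E) \<noteq> snd (edge_ends E)"
proof -
  obtain a b c where abc: "a \<noteq> b" "E = closed_segment a b" using triangle_edge_cases[OF assms] by metis
  show 1: "E = closed_segment (fst (edge_ends E)) (snd (edge_ends E))"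
    unfolding edge_ends_def by (rule someI[of _ "(a, b)"]) (use abc in simp)
  show "fst (edge_ends E) \<noteq> snd (edge_ends E)"
  proof
    assume "fst (edge_ends E) = snd (edge_ends E)"
    then have "E = {fst (edge_ends E)}" using 1 by simp
    then show False using assms(2) by (metis aff_dim_sing edge_of_def zero_neq_one)
  qed
qed

lemma diameter_segment: "diameter (closed_segment a b) = dist a (b::plane)"
proof (rule antisym)
  show "diameter (closed_segment a b) \<le> dist a b"
  proof (rule diameter_le)
    fix x y assume "x \<in> closed_segment a b" "y \<in> closed_segment a b"
    then obtain u v where uv: "0 \<le> u" "u \<le> 1" "x = (1 - u) *\<^sub>R a + u *\<^sub>R b" "0 \<le> v" "v \<le> 1" "y = (1 - v) *\<^sub>R a + v *\<^sub>R b"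
      by (auto simp: in_segment)
    have "x - y = (v - u) *\<^sub>R (a - b)" unfolding uv by (simp add: algebra_simps)
    then have "norm (x - y) = \<bar>v - u\<bar> * norm (a - b)" by simp
    also have "\<dots> \<le> 1 * norm (a - b)" using uv by (intro mult_right_mono) auto
    finally show "norm (x - y) \<le> dist a b" by (simp add: dist_norm)
  qed simp
  show "dist a b \<le> diameter (closed_segment a b)"
    by (intro diameter_bounded_bound compact_imp_bounded[OF compact_segment]) auto
qed

text \<open>The unit tangent \<open>t\<close> need not point from the first to the second of \<open>edge_ends E\<close>; the sign is \<open>\<sigma>\<close>.\<close>

lemma edge_ends_frame:
  assumes "2 simplex T" "E edge_of T" "frame t n" "\<forall>x\<in>E. \<forall>y\<in>E. n \<bullet> (x - y) = 0"
  obtains \<sigma> :: real where "\<bar>\<sigma>\<bar> = 1" "fst (edge_ends E) = edge_mid E - (\<sigma> * (diameter E / 2)) *\<^sub>R t"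
    "snd (edge_ends E) = edge_mid E + (\<sigma> * (diameter E / 2)) *\<^sub>R t" "diameter E > 0"
    "diameter E = dist (fst (edge_ends E)) (snd (edge_ends E))"
proof -
  interpret frame t n by fact
  define a b where ab: "a = fst (edge_ends E)" "b = snd (edge_ends E)"
  have E: "E = closed_segment a b" "a \<noteq> b" using edge_ends_segment[OF assms(1,2)] by (auto simp: ab)
  have d: "diameter E = dist a b" by (simp add: E(1) diameter_segment)
  have "n \<bullet> (b - a) = 0" using assms(4) E by simp
  then have w: "b - a = ((b - a) \<bullet> t) *\<^sub>R t" using expand[of "b - a"] by (simp add: inner_commute)
  have aw: "\<bar>(b - a) \<bullet> t\<bar> = diameter E"
    using arg_cong[OF w, of norm] by (simp add: d dist_norm norm_minus_commute norm_tau)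
  have dpos: "diameter E > 0" using d E(2) by simp
  define \<sigma> where "\<sigma> = sgn ((b - a) \<bullet> t)"
  have \<sigma>: "(b - a) \<bullet> t = \<sigma> * diameter E" using aw by (simp add: \<sigma>_def sgn_mult_abs flip: aw)
  have ba: "b = a + (\<sigma> * diameter E) *\<^sub>R t" using w \<sigma> by (metis add.commute diff_add_cancel)
  have mid: "edge_mid E = (1/2) *\<^sub>R (a + b)" by (simp add: edge_mid_def midpoint_def ab)
  show ?thesis
  proof (rule that[of \<sigma>])
    show "\<bar>\<sigma>\<bar> = 1" using aw dpos by (auto simp: \<sigma>_def sgn_if)
    show "fst (edge_ends E) = edge_mid E - (\<sigma> * (diameter E / 2)) *\<^sub>R t"
      "snd (edge_ends E) = edge_mid E + (\<sigma> * (diameter E / 2)) *\<^sub>R t"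
      unfolding mid ab[symmetric] ba by (simp_all add: plane_eq_iff field_simps)
  qed (use dpos d ab in auto)
qed

lemma oriented_edgeI:
  assumes "2 simplex T" "E edge_of T" "frame t n" "\<forall>x\<in>E. \<forall>y\<in>E. n \<bullet> (x - y) = 0" "outward T E n"
  shows "oriented_edge t n T E (edge_mid E) (diameter E)"
proof -
  obtain \<sigma> :: real where \<sigma>: "\<bar>\<sigma>\<bar> = 1" "fst (edge_ends E) = edge_mid E - (\<sigma> * (diameter E / 2)) *\<^sub>R t"
    "snd (edge_ends E) = edge_mid E + (\<sigma> * (diameter E / 2)) *\<^sub>R t" "diameter E > 0"
    using edge_ends_frame[OF assms(1-4)] by metis
  have seg: "E = closed_segment (edge_mid E - (diameter E / 2) *\<^sub>R t) (edge_mid E + (diameter E / 2) *\<^sub>R t)"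
  proof -
    have E: "E = closed_segment (edge_mid E - (\<sigma> * (diameter E / 2)) *\<^sub>R t) (edge_mid E + (\<sigma> * (diameter E / 2)) *\<^sub>R t)"
      using edge_ends_segment(1)[OF assms(1,2)] by (simp only: \<sigma>(2,3))
    have "\<sigma> = 1 \<or> \<sigma> = -1" using \<sigma>(1) by linarith
    then show ?thesis
    proof
      assume "\<sigma> = 1"
      then show ?thesis using E by simp
    next
      assume "\<sigma> = -1"
      then show ?thesis using E by (subst closed_segment_commute) simp
    qed
  qed
  have "midpoint (fst (edge_ends E)) (snd (edge_ends E)) \<in> closed_segment (fst (edge_ends E)) (snd (edge_ends E))"
    by simp
  then have mE: "edge_mid E \<in> E" using edge_ends_segment(1)[OF assms(1,2)] by (simp add: edge_mid_def)
  have "T \<subseteq> half_plane n (edge_mid E)"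
    using assms(5) mE by (auto simp: outward_def half_plane_def inner_commute)
  then show ?thesis
    using assms(1-3) \<sigma>(4) seg by (intro oriented_edge.intro oriented_edge_axioms.intro)
qed


section \<open>Triangulations\<close>

lemma face_eqI:
  fixes T :: "plane set"
  assumes "F face_of T" "G face_of T" "F \<subseteq> G" "aff_dim F = aff_dim G"
  shows "F = G"
proof -
  have "F face_of G" using assms face_of_face by blast
  then show ?thesis using face_of_aff_dim_lt[of G F] assms face_of_imp_convex by fastforce
qed

locale mesh =
  fixes \<Omega> :: "plane set" and \<T> :: "plane set set" and \<nu> \<tau> :: "plane set \<Rightarrow> plane"
  assumes bounded: "bounded \<Omega>" and lipschitz: "Lipschitz_domain \<Omega>"
    and conforming: "conforming_triangulation \<Omega> \<T>" and frames: "edge_frames \<Omega> \<T> \<nu> \<tau>"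
begin

lemma open_domain: "open \<Omega>"
  using lipschitz by (simp add: Lipschitz_domain_def)

lemma finite_mesh: "finite \<T>" and triangles: "T \<in> \<T> \<Longrightarrow> 2 simplex T"
  and Union_mesh: "\<Union>\<T> = closure \<Omega>"
  and face_Int: "T \<in> \<T> \<Longrightarrow> T' \<in> \<T> \<Longrightarrow> (T \<inter> T') face_of T"
  using conforming by (auto simp: conforming_triangulation_def triangulation_def)

text \<open>A Lipschitz domain lies on one side of its boundary. Straight below a boundary point, in
  the local epigraph coordinates, there are points arbitrarily close that have a neighbourhood
  disjoint from the domain, so the boundary point is not interior to the closure. This excludes
  slits: an open set covered by triangles lies in the domain.\<close>

lemma interior_closure_domain: "interior (closure \<Omega>) = \<Omega>"
proof
  show "\<Omega> \<subseteq> interior (closure \<Omega>)" using open_domain closure_subset[of \<Omega>] by (simp add: interior_maximal)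
  show "interior (closure \<Omega>) \<subseteq> \<Omega>"
  proof (rule ccontr)
    assume "\<not> ?thesis"
    then obtain z where z: "z \<in> interior (closure \<Omega>)" "z \<notin> \<Omega>" by blast
    then have "z \<in> frontier \<Omega>"
      using open_domain interior_subset by (auto simp: frontier_def interior_open)
    then obtain r e1 e2 L \<gamma> where r: "r > 0" "norm e1 = 1" "norm e2 = 1" "L-lipschitz_on UNIV \<gamma>"
      "\<forall>y\<in>ball z r. y \<in> \<Omega> \<longleftrightarrow> \<gamma> ((y - z) \<bullet> e1) < (y - z) \<bullet> (e2 :: plane)" and e12: "e1 \<bullet> e2 = 0"
      using lipschitz unfolding Lipschitz_domain_def by metis
    have g0: "\<gamma> 0 \<ge> 0" using r(1,5) z(2) by (force simp: not_less)
    obtain s where s: "s > 0" "ball z s \<subseteq> closure \<Omega>" using z(1) by (auto simp: mem_interior)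
    define t where "t = min r s / 2"
    have t: "0 < t" "t < r" "t < s" using r(1) s(1) by (auto simp: t_def min_def)
    let ?U = "ball z r \<inter> {y. (y - z) \<bullet> e2 < \<gamma> ((y - z) \<bullet> e1)}"
    have "continuous_on UNIV \<gamma>" using r(4) by (rule lipschitz_on_continuous_on)
    then have "continuous_on UNIV (\<lambda>y. \<gamma> ((y - z) \<bullet> e1))"
      by (rule continuous_on_compose2) (auto intro!: continuous_intros)
    then have "open ?U" by (intro open_Int open_ball open_Collect_less continuous_intros)
    moreover have "?U \<inter> \<Omega> = {}" using r(5) by force
    ultimately have "?U \<inter> closure \<Omega> = {}" by (simp add: open_Int_closure_eq_empty)
    moreover have "z - t *\<^sub>R e2 \<in> ?U"
      using t r g0 e12 by (auto simp: dist_norm inner_commute dot_square_norm)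
    moreover have "z - t *\<^sub>R e2 \<in> closure \<Omega>"
      using t r s by (auto intro!: subsetD[OF s(2)] simp: dist_norm)
    ultimately show False by blast
  qed
qed

lemma interior_subset_domain: "T \<in> \<T> \<Longrightarrow> interior T \<subseteq> \<Omega>"
  using Union_mesh interior_closure_domain interior_mono[of T "closure \<Omega>"] by blast

text \<open>The intersection is a face of both triangles. A proper face misses the interior;
  otherwise one triangle is a face of the other, and equal dimension makes them equal.\<close>

lemma triangle_disjoint_interior:
  assumes "T \<in> \<T>" "T' \<in> \<T>" "T \<noteq> T'"
  shows "T' \<inter> interior T = {}"
proof (rule ccontr)
  assume ne: "T' \<inter> interior T \<noteq> {}"
  have f: "(T \<inter> T') face_of T" "(T' \<inter> T) face_of T'" using assms face_Int by auto
  have "T \<inter> T' = T"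
  proof (rule ccontr)
    assume "T \<inter> T' \<noteq> T"
    from face_of_disjoint_interior[OF f(1) this] ne show False using interior_subset by blast
  qed
  then have sub: "T \<subseteq> T'" "T face_of T'" using f(2) by (auto simp: Int_commute)
  have "T = T'"
    using face_of_aff_dim_lt[of T' T] sub triangles[OF assms(1)] triangles[OF assms(2)]
    by (metis aff_dim_simplex convex_simplex less_irrefl)
  with assms show False by simp
qed

lemma frame_edge:
  assumes "T \<in> \<T>" "E edge_of T" "\<sigma> = 1 \<or> \<sigma> = (-1::real)"
  shows "frame (\<tau> E) (\<sigma> *\<^sub>R \<nu> E)" "\<forall>x\<in>E. \<forall>y\<in>E. (\<sigma> *\<^sub>R \<nu> E) \<bullet> (x - y) = 0"
proof -
  have "E \<in> edges \<T>" using assms by (auto simp: edges_def)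
  then show "frame (\<tau> E) (\<sigma> *\<^sub>R \<nu> E)" "\<forall>x\<in>E. \<forall>y\<in>E. (\<sigma> *\<^sub>R \<nu> E) \<bullet> (x - y) = 0"
    using frames assms(3) unfolding edge_frames_def frame_def by auto
qed

lemma oriented:
  assumes "T \<in> \<T>" "E edge_of T" "\<sigma> = 1 \<or> \<sigma> = (-1::real)" "outward T E (\<sigma> *\<^sub>R \<nu> E)"
  shows "oriented_edge (\<tau> E) (\<sigma> *\<^sub>R \<nu> E) T E (edge_mid E) (diameter E)"
  using assms by (intro oriented_edgeI triangles frame_edge)

text \<open>The opposite vertex decides the sign, since every point of T is a combination of this
  vertex with an edge point.\<close>

lemma outward_cases:
  assumes "T \<in> \<T>" "E edge_of T"
  obtains \<sigma> :: real where "\<sigma> = 1 \<or> \<sigma> = -1" "outward T E (\<sigma> *\<^sub>R \<nu> E)"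
proof -
  obtain a b c where abc: "a \<noteq> b" "E = closed_segment a b" "T = convex hull {a, b, c}"
    using triangle_edge_cases[OF triangles[OF assms(1)] assms(2)] by metis
  define \<sigma> where "\<sigma> = (if \<nu> E \<bullet> (c - a) \<le> 0 then 1 else -1 :: real)"
  have \<sigma>: "\<sigma> = 1 \<or> \<sigma> = -1" "\<sigma> * (\<nu> E \<bullet> (c - a)) \<le> 0" by (auto simp: \<sigma>_def)
  have flat: "\<nu> E \<bullet> (x - y) = 0" if "x \<in> E" "y \<in> E" for x y
    using frame_edge(2)[OF assms, of 1] that by simp
  have aE: "a \<in> E" by (simp add: abc(2))
  have "outward T E (\<sigma> *\<^sub>R \<nu> E)" unfolding outward_def
  proof (intro ballI)
    fix x y assume "x \<in> T" and y: "y \<in> E"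
    then have "x \<in> convex hull (insert c {a, b})" using abc(3) by (simp add: insert_commute)
    then obtain u v e where x: "u \<ge> 0" "v \<ge> 0" "u + v = 1" "e \<in> convex hull {a, b}" "x = u *\<^sub>R c + v *\<^sub>R e"
      using convex_hull_insert[of "{a, b}" c] by blast
    have e: "e \<in> E" using x(4) by (simp add: abc(2) segment_convex_hull)
    have v: "v = 1 - u" using x(3) by simp
    have "x - y = u *\<^sub>R (c - a) + (u *\<^sub>R (a - y) + v *\<^sub>R (e - y))"
      unfolding x(5) v by (simp add: algebra_simps)
    then have "\<nu> E \<bullet> (x - y) = u * (\<nu> E \<bullet> (c - a))"
      using flat[OF aE y] flat[OF e y] by (simp add: inner_add_right)
    then have "(\<sigma> *\<^sub>R \<nu> E) \<bullet> (x - y) = u * (\<sigma> * (\<nu> E \<bullet> (c - a)))" by simp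
    also have "\<dots> \<le> 0" using x(1) \<sigma>(2) by (rule mult_nonneg_nonpos)
    finally show "(\<sigma> *\<^sub>R \<nu> E) \<bullet> (x - y) \<le> 0" .
  qed
  with \<sigma> show ?thesis using that by blast
qed

text \<open>Each of the two triangles contains a kite on the same side of the edge, so a point
  slightly inside from the midpoint is interior to both.\<close>

lemma same_side_eq:
  assumes "T \<in> \<T>" "T' \<in> \<T>" "E edge_of T" "E edge_of T'" "\<sigma> = 1 \<or> \<sigma> = (-1::real)"
    "outward T E (\<sigma> *\<^sub>R \<nu> E)" "outward T' E (\<sigma> *\<^sub>R \<nu> E)"
  shows "T = T'"
proof (rule ccontr)
  assume ne: "T \<noteq> T'"
  interpret A: oriented_edge "\<tau> E" "\<sigma> *\<^sub>R \<nu> E" T E "edge_mid E" "diameter E" using assms by (intro oriented)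
  interpret B: oriented_edge "\<tau> E" "\<sigma> *\<^sub>R \<nu> E" T' E "edge_mid E" "diameter E" using assms by (intro oriented)
  obtain c where c: "c > 0" "\<And>x. - (x - edge_mid E) \<bullet> (\<sigma> *\<^sub>R \<nu> E) < c * (diameter E / 2 - \<bar>(x - edge_mid E) \<bullet> \<tau> E\<bar>) \<Longrightarrow> (x - edge_mid E) \<bullet> (\<sigma> *\<^sub>R \<nu> E) < 0 \<Longrightarrow> x \<in> interior T"
    using A.some_kite by metis
  obtain c' where c': "c' > 0" "\<And>x. - (x - edge_mid E) \<bullet> (\<sigma> *\<^sub>R \<nu> E) < c' * (diameter E / 2 - \<bar>(x - edge_mid E) \<bullet> \<tau> E\<bar>) \<Longrightarrow> (x - edge_mid E) \<bullet> (\<sigma> *\<^sub>R \<nu> E) < 0 \<Longrightarrow> x \<in> interior T'"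
    using B.some_kite by metis
  \<comment> \<open>A quarter of the edge length times the smaller slope stays below the height of
    both kites at the midpoint, which is half the edge length times the slope.\<close>
  define e where "e = min c c' * diameter E / 4"
  have dpos: "diameter E > 0" by (rule A.length_pos)
  have e: "e > 0" "e < c * (diameter E / 2)" "e < c' * (diameter E / 2)"
  proof -
    have m: "min c c' > 0" "min c c' \<le> c" "min c c' \<le> c'" using c(1) c'(1) by auto
    show "e > 0" using m dpos by (simp add: e_def)
    have "min c c' * diameter E \<le> c * diameter E" "min c c' * diameter E \<le> c' * diameter E"
      "0 < c * diameter E" "0 < c' * diameter E"
      using m dpos c(1) c'(1) by (auto intro: mult_right_mono)
    then show "e < c * (diameter E / 2)" "e < c' * (diameter E / 2)" unfolding e_def by linarith+
  qed
  let ?x = "edge_mid E + (- e) *\<^sub>R (\<sigma> *\<^sub>R \<nu> E)"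
  have nn: "(\<sigma> *\<^sub>R \<nu> E) \<bullet> (\<sigma> *\<^sub>R \<nu> E) = 1" "(\<sigma> *\<^sub>R \<nu> E) \<bullet> \<tau> E = 0" by (rule A.inner_frame)+
  have xx: "(?x - edge_mid E) \<bullet> (\<sigma> *\<^sub>R \<nu> E) = - e" "(?x - edge_mid E) \<bullet> \<tau> E = 0"
    by (simp_all only: add_diff_cancel_left' inner_scaleR_left[of "- e"] nn mult_zero_right mult_1_right)
  have "- (?x - edge_mid E) \<bullet> (\<sigma> *\<^sub>R \<nu> E) = e" by (subst inner_minus_left, subst xx) simp
  then have "?x \<in> interior T" "?x \<in> interior T'"
    using c(2)[of ?x] c'(2)[of ?x] xx e by (simp_all only: abs_zero diff_zero neg_less_0_iff_less simp_thms)
  then show False using triangle_disjoint_interior[OF assms(1,2) ne] interior_subset by blast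
qed

text \<open>Some point x of the relative interior of E lies in the domain, and a small ball about x
  meets only triangles that contain x. A step across E leads to such a triangle, different from T;
  the two meet in a common proper face that contains E, and this face is E.\<close>

lemma interior_edge_neighbours:
  assumes E: "E \<in> interior_edges \<Omega> \<T>" and T: "T \<in> \<T>" "E edge_of T" and \<sigma>: "\<sigma> = 1 \<or> \<sigma> = (-1::real)"
    and out: "outward T E (\<sigma> *\<^sub>R \<nu> E)"
  obtains T' where "T' \<in> \<T>" "E edge_of T'" "outward T' E ((- \<sigma>) *\<^sub>R \<nu> E)"
proof -
  interpret A: oriented_edge "\<tau> E" "\<sigma> *\<^sub>R \<nu> E" T E "edge_mid E" "diameter E" using assms by (intro oriented)
  have "E \<subseteq> closure \<Omega>" using A.E_subset T Union_mesh by blast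
  moreover have "\<not> E \<subseteq> frontier \<Omega>" using E by (auto simp: interior_edges_def boundary_edges_def)
  ultimately obtain y where "y \<in> E" "y \<in> \<Omega>"
    using open_domain by (auto simp: frontier_def interior_open)
  have "convex E" by (subst A.segment) (rule convex_closed_segment)
  then have "y \<in> closure (rel_interior E)" using \<open>y \<in> E\<close> closure_subset[of E] by (auto simp: convex_closure_rel_interior)
  then have "\<Omega> \<inter> rel_interior E \<noteq> {}"
    using open_domain \<open>y \<in> \<Omega>\<close> open_Int_closure_eq_empty[of \<Omega> "rel_interior E"] by blast
  then obtain x where x: "x \<in> rel_interior E" "x \<in> \<Omega>" by blast
  let ?F = "{T'\<in>\<T>. x \<notin> T'}"
  have "closed (\<Union>?F)" using finite_mesh triangles by (intro closed_Union) (auto intro: closed_simplex)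
  then have "open (\<Omega> - \<Union>?F)" using open_domain by (intro open_Diff)
  moreover have "x \<in> \<Omega> - \<Union>?F" using x by auto
  ultimately obtain e where e: "e > 0" "ball x e \<subseteq> \<Omega> - \<Union>?F" by (meson open_contains_ball)
  define w where "w = x + (e / 2) *\<^sub>R (\<sigma> *\<^sub>R \<nu> E)"
  have "dist x w = \<bar>e / 2\<bar> * norm (\<sigma> *\<^sub>R \<nu> E)" by (simp add: w_def dist_norm abs_mult)
  then have "w \<in> ball x e" using e(1) A.norm_nu by simp
  then have w: "w \<in> \<Omega>" "w \<notin> \<Union>?F" using e(2) by auto
  then obtain T' where T': "T' \<in> \<T>" "w \<in> T'" using Union_mesh closure_subset by blast
  with w have xT': "x \<in> T'" by blast
  have xn: "(x - edge_mid E) \<bullet> (\<sigma> *\<^sub>R \<nu> E) = 0" using x(1) A.mem_rel_interior_edge by blast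
  have nn: "(\<sigma> *\<^sub>R \<nu> E) \<bullet> (\<sigma> *\<^sub>R \<nu> E) = 1" by (rule A.inner_frame)
  have "(w - edge_mid E) \<bullet> (\<sigma> *\<^sub>R \<nu> E) = (x - edge_mid E) \<bullet> (\<sigma> *\<^sub>R \<nu> E) + (e / 2) * ((\<sigma> *\<^sub>R \<nu> E) \<bullet> (\<sigma> *\<^sub>R \<nu> E))"
  proof -
    have "w - edge_mid E = (x - edge_mid E) + (e / 2) *\<^sub>R (\<sigma> *\<^sub>R \<nu> E)" by (simp add: w_def)
    then show ?thesis by (simp only: inner_add_left inner_scaleR_left[of "e / 2"])
  qed
  then have wn: "(w - edge_mid E) \<bullet> (\<sigma> *\<^sub>R \<nu> E) = e / 2" using xn nn by simp
  then have "w \<notin> T" using A.side e(1) by (auto simp: half_plane_def)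
  then have ne: "T \<noteq> T'" using T' by blast
  have f: "(T \<inter> T') face_of T" "(T' \<inter> T) face_of T'" using T T' face_Int by auto
  have Ef: "E face_of T" "aff_dim E = 1" using T(2) by (auto simp: edge_of_def)
  have sub: "E \<subseteq> T \<inter> T'"
    by (rule subset_of_face_of[OF f(1) A.E_subset]) (use A.E_subset x(1) xT' rel_interior_subset[of E] in blast)
  have "T \<inter> T' \<noteq> T" using triangle_disjoint_interior[OF T(1) T'(1) ne] A.T_props(5) interior_subset by blast
  then have "aff_dim (T \<inter> T') < aff_dim T" using face_of_aff_dim_lt[OF A.T_props(1) f(1)] by blast
  then have "aff_dim (T \<inter> T') = 1" using A.T_props(8) aff_dim_subset[OF sub] Ef(2) by simp
  then have "E = T \<inter> T'" using face_eqI[OF Ef(1) f(1) sub] Ef(2) by simp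
  then have ET': "E edge_of T'" using f(2) Ef(2) by (simp add: edge_of_def Int_commute)
  obtain \<sigma>' :: real where \<sigma>': "\<sigma>' = 1 \<or> \<sigma>' = -1" "outward T' E (\<sigma>' *\<^sub>R \<nu> E)"
    using outward_cases[OF T'(1) ET'] by blast
  have "\<sigma>' \<noteq> \<sigma>"
  proof
    assume "\<sigma>' = \<sigma>"
    then have "(\<sigma> *\<^sub>R \<nu> E) \<bullet> (w - edge_mid E) \<le> 0"
      using \<sigma>'(2) T'(2) A.E_ends(3) by (auto simp: outward_def)
    then show False using wn e(1) by (simp add: inner_commute)
  qed
  then have "\<sigma>' = - \<sigma>" using \<sigma> \<sigma>'(1) by auto
  then show ?thesis using that T'(1) ET' \<sigma>'(2) by blast
qed

text \<open>A sign replaces the distinction of two triangles, so that one argument, with outer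
  normal \<sigma> times \<nu>, treats both sides.\<close>

definition side_of :: "plane set \<Rightarrow> real \<Rightarrow> plane set" where
  "side_of E \<sigma> = (if \<sigma> = 1 then T_plus \<T> \<nu> E else T_minus \<T> \<nu> E)"

text \<open>The descriptions behind \<open>T_plus\<close> and \<open>T_minus\<close> are justified:
  a triangle exists on either side of an interior edge, and \<open>same_side_eq\<close> makes it
  unique.\<close>

lemma side_of:
  assumes E: "E \<in> interior_edges \<Omega> \<T>" and \<sigma>: "\<sigma> = 1 \<or> \<sigma> = (-1::real)"
  shows "side_of E \<sigma> \<in> \<T>" "E edge_of side_of E \<sigma>" "outward (side_of E \<sigma>) E (\<sigma> *\<^sub>R \<nu> E)"
proof -
  have ex: "\<exists>T. T \<in> \<T> \<and> E edge_of T \<and> outward T E (\<sigma> *\<^sub>R \<nu> E)" if \<sigma>: "\<sigma> = 1 \<or> \<sigma> = (-1::real)" for \<sigma>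
  proof -
    obtain T where T: "T \<in> \<T>" "E edge_of T" using E by (auto simp: interior_edges_def edges_def)
    obtain \<sigma>' :: real where \<sigma>': "\<sigma>' = 1 \<or> \<sigma>' = -1" "outward T E (\<sigma>' *\<^sub>R \<nu> E)"
      using outward_cases[OF T] by blast
    show ?thesis
    proof (cases "\<sigma>' = \<sigma>")
      case True
      then show ?thesis using T \<sigma>' by blast
    next
      case False
      then have "- \<sigma>' = \<sigma>" using \<sigma> \<sigma>' by auto
      then show ?thesis using interior_edge_neighbours[OF E T \<sigma>'] by metis
    qed
  qed
  have th: "(THE T. T \<in> \<T> \<and> E edge_of T \<and> outward T E (\<sigma> *\<^sub>R \<nu> E)) = T"
    if "\<sigma> = 1 \<or> \<sigma> = (-1::real)" "T \<in> \<T> \<and> E edge_of T \<and> outward T E (\<sigma> *\<^sub>R \<nu> E)" for \<sigma> T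
    using that same_side_eq by (intro the_equality) auto
  obtain T where T: "T \<in> \<T> \<and> E edge_of T \<and> outward T E (\<sigma> *\<^sub>R \<nu> E)" using ex[OF \<sigma>] by blast
  have "side_of E \<sigma> = T" using th[OF \<sigma> T] \<sigma> by (auto simp: side_of_def T_plus_def T_minus_def)
  with T show "side_of E \<sigma> \<in> \<T>" "E edge_of side_of E \<sigma>" "outward (side_of E \<sigma>) E (\<sigma> *\<^sub>R \<nu> E)" by auto
qed

lemma side_of_oriented:
  assumes "E \<in> interior_edges \<Omega> \<T>" "\<sigma> = 1 \<or> \<sigma> = (-1::real)"
  shows "oriented_edge (\<tau> E) (\<sigma> *\<^sub>R \<nu> E) (side_of E \<sigma>) E (edge_mid E) (diameter E)"
  using assms side_of by (intro oriented) auto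

lemma neighbours_eq:
  assumes "E \<in> interior_edges \<Omega> \<T>" "T \<in> \<T>" "E edge_of T"
  shows "T = side_of E 1 \<or> T = side_of E (-1)"
  using outward_cases[OF assms(2,3)] same_side_eq[OF assms(2) _ assms(3)] side_of[OF assms(1)] by metis

lemma side_of_neq:
  assumes "E \<in> interior_edges \<Omega> \<T>" shows "side_of E 1 \<noteq> side_of E (-1)"
proof
  assume eq: "side_of E 1 = side_of E (-1)"
  interpret A: oriented_edge "\<tau> E" "1 *\<^sub>R \<nu> E" "side_of E 1" E "edge_mid E" "diameter E"
    using assms by (intro side_of_oriented) auto
  have "side_of E 1 \<subseteq> {x. \<nu> E \<bullet> x = \<nu> E \<bullet> edge_mid E}"
    using side_of(3)[OF assms, of 1] side_of(3)[OF assms, of "-1"] A.E_ends(3)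
    by (auto simp: outward_def eq inner_diff_right intro!: antisym)
  moreover have "\<nu> E \<noteq> 0" using A.norm_nu by auto
  ultimately have "interior (side_of E 1) = {}"
    using interior_hyperplane[of "\<nu> E" "\<nu> E \<bullet> edge_mid E"] interior_mono by blast
  then show False using A.T_props by simp
qed

text \<open>The edge patch without its outer boundary. Other triangles, other edges and all vertices
  miss it, so a function supported there sees the source only through the two triangles and E
  itself.\<close>

definition edge_region :: "plane set \<Rightarrow> plane set" where
  "edge_region E = interior (side_of E 1) \<union> interior (side_of E (-1)) \<union> rel_interior E"

text \<open>A triangle that meets the relative interior of E meets a side of E in a face, and this
  face contains all of E. It has dimension 1 and equals E, so that E is an edge of the triangle,
  which leaves only the two sides.\<close>

lemma triangle_disjoint_region:
  assumes E: "E \<in> interior_edges \<Omega> \<T>" and T: "T \<in> \<T>" "T \<noteq> side_of E 1" "T \<noteq> side_of E (-1)"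
  shows "T \<inter> edge_region E = {}"
proof -
  have s: "side_of E 1 \<in> \<T>" "E edge_of side_of E 1" "side_of E (-1) \<in> \<T>" using side_of[OF E] by auto
  have "T \<inter> rel_interior E = {}"
  proof (rule ccontr)
    assume ne: "T \<inter> rel_interior E \<noteq> {}"
    let ?P = "side_of E 1"
    have f: "(?P \<inter> T) face_of ?P" "(T \<inter> ?P) face_of T" using T s face_Int by auto
    have Ef: "E face_of ?P" "aff_dim E = 1" using s(2) by (auto simp: edge_of_def)
    have EP: "E \<subseteq> ?P" using Ef(1) by (rule face_of_imp_subset)
    have sub: "E \<subseteq> ?P \<inter> T"
      by (rule subset_of_face_of[OF f(1) EP]) (use EP ne rel_interior_subset[of E] in blast)
    have P: "2 simplex ?P" using triangles s by blast
    have "?P \<inter> T \<noteq> ?P" using triangle_disjoint_interior[OF s(1) T(1)] T(2) triangle_props(5)[OF P] interior_subset by blast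
    then have "aff_dim (?P \<inter> T) < aff_dim ?P" using face_of_aff_dim_lt[OF triangle_props(1)[OF P] f(1)] by blast
    then have "aff_dim (?P \<inter> T) = 1" using triangle_props(8)[OF P] aff_dim_subset[OF sub] Ef(2) by simp
    then have "E = ?P \<inter> T" using face_eqI[OF Ef(1) f(1) sub] Ef(2) by simp
    then have "E edge_of T" using f(2) Ef(2) by (simp add: edge_of_def Int_commute)
    then show False using neighbours_eq[OF E T(1)] T by blast
  qed
  then show ?thesis
    using triangle_disjoint_interior[OF s(1) T(1)] triangle_disjoint_interior[OF s(3) T(1)] T
    by (auto simp: edge_region_def)
qed

lemma edge_disjoint_interior:
  assumes "T \<in> \<T>" "T' \<in> \<T>" "E' edge_of T'"
  shows "E' \<inter> interior T = {}"
proof (cases "T = T'")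
  case True
  have "E' \<noteq> T" using assms triangle_props(8)[OF triangles[OF assms(1)]] by (auto simp: edge_of_def)
  then show ?thesis using True assms face_of_disjoint_interior by (auto simp: edge_of_def)
next
  case False
  then show ?thesis using triangle_disjoint_interior[OF assms(1,2)] edge_of_imp_subset[OF assms(3)] by blast
qed

lemma edge_disjoint_region:
  assumes E: "E \<in> interior_edges \<Omega> \<T>" and T: "T' \<in> \<T>" "E' edge_of T'" "E' \<noteq> E"
  shows "E' \<inter> edge_region E = {}"
proof -
  have "E' \<inter> rel_interior E = {}"
  proof (rule ccontr)
    assume ne: "E' \<inter> rel_interior E \<noteq> {}"
    have "E' \<subseteq> T'" using T(2) by (rule edge_of_imp_subset)
    then have "T' = side_of E 1 \<or> T' = side_of E (-1)"
      using triangle_disjoint_region[OF E T(1)] ne by (auto simp: edge_region_def)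
    then have ET: "E edge_of T'" using side_of(2)[OF E] by auto
    have f: "E face_of T'" "E' face_of T'" "aff_dim E = aff_dim E'" using ET T(2) by (auto simp: edge_of_def)
    have "E \<subseteq> E'" by (rule subset_of_face_of[OF f(2) face_of_imp_subset[OF f(1)] ne])
    then have "E = E'" using face_eqI[OF f(1,2)] f(3) by blast
    then show False using T(3) by simp
  qed
  then show ?thesis
    using edge_disjoint_interior[OF _ T(1,2)] side_of(1)[OF E] by (auto simp: edge_region_def)
qed

lemma vertex_not_in_interior:
  assumes "T \<in> \<T>" "z \<in> vertices \<T>"
  shows "z \<notin> interior T"
proof
  assume z: "z \<in> interior T"
  obtain T' where T': "T' \<in> \<T>" "{z} face_of T'"
    using assms(2) by (auto simp: vertices_def tri_vertices_def face_of_singleton)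
  have "z \<in> T'" using face_of_imp_subset[OF T'(2)] by simp
  then have "T' = T" using triangle_disjoint_interior[OF assms(1) T'(1)] z by blast
  then show False
    using T' z face_of_disjoint_interior[of "{z}" T] triangle_props(8)[OF triangles[OF assms(1)]]
    by (metis Int_insert_left_if1 aff_dim_sing insert_not_empty numeral_neq_zero)
qed

text \<open>A vertex is a singleton face of its triangle. If it lay in the relative interior of E,
  that triangle would have E as an edge, and E would be contained in the singleton.\<close>

lemma vertex_not_in_region:
  assumes E: "E \<in> interior_edges \<Omega> \<T>" and z: "z \<in> vertices \<T>"
  shows "z \<notin> edge_region E"
proof -
  have "z \<notin> rel_interior E"
  proof
    assume zE: "z \<in> rel_interior E"
    obtain T' where T': "T' \<in> \<T>" "{z} face_of T'"
      using z by (auto simp: vertices_def tri_vertices_def face_of_singleton)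
    have "z \<in> T'" using face_of_imp_subset[OF T'(2)] by simp
    then have "T' = side_of E 1 \<or> T' = side_of E (-1)"
      using triangle_disjoint_region[OF E T'(1)] zE by (auto simp: edge_region_def)
    then have "E edge_of T'" using side_of(2)[OF E] by auto
    then have "E \<subseteq> T'" "aff_dim E = 1" by (auto simp: edge_of_def dest: face_of_imp_subset)
    moreover have "E \<subseteq> {z}" by (rule subset_of_face_of[OF T'(2) \<open>E \<subseteq> T'\<close>]) (use zE in blast)
    ultimately show False using aff_dim_subset[of E "{z}"] by simp
  qed
  then show ?thesis using vertex_not_in_interior[OF _ z] side_of(1)[OF E] by (auto simp: edge_region_def)
qed

text \<open>The relative interior of E has an open neighbourhood covered by two kites, hence by the
  two triangles. It lies in the interior of the closure of the domain, which is the domain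
  itself.\<close>

lemma region_subset_domain:
  assumes E: "E \<in> interior_edges \<Omega> \<T>"
  shows "edge_region E \<subseteq> \<Omega>"
proof -
  let ?m = "edge_mid E" and ?d = "diameter E"
  interpret A: oriented_edge "\<tau> E" "1 *\<^sub>R \<nu> E" "side_of E 1" E ?m ?d
    using E by (intro side_of_oriented) auto
  interpret B: oriented_edge "\<tau> E" "(-1) *\<^sub>R \<nu> E" "side_of E (-1)" E ?m ?d
    using E by (intro side_of_oriented) auto
  obtain c where c: "c > 0" "\<And>x. - (x - ?m) \<bullet> (1 *\<^sub>R \<nu> E) \<le> c * (?d / 2 - \<bar>(x - ?m) \<bullet> \<tau> E\<bar>) \<Longrightarrow> (x - ?m) \<bullet> (1 *\<^sub>R \<nu> E) \<le> 0 \<Longrightarrow> x \<in> side_of E 1"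
    using A.some_kite by metis
  obtain c' where c': "c' > 0" "\<And>x. - (x - ?m) \<bullet> ((-1) *\<^sub>R \<nu> E) \<le> c' * (?d / 2 - \<bar>(x - ?m) \<bullet> \<tau> E\<bar>) \<Longrightarrow> (x - ?m) \<bullet> ((-1) *\<^sub>R \<nu> E) \<le> 0 \<Longrightarrow> x \<in> side_of E (-1)"
    using B.some_kite by metis
  define U where "U = {x. \<bar>(x - ?m) \<bullet> \<nu> E\<bar> < c * (?d / 2 - \<bar>(x - ?m) \<bullet> \<tau> E\<bar>)} \<inter> {x. \<bar>(x - ?m) \<bullet> \<nu> E\<bar> < c' * (?d / 2 - \<bar>(x - ?m) \<bullet> \<tau> E\<bar>)}"
  have "open U" unfolding U_def by (intro open_Int open_Collect_less continuous_intros)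
  moreover have "U \<subseteq> closure \<Omega>"
  proof
    fix x assume x: "x \<in> U"
    have neg: "- (x - ?m) \<bullet> (1 *\<^sub>R \<nu> E) = - ((x - ?m) \<bullet> \<nu> E)" "(x - ?m) \<bullet> ((-1) *\<^sub>R \<nu> E) = - ((x - ?m) \<bullet> \<nu> E)"
      "- (x - ?m) \<bullet> ((-1) *\<^sub>R \<nu> E) = (x - ?m) \<bullet> \<nu> E"
      by (simp_all only: inner_minus_left inner_minus_right scaleR_one scaleR_minus1_left minus_minus)
    show "x \<in> closure \<Omega>"
    proof (cases "(x - ?m) \<bullet> \<nu> E \<le> 0")
      case True
      have "- (x - ?m) \<bullet> (1 *\<^sub>R \<nu> E) \<le> c * (?d / 2 - \<bar>(x - ?m) \<bullet> \<tau> E\<bar>)" unfolding neg using x by (auto simp: U_def)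
      then have "x \<in> side_of E 1" using c(2) True by simp
      then show ?thesis using side_of(1)[OF E, of 1] Union_mesh by blast
    next
      case False
      have "- (x - ?m) \<bullet> ((-1) *\<^sub>R \<nu> E) \<le> c' * (?d / 2 - \<bar>(x - ?m) \<bullet> \<tau> E\<bar>)" unfolding neg using x by (auto simp: U_def)
      moreover have "(x - ?m) \<bullet> ((-1) *\<^sub>R \<nu> E) \<le> 0" unfolding neg using False by simp
      ultimately have "x \<in> side_of E (-1)" by (rule c'(2))
      then show ?thesis using side_of(1)[OF E, of "-1"] Union_mesh by blast
    qed
  qed
  ultimately have "U \<subseteq> \<Omega>" using interior_closure_domain interior_maximal by blast
  moreover have "rel_interior E \<subseteq> U"
    using A.mem_rel_interior_edge c(1) c'(1) by (auto simp: U_def)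
  ultimately show ?thesis
    using interior_subset_domain side_of(1)[OF E] by (auto simp: edge_region_def)
qed

text \<open>In the square the distance from the edge line is at most d / (8 K), with d the edge
  length, whereas the kite of slope 1 / (2 K) has height at least 3 d / (16 K) at tangential
  distance up to d / 8. This fixes the half-side d / (8 K) of the edge test functions.\<close>

lemma square_subset_region:
  assumes E: "E \<in> interior_edges \<Omega> \<T>" and K: "K \<ge> 1"
    and ball: "\<And>T. T \<in> \<T> \<Longrightarrow> \<exists>x r. r > 0 \<and> cball x r \<subseteq> T \<and> diameter T \<le> K * r"
    and x: "\<bar>(x - edge_mid E) \<bullet> \<tau> E\<bar> \<le> diameter E / (8 * K)" "\<bar>(x - edge_mid E) \<bullet> \<nu> E\<bar> \<le> diameter E / (8 * K)"
  shows "x \<in> edge_region E"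
proof -
  let ?m = "edge_mid E" and ?d = "diameter E"
  have strip: "x \<in> interior (side_of E \<sigma>)" if \<sigma>: "\<sigma> = 1 \<or> \<sigma> = (-1::real)" "(x - ?m) \<bullet> (\<sigma> *\<^sub>R \<nu> E) < 0" for \<sigma>
  proof -
    interpret A: oriented_edge "\<tau> E" "\<sigma> *\<^sub>R \<nu> E" "side_of E \<sigma>" E ?m ?d
      using E \<sigma> by (intro side_of_oriented) auto
    obtain x0 r where r: "r > 0" "cball x0 r \<subseteq> side_of E \<sigma>" "diameter (side_of E \<sigma>) \<le> K * r"
      using ball[OF side_of(1)[OF E \<sigma>(1)]] by blast
    have "- (x - ?m) \<bullet> (\<sigma> *\<^sub>R \<nu> E) = - (\<sigma> * ((x - ?m) \<bullet> \<nu> E))" by (simp only: inner_minus_left inner_scaleR_right)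
    also have "\<dots> \<le> ?d / (8 * K)" using x(2) \<sigma>(1) by auto
    also have "\<dots> < 1 / (2 * K) * (?d / 2 - ?d / (8 * K))"
    proof -
      have "?d / (8 * K) \<le> ?d / 8" using K A.length_pos by (simp add: field_simps)
      then have "1 / (2 * K) * (?d / 2 - ?d / 8) \<le> 1 / (2 * K) * (?d / 2 - ?d / (8 * K))"
        using K by (intro mult_left_mono) auto
      moreover have "?d / (8 * K) < 1 / (2 * K) * (?d / 2 - ?d / 8)" using K A.length_pos by (simp add: field_simps)
      ultimately show ?thesis by linarith
    qed
    also have "\<dots> \<le> 1 / (2 * K) * (?d / 2 - \<bar>(x - ?m) \<bullet> \<tau> E\<bar>)" using x(1) K by (intro mult_left_mono) auto
    finally show ?thesis using A.kite_interior[OF r(2,1,3)] K \<sigma>(2) by simp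
  qed
  interpret A: oriented_edge "\<tau> E" "1 *\<^sub>R \<nu> E" "side_of E 1" E ?m ?d
    using E by (intro side_of_oriented) auto
  consider "(x - ?m) \<bullet> \<nu> E < 0" | "(x - ?m) \<bullet> \<nu> E > 0" | "(x - ?m) \<bullet> \<nu> E = 0" by linarith
  then show ?thesis
  proof cases
    case 1
    then show ?thesis using strip[of 1] by (simp add: edge_region_def)
  next
    case 2
    then show ?thesis using strip[of "-1"] by (simp add: edge_region_def)
  next
    case 3
    have "?d / (8 * K) < ?d / 2" using K A.length_pos by (simp add: field_simps)
    then have "x \<in> rel_interior E" using 3 x(1) A.mem_rel_interior_edge[of x] by simp
    then show ?thesis by (simp add: edge_region_def)
  qed
qed

end


section \<open>Arc length on edges\<close>

locale mesh_edge = oriented_edge \<tau> \<nu> T E "edge_mid E" "diameter E" for \<tau> \<nu> T E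
begin

text \<open>\<open>edge_ends\<close> may run against \<tau>, which the sign \<sigma> records. The
  parametrization is centred at the midpoint, so the sign drops out of integrals by
  symmetry.\<close>

lemma edge_measure_embed:
  obtains \<sigma> :: real where "\<sigma> = 1 \<or> \<sigma> = -1"
    "edge_measure E = embed_measure (lebesgue_on {0..diameter E}) (\<lambda>s. edge_mid E + (\<sigma> * (s - diameter E / 2)) *\<^sub>R \<tau>)"
    "inj_on (\<lambda>s. edge_mid E + (\<sigma> * (s - diameter E / 2)) *\<^sub>R \<tau>) (space (lebesgue_on {0..diameter E}))"
proof -
  have fr: "frame \<tau> \<nu>" by unfold_locales
  have flat: "\<forall>x\<in>E. \<forall>y\<in>E. \<nu> \<bullet> (x - y) = 0"
    using edge_chart by (auto simp: inner_diff_left inner_diff_right inner_commute)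
  obtain \<sigma> :: real where \<sigma>: "\<bar>\<sigma>\<bar> = 1" "fst (edge_ends E) = edge_mid E - (\<sigma> * (diameter E / 2)) *\<^sub>R \<tau>"
    "snd (edge_ends E) = edge_mid E + (\<sigma> * (diameter E / 2)) *\<^sub>R \<tau>" "diameter E > 0"
    "diameter E = dist (fst (edge_ends E)) (snd (edge_ends E))"
    using edge_ends_frame[OF triangle edge fr flat] by metis
  have s1: "\<sigma> = 1 \<or> \<sigma> = -1" using \<sigma>(1) by linarith
  have eq: "fst (edge_ends E) + (s / diameter E) *\<^sub>R (snd (edge_ends E) - fst (edge_ends E))
      = edge_mid E + (\<sigma> * (s - diameter E / 2)) *\<^sub>R \<tau>" for s
    unfolding \<sigma>(2,3) using \<sigma>(4) by (simp add: plane_eq_iff field_simps)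
  have "edge_measure E = embed_measure (lebesgue_on {0..diameter E}) (\<lambda>s. edge_mid E + (\<sigma> * (s - diameter E / 2)) *\<^sub>R \<tau>)"
    by (simp add: edge_measure_def split_beta \<sigma>(5)[symmetric] eq)
  moreover have "inj_on (\<lambda>s. edge_mid E + (\<sigma> * (s - diameter E / 2)) *\<^sub>R \<tau>) A" for A
    using s1 norm_tau by (auto simp: inj_on_def)
  ultimately show ?thesis using that s1 by blast
qed

lemma edge_measurable_borel: "f \<in> borel_measurable borel \<Longrightarrow> f \<in> borel_measurable (edge_measure E)"
proof -
  assume f: "f \<in> borel_measurable borel"
  obtain \<sigma> :: real where eq: "edge_measure E = embed_measure (lebesgue_on {0..diameter E}) (\<lambda>s. edge_mid E + (\<sigma> * (s - diameter E / 2)) *\<^sub>R \<tau>)"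
    using edge_measure_embed by metis
  have "(\<lambda>s. f (edge_mid E + (\<sigma> * (s - diameter E / 2)) *\<^sub>R \<tau>)) \<in> borel_measurable (lebesgue_on {0..diameter E})"
  proof -
    have "(\<lambda>s. f (edge_mid E + (\<sigma> * (s - diameter E / 2)) *\<^sub>R \<tau>)) \<in> borel_measurable borel"
      by (intro measurable_compose[OF _ f] borel_measurable_continuous_onI continuous_intros)
    then show ?thesis by (intro lebesgue_on_measurable)
  qed
  then show ?thesis unfolding eq by (rule measurable_embed_measure1)
qed

lemma edge_integral_lebesgue:
  fixes f :: "plane \<Rightarrow> real"
  assumes f: "f \<in> borel_measurable (edge_measure E)"
  shows "(LINT x|edge_measure E. f x) = (LINT s|lebesgue. indicator {- (diameter E / 2)..diameter E / 2} s * f (edge_mid E + s *\<^sub>R \<tau>))"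
proof -
  obtain \<sigma> :: real where s1: "\<sigma> = 1 \<or> \<sigma> = -1" and
    eq: "edge_measure E = embed_measure (lebesgue_on {0..diameter E}) (\<lambda>s. edge_mid E + (\<sigma> * (s - diameter E / 2)) *\<^sub>R \<tau>)"
    and inj: "inj_on (\<lambda>s. edge_mid E + (\<sigma> * (s - diameter E / 2)) *\<^sub>R \<tau>) (space (lebesgue_on {0..diameter E}))"
    using edge_measure_embed by metis
  let ?e = "\<lambda>s. edge_mid E + (\<sigma> * (s - diameter E / 2)) *\<^sub>R \<tau>"
  have "(LINT x|edge_measure E. f x) = (LINT x|distr (lebesgue_on {0..diameter E}) (edge_measure E) ?e. f x)"
    using embed_measure_eq_distr'[OF inj] by (simp only: eq)
  also have "\<dots> = (LINT s|lebesgue_on {0..diameter E}. f (?e s))"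
    by (rule integral_distr[OF _ f]) (simp only: eq measurable_embed_measure2'[OF inj])
  also have "\<dots> = (LINT s|lebesgue. indicator {0..diameter E} s * f (?e s))"
    by (simp add: integral_restrict_space)
  also have "\<dots> = \<bar>\<sigma>\<bar> *\<^sub>R (LINT s|lebesgue. indicator {0..diameter E} (diameter E / 2 + \<sigma> * s) * f (?e (diameter E / 2 + \<sigma> * s)))"
    using s1 by (intro lebesgue_integral_real_affine) auto
  also have "\<dots> = (LINT s|lebesgue. indicator {- (diameter E / 2)..diameter E / 2} s * f (edge_mid E + s *\<^sub>R \<tau>))"
  proof -
    have "indicator {0..diameter E} (diameter E / 2 + \<sigma> * s) = (indicator {- (diameter E / 2)..diameter E / 2} s :: real)" for s
      using s1 by (auto simp: indicator_def field_simps)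
    moreover have "?e (diameter E / 2 + \<sigma> * s) = edge_mid E + s *\<^sub>R \<tau>" for s
      using s1 by auto
    ultimately show ?thesis using s1 by auto
  qed
  finally show ?thesis .
qed

lemma edge_integral:
  fixes f :: "plane \<Rightarrow> real"
  assumes f: "f \<in> borel_measurable borel"
  shows "(LINT x|edge_measure E. f x) = (LINT s|lborel. indicator {- (diameter E / 2)..diameter E / 2} s * f (edge_mid E + s *\<^sub>R \<tau>))"
proof -
  have "(\<lambda>s. indicator {- (diameter E / 2)..diameter E / 2} s * f (edge_mid E + s *\<^sub>R \<tau>)) \<in> borel_measurable lborel"
  proof -
    have "(\<lambda>s. f (edge_mid E + s *\<^sub>R \<tau>)) \<in> borel_measurable borel"
      by (intro measurable_compose[OF _ f] borel_measurable_continuous_onI continuous_intros)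
    then show ?thesis by measurable
  qed
  then show ?thesis
    by (simp add: edge_integral_lebesgue[OF edge_measurable_borel[OF f]] integral_completion)
qed

lemma AE_lebesgue_neq: "AE s in lebesgue. s \<noteq> (c::real)"
proof -
  have "AE s in lebesgue. s \<notin> {c}" by (intro AE_not_in) (simp add: negligible_iff_null_sets[symmetric])
  then show ?thesis by simp
qed

text \<open>End points are null sets for arc length. Since \<open>edgewise_poly\<close> speaks of
  relative interiors, its polynomial represents the data almost everywhere on E.\<close>

lemma AE_edge_rel_interior: "AE x in edge_measure E. x \<in> rel_interior E"
proof -
  obtain \<sigma> :: real where s1: "\<sigma> = 1 \<or> \<sigma> = -1" and
    eq: "edge_measure E = embed_measure (lebesgue_on {0..diameter E}) (\<lambda>s. edge_mid E + (\<sigma> * (s - diameter E / 2)) *\<^sub>R \<tau>)"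
    and inj: "inj_on (\<lambda>s. edge_mid E + (\<sigma> * (s - diameter E / 2)) *\<^sub>R \<tau>) (space (lebesgue_on {0..diameter E}))"
    using edge_measure_embed by metis
  have "AE s in lebesgue. s \<in> {0..diameter E} \<longrightarrow> edge_mid E + (\<sigma> * (s - diameter E / 2)) *\<^sub>R \<tau> \<in> rel_interior E"
    using AE_lebesgue_neq[of 0] AE_lebesgue_neq[of "diameter E"]
  proof eventually_elim
    case (elim s)
    then show ?case using s1 by (auto simp: mem_rel_interior_edge abs_if)
  qed
  then have "AE s in lebesgue_on {0..diameter E}. edge_mid E + (\<sigma> * (s - diameter E / 2)) *\<^sub>R \<tau> \<in> rel_interior E"
    by (simp add: AE_restrict_space_iff)
  then show ?thesis unfolding eq by (simp only: AE_embed_measure'[OF inj])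
qed

lemma space_edge_measure: "space (edge_measure E) = E"
proof -
  obtain \<sigma> :: real where s1: "\<sigma> = 1 \<or> \<sigma> = -1" and
    eq: "edge_measure E = embed_measure (lebesgue_on {0..diameter E}) (\<lambda>s. edge_mid E + (\<sigma> * (s - diameter E / 2)) *\<^sub>R \<tau>)"
    using edge_measure_embed by metis
  have "(\<lambda>s. edge_mid E + (\<sigma> * (s - diameter E / 2)) *\<^sub>R \<tau>) ` {0..diameter E} = E"
  proof
    show "(\<lambda>s. edge_mid E + (\<sigma> * (s - diameter E / 2)) *\<^sub>R \<tau>) ` {0..diameter E} \<subseteq> E"
      using s1 by (auto simp: mem_edge abs_if)
    show "E \<subseteq> (\<lambda>s. edge_mid E + (\<sigma> * (s - diameter E / 2)) *\<^sub>R \<tau>) ` {0..diameter E}"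
    proof
      fix x assume x: "x \<in> E"
      define s where "s = (x - edge_mid E) \<bullet> \<tau>"
      have xs: "x = edge_mid E + s *\<^sub>R \<tau>" using edge_chart[OF x] by (simp add: s_def)
      then have "\<bar>s\<bar> \<le> diameter E / 2" using x mem_edge by simp
      then show "x \<in> (\<lambda>s. edge_mid E + (\<sigma> * (s - diameter E / 2)) *\<^sub>R \<tau>) ` {0..diameter E}"
        using s1 xs by (intro image_eqI[of _ _ "diameter E / 2 + \<sigma> * s"]) (auto simp: abs_le_iff)
    qed
  qed
  then show ?thesis by (simp add: eq space_embed_measure)
qed

lemma edge_measure_total: "emeasure (edge_measure E) (space (edge_measure E)) = ennreal (diameter E)"
  "measure (edge_measure E) (space (edge_measure E)) = diameter E"
proof -
  obtain \<sigma> :: real where s1: "\<sigma> = 1 \<or> \<sigma> = -1" and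
    eq: "edge_measure E = embed_measure (lebesgue_on {0..diameter E}) (\<lambda>s. edge_mid E + (\<sigma> * (s - diameter E / 2)) *\<^sub>R \<tau>)"
    and inj: "inj_on (\<lambda>s. edge_mid E + (\<sigma> * (s - diameter E / 2)) *\<^sub>R \<tau>) (space (lebesgue_on {0..diameter E}))"
    using edge_measure_embed by metis
  have "emeasure (edge_measure E) (space (edge_measure E)) = emeasure (lebesgue_on {0..diameter E}) {0..diameter E}"
    unfolding eq space_embed_measure using emeasure_embed_measure_image'[OF inj sets.top] by simp
  also have "\<dots> = ennreal (diameter E)" using length_pos by (simp add: emeasure_restrict_space)
  finally show *: "emeasure (edge_measure E) (space (edge_measure E)) = ennreal (diameter E)" .
  then show "measure (edge_measure E) (space (edge_measure E)) = diameter E"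
    using length_pos by (simp add: measure_def)
qed

text \<open>The values of \<open>G\<close> at the end points are arbitrary; after parametrization
  they change a Borel function at two parameters only, which keeps it measurable.\<close>

lemma edge_measurable_if_eq:
  assumes p: "p \<in> borel_measurable borel" and G: "\<And>x. x \<in> rel_interior E \<Longrightarrow> G x = p x"
  shows "G \<in> borel_measurable (edge_measure E)" "AE x in edge_measure E. G x = p x"
proof -
  obtain \<sigma> :: real where s1: "\<sigma> = 1 \<or> \<sigma> = -1" and
    eq: "edge_measure E = embed_measure (lebesgue_on {0..diameter E}) (\<lambda>s. edge_mid E + (\<sigma> * (s - diameter E / 2)) *\<^sub>R \<tau>)"
    using edge_measure_embed by metis
  let ?e = "\<lambda>s. edge_mid E + (\<sigma> * (s - diameter E / 2)) *\<^sub>R \<tau>"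
  let ?h = "\<lambda>s. if s = 0 then G (?e 0) else if s = diameter E then G (?e (diameter E)) else p (?e s)"
  have "?h \<in> borel_measurable (lebesgue_on {0..diameter E})"
  proof -
    have "(\<lambda>s. p (?e s)) \<in> borel_measurable borel"
      by (intro measurable_compose[OF _ p] borel_measurable_continuous_onI continuous_intros)
    then have "?h \<in> borel_measurable borel" by measurable
    then show ?thesis by (rule lebesgue_on_measurable)
  qed
  then have "(\<lambda>s. G (?e s)) \<in> borel_measurable (lebesgue_on {0..diameter E})"
  proof (rule measurable_cong[THEN iffD2, rotated])
    fix s assume "s \<in> space (lebesgue_on {0..diameter E})"
    then have s: "0 \<le> s" "s \<le> diameter E" by auto
    show "G (?e s) = ?h s"
    proof (cases "s = 0 \<or> s = diameter E")
      case False
      then have "?e s \<in> rel_interior E" using s s1 by (auto simp: mem_rel_interior_edge abs_if)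
      then show ?thesis using False G by simp
    qed auto
  qed
  then show "G \<in> borel_measurable (edge_measure E)" unfolding eq by (rule measurable_embed_measure1)
  show "AE x in edge_measure E. G x = p x"
    using AE_edge_rel_interior by eventually_elim (rule G)
qed

lemma edge_bounded_L2:
  assumes "f \<in> borel_measurable (edge_measure E)" "\<And>x. x \<in> E \<Longrightarrow> \<bar>f x\<bar> \<le> B"
  shows "f \<in> L2 (edge_measure E)" "L2_nrm (edge_measure E) f \<le> B * sqrt (diameter E)"
  using L2_bounded[OF assms(1), of B] assms(2) space_edge_measure edge_measure_total by auto

lemma smooth_edge_L2: "smooth f \<Longrightarrow> f \<in> L2 (edge_measure E)"
proof -
  assume f: "smooth f"
  have "compact E" by (subst segment) (rule compact_segment)
  then have "compact (f ` E)" using f by (intro compact_continuous_image smooth_continuous)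
  then obtain B where "\<forall>x\<in>E. \<bar>f x\<bar> \<le> B" by (auto dest!: compact_imp_bounded simp: bounded_iff)
  then show ?thesis
    by (intro edge_bounded_L2[where B = B] edge_measurable_borel smooth_measurable f) auto
qed

end


section \<open>Traces and point values of smooth functions\<close>

lemma dderiv_at_min:
  assumes "smooth f" "\<And>x. 0 \<le> f x" "f x = 0"
  shows "dderiv v f x = 0"
proof -
  have "((\<lambda>t. f (x + t *\<^sub>R v)) has_real_derivative dderiv v f x) (at 0)"
    using smooth_DERIV_line[OF assms(1), of x v 0] by simp
  then show ?thesis
    by (rule DERIV_local_min[of _ _ _ 1]) (use assms in auto)
qed

lemma dderiv_mult: "smooth f \<Longrightarrow> smooth g \<Longrightarrow> dderiv v (\<lambda>x. f x * g x) x = dderiv v f x * g x + f x * dderiv v g x"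
  by (simp add: dderiv_def partial_mult smooth_differentiable algebra_simps)

text \<open>The difference of the two sides is the square of the derivative in the orthogonal
  direction.\<close>

lemma dderiv_sq_le: "norm v = 1 \<Longrightarrow> (dderiv v f x)\<^sup>2 \<le> (partial 1 f x)\<^sup>2 + (partial 2 f x)\<^sup>2"
proof -
  assume "norm v = 1"
  then have v: "v $ 1 * v $ 1 + v $ 2 * v $ 2 = 1" by (simp add: norm_plane_1)
  have "(partial 1 f x)\<^sup>2 + (partial 2 f x)\<^sup>2 - (dderiv v f x)\<^sup>2 = (v $ 2 * partial 1 f x - v $ 1 * partial 2 f x)\<^sup>2"
    unfolding dderiv_def using v by algebra
  then show ?thesis by (smt (verit) zero_le_power2)
qed

lemma AE_not_frontier: "convex (T::plane set) \<Longrightarrow> AE x in lebesgue. x \<notin> frontier T"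
  using negligible_convex_frontier[of T] by (intro AE_not_in) (simp add: negligible_iff_null_sets)

context mesh_edge
begin

text \<open>The weight vanishes on the part of the half-plane outside T, which turns Green's formula
  for the half-plane into one for T. It is positive on the open edge and vanishes along the rest of
  the edge line.\<close>

lemma edge_weight:
  obtains \<omega> R where "smooth \<omega>" "\<And>x. 0 \<le> \<omega> x" "\<And>x. \<omega> x \<le> 1" "\<And>x. norm x > R \<Longrightarrow> \<omega> x = 0"
    "\<And>x. x \<in> half_plane \<nu> (edge_mid E) \<Longrightarrow> x \<notin> T \<Longrightarrow> \<omega> x = 0"
    "\<And>x. x \<in> rel_interior E \<Longrightarrow> 0 < \<omega> x" "\<And>s. \<bar>s\<bar> \<ge> diameter E / 2 \<Longrightarrow> \<omega> (edge_mid E + s *\<^sub>R \<tau>) = 0"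
proof -
  let ?m = "edge_mid E" and ?d = "diameter E"
  obtain c where c: "c > 0" "\<And>x. - (x - ?m) \<bullet> \<nu> \<le> c * (?d / 2 - \<bar>(x - ?m) \<bullet> \<tau>\<bar>) \<Longrightarrow> (x - ?m) \<bullet> \<nu> \<le> 0 \<Longrightarrow> x \<in> T"
    using some_kite by metis
  \<comment> \<open>The first two factors cut out the kite over the edge, the third makes the support bounded.\<close>
  define \<omega> where "\<omega> x = flat (c * (?d / 2 - (x - ?m) \<bullet> \<tau>) + (x - ?m) \<bullet> \<nu>) *
     (flat (c * (?d / 2 + (x - ?m) \<bullet> \<tau>) + (x - ?m) \<bullet> \<nu>) * flat (1 - (x - ?m) \<bullet> \<nu>))" for x
  have sm: "smooth (\<lambda>x. flat (a * ((x - ?m) \<bullet> \<tau>) + b * ((x - ?m) \<bullet> \<nu>) + e))" for a b e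
  proof -
    have "smooth (\<lambda>x. flat ((a *\<^sub>R \<tau> + b *\<^sub>R \<nu>) \<bullet> x + (e - (a *\<^sub>R \<tau> + b *\<^sub>R \<nu>) \<bullet> ?m)))"
      by (intro smooth_ridge smooth1_flat)
    moreover have "(a *\<^sub>R \<tau> + b *\<^sub>R \<nu>) \<bullet> x + (e - (a *\<^sub>R \<tau> + b *\<^sub>R \<nu>) \<bullet> ?m) = a * ((x - ?m) \<bullet> \<tau>) + b * ((x - ?m) \<bullet> \<nu>) + e" for x
      by (simp add: inner_simps inner_commute algebra_simps)
    ultimately show ?thesis by simp
  qed
  have eqs: "c * (?d / 2 - (x - ?m) \<bullet> \<tau>) + (x - ?m) \<bullet> \<nu> = (- c) * ((x - ?m) \<bullet> \<tau>) + 1 * ((x - ?m) \<bullet> \<nu>) + c * ?d / 2"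
    "c * (?d / 2 + (x - ?m) \<bullet> \<tau>) + (x - ?m) \<bullet> \<nu> = c * ((x - ?m) \<bullet> \<tau>) + 1 * ((x - ?m) \<bullet> \<nu>) + c * ?d / 2"
    "1 - (x - ?m) \<bullet> \<nu> = 0 * ((x - ?m) \<bullet> \<tau>) + (-1) * ((x - ?m) \<bullet> \<nu>) + 1" for x
    by (simp_all add: algebra_simps)
  have s\<omega>: "smooth \<omega>" unfolding \<omega>_def[abs_def] eqs by (intro smooth_mult sm)
  have nz: "- ((x - ?m) \<bullet> \<nu>) < c * (?d / 2 - \<bar>(x - ?m) \<bullet> \<tau>\<bar>) \<and> (x - ?m) \<bullet> \<nu> < 1" if "\<omega> x \<noteq> 0" for x
  proof -
    have "0 < c * (?d / 2 - (x - ?m) \<bullet> \<tau>) + (x - ?m) \<bullet> \<nu>" "0 < c * (?d / 2 + (x - ?m) \<bullet> \<tau>) + (x - ?m) \<bullet> \<nu>"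
      "0 < 1 - (x - ?m) \<bullet> \<nu>"
      using that flat_zero unfolding \<omega>_def by (auto simp: not_le[symmetric])
    then show ?thesis by (auto simp: abs_if)
  qed
  have supp: "\<omega> x = 0" if "norm x > norm ?m + (c * ?d + 1 + (?d / 2 + 1 / c))" for x
  proof (rule ccontr)
    assume "\<omega> x \<noteq> 0"
    from nz[OF this] have n: "- ((x - ?m) \<bullet> \<nu>) < c * (?d / 2 - \<bar>(x - ?m) \<bullet> \<tau>\<bar>)" "(x - ?m) \<bullet> \<nu> < 1" by auto
    have "c * \<bar>(x - ?m) \<bullet> \<tau>\<bar> < c * (?d / 2 + 1 / c)" using n c(1) by (simp add: algebra_simps)
    then have a: "\<bar>(x - ?m) \<bullet> \<tau>\<bar> < ?d / 2 + 1 / c" using c(1) by simp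
    have "c * (?d / 2 - \<bar>(x - ?m) \<bullet> \<tau>\<bar>) \<le> c * ?d"
      using c(1) length_pos by (intro mult_left_mono) auto
    then have "- ((x - ?m) \<bullet> \<nu>) < c * ?d" using n(1) by linarith
    moreover have "0 < c * ?d" using c(1) length_pos by simp
    ultimately have b: "\<bar>(x - ?m) \<bullet> \<nu>\<bar> < c * ?d + 1" using n(2) by (auto simp: abs_less_iff)
    have "norm (x - ?m) = norm (((x - ?m) \<bullet> \<tau>) *\<^sub>R \<tau> + ((x - ?m) \<bullet> \<nu>) *\<^sub>R \<nu>)"
      using expand[of "x - ?m"] by simp
    also have "\<dots> \<le> \<bar>(x - ?m) \<bullet> \<tau>\<bar> + \<bar>(x - ?m) \<bullet> \<nu>\<bar>"
      using norm_triangle_ineq[of "((x - ?m) \<bullet> \<tau>) *\<^sub>R \<tau>" "((x - ?m) \<bullet> \<nu>) *\<^sub>R \<nu>"] norm_tau norm_nu by simp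
    finally have "norm (x - ?m) < c * ?d + 1 + (?d / 2 + 1 / c)" using a b by linarith
    then show False using that norm_triangle_sub[of x ?m] by linarith
  qed
  show ?thesis
  proof (rule that[OF s\<omega> _ _ supp])
    show "0 \<le> \<omega> x" "\<omega> x \<le> 1" for x
      unfolding \<omega>_def by (auto intro!: mult_nonneg_nonneg mult_le_one flat_nonneg flat_le_1)
    show "\<omega> x = 0" if "x \<in> half_plane \<nu> ?m" "x \<notin> T" for x
    proof (rule ccontr)
      assume "\<omega> x \<noteq> 0"
      from nz[OF this] have "x \<in> T" using that(1) by (intro c(2)) (auto simp: half_plane_def inner_simps)
      with that(2) show False by simp
    qed
    show "0 < \<omega> x" if "x \<in> rel_interior E" for x
      using that c(1) unfolding mem_rel_interior_edge \<omega>_def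
      by (auto intro!: mult_pos_pos flat_pos simp: abs_less_iff)
    show "\<omega> (?m + s *\<^sub>R \<tau>) = 0" if "\<bar>s\<bar> \<ge> ?d / 2" for s
    proof (rule ccontr)
      assume "\<omega> (?m + s *\<^sub>R \<tau>) \<noteq> 0"
      from nz[OF this] have "0 < c * (?d / 2 - \<bar>s\<bar>)" by simp
      then show False using that c(1) by (simp add: zero_less_mult_iff)
    qed
  qed
qed

text \<open>Green's formula for \<psi>^2 \<omega>, followed by 2 a b \<le> a^2 + b^2. The
  nonnegative weight has zero derivative wherever it vanishes, so the integrand lives on T. The
  constant may depend on the triangle, because the bound serves only to pass to a limit.\<close>

lemma weighted_trace_bound:
  "\<exists>\<omega> B. smooth \<omega> \<and> (\<forall>x. 0 \<le> \<omega> x \<and> \<omega> x \<le> 1) \<and> (\<forall>x\<in>rel_interior E. 0 < \<omega> x) \<and>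
    (\<forall>\<psi>. smooth \<psi> \<longrightarrow> (LINT x|edge_measure E. \<omega> x * (\<psi> x)\<^sup>2)
       \<le> B * (\<Sum>\<alpha>\<in>multi_upto 1. LINT x|lebesgue_on (interior T). (multi_partial \<alpha> \<psi> x)\<^sup>2))"
proof -
  let ?m = "edge_mid E" and ?d = "diameter E"
  obtain \<omega> R where \<omega>: "smooth \<omega>" "\<And>x. 0 \<le> \<omega> x" "\<And>x. \<omega> x \<le> 1" "\<And>x. norm x > R \<Longrightarrow> \<omega> x = 0"
    "\<And>x. x \<in> half_plane \<nu> ?m \<Longrightarrow> x \<notin> T \<Longrightarrow> \<omega> x = 0"
    "\<And>x. x \<in> rel_interior E \<Longrightarrow> 0 < \<omega> x" "\<And>s. \<bar>s\<bar> \<ge> ?d / 2 \<Longrightarrow> \<omega> (?m + s *\<^sub>R \<tau>) = 0"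
    using edge_weight by metis
  obtain B where B: "\<And>x. \<bar>dderiv \<nu> \<omega> x\<bar> \<le> B"
    by (rule bounded_support_bounded[OF smooth_continuous[OF smooth_dderiv[OF \<omega>(1)]], of R \<nu>])
       (auto intro: dderiv_zero_outside(2)[OF \<omega>(4)])
  have B0: "0 \<le> B" using B[of 0] by linarith
  have main: "(LINT x|edge_measure E. \<omega> x * (\<psi> x)\<^sup>2)
       \<le> (1 + B) * (\<Sum>\<alpha>\<in>multi_upto 1. LINT x|lebesgue_on (interior T). (multi_partial \<alpha> \<psi> x)\<^sup>2)" if \<psi>: "smooth \<psi>" for \<psi>
  proof -
    define F where "F x = \<psi> x * \<psi> x * \<omega> x" for x
    have sF: "smooth F" unfolding F_def[abs_def] by (intro smooth_mult \<psi> \<omega>)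
    have suppF: "norm x > R \<Longrightarrow> F x = 0" for x using \<omega>(4) by (simp add: F_def)
    define Q where "Q x = (\<psi> x)\<^sup>2 + (partial 1 \<psi> x)\<^sup>2 + (partial 2 \<psi> x)\<^sup>2" for x
    have intT: "interior T \<in> sets lebesgue" "bounded (interior T)"
      using T_props(4) interior_subset by (auto intro: bounded_subset)
    have intQ: "integrable (lebesgue_on (interior T)) Q" unfolding Q_def
      by (intro Bochner_Integration.integrable_add L2_integrable smooth_L2 smooth_partial \<psi> intT)
    have "(LINT x|edge_measure E. \<omega> x * (\<psi> x)\<^sup>2) = (LINT x|edge_measure E. F x)"
      by (simp add: F_def power2_eq_square mult_ac)
    also have "\<dots> = (LINT s|lborel. indicator {- (?d / 2)..?d / 2} s * F (?m + s *\<^sub>R \<tau>))"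
      by (rule edge_integral[OF smooth_measurable[OF sF]])
    also have "\<dots> = (LINT s|lborel. F (?m + s *\<^sub>R \<tau>))"
    proof (rule Bochner_Integration.integral_cong[OF refl])
      show "indicator {- (?d / 2)..?d / 2} s * F (?m + s *\<^sub>R \<tau>) = F (?m + s *\<^sub>R \<tau>)" for s
        using \<omega>(7)[of s] by (cases "\<bar>s\<bar> \<ge> ?d / 2") (auto simp: F_def indicator_def abs_le_iff)
    qed
    also have "\<dots> = (LINT x|lborel. indicator (half_plane \<nu> ?m) x * dderiv \<nu> F x)"
      by (rule green_normal[OF sF suppF, symmetric])
    also have "\<dots> = (LINT x|lebesgue. indicator (half_plane \<nu> ?m) x * dderiv \<nu> F x)"
      using smooth_measurable[OF smooth_dderiv[OF sF]] by (intro integral_completion[symmetric]) measurable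
    also have "\<dots> \<le> (LINT x|lebesgue. indicator (interior T) x * ((1 + B) * Q x))"
    proof (rule integral_mono_AE)
      show "integrable lebesgue (\<lambda>x. indicator (half_plane \<nu> ?m) x * dderiv \<nu> F x)"
        using green_integrable[OF sF suppF] by (simp add: integrable_completion)
      show "integrable lebesgue (\<lambda>x. indicator (interior T) x * ((1 + B) * Q x))"
        by (rule lebesgue_on_integral_extend(2)[OF intT(1), THEN iffD1]) (intro integrable_mult_right intQ)
      show "AE x in lebesgue. indicator (half_plane \<nu> ?m) x * dderiv \<nu> F x \<le> indicator (interior T) x * ((1 + B) * Q x)"
        using AE_not_frontier[OF T_props(1)]
      proof eventually_elim
        case (elim x)
        have Q0: "0 \<le> Q x" by (simp add: Q_def)
        show ?case
        proof (cases "x \<in> half_plane \<nu> ?m")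
          case True
          show ?thesis
          proof (cases "x \<in> T")
            case False
            then have "\<omega> x = 0" using \<omega>(5) True by blast
            moreover from this have "dderiv \<nu> \<omega> x = 0" using dderiv_at_min \<omega>(1,2) by blast
            ultimately have "dderiv \<nu> F x = 0"
              unfolding F_def[abs_def] by (simp add: dderiv_mult smooth_mult \<psi> \<omega>(1))
            then show ?thesis using Q0 B0 by (auto simp: indicator_def)
          next
            case xT: True
            then have "x \<in> interior T" using elim T_props(3) by (auto simp: frontier_def)
            have "dderiv \<nu> F x = 2 * \<psi> x * dderiv \<nu> \<psi> x * \<omega> x + (\<psi> x)\<^sup>2 * dderiv \<nu> \<omega> x"
              unfolding F_def[abs_def] by (simp add: dderiv_mult smooth_mult \<psi> \<omega>(1) power2_eq_square algebra_simps)
            also have "\<dots> \<le> ((\<psi> x)\<^sup>2 + (dderiv \<nu> \<psi> x)\<^sup>2) * 1 + (\<psi> x)\<^sup>2 * B"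
            proof (intro add_mono)
              have "2 * \<psi> x * dderiv \<nu> \<psi> x \<le> (\<psi> x)\<^sup>2 + (dderiv \<nu> \<psi> x)\<^sup>2" by (rule sum_squares_bound)
              then have "2 * \<psi> x * dderiv \<nu> \<psi> x * \<omega> x \<le> ((\<psi> x)\<^sup>2 + (dderiv \<nu> \<psi> x)\<^sup>2) * \<omega> x"
                using \<omega>(2) by (rule mult_right_mono)
              also have "\<dots> \<le> ((\<psi> x)\<^sup>2 + (dderiv \<nu> \<psi> x)\<^sup>2) * 1" using \<omega>(3) by (intro mult_left_mono) auto
              finally show "2 * \<psi> x * dderiv \<nu> \<psi> x * \<omega> x \<le> ((\<psi> x)\<^sup>2 + (dderiv \<nu> \<psi> x)\<^sup>2) * 1" .
              show "(\<psi> x)\<^sup>2 * dderiv \<nu> \<omega> x \<le> (\<psi> x)\<^sup>2 * B" using B[of x] by (intro mult_left_mono) auto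
            qed
            also have "\<dots> \<le> Q x + Q x * B"
            proof (intro add_mono mult_right_mono B0)
              show "((\<psi> x)\<^sup>2 + (dderiv \<nu> \<psi> x)\<^sup>2) * 1 \<le> Q x"
                using dderiv_sq_le[OF norm_nu, of \<psi> x] by (simp add: Q_def)
              show "(\<psi> x)\<^sup>2 \<le> Q x" by (simp add: Q_def)
            qed
            finally show ?thesis using True \<open>x \<in> interior T\<close> by (simp add: algebra_simps)
          qed
        qed (use Q0 B0 in \<open>auto simp: indicator_def\<close>)
      qed
    qed
    also have "\<dots> = (1 + B) * (LINT x|lebesgue_on (interior T). Q x)"
      by (simp add: lebesgue_on_integral_extend(1)[OF intT(1)] mult.left_commute)
    also have "(LINT x|lebesgue_on (interior T). Q x) = (\<Sum>\<alpha>\<in>multi_upto 1. LINT x|lebesgue_on (interior T). (multi_partial \<alpha> \<psi> x)\<^sup>2)"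
    proof -
      have "integrable (lebesgue_on (interior T)) (\<lambda>x. (\<psi> x)\<^sup>2)" "integrable (lebesgue_on (interior T)) (\<lambda>x. (partial i \<psi> x)\<^sup>2)" for i
        by (intro L2_integrable smooth_L2 smooth_partial \<psi> intT)+
      then show ?thesis unfolding multi_upto_1 Q_def by (simp add: multi_partial_simps)
    qed
    finally show ?thesis .
  qed
  show ?thesis using \<omega>(1,2,3,6) main by (intro exI[of _ \<omega>] exI[of _ "1 + B"]) simp
qed

theorem trace_on_smooth:
  assumes w: "w \<in> borel_measurable (lebesgue_on (interior T))" and w': "smooth w'"
    and eq: "AE x in lebesgue_on (interior T). w x = w' x"
  shows "AE x in edge_measure E. trace_on T E w x = w' x" "trace_on T E w \<in> L2 (edge_measure E)"
proof -
  let ?U = "interior T"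
  have U: "open ?U" "bounded ?U" using T_props(4) interior_subset by (auto intro: bounded_subset)
  have Ul: "?U \<in> sets lebesgue" by auto
  have wd: "AE x in lebesgue_on ?U. weak_deriv ?U \<alpha> (\<lambda>x. w x - \<phi> x) x = multi_partial \<alpha> (\<lambda>x. w' x - \<phi> x) x"
     "weak_deriv ?U \<alpha> (\<lambda>x. w x - \<phi> x) \<in> L2 (lebesgue_on ?U)"
    if "smooth \<phi>" "\<alpha> \<in> multi_upto 1" for \<phi> \<alpha>
  proof -
    have s: "smooth (\<lambda>x. w' x - \<phi> x)" using w' that by (intro smooth_diff)
    have "is_weak_deriv ?U \<alpha> (\<lambda>x. w' x - \<phi> x) (multi_partial \<alpha> (\<lambda>x. w' x - \<phi> x))"
      using s U that(2) by (intro smooth_is_weak_deriv) auto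
    moreover have "is_weak_deriv ?U \<alpha> (\<lambda>x. w x - \<phi> x) v \<longleftrightarrow> is_weak_deriv ?U \<alpha> (\<lambda>x. w' x - \<phi> x) v" for v
    proof (rule is_weak_deriv_cong_AE)
      show "AE x in lebesgue_on ?U. w x - \<phi> x = w' x - \<phi> x" using eq by eventually_elim simp
      show "(\<lambda>x. w x - \<phi> x) \<in> borel_measurable (lebesgue_on ?U)" "(\<lambda>x. w' x - \<phi> x) \<in> borel_measurable (lebesgue_on ?U)"
        using w lebesgue_on_measurable[OF smooth_measurable[OF w'], of ?U]
          lebesgue_on_measurable[OF smooth_measurable[OF that(1)], of ?U] by measurable
    qed
    ultimately have "is_weak_deriv ?U \<alpha> (\<lambda>x. w x - \<phi> x) (multi_partial \<alpha> (\<lambda>x. w' x - \<phi> x))" by simp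
    from weak_deriv_props[OF U(1) smooth_L2[OF smooth_multi_partial[OF s] U(2) Ul] this]
    show "AE x in lebesgue_on ?U. weak_deriv ?U \<alpha> (\<lambda>x. w x - \<phi> x) x = multi_partial \<alpha> (\<lambda>x. w' x - \<phi> x) x"
     "weak_deriv ?U \<alpha> (\<lambda>x. w x - \<phi> x) \<in> L2 (lebesgue_on ?U)" by auto
  qed
  have H: "(H_nrm 1 ?U (\<lambda>x. w x - \<phi> x))\<^sup>2 = (\<Sum>\<alpha>\<in>multi_upto 1. LINT x|lebesgue_on ?U. (multi_partial \<alpha> (\<lambda>x. w' x - \<phi> x) x)\<^sup>2)"
    if "smooth \<phi>" for \<phi>
  proof -
    have "(L2_nrm (lebesgue_on ?U) (weak_deriv ?U \<alpha> (\<lambda>x. w x - \<phi> x)))\<^sup>2 = (LINT x|lebesgue_on ?U. (multi_partial \<alpha> (\<lambda>x. w' x - \<phi> x) x)\<^sup>2)"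
      if "\<alpha> \<in> multi_upto 1" for \<alpha>
      unfolding L2_nrm_real_sq[symmetric]
      by (intro arg_cong[of _ _ "\<lambda>y. y\<^sup>2"] L2_nrm_cong_AE wd \<open>smooth \<phi>\<close> that L2_measurable[OF wd(2)]
          lebesgue_on_measurable smooth_measurable smooth_multi_partial smooth_diff w')
    then show ?thesis by (simp add: H_nrm_def sum_nonneg)
  qed
  have "is_trace T E w w'"
  proof -
    have "(H_nrm 1 ?U (\<lambda>x. w x - w' x))\<^sup>2 = 0"
    proof -
      have "multi_partial \<alpha> (\<lambda>x. w' x - w' x) x = 0" for \<alpha> x
        by (rule multi_partial_zero_open[of UNIV]) auto
      then show ?thesis by (subst H[OF w']) simp
    qed
    then have "H_nrm 1 ?U (\<lambda>x. w x - w' x) = 0" by simp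
    moreover have "L2_nrm (edge_measure E) (\<lambda>x. w' x - w' x) = 0" by (simp add: L2_nrm_def)
    ultimately show ?thesis unfolding is_trace_def
      using w' smooth_edge_L2[OF w'] by (auto intro!: exI[of _ "\<lambda>n. w'"])
  qed
  then have tr: "is_trace T E w (trace_on T E w)" unfolding trace_on_def by (rule someI[of "is_trace T E w"])
  then obtain \<phi> where g: "trace_on T E w \<in> L2 (edge_measure E)" and \<phi>: "\<And>n. smooth (\<phi> n)"
    "(\<lambda>n. H_nrm 1 ?U (\<lambda>x. w x - \<phi> n x)) \<longlonglongrightarrow> 0"
    "(\<lambda>n. L2_nrm (edge_measure E) (\<lambda>x. trace_on T E w x - \<phi> n x)) \<longlonglongrightarrow> 0"
    unfolding is_trace_def by blast
  show "trace_on T E w \<in> L2 (edge_measure E)" by (rule g)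
  let ?g = "trace_on T E w" and ?\<mu> = "edge_measure E"
  obtain \<omega> B where \<omega>0: "smooth \<omega>" "\<forall>x. 0 \<le> \<omega> x \<and> \<omega> x \<le> 1" "\<forall>x\<in>rel_interior E. 0 < \<omega> x"
    "\<forall>\<psi>. smooth \<psi> \<longrightarrow> (LINT x|edge_measure E. \<omega> x * (\<psi> x)\<^sup>2)
       \<le> B * (\<Sum>\<alpha>\<in>multi_upto 1. LINT x|lebesgue_on (interior T). (multi_partial \<alpha> \<psi> x)\<^sup>2)"
    using weighted_trace_bound by blast
  then have \<omega>: "smooth \<omega>" "\<And>x. 0 \<le> \<omega> x" "\<And>x. \<omega> x \<le> 1" "\<And>x. x \<in> rel_interior E \<Longrightarrow> 0 < \<omega> x"
    "\<And>\<psi>. smooth \<psi> \<Longrightarrow> (LINT x|edge_measure E. \<omega> x * (\<psi> x)\<^sup>2)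
       \<le> B * (\<Sum>\<alpha>\<in>multi_upto 1. LINT x|lebesgue_on (interior T). (multi_partial \<alpha> \<psi> x)\<^sup>2)"
    by blast+
  have \<omega>m: "\<omega> \<in> borel_measurable ?\<mu>" using \<omega>(1) by (intro edge_measurable_borel smooth_measurable)
  have wint: "integrable ?\<mu> (\<lambda>x. \<omega> x * (f x)\<^sup>2)" if "f \<in> L2 ?\<mu>" for f
  proof (rule Bochner_Integration.integrable_bound[OF L2_integrable[OF that]])
    show "(\<lambda>x. \<omega> x * (f x)\<^sup>2) \<in> borel_measurable ?\<mu>" using \<omega>m L2_measurable[OF that] by measurable
    show "AE x in ?\<mu>. norm (\<omega> x * (f x)\<^sup>2) \<le> norm ((f x)\<^sup>2)"
      using \<omega>(2,3) by (auto simp: abs_mult intro!: mult_left_le_one_le)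
  qed
  have dL2: "(\<lambda>x. w' x - ?g x) \<in> L2 ?\<mu>" by (intro L2_diff g smooth_edge_L2 w')
  \<comment> \<open>The difference is split at the approximating function; the weight is kept on the
    part that the trace inequality controls and bounded by 1 on the other part.\<close>
  have le: "(LINT x|?\<mu>. \<omega> x * (w' x - ?g x)\<^sup>2) \<le> 2 * (B * (H_nrm 1 ?U (\<lambda>x. w x - \<phi> n x))\<^sup>2) + 2 * (L2_nrm ?\<mu> (\<lambda>x. ?g x - \<phi> n x))\<^sup>2" for n
  proof -
    have L: "(\<lambda>x. w' x - \<phi> n x) \<in> L2 ?\<mu>" "(\<lambda>x. ?g x - \<phi> n x) \<in> L2 ?\<mu>"
      by (intro L2_diff g smooth_edge_L2 w' \<phi>)+
    have "(LINT x|?\<mu>. \<omega> x * (w' x - ?g x)\<^sup>2) \<le> (LINT x|?\<mu>. 2 * (\<omega> x * (w' x - \<phi> n x)\<^sup>2) + 2 * (?g x - \<phi> n x)\<^sup>2)"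
    proof (rule integral_mono)
      show "integrable ?\<mu> (\<lambda>x. 2 * (\<omega> x * (w' x - \<phi> n x)\<^sup>2) + 2 * (?g x - \<phi> n x)\<^sup>2)"
        using wint[OF L(1)] L2_integrable[OF L(2)] by auto
      fix x
      have "(w' x - ?g x)\<^sup>2 \<le> 2 * (w' x - \<phi> n x)\<^sup>2 + 2 * (?g x - \<phi> n x)\<^sup>2"
      proof -
        have "2 * (w' x - \<phi> n x)\<^sup>2 + 2 * (?g x - \<phi> n x)\<^sup>2 - (w' x - ?g x)\<^sup>2 = ((w' x - \<phi> n x) + (?g x - \<phi> n x))\<^sup>2"
          by (simp add: power2_eq_square algebra_simps)
        then show ?thesis by (smt (verit) zero_le_power2)
      qed
      then have "\<omega> x * (w' x - ?g x)\<^sup>2 \<le> \<omega> x * (2 * (w' x - \<phi> n x)\<^sup>2 + 2 * (?g x - \<phi> n x)\<^sup>2)"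
        using \<omega>(2) by (rule mult_left_mono)
      also have "\<dots> \<le> 2 * (\<omega> x * (w' x - \<phi> n x)\<^sup>2) + 2 * (?g x - \<phi> n x)\<^sup>2"
        using mult_right_mono[OF \<omega>(3)[of x], of "2 * (?g x - \<phi> n x)\<^sup>2"] by (simp add: algebra_simps)
      finally show "\<omega> x * (w' x - ?g x)\<^sup>2 \<le> 2 * (\<omega> x * (w' x - \<phi> n x)\<^sup>2) + 2 * (?g x - \<phi> n x)\<^sup>2" .
    qed (rule wint[OF dL2])
    also have "\<dots> = 2 * (LINT x|?\<mu>. \<omega> x * (w' x - \<phi> n x)\<^sup>2) + 2 * (L2_nrm ?\<mu> (\<lambda>x. ?g x - \<phi> n x))\<^sup>2"
      using wint[OF L(1)] L2_integrable[OF L(2)] by (simp add: L2_nrm_real_sq)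
    also have "(LINT x|?\<mu>. \<omega> x * (w' x - \<phi> n x)\<^sup>2) \<le> B * (H_nrm 1 ?U (\<lambda>x. w x - \<phi> n x))\<^sup>2"
      using \<omega>(5)[OF smooth_diff[OF w' \<phi>(1)[of n]]] by (simp only: H[OF \<phi>(1)])
    finally show ?thesis by simp
  qed
  have "(\<lambda>n. 2 * (B * (H_nrm 1 ?U (\<lambda>x. w x - \<phi> n x))\<^sup>2) + 2 * (L2_nrm ?\<mu> (\<lambda>x. ?g x - \<phi> n x))\<^sup>2) \<longlonglongrightarrow> 2 * (B * 0\<^sup>2) + 2 * 0\<^sup>2"
    by (intro tendsto_intros \<phi>)
  then have "(LINT x|?\<mu>. \<omega> x * (w' x - ?g x)\<^sup>2) \<le> 0"
    by (intro LIMSEQ_le_const[of _ 0]) (use le in auto)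
  moreover have "0 \<le> (LINT x|?\<mu>. \<omega> x * (w' x - ?g x)\<^sup>2)"
    using \<omega>(2) by (intro Bochner_Integration.integral_nonneg) auto
  ultimately have "(LINT x|?\<mu>. \<omega> x * (w' x - ?g x)\<^sup>2) = 0" by simp
  then have "AE x in ?\<mu>. \<omega> x * (w' x - ?g x)\<^sup>2 = 0"
    using integral_nonneg_eq_0_iff_AE[OF wint[OF dL2]] \<omega>(2) by simp
  then show "AE x in ?\<mu>. ?g x = w' x"
    using AE_edge_rel_interior
  proof eventually_elim
    case (elim x)
    then show ?case using \<omega>(4)[of x] by simp
  qed
qed

end

text \<open>Every neighbourhood of z meets the interior of T in a nonempty open set, which is not
  negligible. Two continuous functions that agree almost everywhere on T therefore agree at z, also
  if z is a vertex.\<close>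

lemma point_value_smooth:
  assumes T: "2 simplex T" and z: "z \<in> T" and v: "smooth v"
  shows "point_value T v z = v z"
  unfolding point_value_def
proof (rule the_equality)
  show "\<exists>w. continuous_on T w \<and> (AE x in lebesgue_on T. w x = v x) \<and> w z = v z"
    using smooth_continuous[OF v] by auto
next
  fix c assume "\<exists>w. continuous_on T w \<and> (AE x in lebesgue_on T. w x = v x) \<and> w z = c"
  then obtain w where w: "continuous_on T w" "AE x in lebesgue_on T. w x = v x" "w z = c" by blast
  note Tp = triangle_props[OF T]
  show "c = v z"
  proof (rule ccontr)
    assume ne: "c \<noteq> v z"
    have "continuous_on T (\<lambda>x. w x - v x)" using w(1) smooth_continuous[OF v] by (intro continuous_intros)
    then obtain \<delta> where \<delta>: "\<delta> > 0" "\<And>x. x \<in> T \<Longrightarrow> dist x z < \<delta> \<Longrightarrow> dist (w x - v x) (w z - v z) < \<bar>w z - v z\<bar>"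
      using z ne w(3) unfolding continuous_on_iff by (metis zero_less_abs_iff right_minus_eq)
    have nz: "w x \<noteq> v x" if "x \<in> T" "dist x z < \<delta>" for x
      using \<delta>(2)[OF that] by (auto simp: dist_real_def)
    let ?O = "interior T \<inter> ball z \<delta>"
    have "z \<in> closure (interior T)" using Tp(6) z by simp
    then have "?O \<noteq> {}" using \<delta>(1) by (metis centre_in_ball disjoint_iff open_Int_closure_eq_empty open_ball Int_commute)
    moreover have "open ?O" by auto
    moreover have "negligible ?O"
    proof -
      have Tl: "T \<in> sets lebesgue" using Tp(3) by auto
      have "AE x in lebesgue. x \<in> T \<longrightarrow> w x = v x" using w(2) by (simp add: AE_restrict_space_iff Tl)
      then obtain N where N: "N \<in> null_sets lebesgue" "{x. \<not> (x \<in> T \<longrightarrow> w x = v x)} \<subseteq> N"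
        by (auto simp: eventually_ae_filter)
      have "?O \<subseteq> N"
      proof
        fix x assume x: "x \<in> ?O"
        then have "x \<in> T" "dist x z < \<delta>" using interior_subset by (auto simp: dist_commute)
        then show "x \<in> N" using nz N(2) by blast
      qed
      then show ?thesis using N(1) negligible_iff_null_sets negligible_subset by blast
    qed
    ultimately show False using open_not_negligible by blast
  qed
qed


section \<open>Polynomials in two variables\<close>

text \<open>The degree is bounded in each variable separately; on a line it can double.\<close>

inductive_set tpoly :: "nat \<Rightarrow> (plane \<Rightarrow> real) set" for k where
  prod: "degree a \<le> k \<Longrightarrow> degree b \<le> k \<Longrightarrow> (\<lambda>x. poly a (x $ 1) * poly b (x $ 2)) \<in> tpoly k"
| add: "f \<in> tpoly k \<Longrightarrow> g \<in> tpoly k \<Longrightarrow> (\<lambda>x. f x + g x) \<in> tpoly k"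

lemma tpoly_zero: "(\<lambda>x. 0) \<in> tpoly k"
  using tpoly.prod[of 0 k 0] by simp

lemma tpoly_cmult: "f \<in> tpoly k \<Longrightarrow> (\<lambda>x. c * f x) \<in> tpoly k"
proof (induction rule: tpoly.induct)
  case (prod a b)
  then show ?case using tpoly.prod[of "smult c a" k b] by (simp add: mult.assoc)
next
  case (add f g)
  then show ?case using tpoly.add[of "\<lambda>x. c * f x" k "\<lambda>x. c * g x"] by (simp add: distrib_left)
qed

lemma tpoly_diff: "f \<in> tpoly k \<Longrightarrow> g \<in> tpoly k \<Longrightarrow> (\<lambda>x. f x - g x) \<in> tpoly k"
  using tpoly.add[of f k "\<lambda>x. -1 * g x"] tpoly_cmult[of g k "-1"] by simp

lemma tpoly_sum: "(\<And>i. i \<in> I \<Longrightarrow> f i \<in> tpoly k) \<Longrightarrow> (\<lambda>x. \<Sum>i\<in>I. f i x) \<in> tpoly k"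
  by (induction I rule: infinite_finite_induct) (auto intro: tpoly_zero tpoly.add)

lemma poly_funs_tpoly:
  assumes "p \<in> poly_funs k" "k \<le> l" shows "p \<in> tpoly l"
proof -
  obtain c where p: "p = (\<lambda>x. \<Sum>\<alpha>\<in>multi_upto k. c \<alpha> * (x $ 1) ^ fst \<alpha> * (x $ 2) ^ snd \<alpha>)"
    using assms(1) by (auto simp: poly_funs_def)
  have "(\<lambda>x. c \<alpha> * (x $ 1) ^ fst \<alpha> * (x $ 2) ^ snd \<alpha>) \<in> tpoly l" if "\<alpha> \<in> multi_upto k" for \<alpha>
  proof -
    have "degree (smult (c \<alpha>) (monom 1 (fst \<alpha>))) \<le> l" "degree (monom (1::real) (snd \<alpha>)) \<le> l"
      using that assms(2) by (auto intro: order_trans[OF degree_smult_le] simp: degree_monom_eq)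
    from tpoly.prod[OF this] show ?thesis by (simp add: poly_monom)
  qed
  then show ?thesis unfolding p by (intro tpoly_sum)
qed

lemma has_derivative_coordinate:
  assumes "(f has_real_derivative d) (at (x $ i))"
  shows "((\<lambda>x::plane. f (x $ i)) has_derivative (\<lambda>h. d * h $ i)) (at x)"
  using has_derivative_ridge[of f d "axis i 1" x 0] assms by (simp add: inner_axis')

lemma partial_poly_prod:
  "partial 1 (\<lambda>x. poly a (x $ 1) * poly b (x $ 2)) = (\<lambda>x. poly (pderiv a) (x $ 1) * poly b (x $ 2))"
  "partial 2 (\<lambda>x. poly a (x $ 1) * poly b (x $ 2)) = (\<lambda>x. poly a (x $ 1) * poly (pderiv b) (x $ 2))"
  "(\<lambda>x::plane. poly a (x $ 1) * poly b (x $ 2)) differentiable at y"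
proof -
  have D: "((\<lambda>x::plane. poly a (x $ 1) * poly b (x $ 2)) has_derivative
     (\<lambda>h. poly a (x $ 1) * (poly (pderiv b) (x $ 2) * h $ 2) + poly (pderiv a) (x $ 1) * h $ 1 * poly b (x $ 2))) (at x)" for x
    by (intro has_derivative_mult has_derivative_coordinate poly_DERIV)
  show "partial 1 (\<lambda>x. poly a (x $ 1) * poly b (x $ 2)) = (\<lambda>x. poly (pderiv a) (x $ 1) * poly b (x $ 2))"
    "partial 2 (\<lambda>x. poly a (x $ 1) * poly b (x $ 2)) = (\<lambda>x. poly a (x $ 1) * poly (pderiv b) (x $ 2))"
    by (rule ext, subst partial_eqI[OF D], simp add: axis_def)+
  show "(\<lambda>x::plane. poly a (x $ 1) * poly b (x $ 2)) differentiable at y" using D by (auto simp: differentiable_def)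
qed

lemma tpoly_partial_aux: "f \<in> tpoly k \<Longrightarrow> (\<forall>x. f differentiable at x) \<and> (\<forall>i. partial i f \<in> tpoly k)"
proof (induction rule: tpoly.induct)
  case (prod a b)
  have "degree (pderiv a) \<le> k" "degree (pderiv b) \<le> k" using prod by (auto simp: degree_pderiv)
  with prod have "partial i (\<lambda>x. poly a (x $ 1) * poly b (x $ 2)) \<in> tpoly k" for i :: 2
    using exhaust_2[of i] by (auto simp: partial_poly_prod intro!: tpoly.prod)
  then show ?case by (auto simp: partial_poly_prod(3))
next
  case (add f g)
  then have "partial i (\<lambda>x. f x + g x) = (\<lambda>x. partial i f x + partial i g x)" for i
    by (auto intro!: partial_add)
  then show ?case using add by (auto intro!: tpoly.add differentiable_add)
qed

lemma tpoly_partial: "f \<in> tpoly k \<Longrightarrow> partial i f \<in> tpoly k"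
  using tpoly_partial_aux by blast

lemma tpoly_smooth: "f \<in> tpoly k \<Longrightarrow> smooth f"
  by (rule smooth_coinduct[of _ "tpoly k"]) (use tpoly_partial_aux in auto)

lemma tpoly_smooth_sym: "f \<in> tpoly k \<Longrightarrow> smooth_sym f"
proof (induction rule: tpoly.induct)
  case (prod a b)
  then show ?case using tpoly_smooth[OF tpoly.prod[OF prod]] by (simp add: smooth_sym_def partial_poly_prod)
next
  case (add f g)
  have "partial i (\<lambda>x. f x + g x) = (\<lambda>x. partial i f x + partial i g x)"
    if "smooth f" "smooth g" for i f g using that by (auto intro!: partial_add smooth_differentiable)
  with add show ?case by (auto simp: smooth_sym_def smooth_add smooth_partial)
qed

lemma tpoly_line: "f \<in> tpoly k \<Longrightarrow> \<exists>p. degree p \<le> 2 * k \<and> (\<forall>s. f (m + s *\<^sub>R v) = poly p s)"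
proof (induction rule: tpoly.induct)
  case (prod a b)
  let ?p = "(a \<circ>\<^sub>p [:m $ 1, v $ 1:]) * (b \<circ>\<^sub>p [:m $ 2, v $ 2:])"
  have "degree (a \<circ>\<^sub>p [:m $ 1, v $ 1:]) \<le> degree a * 1" "degree (b \<circ>\<^sub>p [:m $ 2, v $ 2:]) \<le> degree b * 1"
    by (intro order_trans[OF degree_pcompose_le] mult_left_mono; simp)+
  then have "degree ?p \<le> 2 * k" using degree_mult_le[of "a \<circ>\<^sub>p [:m $ 1, v $ 1:]" "b \<circ>\<^sub>p [:m $ 2, v $ 2:]"] prod by linarith
  then show ?case by (intro exI[of _ ?p]) (simp add: poly_pcompose)
next
  case (add f g)
  then obtain p q where "degree p \<le> 2 * k" "\<forall>s. f (m + s *\<^sub>R v) = poly p s" "degree q \<le> 2 * k" "\<forall>s. g (m + s *\<^sub>R v) = poly q s" by blast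
  then show ?case by (intro exI[of _ "p + q"]) (auto intro: degree_add_le)
qed

lemma poly_bounded_degree: "degree p \<le> N \<Longrightarrow> poly p y = (\<Sum>i\<le>N. coeff p i * y ^ i)" for y :: real
  unfolding poly_altdef by (rule sum.mono_neutral_left) (auto simp: coeff_eq_0)

lemma poly_scaled_coeffs:
  fixes p :: "real poly"
  assumes "degree p \<le> N" "\<rho> \<noteq> 0"
  shows "poly p s = (\<Sum>i\<le>N. (coeff p i * \<rho> ^ i) * (s / \<rho>) ^ i)"
  using assms by (simp add: poly_bounded_degree power_divide)

text \<open>The shift to \<open>m\<close> does not raise the degrees, and the powers of \<rho> are
  absorbed into the coefficients. In these variables the constants become independent of the mesh
  size.\<close>

lemma tpoly_scaled_coeffs:
  fixes m :: plane
  assumes "f \<in> tpoly k" "\<rho> \<noteq> 0"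
  shows "\<exists>c. \<forall>x. f x = (\<Sum>i\<le>k. \<Sum>j\<le>k. c i j * ((x $ 1 - m $ 1) / \<rho>) ^ i * ((x $ 2 - m $ 2) / \<rho>) ^ j)"
  using assms(1)
proof (induction rule: tpoly.induct)
  case (prod a b)
  let ?a = "a \<circ>\<^sub>p [:m $ 1, 1:]" and ?b = "b \<circ>\<^sub>p [:m $ 2, 1:]"
  have d: "degree ?a \<le> k" "degree ?b \<le> k" using prod by (simp_all add: degree_pcompose)
  have ab: "poly a (x $ 1) = poly ?a (x $ 1 - m $ 1)" "poly b (x $ 2) = poly ?b (x $ 2 - m $ 2)" for x :: plane
    by (simp_all add: poly_pcompose)
  have "poly a (x $ 1) * poly b (x $ 2) = (\<Sum>i\<le>k. \<Sum>j\<le>k. (coeff ?a i * \<rho> ^ i * (coeff ?b j * \<rho> ^ j)) *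
        ((x $ 1 - m $ 1) / \<rho>) ^ i * ((x $ 2 - m $ 2) / \<rho>) ^ j)" for x :: plane
    unfolding ab poly_scaled_coeffs[OF d(1) assms(2)] poly_scaled_coeffs[OF d(2) assms(2)] sum_product
    by (intro sum.cong refl) (simp only: mult_ac)
  then show ?case by (intro exI[of _ "\<lambda>i j. coeff ?a i * \<rho> ^ i * (coeff ?b j * \<rho> ^ j)"]) blast
next
  case (add f g)
  then obtain c d where c: "\<And>x. f x = (\<Sum>i\<le>k. \<Sum>j\<le>k. c i j * ((x $ 1 - m $ 1) / \<rho>) ^ i * ((x $ 2 - m $ 2) / \<rho>) ^ j)"
    and d: "\<And>x. g x = (\<Sum>i\<le>k. \<Sum>j\<le>k. d i j * ((x $ 1 - m $ 1) / \<rho>) ^ i * ((x $ 2 - m $ 2) / \<rho>) ^ j)" by blast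
  show ?case
    by (intro exI[of _ "\<lambda>i j. c i j + d i j"]) (simp add: c d sum.distrib distrib_right)
qed

lemma quadratic_second_derivatives:
  assumes "p \<in> poly_funs 2"
  obtains h where "\<And>i j x. partial i (partial j p) x = h i j" "\<And>i j. h i j = h j i"
proof -
  obtain c where p: "p = (\<lambda>x. \<Sum>\<alpha>\<in>multi_upto 2. c \<alpha> * (x $ 1) ^ fst \<alpha> * (x $ 2) ^ snd \<alpha>)"
    using assms(1) by (auto simp: poly_funs_def)
  have p: "p = (\<lambda>x. c (0,0) + c (1,0) * x $ 1 + c (0,1) * x $ 2 + c (2,0) * (x $ 1)\<^sup>2 + c (1,1) * x $ 1 * x $ 2 + c (0,2) * (x $ 2)\<^sup>2)"
    unfolding p multi_upto_2 by (simp add: add.assoc)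
  have c1: "((\<lambda>x::plane. x $ i) has_derivative (\<lambda>h. h $ i)) (at x)" for i x
    by (rule bounded_linear.has_derivative[OF bounded_linear_vec_nth]) (rule has_derivative_ident)
  have D: "(p has_derivative (\<lambda>h. c (1,0) * h $ 1 + c (0,1) * h $ 2 + c (2,0) * (2 * x $ 1 * h $ 1)
      + c (1,1) * (h $ 1 * x $ 2 + x $ 1 * h $ 2) + c (0,2) * (2 * x $ 2 * h $ 2))) (at x)" for x
    unfolding p by (auto intro!: derivative_eq_intros c1 simp: algebra_simps)
  have p1: "partial 1 p = (\<lambda>x. c (1,0) + c (2,0) * (2 * x $ 1) + c (1,1) * x $ 2)"
    "partial 2 p = (\<lambda>x. c (0,1) + c (0,2) * (2 * x $ 2) + c (1,1) * x $ 1)"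
    by (rule ext, subst partial_eqI[OF D], simp add: axis_def)+
  have D2: "((\<lambda>x::plane. a + b * (2 * x $ i) + d * x $ j) has_derivative (\<lambda>h. b * (2 * h $ i) + d * h $ j)) (at x)" for a b d i j x
    by (auto intro!: derivative_eq_intros c1)
  have p2: "partial 1 (partial 1 p) x = 2 * c (2,0)" "partial 2 (partial 1 p) x = c (1,1)"
    "partial 1 (partial 2 p) x = c (1,1)" "partial 2 (partial 2 p) x = 2 * c (0,2)" for x
    unfolding p1 by (simp_all add: partial_eqI[OF D2] axis_def)
  define h :: "2 \<Rightarrow> 2 \<Rightarrow> real" where "h i j = (if i = 1 \<and> j = 1 then 2 * c (2,0) else if i = 2 \<and> j = 2 then 2 * c (0,2) else c (1,1))" for i j
  show ?thesis
  proof (rule that[of h])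
    show "partial i (partial j p) x = h i j" for i j x
      using exhaust_2[of i] exhaust_2[of j] by (auto simp: p2 h_def)
    show "h i j = h j i" for i j by (auto simp: h_def)
  qed
qed


section \<open>Coercivity of weighted integrals of polynomials\<close>

lemma bump_pow_integrable: "integrable lborel (bump_pow n)"
proof -
  obtain B where B: "\<forall>y. \<bar>bump_pow n y\<bar> \<le> B"
    using bump_pow_derivs_bounded[of n] by (metis funpow_0 le_refl zero_le)
  show ?thesis
  proof (rule Bochner_Integration.integrable_bound)
    show "integrable lborel (\<lambda>y::real. B * indicator {-1..1} y :: real)" 
      by (intro integrable_mult_right integrable_real_indicator) auto
    show "bump_pow n \<in> borel_measurable lborel"
      by (simp add: borel_measurable_continuous_onI smooth1_continuous smooth1_bump_pow)
    show "AE y in lborel. norm (bump_pow n y) \<le> norm (B * indicator {-1..1} y :: real)"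
    proof (rule AE_I2)
      fix y :: real
      show "norm (bump_pow n y) \<le> norm (B * indicator {-1..1} y :: real)"
      proof (cases "\<bar>y\<bar> < 1")
        case True
        then show ?thesis using B[rule_format, of y] by (simp add: indicator_def abs_less_iff)
      next
        case False
        then show ?thesis using bump_pow_derivs_zero[of y 0 n] by simp
      qed
    qed
  qed
qed

lemma weighted_square_expand:
  "(\<Sum>i\<le>N. c i * y ^ i)\<^sup>2 * bump y = (\<Sum>i\<le>N. \<Sum>j\<le>N. c i * c j * bump_pow (i + j) y)"
  by (simp add: power2_eq_square sum_product sum_distrib_right sum_distrib_left bump_pow_def power_add mult_ac)

lemma weighted_square_integrable: "integrable lborel (\<lambda>y. (\<Sum>i\<le>N. c i * y ^ i)\<^sup>2 * bump y)"
  unfolding weighted_square_expand by (intro Bochner_Integration.integrable_sum integrable_mult_right bump_pow_integrable)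

lemma weighted_square_integral:
  "(LINT y|lborel. (\<Sum>i\<le>N. c i * y ^ i)\<^sup>2 * bump y) = (\<Sum>i\<le>N. \<Sum>j\<le>N. c i * c j * (LINT y|lborel. bump_pow (i + j) y))"
  unfolding weighted_square_expand by (simp add: bump_pow_integrable)

text \<open>The weight is positive on (-1, 1), so the polynomial vanishes almost everywhere there; a
  nonzero polynomial has finitely many roots, which form a null set.\<close>

lemma weighted_square_pos:
  assumes "(LINT y|lborel. (\<Sum>i\<le>N. c i * y ^ i)\<^sup>2 * bump y) = 0" "i \<le> N"
  shows "c i = 0"
proof -
  define p where "p = (\<Sum>i\<le>N. monom (c i) i)"
  have p: "poly p y = (\<Sum>i\<le>N. c i * y ^ i)" for y by (simp add: p_def poly_sum poly_monom)
  have "AE y in lborel. (\<Sum>i\<le>N. c i * y ^ i)\<^sup>2 * bump y = 0"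
    using assms(1) integral_nonneg_eq_0_iff_AE[OF weighted_square_integrable[where N = N and c = c]] bump_nonneg by simp
  then have "AE y in lborel. \<bar>y\<bar> < 1 \<longrightarrow> poly p y = 0"
    by eventually_elim (use bump_pos in \<open>force simp: p\<close>)
  then have ae: "AE y in lborel. y \<notin> {-1<..<1} - {y. poly p y = 0}"
    by eventually_elim (auto simp: abs_less_iff)
  have "p = 0"
  proof (rule ccontr)
    assume "p \<noteq> 0"
    then have fin: "finite {y. poly p y = 0}" by (rule poly_roots_finite)
    then have "AE y in lborel. y \<notin> {y. poly p y = 0}"
      by (intro AE_not_in) (simp add: finite_imp_null_set_lborel)
    with ae have "AE y in lborel. y \<notin> {-1<..<1::real}" by eventually_elim auto
    then have "{-1<..<1::real} \<in> null_sets lborel" by (subst (asm) AE_iff_null_sets[symmetric]) auto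
    then show False by (auto simp: null_sets_def)
  qed
  then have "coeff p i = 0" by simp
  moreover have "coeff p i = c i"
    using assms(2) by (simp add: p_def coeff_sum sum.delta)
  ultimately show ?thesis by simp
qed

text \<open>The weighted integral is a quadratic form that is positive definite in the first N + 1
  coefficients. Its minimum over the unit sphere of the sum norm is the constant, and homogeneity
  does the rest.\<close>

lemma weighted_square_coercive:
  "\<exists>\<delta>>0. \<forall>c. \<delta> * (\<Sum>i\<le>N. \<bar>c i\<bar>)\<^sup>2 \<le> (LINT y|lborel. (\<Sum>i\<le>N. c i * y ^ i)\<^sup>2 * bump y)"
proof -
  define Q where "Q c = (LINT y|lborel. (\<Sum>i\<le>N. c i * y ^ i)\<^sup>2 * bump y)" for c :: "nat \<Rightarrow> real"
  have Q: "Q c = (\<Sum>i\<le>N. \<Sum>j\<le>N. c i * c j * (LINT y|lborel. bump_pow (i + j) y))" for c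
    by (simp add: Q_def weighted_square_integral)
  \<comment> \<open>Compact by Tychonoff's theorem; the entries beyond \<open>N\<close> play no role.\<close>
  define S where "S = PiE (UNIV :: nat set) (\<lambda>i. {-1..1::real}) \<inter> {c. (\<Sum>i\<le>N. \<bar>c i\<bar>) = 1}"
  have "compactin (product_topology (\<lambda>i. euclidean) UNIV) (PiE (UNIV :: nat set) (\<lambda>i. {-1..1::real}))"
    by (subst compactin_PiE) auto
  then have "compact (PiE (UNIV :: nat set) (\<lambda>i. {-1..1::real}))" by (simp add: euclidean_product_topology)
  moreover have "closed {c :: nat \<Rightarrow> real. (\<Sum>i\<le>N. \<bar>c i\<bar>) = 1}"
    by (intro closed_Collect_eq continuous_intros continuous_on_product_coordinates)
  ultimately have cS: "compact S" unfolding S_def by (rule compact_Int_closed)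
  have "(\<lambda>i. if i = 0 then 1 else 0) \<in> S" by (auto simp: S_def sum.delta if_distrib cong: if_cong)
  then have ne: "S \<noteq> {}" by blast
  have "continuous_on S Q" unfolding Q
    by (intro continuous_intros continuous_on_subset[OF continuous_on_product_coordinates]) auto
  then obtain c0 where c0: "c0 \<in> S" "\<And>c. c \<in> S \<Longrightarrow> Q c0 \<le> Q c"
    using continuous_attains_inf[OF cS ne] by blast
  have "0 \<le> Q c0" using bump_nonneg by (simp add: Q_def)
  moreover have "Q c0 \<noteq> 0"
  proof
    assume "Q c0 = 0"
    then have "c0 i = 0" if "i \<le> N" for i using weighted_square_pos that by (simp add: Q_def)
    then have "(\<Sum>i\<le>N. \<bar>c0 i\<bar>) = 0" by simp
    with c0(1) show False by (simp add: S_def)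
  qed
  ultimately have pos: "Q c0 > 0" by simp
  have "Q c0 * (\<Sum>i\<le>N. \<bar>c i\<bar>)\<^sup>2 \<le> Q c" for c
  proof (cases "(\<Sum>i\<le>N. \<bar>c i\<bar>) = 0")
    case True
    then show ?thesis using bump_nonneg by (simp add: Q_def)
  next
    case False
    define a where "a = (\<Sum>i\<le>N. \<bar>c i\<bar>)"
    have a: "a > 0" using False by (simp add: a_def sum_nonneg less_le)
    \<comment> \<open>Entries beyond \<open>N\<close> are cut off so that the rescaled sequence lies
      in the compact product of intervals.\<close>
    define c' where "c' i = (if i \<le> N then c i / a else 0)" for i
    have "(\<Sum>i\<le>N. \<bar>c' i\<bar>) = (\<Sum>i\<le>N. \<bar>c i\<bar>) / a"
      using a by (simp add: c'_def sum_divide_distrib)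
    then have s1: "(\<Sum>i\<le>N. \<bar>c' i\<bar>) = 1" using a by (simp add: a_def[symmetric])
    have "\<bar>c' i\<bar> \<le> 1" for i
    proof (cases "i \<le> N")
      case True
      then have "\<bar>c' i\<bar> \<le> (\<Sum>i\<le>N. \<bar>c' i\<bar>)" by (intro member_le_sum) auto
      then show ?thesis using s1 by simp
    qed (simp add: c'_def)
    then have "c' \<in> S" using s1 by (auto simp: S_def abs_le_iff minus_le_iff)
    then have "Q c0 \<le> Q c'" by (rule c0(2))
    also have "Q c' = Q c / a\<^sup>2"
      unfolding Q sum_divide_distrib by (intro sum.cong refl) (simp add: c'_def power2_eq_square)
    finally show ?thesis using a by (simp add: a_def[symmetric] field_simps)
  qed
  with pos show ?thesis unfolding Q_def by blast
qed


section \<open>Scaled tensor product test functions\<close>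

context frame
begin

text \<open>The indices \<open>a\<close> and \<open>b\<close> count derivatives of the tangential
  and of the normal factor. A partial derivative is a combination of two members of this family
  divided by \<rho>, and the members with indices up to \<open>N\<close> obey a common
  bound.\<close>

definition test_fun :: "plane \<Rightarrow> real \<Rightarrow> nat \<Rightarrow> (nat \<Rightarrow> nat \<Rightarrow> real) \<Rightarrow> nat \<Rightarrow> nat \<Rightarrow> plane \<Rightarrow> real" where
  "test_fun m \<rho> N c a b x = (\<Sum>i\<le>N. \<Sum>j\<le>N. c i j * ((deriv ^^ a) (bump_pow i) ((x - m) \<bullet> \<tau> / \<rho>) * (deriv ^^ b) (bump_pow j) ((x - m) \<bullet> \<nu> / \<rho>)))"

lemma smooth_bump_pow_ridge: "smooth (\<lambda>x. (deriv ^^ a) (bump_pow i) ((x - m) \<bullet> v / \<rho>))"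
proof -
  have "smooth (\<lambda>x. (deriv ^^ a) (bump_pow i) (((1 / \<rho>) *\<^sub>R v) \<bullet> x + (- (m \<bullet> v) / \<rho>)))"
    by (intro smooth_ridge smooth1_derivs smooth1_bump_pow)
  moreover have "((1 / \<rho>) *\<^sub>R v) \<bullet> x + (- (m \<bullet> v) / \<rho>) = (x - m) \<bullet> v / \<rho>" for x
    by (simp add: inner_diff_left inner_diff_right inner_commute diff_divide_distrib)
  ultimately show ?thesis by simp
qed

lemma partial_bump_pow_ridge:
  "partial l (\<lambda>x. (deriv ^^ a) (bump_pow i) ((x - m) \<bullet> v / \<rho>)) x = (v $ l / \<rho>) * (deriv ^^ (Suc a)) (bump_pow i) ((x - m) \<bullet> v / \<rho>)"
proof -
  have eq: "((1 / \<rho>) *\<^sub>R v) \<bullet> x + (- (m \<bullet> v) / \<rho>) = (x - m) \<bullet> v / \<rho>" for x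
    by (simp add: inner_diff_left inner_diff_right inner_commute diff_divide_distrib)
  have "((\<lambda>x. (deriv ^^ a) (bump_pow i) (((1 / \<rho>) *\<^sub>R v) \<bullet> x + (- (m \<bullet> v) / \<rho>))) has_derivative
     (\<lambda>h. deriv ((deriv ^^ a) (bump_pow i)) (((1 / \<rho>) *\<^sub>R v) \<bullet> x + (- (m \<bullet> v) / \<rho>)) * (((1 / \<rho>) *\<^sub>R v) \<bullet> h))) (at x)"
    by (intro has_derivative_ridge smooth1_DERIV smooth1_derivs smooth1_bump_pow)
  from partial_eqI[OF this] show ?thesis unfolding eq by (simp add: inner_axis)
qed

lemma smooth_test_fun: "smooth (test_fun m \<rho> N c a b)"
  unfolding test_fun_def[abs_def] by (intro smooth_sum smooth_cmult smooth_mult smooth_bump_pow_ridge)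

lemma partial_sum:
  "(\<And>i. i \<in> I \<Longrightarrow> smooth (f i)) \<Longrightarrow> partial l (\<lambda>x. \<Sum>i\<in>I. f i x) x = (\<Sum>i\<in>I. partial l (f i) x)"
proof (induction I rule: infinite_finite_induct)
  case (insert j I)
  then show ?case by (simp add: partial_add smooth_differentiable smooth_sum)
qed (auto intro: partial_zero_open[of UNIV])

lemma partial_test_fun:
  "partial l (test_fun m \<rho> N c a b) = (\<lambda>x. (\<tau> $ l * test_fun m \<rho> N c (Suc a) b x + \<nu> $ l * test_fun m \<rho> N c a (Suc b) x) / \<rho>)"
proof
  fix x
  let ?g = "\<lambda>a i v x. (deriv ^^ a) (bump_pow i) ((x - m) \<bullet> v / \<rho>)"
  have sm: "smooth (\<lambda>x. c i j * (?g a i \<tau> x * ?g b j \<nu> x))" for i j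
    by (intro smooth_cmult smooth_mult smooth_bump_pow_ridge)
  have "partial l (test_fun m \<rho> N c a b) x = (\<Sum>i\<le>N. \<Sum>j\<le>N. partial l (\<lambda>x. c i j * (?g a i \<tau> x * ?g b j \<nu> x)) x)"
    unfolding test_fun_def[abs_def] by (simp add: partial_sum sm smooth_sum)
  also have "\<dots> = (\<Sum>i\<le>N. \<Sum>j\<le>N. (\<tau> $ l * (c i j * (?g (Suc a) i \<tau> x * ?g b j \<nu> x)) + \<nu> $ l * (c i j * (?g a i \<tau> x * ?g (Suc b) j \<nu> x))) / \<rho>)"
  proof (intro sum.cong refl)
    fix i j
    have "partial l (\<lambda>x. c i j * (?g a i \<tau> x * ?g b j \<nu> x)) x =
        c i j * ((\<tau> $ l / \<rho>) * ?g (Suc a) i \<tau> x * ?g b j \<nu> x + ?g a i \<tau> x * ((\<nu> $ l / \<rho>) * ?g (Suc b) j \<nu> x))"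
      by (simp only: partial_cmult partial_mult smooth_differentiable smooth_mult smooth_bump_pow_ridge partial_bump_pow_ridge)
    then show "partial l (\<lambda>x. c i j * (?g a i \<tau> x * ?g b j \<nu> x)) x =
       (\<tau> $ l * (c i j * (?g (Suc a) i \<tau> x * ?g b j \<nu> x)) + \<nu> $ l * (c i j * (?g a i \<tau> x * ?g (Suc b) j \<nu> x))) / \<rho>"
      by (simp add: add_divide_distrib algebra_simps)
  qed
  also have "\<dots> = (\<tau> $ l * test_fun m \<rho> N c (Suc a) b x + \<nu> $ l * test_fun m \<rho> N c a (Suc b) x) / \<rho>"
    unfolding test_fun_def by (simp only: sum.distrib sum_distrib_left sum_divide_distrib add_divide_distrib)
  finally show "partial l (test_fun m \<rho> N c a b) x = (\<tau> $ l * test_fun m \<rho> N c (Suc a) b x + \<nu> $ l * test_fun m \<rho> N c a (Suc b) x) / \<rho>" .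
qed

lemma partial_partial_test_fun:
  "partial k (partial l (test_fun m \<rho> N c a b)) = (\<lambda>x. (\<tau> $ k * \<tau> $ l * test_fun m \<rho> N c (Suc (Suc a)) b x
      + (\<tau> $ k * \<nu> $ l + \<nu> $ k * \<tau> $ l) * test_fun m \<rho> N c (Suc a) (Suc b) x
      + \<nu> $ k * \<nu> $ l * test_fun m \<rho> N c a (Suc (Suc b)) x) / \<rho>\<^sup>2)"
proof
  fix x
  have "partial l (test_fun m \<rho> N c a b) = (\<lambda>x. (\<tau> $ l / \<rho>) * test_fun m \<rho> N c (Suc a) b x + (\<nu> $ l / \<rho>) * test_fun m \<rho> N c a (Suc b) x)"
    by (simp add: partial_test_fun add_divide_distrib)
  then have "partial k (partial l (test_fun m \<rho> N c a b)) x =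
      (\<tau> $ l / \<rho>) * partial k (test_fun m \<rho> N c (Suc a) b) x + (\<nu> $ l / \<rho>) * partial k (test_fun m \<rho> N c a (Suc b)) x"
    by (simp only: partial_add partial_cmult smooth_differentiable smooth_cmult smooth_test_fun)
  then show "partial k (partial l (test_fun m \<rho> N c a b)) x = (\<tau> $ k * \<tau> $ l * test_fun m \<rho> N c (Suc (Suc a)) b x
      + (\<tau> $ k * \<nu> $ l + \<nu> $ k * \<tau> $ l) * test_fun m \<rho> N c (Suc a) (Suc b) x
      + \<nu> $ k * \<nu> $ l * test_fun m \<rho> N c a (Suc (Suc b)) x) / \<rho>\<^sup>2"
    unfolding partial_test_fun by (simp add: power2_eq_square add_divide_distrib algebra_simps)
qed

lemma smooth_sym_test_fun: "smooth_sym (test_fun m \<rho> N c a b)"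
  unfolding smooth_sym_def partial_partial_test_fun using smooth_test_fun by (simp add: algebra_simps)

lemma test_fun_zero:
  assumes "\<rho> > 0" "\<bar>(x - m) \<bullet> \<tau>\<bar> \<ge> \<rho> \<or> \<bar>(x - m) \<bullet> \<nu>\<bar> \<ge> \<rho>"
  shows "test_fun m \<rho> N c a b x = 0"
proof -
  have "\<bar>(x - m) \<bullet> \<tau> / \<rho>\<bar> \<ge> 1 \<or> \<bar>(x - m) \<bullet> \<nu> / \<rho>\<bar> \<ge> 1" using assms by (auto simp: abs_divide)
  then have "(deriv ^^ a) (bump_pow i) ((x - m) \<bullet> \<tau> / \<rho>) * (deriv ^^ b) (bump_pow j) ((x - m) \<bullet> \<nu> / \<rho>) = 0" for i j
    using bump_pow_derivs_zero by (auto simp del: mult_eq_0_iff)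
  then show ?thesis unfolding test_fun_def by (simp only: mult_zero_right sum.neutral_const)
qed

lemma test_fun_bound:
  assumes B: "\<forall>i\<le>N. \<forall>n\<le>N. \<forall>y. \<bar>(deriv ^^ n) (bump_pow i) y\<bar> \<le> B" and ab: "a \<le> N" "b \<le> N"
  shows "\<bar>test_fun m \<rho> N c a b x\<bar> \<le> B\<^sup>2 * (\<Sum>i\<le>N. \<Sum>j\<le>N. \<bar>c i j\<bar>)"
proof -
  have "\<bar>test_fun m \<rho> N c a b x\<bar> \<le> (\<Sum>i\<le>N. \<Sum>j\<le>N. \<bar>c i j * ((deriv ^^ a) (bump_pow i) ((x - m) \<bullet> \<tau> / \<rho>) * (deriv ^^ b) (bump_pow j) ((x - m) \<bullet> \<nu> / \<rho>))\<bar>)"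
    unfolding test_fun_def by (rule order_trans[OF sum_abs], intro sum_mono, rule sum_abs)
  also have "\<dots> \<le> (\<Sum>i\<le>N. \<Sum>j\<le>N. B\<^sup>2 * \<bar>c i j\<bar>)"
  proof (intro sum_mono)
    fix i j assume ij: "i \<in> {..N}" "j \<in> {..N}"
    have "\<bar>(deriv ^^ a) (bump_pow i) ((x - m) \<bullet> \<tau> / \<rho>) * (deriv ^^ b) (bump_pow j) ((x - m) \<bullet> \<nu> / \<rho>)\<bar> \<le> B * B"
      unfolding abs_mult using B ij ab by (intro mult_mono) (auto intro: order_trans[OF abs_ge_zero])
    from mult_left_mono[OF this abs_ge_zero[of "c i j"]]
    show "\<bar>c i j * ((deriv ^^ a) (bump_pow i) ((x - m) \<bullet> \<tau> / \<rho>) * (deriv ^^ b) (bump_pow j) ((x - m) \<bullet> \<nu> / \<rho>))\<bar> \<le> B\<^sup>2 * \<bar>c i j\<bar>"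
      by (simp add: abs_mult power2_eq_square mult_ac)
  qed
  also have "\<dots> = B\<^sup>2 * (\<Sum>i\<le>N. \<Sum>j\<le>N. \<bar>c i j\<bar>)" by (simp add: sum_distrib_left)
  finally show ?thesis .
qed

lemma component_le: "\<bar>\<tau> $ l\<bar> \<le> 1" "\<bar>\<nu> $ l\<bar> \<le> 1"
  using component_le_norm_cart[of \<tau> l] component_le_norm_cart[of \<nu> l] norm_tau norm_nu by auto

text \<open>A second derivative consists of four members of the family with coefficients of modulus
  at most 1, whence the factor 4, which also covers the lower orders. The bound \<open>B\<close>
  reaches second derivatives of the factors because of \<open>2 \<le> N\<close>.\<close>

lemma test_fun_derivative_bound:
  assumes B: "\<forall>i\<le>N. \<forall>n\<le>N. \<forall>y. \<bar>(deriv ^^ n) (bump_pow i) y\<bar> \<le> B" and N: "2 \<le> N" and \<rho>: "\<rho> > 0"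
    and \<alpha>: "\<alpha> \<in> multi_upto 2"
  shows "\<bar>multi_partial \<alpha> (test_fun m \<rho> N c 0 0) x\<bar> \<le> 4 * B\<^sup>2 * (\<Sum>i\<le>N. \<Sum>j\<le>N. \<bar>c i j\<bar>) / \<rho> ^ (fst \<alpha> + snd \<alpha>)"
proof -
  let ?M = "B\<^sup>2 * (\<Sum>i\<le>N. \<Sum>j\<le>N. \<bar>c i j\<bar>)"
  have M: "\<bar>test_fun m \<rho> N c a b x\<bar> \<le> ?M" if "a \<le> 2" "b \<le> 2" for a b
    using that N by (intro test_fun_bound[OF B]) auto
  have M0: "0 \<le> ?M" by (simp add: sum_nonneg)
  have tm: "\<bar>u * t\<bar> \<le> ?M" if "\<bar>u\<bar> \<le> 1" "\<bar>t\<bar> \<le> ?M" for u t :: real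
    using mult_mono[OF that] M0 by (simp add: abs_mult)
  have uv: "\<bar>u * v\<bar> \<le> 1" if "\<bar>u\<bar> \<le> 1" "\<bar>v\<bar> \<le> 1" for u v :: real
    using mult_mono[OF that] by (simp add: abs_mult)
  have d1: "\<bar>partial l (test_fun m \<rho> N c 0 0) x\<bar> \<le> 4 * ?M / \<rho>" for l
  proof -
    have "\<bar>\<tau> $ l * test_fun m \<rho> N c (Suc 0) 0 x + \<nu> $ l * test_fun m \<rho> N c 0 (Suc 0) x\<bar> \<le> 4 * ?M"
      using tm[OF component_le(1)[of l] M[of "Suc 0" 0]] tm[OF component_le(2)[of l] M[of 0 "Suc 0"]] M0 by simp
    then show ?thesis using \<rho> by (simp add: partial_test_fun divide_right_mono)
  qed
  have d2: "\<bar>partial l (partial k (test_fun m \<rho> N c 0 0)) x\<bar> \<le> 4 * ?M / \<rho>\<^sup>2" for k l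
  proof -
    let ?a = "\<tau> $ l * \<tau> $ k * test_fun m \<rho> N c (Suc (Suc 0)) 0 x" and ?b = "\<tau> $ l * \<nu> $ k * test_fun m \<rho> N c (Suc 0) (Suc 0) x"
      and ?c = "\<nu> $ l * \<tau> $ k * test_fun m \<rho> N c (Suc 0) (Suc 0) x" and ?d = "\<nu> $ l * \<nu> $ k * test_fun m \<rho> N c 0 (Suc (Suc 0)) x"
    have "\<bar>?a\<bar> \<le> ?M" "\<bar>?b\<bar> \<le> ?M" "\<bar>?c\<bar> \<le> ?M" "\<bar>?d\<bar> \<le> ?M"
      by (intro tm uv component_le M; simp)+
    then have "\<bar>?a + ?b + ?c + ?d\<bar> \<le> 4 * ?M" by linarith
    moreover have "?a + ?b + ?c + ?d = \<tau> $ l * \<tau> $ k * test_fun m \<rho> N c (Suc (Suc 0)) 0 x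
      + (\<tau> $ l * \<nu> $ k + \<nu> $ l * \<tau> $ k) * test_fun m \<rho> N c (Suc 0) (Suc 0) x
      + \<nu> $ l * \<nu> $ k * test_fun m \<rho> N c 0 (Suc (Suc 0)) x" by (simp add: distrib_right)
    ultimately show ?thesis using \<rho> unfolding partial_partial_test_fun by (simp add: divide_right_mono)
  qed
  have d0: "\<bar>test_fun m \<rho> N c 0 0 x\<bar> \<le> 4 * ?M" using M[of 0 0] M0 by simp
  show ?thesis
    using \<alpha> d0 d1 d2 unfolding multi_upto_2 by (auto simp: multi_partial_simps mult.assoc simp flip: One_nat_def)
qed

lemma test_fun_test_funs:
  assumes \<rho>: "\<rho> > 0" and U: "\<And>x. \<bar>(x - m) \<bullet> \<tau>\<bar> \<le> \<rho> \<Longrightarrow> \<bar>(x - m) \<bullet> \<nu>\<bar> \<le> \<rho> \<Longrightarrow> x \<in> U"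
  shows "test_fun m \<rho> N c 0 0 \<in> test_funs U"
proof (rule test_funsI[OF smooth_test_fun])
  let ?K = "chart m \<tau> \<nu> ` ({-\<rho>..\<rho>} \<times> {-\<rho>..\<rho>})"
  show "compact ?K" by (intro compact_continuous_image chart_continuous compact_Times) auto
  show "?K \<subseteq> U" using U by (auto simp: chart_inner abs_le_iff)
  show "test_fun m \<rho> N c 0 0 x = 0" if "x \<notin> ?K" for x
  proof (rule test_fun_zero[OF \<rho>], rule ccontr)
    assume "\<not> (\<rho> \<le> \<bar>(x - m) \<bullet> \<tau>\<bar> \<or> \<rho> \<le> \<bar>(x - m) \<bullet> \<nu>\<bar>)"
    then have "chart m \<tau> \<nu> ((x - m) \<bullet> \<tau>, (x - m) \<bullet> \<nu>) \<in> ?K" by (intro imageI) auto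
    then show False using that by (simp add: chart_collapse)
  qed
qed

lemma multi_partial_test_fun_zero:
  assumes \<rho>: "\<rho> > 0" and \<alpha>: "\<alpha> \<in> multi_upto 2" and x: "\<bar>(x - m) \<bullet> \<tau>\<bar> \<ge> \<rho> \<or> \<bar>(x - m) \<bullet> \<nu>\<bar> \<ge> \<rho>"
  shows "multi_partial \<alpha> (test_fun m \<rho> N c 0 0) x = 0"
proof -
  have z: "test_fun m \<rho> N c a b x = 0" for a b by (rule test_fun_zero[OF \<rho> x])
  have "partial l (test_fun m \<rho> N c 0 0) x = 0" "partial k (partial l (test_fun m \<rho> N c 0 0)) x = 0" for k l
    unfolding partial_partial_test_fun by (simp_all add: partial_test_fun z)
  then show ?thesis
    using \<alpha> z unfolding multi_upto_2 by (auto simp: multi_partial_simps simp flip: One_nat_def)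
qed

end


section \<open>Coercivity in two variables\<close>

text \<open>Coercivity in t is applied with coefficients q_j(s), then coercivity in s to each q_j.
  Passing from the squared sum of |q_j| to the sum of the squares costs nothing, and Cauchy-Schwarz
  for the sum over j costs the factor N + 1.\<close>

lemma weighted_square_coercive_2:
  "\<exists>\<delta>>0. \<forall>c. \<delta> * (\<Sum>i\<le>N. \<Sum>j\<le>N. \<bar>c i j\<bar>)\<^sup>2
      \<le> (LINT s|lborel. LINT t|lborel. (\<Sum>i\<le>N. \<Sum>j\<le>N. c i j * s ^ i * t ^ j)\<^sup>2 * (bump s * bump t))"
proof -
  obtain \<delta> where \<delta>: "\<delta> > 0" "\<And>c. \<delta> * (\<Sum>i\<le>N. \<bar>c i\<bar>)\<^sup>2 \<le> (LINT y|lborel. (\<Sum>i\<le>N. c i * y ^ i)\<^sup>2 * bump y)"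
    using weighted_square_coercive by blast
  have main: "(\<delta> * \<delta> / (N + 1)) * (\<Sum>i\<le>N. \<Sum>j\<le>N. \<bar>c i j\<bar>)\<^sup>2
      \<le> (LINT s|lborel. LINT t|lborel. (\<Sum>i\<le>N. \<Sum>j\<le>N. c i j * s ^ i * t ^ j)\<^sup>2 * (bump s * bump t))" for c
  proof -
    define q where "q j s = (\<Sum>i\<le>N. c i j * s ^ i)" for j and s :: real
    define I where "I s = (LINT t|lborel. (\<Sum>j\<le>N. q j s * t ^ j)\<^sup>2 * bump t)" for s
    have swap: "(\<Sum>i\<le>N. \<Sum>j\<le>N. c i j * s ^ i * t ^ j) = (\<Sum>j\<le>N. q j s * t ^ j)" for s t
      unfolding q_def sum_distrib_right by (rule sum.swap)
    have inner: "(LINT t|lborel. (\<Sum>i\<le>N. \<Sum>j\<le>N. c i j * s ^ i * t ^ j)\<^sup>2 * (bump s * bump t)) = I s * bump s" for s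
    proof -
      have "(\<Sum>i\<le>N. \<Sum>j\<le>N. c i j * s ^ i * t ^ j)\<^sup>2 * (bump s * bump t) = bump s * ((\<Sum>j\<le>N. q j s * t ^ j)\<^sup>2 * bump t)" for t
        by (simp add: swap)
      then have "(LINT t|lborel. (\<Sum>i\<le>N. \<Sum>j\<le>N. c i j * s ^ i * t ^ j)\<^sup>2 * (bump s * bump t))
          = (LINT t|lborel. bump s * ((\<Sum>j\<le>N. q j s * t ^ j)\<^sup>2 * bump t))" by (simp only:)
      then show ?thesis by (simp add: I_def)
    qed
    have Iint: "integrable lborel (\<lambda>s. I s * bump s)"
    proof -
      have "I s * bump s = (\<Sum>j\<le>N. \<Sum>l\<le>N. (LINT t|lborel. bump_pow (j + l) t) * (\<Sum>i\<le>N. \<Sum>i'\<le>N. c i j * c i' l * bump_pow (i + i') s))" for s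
      proof -
        have "q j s * q l s * bump s = (\<Sum>i\<le>N. \<Sum>i'\<le>N. c i j * c i' l * bump_pow (i + i') s)" for j l
          unfolding q_def sum_product bump_pow_def power_add unfolding sum_distrib_right
          by (intro sum.cong refl) (simp only: mult_ac)
        then show ?thesis
          unfolding I_def weighted_square_integral sum_distrib_right
          by (intro sum.cong refl) (simp add: mult_ac flip: sum_distrib_right)
      qed
      then show ?thesis
        by (simp only:) (intro Bochner_Integration.integrable_sum integrable_mult_right bump_pow_integrable)
    qed
    have lower: "\<delta> * (\<Sum>j\<le>N. (q j s)\<^sup>2 * bump s) \<le> I s * bump s" for s
    proof -
      have "(\<Sum>j\<le>N. (q j s)\<^sup>2) \<le> (\<Sum>j\<le>N. \<bar>q j s\<bar>)\<^sup>2"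
      proof -
        have "(\<Sum>j\<le>N. (q j s)\<^sup>2) \<le> (\<Sum>j\<le>N. \<bar>q j s\<bar> * (\<Sum>j\<le>N. \<bar>q j s\<bar>))"
        proof (rule sum_mono)
          fix j assume "j \<in> {..N}"
          then have "\<bar>q j s\<bar> \<le> (\<Sum>j\<le>N. \<bar>q j s\<bar>)" by (intro member_le_sum) auto
          then have "\<bar>q j s\<bar> * \<bar>q j s\<bar> \<le> \<bar>q j s\<bar> * (\<Sum>j\<le>N. \<bar>q j s\<bar>)" by (intro mult_left_mono) auto
          then show "(q j s)\<^sup>2 \<le> \<bar>q j s\<bar> * (\<Sum>j\<le>N. \<bar>q j s\<bar>)" by (simp add: power2_eq_square)
        qed
        then show ?thesis by (simp add: power2_eq_square sum_distrib_right)
      qed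
      then have "\<delta> * (\<Sum>j\<le>N. (q j s)\<^sup>2) \<le> I s"
        using \<delta>(2)[of "\<lambda>j. q j s"] \<delta>(1) by (auto simp: I_def intro: order_trans[OF mult_left_mono])
      then have "\<delta> * (\<Sum>j\<le>N. (q j s)\<^sup>2) * bump s \<le> I s * bump s" using bump_nonneg by (rule mult_right_mono)
      then show ?thesis by (simp add: sum_distrib_right mult.assoc)
    qed
    have qint: "integrable lborel (\<lambda>s. (q j s)\<^sup>2 * bump s)" for j
      unfolding q_def by (rule weighted_square_integrable)
    have "(\<delta> * \<delta> / (N + 1)) * (\<Sum>i\<le>N. \<Sum>j\<le>N. \<bar>c i j\<bar>)\<^sup>2 = (\<delta> * \<delta> / (N + 1)) * (\<Sum>j\<le>N. 1 * (\<Sum>i\<le>N. \<bar>c i j\<bar>))\<^sup>2"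
      by (subst sum.swap) simp
    also have "\<dots> \<le> (\<delta> * \<delta> / (N + 1)) * ((\<Sum>j\<le>N. 1\<^sup>2) * (\<Sum>j\<le>N. (\<Sum>i\<le>N. \<bar>c i j\<bar>)\<^sup>2))"
      using \<delta>(1) by (intro mult_left_mono Cauchy_Schwarz_ineq_sum) auto
    also have "\<dots> = \<delta> * (\<Sum>j\<le>N. \<delta> * (\<Sum>i\<le>N. \<bar>c i j\<bar>)\<^sup>2)"
    proof -
      have "(\<Sum>j\<le>N. 1\<^sup>2) = real N + 1" by simp
      moreover have "\<delta> * \<delta> / (real N + 1) * ((real N + 1) * X) = \<delta> * (\<delta> * X)" for X by (simp add: field_simps)
      ultimately show ?thesis by (simp only: sum_distrib_left[symmetric] of_nat_add of_nat_1)
    qed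
    also have "\<dots> \<le> \<delta> * (\<Sum>j\<le>N. (LINT s|lborel. (q j s)\<^sup>2 * bump s))"
      unfolding q_def using \<delta> by (intro mult_left_mono sum_mono) auto
    also have "\<dots> = (LINT s|lborel. \<delta> * (\<Sum>j\<le>N. (q j s)\<^sup>2 * bump s))"
      using qint by simp
    also have "\<dots> \<le> (LINT s|lborel. I s * bump s)"
      using qint Iint lower by (intro integral_mono) auto
    finally show ?thesis by (simp only: inner)
  qed
  show ?thesis
    by (rule exI[of _ "\<delta> * \<delta> / (N + 1)"]) (use \<delta>(1) main in auto)
qed

lemma integral_scale: "\<rho> > 0 \<Longrightarrow> (LINT s|lborel. f (s / \<rho>)) = \<rho> * (LINT s|lborel. f s)" for f :: "real \<Rightarrow> real"
  using lborel_integral_real_affine[of \<rho> "\<lambda>s. f (s / \<rho>)" 0] by simp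


section \<open>Integration by parts on a triangle\<close>

context mesh_edge
begin

text \<open>The integral runs over the whole line. For the test functions it reduces to the edge,
  and integration by parts along the line leaves no end point terms.\<close>

definition edge_line_integral :: "(plane \<Rightarrow> real) \<Rightarrow> real" where
  "edge_line_integral f = (LINT s|lborel. f (edge_mid E + s *\<^sub>R \<tau>))"

text \<open>The conditions under which the half-plane formula acts as Green's formula on T: all
  derivatives up to order two vanish on the half-plane outside T, while \<open>v\<close> may cross
  the edge.\<close>

definition admissible :: "(plane \<Rightarrow> real) \<Rightarrow> bool" where
  "admissible v \<longleftrightarrow> smooth_sym v \<and> (\<exists>R. \<forall>x. norm x > R \<longrightarrow> v x = 0) \<and>
     (\<forall>\<alpha>\<in>multi_upto 2. \<forall>x\<in>half_plane \<nu> (edge_mid E) - T. multi_partial \<alpha> v x = 0)"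

lemma smooth_line_integrable:
  assumes "smooth f" "\<And>x. norm x > R \<Longrightarrow> f x = 0"
  shows "integrable lborel (\<lambda>s. f (edge_mid E + s *\<^sub>R \<tau>))"
proof -
  define N where "N = \<bar>R\<bar> + norm (edge_mid E) + 1"
  have z: "f (edge_mid E + s *\<^sub>R \<tau>) = 0" if "\<bar>s\<bar> > N" for s
  proof (rule assms(2))
    have "\<bar>s\<bar> = norm (s *\<^sub>R \<tau>)" by (simp add: norm_tau)
    also have "\<dots> \<le> norm (edge_mid E + s *\<^sub>R \<tau>) + norm (edge_mid E)"
      using norm_triangle_ineq4[of "edge_mid E + s *\<^sub>R \<tau>" "edge_mid E"] by simp
    finally show "norm (edge_mid E + s *\<^sub>R \<tau>) > R" using that by (simp add: N_def)
  qed
  have "continuous_on {-N..N} (\<lambda>s. f (edge_mid E + s *\<^sub>R \<tau>))"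
    by (intro continuous_on_compose2[OF smooth_continuous[OF assms(1), of UNIV]] continuous_intros) auto
  then have "integrable lborel (\<lambda>s. indicator {-N..N} s *\<^sub>R f (edge_mid E + s *\<^sub>R \<tau>))"
    using borel_integrable_atLeastAtMost'[of "-N" N "\<lambda>s. f (edge_mid E + s *\<^sub>R \<tau>)"] by (simp add: set_integrable_def)
  moreover have "(\<lambda>s. indicator {-N..N} s *\<^sub>R f (edge_mid E + s *\<^sub>R \<tau>)) = (\<lambda>s. f (edge_mid E + s *\<^sub>R \<tau>))"
  proof
    show "indicator {-N..N} s *\<^sub>R f (edge_mid E + s *\<^sub>R \<tau>) = f (edge_mid E + s *\<^sub>R \<tau>)" for s
      using z[of s] by (cases "\<bar>s\<bar> \<le> N") (auto simp: indicator_def abs_le_iff)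
  qed
  ultimately show ?thesis by simp
qed

lemma T_region: "interior T \<in> sets lebesgue" "open (interior T)" "Elementary_Metric_Spaces.bounded (interior T)"
  using T_props(4) interior_subset by (auto intro: bounded_subset)

lemma green_triangle:
  assumes f: "smooth f" and supp: "\<And>x. norm x > R \<Longrightarrow> f x = 0"
    and out: "\<And>x. x \<in> half_plane \<nu> (edge_mid E) - T \<Longrightarrow> partial i f x = 0"
  shows "(LINT x|lebesgue_on (interior T). partial i f x) = \<nu> $ i * edge_line_integral f"
proof -
  have m: "partial i f \<in> borel_measurable borel" by (intro smooth_measurable smooth_partial f)
  have "(LINT x|lebesgue_on (interior T). partial i f x) = (LINT x|lebesgue. indicator (interior T) x * partial i f x)"
    by (rule lebesgue_on_integral_extend(1)[OF T_region(1)])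
  also have "\<dots> = (LINT x|lebesgue. indicator (half_plane \<nu> (edge_mid E)) x * partial i f x)"
  proof (rule integral_cong_AE)
    have mc: "(\<lambda>x. indicator S x * partial i f x) \<in> borel_measurable lebesgue" if "S \<in> sets borel" for S
      using that m by (intro measurable_completion) simp
    show "(\<lambda>x. indicator (interior T) x * partial i f x) \<in> borel_measurable lebesgue" by (rule mc) simp
    show "(\<lambda>x. indicator (half_plane \<nu> (edge_mid E)) x * partial i f x) \<in> borel_measurable lebesgue" by (rule mc) simp
    show "AE x in lebesgue. indicator (interior T) x * partial i f x = indicator (half_plane \<nu> (edge_mid E)) x * partial i f x"
      using AE_not_frontier[OF T_props(1)]
    proof eventually_elim
      case (elim x)
      then have "x \<in> interior T \<longleftrightarrow> x \<in> T" using T_props(3) interior_subset by (auto simp: frontier_def)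
      then show ?case using side out[of x] by (cases "x \<in> T") (auto simp: indicator_def)
    qed
  qed
  also have "\<dots> = (LINT x|lborel. indicator (half_plane \<nu> (edge_mid E)) x * partial i f x)"
    using m by (intro integral_completion) simp
  also have "\<dots> = \<nu> $ i * edge_line_integral f"
    unfolding edge_line_integral_def by (rule green_half_plane[OF f supp])
  finally show ?thesis .
qed

lemma parts_triangle:
  assumes q: "smooth q" and v: "smooth v" and supp: "\<And>x. norm x > R \<Longrightarrow> v x = 0"
    and out: "\<And>x. x \<in> half_plane \<nu> (edge_mid E) - T \<Longrightarrow> v x = 0 \<and> partial i v x = 0"
  shows "(LINT x|lebesgue_on (interior T). q x * partial i v x) =
     - (LINT x|lebesgue_on (interior T). partial i q x * v x) + \<nu> $ i * edge_line_integral (\<lambda>x. q x * v x)"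
proof -
  have p: "partial i (\<lambda>x. q x * v x) x = partial i q x * v x + q x * partial i v x" for x
    using q v by (simp add: partial_mult smooth_differentiable)
  have int: "integrable (lebesgue_on (interior T)) (\<lambda>x. f x * g x)" if "smooth f" "smooth g" for f g
    using that T_region by (intro L2_mult_integrable smooth_L2)
  have "(LINT x|lebesgue_on (interior T). partial i (\<lambda>x. q x * v x) x) = \<nu> $ i * edge_line_integral (\<lambda>x. q x * v x)"
    by (rule green_triangle[of _ R]) (use q v supp out in \<open>auto intro: smooth_mult simp: p\<close>)
  then show ?thesis unfolding p using int q v by (simp add: smooth_partial)
qed

lemma parts_line:
  assumes q: "smooth q" and v: "smooth v" and supp: "\<And>x. norm x > R \<Longrightarrow> v x = 0"
  shows "edge_line_integral (\<lambda>x. q x * dderiv \<tau> v x) = - edge_line_integral (\<lambda>x. dderiv \<tau> q x * v x)"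
proof -
  have z: "norm x > R \<Longrightarrow> dderiv \<tau> v x = 0" for x by (rule dderiv_zero_outside(2)[OF supp])
  have "(LINT s|lborel. dderiv \<tau> (\<lambda>x. q x * v x) (edge_mid E + s *\<^sub>R \<tau>)) = 0"
    by (rule integral_dderiv_line[of _ _ R]) (use q v supp norm_tau in \<open>auto intro: smooth_mult\<close>)
  then have "(LINT s|lborel. dderiv \<tau> q (edge_mid E + s *\<^sub>R \<tau>) * v (edge_mid E + s *\<^sub>R \<tau>)
      + q (edge_mid E + s *\<^sub>R \<tau>) * dderiv \<tau> v (edge_mid E + s *\<^sub>R \<tau>)) = 0"
    using q v by (simp add: dderiv_mult)
  moreover have "integrable lborel (\<lambda>s. dderiv \<tau> q (edge_mid E + s *\<^sub>R \<tau>) * v (edge_mid E + s *\<^sub>R \<tau>))"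
    by (rule smooth_line_integrable[of "\<lambda>x. dderiv \<tau> q x * v x" R]) (use q v supp in \<open>auto intro: smooth_mult smooth_dderiv\<close>)
  moreover have "integrable lborel (\<lambda>s. q (edge_mid E + s *\<^sub>R \<tau>) * dderiv \<tau> v (edge_mid E + s *\<^sub>R \<tau>))"
    by (rule smooth_line_integrable[of "\<lambda>x. q x * dderiv \<tau> v x" R]) (use q v z in \<open>auto intro: smooth_mult smooth_dderiv\<close>)
  ultimately show ?thesis by (simp add: edge_line_integral_def)
qed

text \<open>Each second-order term is integrated by parts twice over T. On the edge the gradient of
  \<open>v\<close> is split into its tangential and normal parts; the tangential part is moved onto
  \<sigma> along the line, which produces the tangential derivative in the shear term, and the
  normal part stays as the moment term.\<close>

theorem green_second_order:
  fixes q0 :: "plane \<Rightarrow> real" and q :: "2 \<Rightarrow> plane \<Rightarrow> real" and \<sigma> :: "2 \<Rightarrow> 2 \<Rightarrow> plane \<Rightarrow> real"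
  assumes q: "smooth q0" "\<And>i. smooth (q i)" "\<And>i j. smooth (\<sigma> i j)" and v: "admissible v"
  shows "(LINT x|lebesgue_on (interior T). q0 x * v x) + (\<Sum>i\<in>UNIV. LINT x|lebesgue_on (interior T). q i x * partial i v x)
      + (\<Sum>i\<in>UNIV. \<Sum>j\<in>UNIV. LINT x|lebesgue_on (interior T). \<sigma> i j x * partial i (partial j v) x) =
    (LINT x|lebesgue_on (interior T). (q0 x - (\<Sum>i\<in>UNIV. partial i (q i) x) + (\<Sum>i\<in>UNIV. \<Sum>j\<in>UNIV. partial j (partial i (\<sigma> i j)) x)) * v x)
    + edge_line_integral (\<lambda>x. ((\<Sum>i\<in>UNIV. \<nu> $ i * q i x) - (\<Sum>i\<in>UNIV. \<Sum>j\<in>UNIV. \<nu> $ j * partial i (\<sigma> i j) x)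
         - (\<Sum>i\<in>UNIV. \<Sum>j\<in>UNIV. \<nu> $ i * \<tau> $ j * dderiv \<tau> (\<sigma> i j) x)) * v x)
    + edge_line_integral (\<lambda>x. (\<Sum>i\<in>UNIV. \<Sum>j\<in>UNIV. \<nu> $ i * \<nu> $ j * \<sigma> i j x) * dderiv \<nu> v x)"
proof -
  let ?I = "\<lambda>f. LINT x|lebesgue_on (interior T). f x"
  let ?J = edge_line_integral
  have sv: "smooth v" and sym: "partial 1 (partial 2 v) = partial 2 (partial 1 v)"
    and out: "\<And>\<alpha> x. \<alpha> \<in> multi_upto 2 \<Longrightarrow> x \<in> half_plane \<nu> (edge_mid E) - T \<Longrightarrow> multi_partial \<alpha> v x = 0"
    using v unfolding admissible_def smooth_sym_def by auto
  obtain R where R: "\<And>x. norm x > R \<Longrightarrow> v x = 0" using v unfolding admissible_def by blast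
  have out0: "v x = 0" "partial i v x = 0" if x: "x \<in> half_plane \<nu> (edge_mid E) - T" for x i
    using out[OF _ x, of "(0,0)"] out[OF _ x, of "(1,0)"] out[OF _ x, of "(0,1)"] exhaust_2[of i]
    by (auto simp: multi_partial_simps)
  have R1: "partial i v x = 0" "dderiv w v x = 0" if "norm x > R" for i w x
    using that by (auto intro: dderiv_zero_outside[OF R])
  have out2: "partial i (partial j v) x = 0" if x: "x \<in> half_plane \<nu> (edge_mid E) - T" for x i j
    using out[OF _ x, of "(1,1)"] out[OF _ x, of "(2,0)"] out[OF _ x, of "(0,2)"] exhaust_2[of i] exhaust_2[of j]
    by (auto simp: multi_partial_simps sym[symmetric])
  note s = sv q smooth_partial smooth_mult smooth_dderiv
  have Iint: "integrable (lebesgue_on (interior T)) (\<lambda>x. f x * v x)" if "smooth f" for f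
    using that sv T_region by (intro L2_mult_integrable smooth_L2)
  have Jint: "integrable lborel (\<lambda>s. f (edge_mid E + s *\<^sub>R \<tau>) * v (edge_mid E + s *\<^sub>R \<tau>))" if "smooth f" for f
    by (rule smooth_line_integrable[of "\<lambda>x. f x * v x" R]) (use that sv R in \<open>auto intro: smooth_mult\<close>)
  have Jint': "integrable lborel (\<lambda>s. f (edge_mid E + s *\<^sub>R \<tau>) * dderiv w v (edge_mid E + s *\<^sub>R \<tau>))" if "smooth f" for f w
    by (rule smooth_line_integrable[of "\<lambda>x. f x * dderiv w v x" R]) (use that sv R1 in \<open>auto intro: smooth_mult smooth_dderiv\<close>)
  have t1: "?I (\<lambda>x. q i x * partial i v x) = - ?I (\<lambda>x. partial i (q i) x * v x) + \<nu> $ i * ?J (\<lambda>x. q i x * v x)" for i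
    using out0 R by (intro parts_triangle[where R = R] q sv) auto
  have t2: "?I (\<lambda>x. \<sigma> i j x * partial i (partial j v) x) = ?I (\<lambda>x. partial j (partial i (\<sigma> i j)) x * v x)
      - \<nu> $ j * ?J (\<lambda>x. partial i (\<sigma> i j) x * v x) - \<nu> $ i * (\<tau> $ j * ?J (\<lambda>x. dderiv \<tau> (\<sigma> i j) x * v x))
      + \<nu> $ i * (\<nu> $ j * ?J (\<lambda>x. \<sigma> i j x * dderiv \<nu> v x))" for i j
  proof -
    have "?I (\<lambda>x. \<sigma> i j x * partial i (partial j v) x) = - ?I (\<lambda>x. partial i (\<sigma> i j) x * partial j v x) + \<nu> $ i * ?J (\<lambda>x. \<sigma> i j x * partial j v x)"
      using out0 out2 R1 by (intro parts_triangle[where R = R] q smooth_partial sv) auto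
    also have "?I (\<lambda>x. partial i (\<sigma> i j) x * partial j v x) = - ?I (\<lambda>x. partial j (partial i (\<sigma> i j)) x * v x) + \<nu> $ j * ?J (\<lambda>x. partial i (\<sigma> i j) x * v x)"
      using out0 R by (intro parts_triangle[where R = R] smooth_partial q sv) auto
    also have "?J (\<lambda>x. \<sigma> i j x * partial j v x) = \<tau> $ j * ?J (\<lambda>x. \<sigma> i j x * dderiv \<tau> v x) + \<nu> $ j * ?J (\<lambda>x. \<sigma> i j x * dderiv \<nu> v x)"
    proof -
      have "\<sigma> i j x * partial j v x = \<tau> $ j * (\<sigma> i j x * dderiv \<tau> v x) + \<nu> $ j * (\<sigma> i j x * dderiv \<nu> v x)" for x
        by (simp add: partial_decompose[of j v x] algebra_simps)
      then show ?thesis using Jint'[OF q(3)[of i j]] by (simp add: edge_line_integral_def)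
    qed
    also have "?J (\<lambda>x. \<sigma> i j x * dderiv \<tau> v x) = - ?J (\<lambda>x. dderiv \<tau> (\<sigma> i j) x * v x)"
      by (rule parts_line[OF q(3) sv R])
    finally show ?thesis by (simp add: algebra_simps)
  qed
  have r1: "?I (\<lambda>x. (q0 x - (\<Sum>i\<in>UNIV. partial i (q i) x) + (\<Sum>i\<in>UNIV. \<Sum>j\<in>UNIV. partial j (partial i (\<sigma> i j)) x)) * v x)
     = ?I (\<lambda>x. q0 x * v x) - (\<Sum>i\<in>UNIV. ?I (\<lambda>x. partial i (q i) x * v x)) + (\<Sum>i\<in>UNIV. \<Sum>j\<in>UNIV. ?I (\<lambda>x. partial j (partial i (\<sigma> i j)) x * v x))"
    using Iint[OF q(1)] Iint[OF smooth_partial[OF q(2)]] Iint[OF smooth_partial[OF smooth_partial[OF q(3)]]]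
    by (simp add: distrib_right left_diff_distrib sum_distrib_right)
  have r2: "?J (\<lambda>x. ((\<Sum>i\<in>UNIV. \<nu> $ i * q i x) - (\<Sum>i\<in>UNIV. \<Sum>j\<in>UNIV. \<nu> $ j * partial i (\<sigma> i j) x)
         - (\<Sum>i\<in>UNIV. \<Sum>j\<in>UNIV. \<nu> $ i * \<tau> $ j * dderiv \<tau> (\<sigma> i j) x)) * v x)
     = (\<Sum>i\<in>UNIV. \<nu> $ i * ?J (\<lambda>x. q i x * v x)) - (\<Sum>i\<in>UNIV. \<Sum>j\<in>UNIV. \<nu> $ j * ?J (\<lambda>x. partial i (\<sigma> i j) x * v x))
         - (\<Sum>i\<in>UNIV. \<Sum>j\<in>UNIV. \<nu> $ i * (\<tau> $ j * ?J (\<lambda>x. dderiv \<tau> (\<sigma> i j) x * v x)))"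
    using Jint[OF q(2)] Jint[OF smooth_partial[OF q(3)]] Jint[OF smooth_dderiv[OF q(3)]]
    by (simp add: edge_line_integral_def left_diff_distrib sum_distrib_right mult.assoc)
  have r3: "?J (\<lambda>x. (\<Sum>i\<in>UNIV. \<Sum>j\<in>UNIV. \<nu> $ i * \<nu> $ j * \<sigma> i j x) * dderiv \<nu> v x)
     = (\<Sum>i\<in>UNIV. \<Sum>j\<in>UNIV. \<nu> $ i * (\<nu> $ j * ?J (\<lambda>x. \<sigma> i j x * dderiv \<nu> v x)))"
    using Jint'[OF q(3)] by (simp add: edge_line_integral_def sum_distrib_right mult.assoc)
  show ?thesis
    unfolding t1 t2 r1 r2 r3 by (simp add: sum.distrib sum_subtractf sum_negf)
qed

end


section \<open>The weak equation tested with smooth functions\<close>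

lemma L2_subset:
  fixes f :: "plane \<Rightarrow> real"
  assumes "f \<in> L2 (lebesgue_on S)" "U \<subseteq> S" "U \<in> sets lebesgue" "S \<in> sets lebesgue"
  shows "f \<in> L2 (lebesgue_on U)"
proof -
  have i: "integrable lebesgue (\<lambda>x. indicator S x * (f x)\<^sup>2)"
    using L2_integrable[OF assms(1)] assms(4) by (simp add: lebesgue_on_integral_extend)
  have eq: "(\<lambda>x. indicator U x *\<^sub>R (indicator S x * (f x)\<^sup>2)) = (\<lambda>x. indicator U x * (f x)\<^sup>2)"
    using assms(2) by (auto simp: indicator_def fun_eq_iff)
  have "integrable lebesgue (\<lambda>x. indicator U x * (f x)\<^sup>2)"
    using integrable_mult_indicator[OF assms(3) i] by (simp only: eq)
  then show ?thesis
    using measurable_restrict_mono[OF L2_measurable[OF assms(1)] assms(2)] assms(3)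
    by (simp add: L2_def lebesgue_on_integral_extend)
qed

lemma unit_multi_sum: "smooth_sym v \<Longrightarrow> multi_partial (unit_multi i + unit_multi j) v = partial i (partial j v)"
  using exhaust_2[of i] exhaust_2[of j]
  by (auto simp: unit_multi_def multi_partial_simps smooth_sym_def numeral_2_eq_2[symmetric] simp flip: One_nat_def)

lemma unit_multi_upto: "unit_multi i + unit_multi j \<in> multi_upto 2" "unit_multi i \<in> multi_upto 2" "unit_multi i \<noteq> (1, 1)"
  by (auto simp: unit_multi_def)

lemma multi_partial_unit: "multi_partial (unit_multi i) v = partial i v"
  using exhaust_2[of i] by (auto simp: unit_multi_def multi_partial_simps)

definition normal_partial :: "nat \<Rightarrow> plane \<Rightarrow> (plane \<Rightarrow> real) \<Rightarrow> plane \<Rightarrow> real" where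
  "normal_partial j n v = (if j = 0 then v else dderiv n v)"

lemma smooth_normal_partial: "smooth v \<Longrightarrow> smooth (normal_partial j n v)"
  by (simp add: normal_partial_def smooth_dderiv)

context mesh
begin

lemma interior_sets: "T \<in> \<T> \<Longrightarrow> interior T \<in> sets lebesgue" "open (interior T)"
  "T \<in> \<T> \<Longrightarrow> Elementary_Metric_Spaces.bounded (interior T)"
  using triangle_props(4)[OF triangles] interior_subset by (auto intro: bounded_subset)

lemma domain_sets: "\<Omega> \<in> sets lebesgue"
  using open_domain by auto

lemma interiors_unique: "T \<in> \<T> \<Longrightarrow> T' \<in> \<T> \<Longrightarrow> x \<in> interior T \<Longrightarrow> x \<in> interior T' \<Longrightarrow> T = T'"
  using triangle_disjoint_interior interior_subset by blast

lemma indicator_sum: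
  fixes h :: "plane set \<Rightarrow> 'b::real_vector"
  shows "T \<in> \<T> \<Longrightarrow> x \<in> interior T \<Longrightarrow> (\<Sum>T\<in>\<T>. indicat_real (interior T) x *\<^sub>R h T) = h T"
    "\<forall>T\<in>\<T>. x \<notin> interior T \<Longrightarrow> (\<Sum>T\<in>\<T>. indicat_real (interior T) x *\<^sub>R h T) = 0"
proof -
  assume T: "T \<in> \<T>" "x \<in> interior T"
  have "(\<Sum>T'\<in>\<T>. indicat_real (interior T') x *\<^sub>R h T') = (\<Sum>T'\<in>\<T>. (if T' = T then h T' else 0))"
  proof (rule sum.cong[OF refl])
    fix T' assume "T' \<in> \<T>"
    then show "indicat_real (interior T') x *\<^sub>R h T' = (if T' = T then h T' else 0)"
      using T interiors_unique by (auto simp: indicator_def)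
  qed
  then show "(\<Sum>T\<in>\<T>. indicat_real (interior T) x *\<^sub>R h T) = h T" using T finite_mesh by simp
qed auto

lemma pw_in: "T \<in> \<T> \<Longrightarrow> x \<in> interior T \<Longrightarrow> pw \<T> q x = q T x"
  and pw_out: "\<forall>T\<in>\<T>. x \<notin> interior T \<Longrightarrow> pw \<T> q x = 0"
  unfolding pw_def by (rule indicator_sum; simp)+

text \<open>The integrand vanishes off the open triangles, as \<open>pw\<close> does by definition,
  so that the integral is exactly the sum over them.\<close>

lemma domain_integral:
  fixes \<Phi> :: "plane \<Rightarrow> real"
  assumes "\<And>T x. T \<in> \<T> \<Longrightarrow> x \<in> interior T \<Longrightarrow> \<Phi> x = h T x" "\<And>x. \<forall>T\<in>\<T>. x \<notin> interior T \<Longrightarrow> \<Phi> x = 0"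
    and "\<And>T. T \<in> \<T> \<Longrightarrow> integrable (lebesgue_on (interior T)) (h T)"
  shows "(LINT x|lebesgue_on \<Omega>. \<Phi> x) = (\<Sum>T\<in>\<T>. LINT x|lebesgue_on (interior T). h T x)"
proof -
  have "indicator \<Omega> x * \<Phi> x = (\<Sum>T\<in>\<T>. indicator (interior T) x * h T x)" for x
  proof (cases "\<exists>T\<in>\<T>. x \<in> interior T")
    case True
    then obtain T where "T \<in> \<T>" "x \<in> interior T" by blast
    moreover from this have "x \<in> \<Omega>" using interior_subset_domain by blast
    ultimately show ?thesis using assms(1) indicator_sum(1)[of T x "\<lambda>T. h T x"] by simp
  next
    case False
    then show ?thesis using assms(2) by auto
  qed
  then have "(LINT x|lebesgue_on \<Omega>. \<Phi> x) = (LINT x|lebesgue. (\<Sum>T\<in>\<T>. indicator (interior T) x * h T x))"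
    by (simp add: lebesgue_on_integral_extend(1)[OF domain_sets])
  also have "\<dots> = (\<Sum>T\<in>\<T>. LINT x|lebesgue. indicator (interior T) x * h T x)"
    using assms(3) interior_sets(1) by (intro Bochner_Integration.integral_sum) (simp add: lebesgue_on_integral_extend)
  also have "\<dots> = (\<Sum>T\<in>\<T>. LINT x|lebesgue_on (interior T). h T x)"
    using interior_sets(1) by (intro sum.cong refl) (simp add: lebesgue_on_integral_extend)
  finally show ?thesis .
qed

text \<open>Both one-sided traces, taken with the same normal, agree almost everywhere with the
  classical value, hence so does their average.\<close>

lemma avg_trace_smooth:
  assumes E: "E \<in> interior_edges \<Omega> \<T>" and v: "smooth v" and j: "j = 0 \<or> j = 1"
  shows "AE x in edge_measure E. avg \<Omega> \<T> \<nu> E (\<lambda>T. trace_on T E (normal_deriv j (\<nu> E) (interior T) v)) x = normal_partial j (\<nu> E) v x"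
    "(\<lambda>x. avg \<Omega> \<T> \<nu> E (\<lambda>T. trace_on T E (normal_deriv j (\<nu> E) (interior T) v)) x) \<in> borel_measurable (edge_measure E)"
proof -
  have tr: "AE x in edge_measure E. trace_on (side_of E \<sigma>) E (normal_deriv j (\<nu> E) (interior (side_of E \<sigma>)) v) x = normal_partial j (\<nu> E) v x"
    "trace_on (side_of E \<sigma>) E (normal_deriv j (\<nu> E) (interior (side_of E \<sigma>)) v) \<in> borel_measurable (edge_measure E)"
    if \<sigma>: "\<sigma> = 1 \<or> \<sigma> = (-1::real)" for \<sigma>
  proof -
    let ?U = "interior (side_of E \<sigma>)"
    interpret mesh_edge "\<tau> E" "\<sigma> *\<^sub>R \<nu> E" "side_of E \<sigma>" E
      unfolding mesh_edge_def using side_of_oriented[OF E \<sigma>] .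
    have wd: "AE x in lebesgue_on ?U. weak_deriv ?U (unit_multi i) v x = partial i v x"
      "weak_deriv ?U (unit_multi i) v \<in> borel_measurable (lebesgue_on ?U)" for i
      using smooth_weak_deriv[OF v T_region(2,3) unit_multi_upto(2)[of i]] unit_multi_upto(3)[of i]
      by (auto simp: multi_partial_unit intro: L2_measurable)
    have meas: "normal_deriv j (\<nu> E) ?U v \<in> borel_measurable (lebesgue_on ?U)"
    proof (cases "j = 0")
      case True
      then have "normal_deriv j (\<nu> E) ?U v = v" by (auto simp: normal_deriv_def)
      then show ?thesis using lebesgue_on_measurable[OF smooth_measurable[OF v]] by simp
    next
      case False
      then have "normal_deriv j (\<nu> E) ?U v = (\<lambda>x. weak_deriv ?U (unit_multi 1) v x * \<nu> E $ 1 + weak_deriv ?U (unit_multi 2) v x * \<nu> E $ 2)"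
        by (auto simp: normal_deriv_def weak_grad_def inner_plane)
      then show ?thesis using wd(2) by simp
    qed
    have eq: "AE x in lebesgue_on ?U. normal_deriv j (\<nu> E) ?U v x = normal_partial j (\<nu> E) v x"
      using wd(1)[of 1] wd(1)[of 2]
      by eventually_elim (use j in \<open>auto simp: normal_deriv_def weak_grad_def inner_plane normal_partial_def dderiv_def mult.commute\<close>)
    from trace_on_smooth[OF meas smooth_normal_partial[OF v] eq]
    show "AE x in edge_measure E. trace_on (side_of E \<sigma>) E (normal_deriv j (\<nu> E) ?U v) x = normal_partial j (\<nu> E) v x"
      "trace_on (side_of E \<sigma>) E (normal_deriv j (\<nu> E) ?U v) \<in> borel_measurable (edge_measure E)"
      by (auto intro: L2_measurable)
  qed
  have sides: "T_plus \<T> \<nu> E = side_of E 1" "T_minus \<T> \<nu> E = side_of E (-1)" by (auto simp: side_of_def)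
  show "AE x in edge_measure E. avg \<Omega> \<T> \<nu> E (\<lambda>T. trace_on T E (normal_deriv j (\<nu> E) (interior T) v)) x = normal_partial j (\<nu> E) v x"
    using tr(1)[of 1, simplified] tr(1)[of "-1", simplified]
    by eventually_elim (use E in \<open>simp add: avg_def sides\<close>)
  show "(\<lambda>x. avg \<Omega> \<T> \<nu> E (\<lambda>T. trace_on T E (normal_deriv j (\<nu> E) (interior T) v)) x) \<in> borel_measurable (edge_measure E)"
    using tr(2)[of 1, simplified] tr(2)[of "-1", simplified] E by (simp add: avg_def sides)
qed

end

text \<open>All three discrete spaces consist of piecewise quadratics, and this is the property of
  \<open>uh\<close> on which the estimates rest.\<close>

locale plate_problem = mesh +
  fixes f :: "nat \<times> nat \<Rightarrow> plane \<Rightarrow> real" and E\<Gamma> :: "nat \<Rightarrow> plane set set" and g :: "nat \<Rightarrow> plane \<Rightarrow> real"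
    and A :: "plane set" and \<beta> :: "plane set \<Rightarrow> plane \<Rightarrow> real"
    and F :: "nat \<times> nat \<Rightarrow> real pw_fun" and G :: "nat \<Rightarrow> plane \<Rightarrow> real" and u :: "plane \<Rightarrow> real" and uh :: "real pw_fun"
    and k :: nat
  assumes f_L2: "\<alpha> \<in> multi_upto 2 \<Longrightarrow> f \<alpha> \<in> L2 (lebesgue_on \<Omega>)"
    and E\<Gamma>: "j \<in> {0, 1} \<Longrightarrow> E\<Gamma> j \<subseteq> interior_edges \<Omega> \<T>"
    and g_L2: "j \<in> {0, 1} \<Longrightarrow> E \<in> E\<Gamma> j \<Longrightarrow> g j \<in> L2 (edge_measure E)"
    and A: "A \<subseteq> interior_vertices \<Omega> \<T>"
    and u: "u \<in> H0_space 2 \<Omega>"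
    and solution: "v \<in> H0_space 2 \<Omega> \<Longrightarrow> a_pw \<Omega> \<T> (\<lambda>T. u) (\<lambda>T. v) = F_hat \<Omega> \<T> \<nu> f E\<Gamma> g A \<beta> (\<lambda>T. v)"
    and uh: "uh \<in> pw_poly 2 \<T>"
    and G: "j \<in> {0, 1} \<Longrightarrow> edgewise_poly k (E\<Gamma> j) (G j)"
    and F: "\<alpha> \<in> multi_upto 2 \<Longrightarrow> F \<alpha> \<in> pw_poly k \<T>"
begin

lemma weak_deriv_u:
  assumes "\<alpha> \<in> multi_upto 2"
  shows "weak_deriv \<Omega> \<alpha> u \<in> L2 (lebesgue_on \<Omega>)" "is_weak_deriv \<Omega> \<alpha> u (weak_deriv \<Omega> \<alpha> u)"
proof -
  obtain w where "w \<in> L2 (lebesgue_on \<Omega>)" "is_weak_deriv \<Omega> \<alpha> u w"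
    using u assms unfolding H0_space_def H_space_def by blast
  from weak_deriv_props[OF open_domain this]
  show "weak_deriv \<Omega> \<alpha> u \<in> L2 (lebesgue_on \<Omega>)" "is_weak_deriv \<Omega> \<alpha> u (weak_deriv \<Omega> \<alpha> u)" by auto
qed

lemma u_L2: "u \<in> L2 (lebesgue_on \<Omega>)"
  using u by (simp add: H0_space_def H_space_def)

lemma L2_triangle: "T \<in> \<T> \<Longrightarrow> w \<in> L2 (lebesgue_on \<Omega>) \<Longrightarrow> w \<in> L2 (lebesgue_on (interior T))"
  by (rule L2_subset[OF _ interior_subset_domain interior_sets(1) domain_sets])

lemma uh_poly: "T \<in> \<T> \<Longrightarrow> uh T \<in> poly_funs 2"
  using uh by (simp add: pw_poly_def)

lemma uh_smooth: "T \<in> \<T> \<Longrightarrow> smooth_sym (uh T)" "T \<in> \<T> \<Longrightarrow> smooth (uh T)"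
  using tpoly_smooth_sym[OF poly_funs_tpoly[OF uh_poly]] by (auto simp: smooth_sym_def)

lemma F_poly: "\<alpha> \<in> multi_upto 2 \<Longrightarrow> T \<in> \<T> \<Longrightarrow> F \<alpha> T \<in> tpoly k"
  by (rule poly_funs_tpoly[OF _ order_refl]) (use F[of \<alpha>] in \<open>auto simp: pw_poly_def\<close>)

definition ddu :: "2 \<Rightarrow> 2 \<Rightarrow> plane \<Rightarrow> real" where
  "ddu i j = weak_deriv \<Omega> (unit_multi i + unit_multi j) u"

lemma ddu_L2: "ddu i j \<in> L2 (lebesgue_on \<Omega>)"
  unfolding ddu_def by (rule weak_deriv_u(1)[OF unit_multi_upto(1)])

lemma weak_hessian_u:
  assumes "T \<in> \<T>"
  shows "AE x in lebesgue_on (interior T). weak_deriv (interior T) (unit_multi i + unit_multi j) u x = ddu i j x"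
    "weak_deriv (interior T) (unit_multi i + unit_multi j) u \<in> L2 (lebesgue_on (interior T))"
proof -
  have "is_weak_deriv (interior T) (unit_multi i + unit_multi j) u (ddu i j)"
    unfolding ddu_def
    by (rule is_weak_deriv_subset[OF weak_deriv_u(2)[OF unit_multi_upto(1)] interior_subset_domain[OF assms] interior_sets(2) open_domain])
  from weak_deriv_props[OF interior_sets(2) L2_triangle[OF assms ddu_L2] this]
  show "AE x in lebesgue_on (interior T). weak_deriv (interior T) (unit_multi i + unit_multi j) u x = ddu i j x"
    "weak_deriv (interior T) (unit_multi i + unit_multi j) u \<in> L2 (lebesgue_on (interior T))" by auto
qed

lemma weak_hessian_error:
  assumes "T \<in> \<T>"
  shows "AE x in lebesgue_on (interior T). weak_deriv (interior T) (unit_multi i + unit_multi j) (\<lambda>x. u x - uh T x) x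
      = ddu i j x - partial i (partial j (uh T)) x"
    "weak_deriv (interior T) (unit_multi i + unit_multi j) (\<lambda>x. u x - uh T x) \<in> L2 (lebesgue_on (interior T))"
    "(\<lambda>x. ddu i j x - partial i (partial j (uh T)) x) \<in> L2 (lebesgue_on (interior T))"
proof -
  let ?U = "interior T"
  have 1: "is_weak_deriv ?U (unit_multi i + unit_multi j) u (ddu i j)"
    unfolding ddu_def
    by (rule is_weak_deriv_subset[OF weak_deriv_u(2)[OF unit_multi_upto(1)] interior_subset_domain[OF assms] interior_sets(2) open_domain])
  have 2: "is_weak_deriv ?U (unit_multi i + unit_multi j) (uh T) (partial i (partial j (uh T)))"
    using smooth_is_weak_deriv[OF uh_smooth(2)[OF assms] interior_sets(2) unit_multi_upto(1) uh_smooth(1)[OF assms]]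
    by (simp add: unit_multi_sum uh_smooth(1)[OF assms])
  have L: "uh T \<in> L2 (lebesgue_on ?U)" "partial i (partial j (uh T)) \<in> L2 (lebesgue_on ?U)"
    by (intro smooth_L2 smooth_partial uh_smooth(2) interior_sets assms)+
  show 3: "(\<lambda>x. ddu i j x - partial i (partial j (uh T)) x) \<in> L2 (lebesgue_on (interior T))"
    by (intro L2_diff L L2_triangle[OF assms ddu_L2])
  have "is_weak_deriv ?U (unit_multi i + unit_multi j) (\<lambda>x. u x - uh T x) (\<lambda>x. ddu i j x - partial i (partial j (uh T)) x)"
    by (intro is_weak_deriv_diff interior_sets 1 2 L L2_triangle[OF assms ddu_L2] L2_triangle[OF assms u_L2])
  from weak_deriv_props[OF interior_sets(2) 3 this]
  show "AE x in lebesgue_on (interior T). weak_deriv (interior T) (unit_multi i + unit_multi j) (\<lambda>x. u x - uh T x) x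
      = ddu i j x - partial i (partial j (uh T)) x"
    "weak_deriv (interior T) (unit_multi i + unit_multi j) (\<lambda>x. u x - uh T x) \<in> L2 (lebesgue_on (interior T))" by auto
qed

lemma finite_edges: "finite (edges \<T>)"
proof -
  have "edges \<T> = (\<Union>T\<in>\<T>. {E. E edge_of T})" by (auto simp: edges_def)
  then show ?thesis using finite_mesh edges_of_triangle_card(1)[OF triangles] by simp
qed

lemma finite_E\<Gamma>: "j \<in> {0, 1} \<Longrightarrow> finite (E\<Gamma> j)"
  using E\<Gamma>[of j] finite_edges by (auto simp: interior_edges_def intro: finite_subset)

text \<open>For such \<open>v\<close> the chosen derivatives, traces and point values become
  classical ones, and the vertex condition removes the point sources.\<close>

theorem tested_equation:
  assumes v: "v \<in> test_funs \<Omega>" "smooth_sym v" "\<And>z. z \<in> vertices \<T> \<Longrightarrow> v z = 0"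
  shows "(\<Sum>T\<in>\<T>. \<Sum>i\<in>UNIV. \<Sum>j\<in>UNIV. LINT x|lebesgue_on (interior T). ddu i j x * partial i (partial j v) x) =
    (\<Sum>T\<in>\<T>. \<Sum>\<alpha>\<in>multi_upto 2. LINT x|lebesgue_on (interior T). f \<alpha> x * multi_partial \<alpha> v x) +
    (\<Sum>j\<in>{0, 1}. \<Sum>E\<in>E\<Gamma> j. LINT x|edge_measure E. g j x * normal_partial j (\<nu> E) v x)"
proof -
  have sv: "smooth v" using v(2) by (simp add: smooth_sym_def)
  have vL2: "multi_partial \<alpha> v \<in> L2 (lebesgue_on (interior T))" if "T \<in> \<T>" for \<alpha> T
    using that by (intro smooth_L2 smooth_multi_partial sv interior_sets)
  have wd: "AE x in lebesgue_on (interior T). weak_deriv (interior T) \<alpha> v x = multi_partial \<alpha> v x"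
    "weak_deriv (interior T) \<alpha> v \<in> L2 (lebesgue_on (interior T))" if "T \<in> \<T>" "\<alpha> \<in> multi_upto 2" for T \<alpha>
    using smooth_weak_deriv[OF sv interior_sets(2) interior_sets(3)[OF that(1)] that(2) v(2)] by auto
  have lhs: "a_pw \<Omega> \<T> (\<lambda>T. u) (\<lambda>T. v) = (\<Sum>T\<in>\<T>. \<Sum>i\<in>UNIV. \<Sum>j\<in>UNIV. LINT x|lebesgue_on (interior T). ddu i j x * partial i (partial j v) x)"
  proof -
    let ?a = "\<lambda>T i j. weak_deriv (interior T) (unit_multi i + unit_multi j)"
    have int: "integrable (lebesgue_on (interior T)) (\<lambda>x. ?a T i j u x * ?a T i j v x)" if "T \<in> \<T>" for T i j
      by (intro L2_mult_integrable weak_hessian_u(2) wd(2) unit_multi_upto that)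
    have "a_pw \<Omega> \<T> (\<lambda>T. u) (\<lambda>T. v) = (\<Sum>T\<in>\<T>. LINT x|lebesgue_on (interior T). (\<Sum>i\<in>UNIV. \<Sum>j\<in>UNIV. ?a T i j u x * ?a T i j v x))"
      unfolding a_pw_def
    proof (rule domain_integral)
      fix T x assume "T \<in> \<T>" "x \<in> interior T"
      then show "pw \<T> (\<lambda>T. weak_hessian (interior T) u) x \<bullet> pw \<T> (\<lambda>T. weak_hessian (interior T) v) x
          = (\<Sum>i\<in>UNIV. \<Sum>j\<in>UNIV. ?a T i j u x * ?a T i j v x)"
        by (simp add: pw_in weak_hessian_def inner_vec_def)
    qed (auto simp: pw_out intro!: Bochner_Integration.integrable_sum int)
    also have "\<dots> = (\<Sum>T\<in>\<T>. \<Sum>i\<in>UNIV. \<Sum>j\<in>UNIV. LINT x|lebesgue_on (interior T). ?a T i j u x * ?a T i j v x)"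
      using int by (intro sum.cong refl) simp
    also have "\<dots> = (\<Sum>T\<in>\<T>. \<Sum>i\<in>UNIV. \<Sum>j\<in>UNIV. LINT x|lebesgue_on (interior T). ddu i j x * partial i (partial j v) x)"
    proof (intro sum.cong refl integral_cong_AE)
      fix T i j assume T: "T \<in> \<T>"
      show "(\<lambda>x. ?a T i j u x * ?a T i j v x) \<in> borel_measurable (lebesgue_on (interior T))"
        using int[OF T] by (rule borel_measurable_integrable)
      have "partial i (partial j v) \<in> L2 (lebesgue_on (interior T))"
        using T by (intro smooth_L2 smooth_partial sv interior_sets)
      then show "(\<lambda>x. ddu i j x * partial i (partial j v) x) \<in> borel_measurable (lebesgue_on (interior T))"
        using L2_triangle[OF T ddu_L2] by (intro borel_measurable_integrable L2_mult_integrable)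
      show "AE x in lebesgue_on (interior T). ?a T i j u x * ?a T i j v x = ddu i j x * partial i (partial j v) x"
        using weak_hessian_u(1)[OF T, of i j] wd(1)[OF T unit_multi_upto(1)[of i j]]
        by eventually_elim (simp add: unit_multi_sum[OF v(2)])
    qed
    finally show ?thesis .
  qed
  have vol: "(LINT x|lebesgue_on \<Omega>. f \<alpha> x * pw \<T> (\<lambda>T. weak_deriv (interior T) \<alpha> v) x) =
      (\<Sum>T\<in>\<T>. LINT x|lebesgue_on (interior T). f \<alpha> x * multi_partial \<alpha> v x)" if \<alpha>: "\<alpha> \<in> multi_upto 2" for \<alpha>
  proof -
    have "(LINT x|lebesgue_on \<Omega>. f \<alpha> x * pw \<T> (\<lambda>T. weak_deriv (interior T) \<alpha> v) x) =
      (\<Sum>T\<in>\<T>. LINT x|lebesgue_on (interior T). f \<alpha> x * weak_deriv (interior T) \<alpha> v x)"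
      by (rule domain_integral) (auto simp: pw_in pw_out intro!: L2_mult_integrable L2_triangle[OF _ f_L2[OF \<alpha>]] wd(2) \<alpha>)
    also have "\<dots> = (\<Sum>T\<in>\<T>. LINT x|lebesgue_on (interior T). f \<alpha> x * multi_partial \<alpha> v x)"
    proof (intro sum.cong refl integral_cong_AE)
      fix T assume T: "T \<in> \<T>"
      show "(\<lambda>x. f \<alpha> x * weak_deriv (interior T) \<alpha> v x) \<in> borel_measurable (lebesgue_on (interior T))"
        "(\<lambda>x. f \<alpha> x * multi_partial \<alpha> v x) \<in> borel_measurable (lebesgue_on (interior T))"
        by (intro borel_measurable_integrable L2_mult_integrable L2_triangle[OF T f_L2[OF \<alpha>]] wd(2)[OF T \<alpha>] vL2[OF T])+
      show "AE x in lebesgue_on (interior T). f \<alpha> x * weak_deriv (interior T) \<alpha> v x = f \<alpha> x * multi_partial \<alpha> v x"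
        using wd(1)[OF T \<alpha>] by eventually_elim simp
    qed
    finally show ?thesis .
  qed
  have edge: "(LINT x|edge_measure E. g j x * avg \<Omega> \<T> \<nu> E (\<lambda>T. trace_on T E (normal_deriv j (\<nu> E) (interior T) v)) x)
      = (LINT x|edge_measure E. g j x * normal_partial j (\<nu> E) v x)" if j: "j \<in> {0, 1}" "E \<in> E\<Gamma> j" for j E
  proof (rule integral_cong_AE)
    have E: "E \<in> interior_edges \<Omega> \<T>" using j E\<Gamma> by blast
    interpret mesh_edge "\<tau> E" "1 *\<^sub>R \<nu> E" "side_of E 1" E
      unfolding mesh_edge_def by (rule side_of_oriented[OF E]) simp
    have j': "j = 0 \<or> j = 1" using j by auto
    have gm: "g j \<in> borel_measurable (edge_measure E)" using g_L2[OF j] by (rule L2_measurable)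
    show "(\<lambda>x. g j x * avg \<Omega> \<T> \<nu> E (\<lambda>T. trace_on T E (normal_deriv j (\<nu> E) (interior T) v)) x) \<in> borel_measurable (edge_measure E)"
      using gm avg_trace_smooth(2)[OF E sv j'] by (rule borel_measurable_times)
    show "(\<lambda>x. g j x * normal_partial j (\<nu> E) v x) \<in> borel_measurable (edge_measure E)"
      by (intro borel_measurable_times gm edge_measurable_borel smooth_measurable smooth_normal_partial sv)
    show "AE x in edge_measure E. g j x * avg \<Omega> \<T> \<nu> E (\<lambda>T. trace_on T E (normal_deriv j (\<nu> E) (interior T) v)) x = g j x * normal_partial j (\<nu> E) v x"
      using avg_trace_smooth(1)[OF E sv j'] by eventually_elim simp
  qed
  have pts: "point_value T v z = 0" if "z \<in> A" "T \<in> vertex_patch \<T> z" for T z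
  proof -
    have "T \<in> \<T>" "z \<in> T" using that by (auto simp: vertex_patch_def)
    moreover have "z \<in> vertices \<T>" using that A by (auto simp: interior_vertices_def)
    ultimately show ?thesis using point_value_smooth[OF triangles _ sv] v(3) by simp
  qed
  have "a_pw \<Omega> \<T> (\<lambda>T. u) (\<lambda>T. v) = F_hat \<Omega> \<T> \<nu> f E\<Gamma> g A \<beta> (\<lambda>T. v)"
    by (rule solution[OF test_funs_H0_space[OF open_domain bounded v(1,2)]])
  also have "\<dots> = (\<Sum>\<alpha>\<in>multi_upto 2. \<Sum>T\<in>\<T>. LINT x|lebesgue_on (interior T). f \<alpha> x * multi_partial \<alpha> v x) +
    (\<Sum>j\<in>{0, 1}. \<Sum>E\<in>E\<Gamma> j. LINT x|edge_measure E. g j x * normal_partial j (\<nu> E) v x)"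
  proof -
    have "(\<Sum>z\<in>A. \<Sum>T\<in>vertex_patch \<T> z. \<beta> T z * point_value T v z) = 0"
      using pts by (intro sum.neutral ballI) auto
    moreover have "(\<Sum>j\<in>{0, 1}. \<Sum>E\<in>E\<Gamma> j. LINT x|edge_measure E. g j x * avg \<Omega> \<T> \<nu> E (\<lambda>T. trace_on T E (normal_deriv j (\<nu> E) (interior T) v)) x)
       = (\<Sum>j\<in>{0, 1}. \<Sum>E\<in>E\<Gamma> j. LINT x|edge_measure E. g j x * normal_partial j (\<nu> E) v x)"
      by (intro sum.cong refl edge)
    ultimately show ?thesis unfolding F_hat_def using vol by simp
  qed
  also have "(\<Sum>\<alpha>\<in>multi_upto 2. \<Sum>T\<in>\<T>. LINT x|lebesgue_on (interior T). f \<alpha> x * multi_partial \<alpha> v x)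
     = (\<Sum>T\<in>\<T>. \<Sum>\<alpha>\<in>multi_upto 2. LINT x|lebesgue_on (interior T). f \<alpha> x * multi_partial \<alpha> v x)"
    by (rule sum.swap)
  finally show ?thesis unfolding lhs .
qed

end


section \<open>The local residual identities\<close>

text \<open>Lebesgue measure is complete, so every subset of a null set is measurable.\<close>

lemma negligible_change_measurable:
  fixes f h :: "plane \<Rightarrow> real"
  assumes f: "f \<in> borel_measurable lebesgue" and N: "negligible N" and eq: "\<And>x. x \<notin> N \<Longrightarrow> h x = f x"
  shows "h \<in> borel_measurable lebesgue"
proof (rule measurableI)
  fix S :: "real set" assume S: "S \<in> sets borel"
  have "h -` S \<inter> space lebesgue = (f -` S \<inter> space lebesgue - N) \<union> (h -` S \<inter> N)"
    using eq by auto
  moreover have "h -` S \<inter> N \<in> sets lebesgue"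
    using N by (intro negligible_imp_sets) (rule negligible_subset, auto)
  ultimately show "h -` S \<inter> space lebesgue \<in> sets lebesgue"
    using sets.Un[OF sets.Diff[OF measurable_sets[OF f S] negligible_imp_sets[OF N]]] by (simp only:)
qed auto

text \<open>\<open>apx\<close> integrates over closed triangles, whereas \<open>f\<close> is known
  to be measurable on the open domain. The boundary of a triangle is a null set, which bridges the
  two.\<close>

lemma L2_nrm_triangle_interior:
  fixes h :: "plane \<Rightarrow> real"
  assumes T: "2 simplex T" and h: "h \<in> borel_measurable (lebesgue_on (interior T))"
  shows "L2_nrm (lebesgue_on T) h = L2_nrm (lebesgue_on (interior T)) h"
proof -
  note Tp = triangle_props[OF T]
  have sets: "T \<in> sets lebesgue" "interior T \<in> sets lebesgue" using Tp(3) by auto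
  have m: "(\<lambda>x. indicator (interior T) x * (h x)\<^sup>2) \<in> borel_measurable lebesgue"
  proof -
    have "(\<lambda>x. (h x)\<^sup>2) \<in> borel_measurable (lebesgue_on (interior T))" using h by measurable
    then show ?thesis using sets(2) by (simp add: borel_measurable_restrict_space_iff)
  qed
  have N: "negligible (frontier T)" using Tp(1) by (rule negligible_convex_frontier)
  have eq: "indicator T x * (h x)\<^sup>2 = indicator (interior T) x * (h x)\<^sup>2" if "x \<notin> frontier T" for x
    using that Tp(3) interior_subset by (auto simp: frontier_def indicator_def)
  have "(LINT x|lebesgue. indicator T x * (h x)\<^sup>2) = (LINT x|lebesgue. indicator (interior T) x * (h x)\<^sup>2)"
  proof (rule integral_cong_AE[OF negligible_change_measurable[OF m N eq] m])
    show "AE x in lebesgue. indicator T x * (h x)\<^sup>2 = indicator (interior T) x * (h x)\<^sup>2"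
      using AE_not_frontier[OF Tp(1)] by eventually_elim (rule eq)
  qed
  then show ?thesis by (simp add: L2_nrm_def lebesgue_on_integral_extend(1)[OF sets(1)] lebesgue_on_integral_extend(1)[OF sets(2)])
qed

lemma triangle_measure_le:
  assumes "2 simplex (T :: plane set)"
  shows "sqrt (measure (lebesgue_on (interior T)) (space (lebesgue_on (interior T)))) \<le> 2 * diameter T"
    "emeasure (lebesgue_on (interior T)) (space (lebesgue_on (interior T))) < \<infinity>"
proof -
  note Tp = triangle_props[OF assms]
  obtain x0 where x0: "x0 \<in> T" using Tp(5) interior_subset by blast
  have h0: "0 \<le> diameter T" using Tp(4) by (rule diameter_ge_0)
  \<comment> \<open>T lies in the square of side 2 \<open>diameter T\<close> centred at any of its
    points, which is the origin of the factor 2.\<close>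
  let ?a = "\<chi> i. x0 $ i - diameter T" and ?b = "\<chi> i. x0 $ i + diameter T"
  have "T \<subseteq> cbox ?a ?b"
  proof
    fix x assume "x \<in> T"
    then have "dist x x0 \<le> diameter T" using x0 Tp(4) by (intro diameter_bounded_bound)
    then have "\<bar>(x - x0) $ i\<bar> \<le> diameter T" for i
      using component_le_norm_cart[of "x - x0" i] by (simp add: dist_norm)
    then show "x \<in> cbox ?a ?b" by (auto simp: mem_box_cart abs_le_iff algebra_simps)
  qed
  then have sub: "interior T \<subseteq> cbox ?a ?b" using interior_subset by blast
  have lm: "interior T \<in> lmeasurable"
    using Tp(4) interior_subset by (intro lmeasurable_interior) auto
  have "measure lebesgue (interior T) \<le> measure lebesgue (cbox ?a ?b)"
    by (rule measure_mono_fmeasurable[OF sub]) (use lm in auto)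
  also have "\<dots> = (2 * diameter T)\<^sup>2"
  proof -
    have "cbox ?a ?b \<noteq> {}" using h0 by (auto simp: box_ne_empty inner_axis Basis_vec_def)
    from content_cbox_cart[OF this] show ?thesis by (simp add: UNIV_2 power2_eq_square)
  qed
  finally have "measure lebesgue (interior T) \<le> (2 * diameter T)\<^sup>2" .
  then have "sqrt (measure lebesgue (interior T)) \<le> 2 * diameter T" using h0 by (intro real_le_lsqrt) auto
  then show "sqrt (measure (lebesgue_on (interior T)) (space (lebesgue_on (interior T)))) \<le> 2 * diameter T"
    by (simp add: measure_restrict_space)
  show "emeasure (lebesgue_on (interior T)) (space (lebesgue_on (interior T))) < \<infinity>"
    using lm by (simp add: emeasure_restrict_space fmeasurable_def)
qed

lemma triangle_bounded_L2:
  assumes "2 simplex T" "smooth h" "\<And>x. x \<in> interior T \<Longrightarrow> \<bar>h x\<bar> \<le> B" "0 \<le> B"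
  shows "L2_nrm (lebesgue_on (interior T)) h \<le> B * (2 * diameter T)"
proof -
  have "L2_nrm (lebesgue_on (interior T)) h \<le> B * sqrt (measure (lebesgue_on (interior T)) (space (lebesgue_on (interior T))))"
    using assms(3) by (intro L2_bounded triangle_measure_le(2)[OF assms(1)] lebesgue_on_measurable smooth_measurable assms(2)) auto
  also have "\<dots> \<le> B * (2 * diameter T)"
    by (intro mult_left_mono triangle_measure_le(1) assms)
  finally show ?thesis .
qed

lemma tpoly_mono: "f \<in> tpoly k \<Longrightarrow> k \<le> l \<Longrightarrow> f \<in> tpoly l"
  by (induction rule: tpoly.induct) (auto intro: tpoly.intros)

lemma sum_UNIV_2: "(\<Sum>i\<in>UNIV. h i) = h 1 + h (2::2)"
  by (rule sum_2)

context plate_problem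
begin

definition M2 :: "plane set \<Rightarrow> 2 \<Rightarrow> 2 \<Rightarrow> plane \<Rightarrow> real" where
  "M2 T i j x = mat_F2 F T x $ i $ j"

definition F1 :: "plane set \<Rightarrow> 2 \<Rightarrow> plane \<Rightarrow> real" where
  "F1 T i x = vec_F1 F T x $ i"

definition residual :: "plane set \<Rightarrow> plane \<Rightarrow> real" where
  "residual T x = F (0,0) T x - divergence (vec_F1 F T) x + divergence (row_divergence (mat_F2 F T)) x"

text \<open>The one-sided effective shear force of Kirchhoff plate theory, which includes the
  tangential derivative of the twisting moment. Its jump together with the edge data is the
  integrand in \<open>mu2_sq\<close>.\<close>

definition shear :: "plane set \<Rightarrow> plane set \<Rightarrow> plane \<Rightarrow> real" where
  "shear E T x = (vec_F1 F T x - row_divergence (mat_F2 F T) x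
     - frechet_derivative (\<lambda>y'. mat_F2 F T y' *v \<tau> E) (at x) (\<tau> E)) \<bullet> \<nu> E"

text \<open>The one-sided normal bending moment of the data minus that of \<open>uh\<close>; its
  jump pairs with the normal derivative of a test function.\<close>

definition moment :: "plane set \<Rightarrow> plane set \<Rightarrow> plane \<Rightarrow> real" where
  "moment E T x = ((mat_F2 F T x - hessian (uh T) x) *v \<nu> E) \<bullet> \<nu> E"

lemma M2_simps: "M2 T 1 1 = F (2,0) T" "M2 T 1 2 = (\<lambda>x. F (1,1) T x / 2)" "M2 T 2 1 = (\<lambda>x. F (1,1) T x / 2)"
  "M2 T 2 2 = F (0,2) T"
  by (auto simp: M2_def mat_F2_def fun_eq_iff vector_2)

lemma F1_simps: "F1 T 1 = F (1,0) T" "F1 T 2 = F (0,1) T"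
  by (auto simp: F1_def vec_F1_def fun_eq_iff vector_2)

lemma M2_sym: "M2 T i j = M2 T j i"
  using exhaust_2[of i] exhaust_2[of j] by (auto simp: M2_simps)

lemma M2_tpoly: "T \<in> \<T> \<Longrightarrow> M2 T i j \<in> tpoly k"
proof -
  assume T: "T \<in> \<T>"
  have "(\<lambda>x. F (1,1) T x / 2) \<in> tpoly k" using tpoly_cmult[OF F_poly[OF _ T], of "(1,1)" "1/2"] by simp
  then show ?thesis using exhaust_2[of i] exhaust_2[of j] T by (auto simp: M2_simps intro!: F_poly)
qed

lemma F1_tpoly: "T \<in> \<T> \<Longrightarrow> F1 T i \<in> tpoly k"
  using exhaust_2[of i] by (auto simp: F1_simps intro!: F_poly)

lemma residual_eq: "residual T x = F (0,0) T x - (\<Sum>i\<in>UNIV. partial i (F1 T i) x) + (\<Sum>i\<in>UNIV. \<Sum>j\<in>UNIV. partial j (partial i (M2 T i j)) x)"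
  if T: "T \<in> \<T>"
proof -
  have s: "smooth (partial j (M2 T i j))" for i j by (intro smooth_partial tpoly_smooth[OF M2_tpoly[OF T]])
  have "divergence (row_divergence (mat_F2 F T)) x = (\<Sum>i\<in>UNIV. partial i (\<lambda>y. \<Sum>j\<in>UNIV. partial j (M2 T i j) y) x)"
    by (simp add: divergence_def row_divergence_def M2_def[abs_def])
  also have "\<dots> = (\<Sum>i\<in>UNIV. \<Sum>j\<in>UNIV. partial i (partial j (M2 T i j)) x)"
    using s by (simp add: sum_UNIV_2 partial_add smooth_differentiable)
  \<comment> \<open>Since the matrix is symmetric, exchanging the order of the two derivatives is a
    relabelling of the indices.\<close>
  also have "\<dots> = (\<Sum>i\<in>UNIV. \<Sum>j\<in>UNIV. partial j (partial i (M2 T i j)) x)"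
    by (subst sum.swap) (simp add: M2_sym)
  finally show ?thesis by (simp add: residual_def divergence_def F1_def[abs_def])
qed

lemma residual_tpoly: "T \<in> \<T> \<Longrightarrow> residual T \<in> tpoly k"
proof -
  assume T: "T \<in> \<T>"
  have "(\<lambda>x. (F (0,0) T x - (\<Sum>i\<in>UNIV. partial i (F1 T i) x)) + (\<Sum>i\<in>UNIV. \<Sum>j\<in>UNIV. partial j (partial i (M2 T i j)) x)) \<in> tpoly k"
    by (intro tpoly.add tpoly_diff tpoly_sum tpoly_partial M2_tpoly F1_tpoly F_poly T) simp
  moreover have "residual T = (\<lambda>x. (F (0,0) T x - (\<Sum>i\<in>UNIV. partial i (F1 T i) x)) + (\<Sum>i\<in>UNIV. \<Sum>j\<in>UNIV. partial j (partial i (M2 T i j)) x))"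
    by (rule ext) (rule residual_eq[OF T])
  ultimately show ?thesis by (simp only:)
qed

lemma uh_hessian_const:
  assumes "T \<in> \<T>"
  obtains h where "\<And>i j. partial i (partial j (uh T)) = (\<lambda>x. h i j)" "\<And>i j. h i j = h j i"
  using quadratic_second_derivatives[OF uh_poly[OF assms]] by (metis ext)

text \<open>The second-order data and \<open>uh\<close> are integrated by parts as one tensor, whose
  derivatives are those of the data alone.\<close>

definition stress :: "plane set \<Rightarrow> 2 \<Rightarrow> 2 \<Rightarrow> plane \<Rightarrow> real" where
  "stress T i j x = M2 T i j x - partial i (partial j (uh T)) x"

lemma stress_smooth: "T \<in> \<T> \<Longrightarrow> smooth (stress T i j)"
  unfolding stress_def[abs_def]
  by (intro smooth_diff tpoly_smooth[OF M2_tpoly] smooth_partial uh_smooth(2))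

lemma stress_tpoly: "T \<in> \<T> \<Longrightarrow> stress T i j \<in> tpoly (k + 2)"
  unfolding stress_def[abs_def]
  by (intro tpoly_diff tpoly_partial) (auto intro: tpoly_mono[OF M2_tpoly] poly_funs_tpoly[OF uh_poly])

lemma stress_partial:
  assumes "T \<in> \<T>"
  shows "partial l (stress T i j) = partial l (M2 T i j)" "dderiv w (stress T i j) = dderiv w (M2 T i j)"
proof -
  obtain h where h: "\<And>i j. partial i (partial j (uh T)) = (\<lambda>x. h i j)"
    using uh_hessian_const[OF assms] by metis
  have "partial l (stress T i j) x = partial l (M2 T i j) x" for l x
  proof -
    have "stress T i j = (\<lambda>x. M2 T i j x + (- h i j))" by (auto simp: stress_def h)
    then show ?thesis
      using partial_add[of "M2 T i j" x "\<lambda>x. - h i j" l] smooth_differentiable[OF tpoly_smooth[OF M2_tpoly[OF assms]]]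
        smooth_differentiable[OF smooth_const] partial_eqI[OF has_derivative_const, of l "- h i j" x]
      by simp
  qed
  then show "partial l (stress T i j) = partial l (M2 T i j)" "dderiv w (stress T i j) = dderiv w (M2 T i j)"
    by (auto simp: dderiv_def fun_eq_iff)
qed

lemma shear_eq:
  assumes T: "T \<in> \<T>"
  shows "shear E T x = (\<Sum>i\<in>UNIV. \<nu> E $ i * F1 T i x) - (\<Sum>i\<in>UNIV. \<Sum>j\<in>UNIV. \<nu> E $ j * partial i (M2 T i j) x)
         - (\<Sum>i\<in>UNIV. \<Sum>j\<in>UNIV. \<nu> E $ i * \<tau> E $ j * dderiv (\<tau> E) (M2 T i j) x)"
proof -
  let ?V = "\<lambda>y. mat_F2 F T y *v \<tau> E"
  have V: "?V = (\<lambda>y. (M2 T 1 1 y * \<tau> E $ 1 + M2 T 1 2 y * \<tau> E $ 2) *\<^sub>R axis 1 1 + (M2 T 2 1 y * \<tau> E $ 1 + M2 T 2 2 y * \<tau> E $ 2) *\<^sub>R axis 2 1)"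
    by (auto simp: fun_eq_iff plane_eq_iff matrix_vector_mult_def M2_def sum_UNIV_2 axis_def)
  have D: "(M2 T i j has_derivative (\<lambda>h. dderiv h (M2 T i j) x)) (at x)" for i j
    using smooth_has_derivative[OF tpoly_smooth[OF M2_tpoly[OF T]], of i j x] by (simp add: dderiv_def)
  have DV: "(?V has_derivative (\<lambda>h. (dderiv h (M2 T 1 1) x * \<tau> E $ 1 + dderiv h (M2 T 1 2) x * \<tau> E $ 2) *\<^sub>R axis 1 1
      + (dderiv h (M2 T 2 1) x * \<tau> E $ 1 + dderiv h (M2 T 2 2) x * \<tau> E $ 2) *\<^sub>R axis 2 1)) (at x)"
    unfolding V
    by (intro has_derivative_add has_derivative_scaleR_left has_derivative_mult_left D)
  have fr: "frechet_derivative ?V (at x) (\<tau> E) = (dderiv (\<tau> E) (M2 T 1 1) x * \<tau> E $ 1 + dderiv (\<tau> E) (M2 T 1 2) x * \<tau> E $ 2) *\<^sub>R axis 1 1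
      + (dderiv (\<tau> E) (M2 T 2 1) x * \<tau> E $ 1 + dderiv (\<tau> E) (M2 T 2 2) x * \<tau> E $ 2) *\<^sub>R axis 2 1"
    using frechet_derivative_at[OF DV] by (metis (no_types, lifting))
  have rd: "row_divergence (mat_F2 F T) x $ i = partial 1 (M2 T i 1) x + partial 2 (M2 T i 2) x" for i
    by (simp add: row_divergence_def divergence_def sum_UNIV_2 M2_def[abs_def])
  show ?thesis
    unfolding shear_def fr by (simp add: inner_plane rd sum_UNIV_2 F1_def[symmetric] M2_sym[of T 2 1] axis_def algebra_simps)
qed

lemma moment_eq:
  assumes T: "T \<in> \<T>"
  shows "moment E T x = (\<Sum>i\<in>UNIV. \<Sum>j\<in>UNIV. \<nu> E $ i * \<nu> E $ j * stress T i j x)"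
  by (simp add: moment_def inner_plane matrix_vector_mult_def sum_UNIV_2 stress_def M2_def hessian_def algebra_simps)

lemma shear_tpoly: "T \<in> \<T> \<Longrightarrow> shear E T \<in> tpoly k"
proof -
  assume T: "T \<in> \<T>"
  have "(\<lambda>x. ((\<Sum>i\<in>UNIV. \<nu> E $ i * F1 T i x) - (\<Sum>i\<in>UNIV. \<Sum>j\<in>UNIV. \<nu> E $ j * partial i (M2 T i j) x))
         - (\<Sum>i\<in>UNIV. \<Sum>j\<in>UNIV. (\<nu> E $ i * \<tau> E $ j) * ((\<tau> E $ 1) * partial 1 (M2 T i j) x + \<tau> E $ 2 * partial 2 (M2 T i j) x))) \<in> tpoly k"
    by (intro tpoly.add tpoly_diff tpoly_sum tpoly_cmult tpoly_partial M2_tpoly F1_tpoly T)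
  moreover have "shear E T = (\<lambda>x. ((\<Sum>i\<in>UNIV. \<nu> E $ i * F1 T i x) - (\<Sum>i\<in>UNIV. \<Sum>j\<in>UNIV. \<nu> E $ j * partial i (M2 T i j) x))
         - (\<Sum>i\<in>UNIV. \<Sum>j\<in>UNIV. (\<nu> E $ i * \<tau> E $ j) * ((\<tau> E $ 1) * partial 1 (M2 T i j) x + \<tau> E $ 2 * partial 2 (M2 T i j) x)))"
    by (rule ext) (simp add: shear_eq[OF T] dderiv_def)
  ultimately show ?thesis by simp
qed

lemma moment_tpoly: "T \<in> \<T> \<Longrightarrow> moment E T \<in> tpoly (k + 2)"
proof -
  assume T: "T \<in> \<T>"
  have "(\<lambda>x. \<Sum>i\<in>UNIV. \<Sum>j\<in>UNIV. (\<nu> E $ i * \<nu> E $ j) * stress T i j x) \<in> tpoly (k + 2)"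
    by (intro tpoly_sum tpoly_cmult stress_tpoly T)
  moreover have "moment E T = (\<lambda>x. \<Sum>i\<in>UNIV. \<Sum>j\<in>UNIV. (\<nu> E $ i * \<nu> E $ j) * stress T i j x)"
    by (rule ext) (simp add: moment_eq[OF T])
  ultimately show ?thesis by simp
qed

text \<open>The approximated volume source minus the discrete energy product on T. Integration by
  parts turns it into residual densities.\<close>

definition discrete_form :: "plane set \<Rightarrow> (plane \<Rightarrow> real) \<Rightarrow> real" where
  "discrete_form T v = (\<Sum>\<alpha>\<in>multi_upto 2. LINT x|lebesgue_on (interior T). F \<alpha> T x * multi_partial \<alpha> v x)
     - (\<Sum>i\<in>UNIV. \<Sum>j\<in>UNIV. LINT x|lebesgue_on (interior T). partial i (partial j (uh T)) x * partial i (partial j v) x)"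

text \<open>What remains of \<open>discrete_form\<close> after subtraction of the same expression
  for the exact data and the exact solution; Cauchy-Schwarz bounds it by the errors.\<close>

definition error_form :: "plane set \<Rightarrow> (plane \<Rightarrow> real) \<Rightarrow> real" where
  "error_form T v = (\<Sum>\<alpha>\<in>multi_upto 2. LINT x|lebesgue_on (interior T). (F \<alpha> T x - f \<alpha> x) * multi_partial \<alpha> v x)
     + (\<Sum>i\<in>UNIV. \<Sum>j\<in>UNIV. LINT x|lebesgue_on (interior T). (ddu i j x - partial i (partial j (uh T)) x) * partial i (partial j v) x)"

lemma F_smooth: "\<alpha> \<in> multi_upto 2 \<Longrightarrow> T \<in> \<T> \<Longrightarrow> smooth (F \<alpha> T)"
  by (rule tpoly_smooth[OF F_poly])

lemma smooth_product_integrable: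
  "T \<in> \<T> \<Longrightarrow> smooth p \<Longrightarrow> smooth q \<Longrightarrow> integrable (lebesgue_on (interior T)) (\<lambda>x. p x * q x)"
  by (intro L2_mult_integrable smooth_L2 interior_sets)

lemma discrete_form_minus_error:
  assumes T: "T \<in> \<T>" and v: "smooth v"
  shows "discrete_form T v = error_form T v + (\<Sum>\<alpha>\<in>multi_upto 2. LINT x|lebesgue_on (interior T). f \<alpha> x * multi_partial \<alpha> v x)
     - (\<Sum>i\<in>UNIV. \<Sum>j\<in>UNIV. LINT x|lebesgue_on (interior T). ddu i j x * partial i (partial j v) x)"
proof -
  have L: "w \<in> L2 (lebesgue_on (interior T))" if "smooth w" for w
    using that T by (intro smooth_L2 interior_sets)
  have 1: "(LINT x|lebesgue_on (interior T). (F \<alpha> T x - f \<alpha> x) * multi_partial \<alpha> v x) =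
     (LINT x|lebesgue_on (interior T). F \<alpha> T x * multi_partial \<alpha> v x) - (LINT x|lebesgue_on (interior T). f \<alpha> x * multi_partial \<alpha> v x)"
    if "\<alpha> \<in> multi_upto 2" for \<alpha>
    using L2_mult_integrable[OF L[OF F_smooth[OF that T]] L[OF smooth_multi_partial[OF v]]]
      L2_mult_integrable[OF L2_triangle[OF T f_L2[OF that]] L[OF smooth_multi_partial[OF v]]]
    by (simp add: left_diff_distrib)
  have 2: "(LINT x|lebesgue_on (interior T). (ddu i j x - partial i (partial j (uh T)) x) * partial i (partial j v) x) =
    (LINT x|lebesgue_on (interior T). ddu i j x * partial i (partial j v) x) - (LINT x|lebesgue_on (interior T). partial i (partial j (uh T)) x * partial i (partial j v) x)" for i j
    using L2_mult_integrable[OF L2_triangle[OF T ddu_L2] L[OF smooth_partial[OF smooth_partial[OF v]]]]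
      L2_mult_integrable[OF L[OF smooth_partial[OF smooth_partial[OF uh_smooth(2)[OF T]]]] L[OF smooth_partial[OF smooth_partial[OF v]]]]
    by (simp add: left_diff_distrib)
  show ?thesis unfolding discrete_form_def error_form_def by (simp add: 1 2 sum_subtractf)
qed

text \<open>The weak equation eliminates the volume terms of the exact problem, and of its
  right-hand side only the source on the edges survives.\<close>

theorem discrete_equation:
  assumes v: "v \<in> test_funs \<Omega>" "smooth_sym v" "\<And>z. z \<in> vertices \<T> \<Longrightarrow> v z = 0"
  shows "(\<Sum>T\<in>\<T>. discrete_form T v) = (\<Sum>T\<in>\<T>. error_form T v)
     - (\<Sum>j\<in>{0, 1}. \<Sum>E\<in>E\<Gamma> j. LINT x|edge_measure E. g j x * normal_partial j (\<nu> E) v x)"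
  using tested_equation[OF v] v(2)
  by (simp add: discrete_form_minus_error smooth_sym_def sum.distrib sum_subtractf)

lemma discrete_form_expand:
  assumes T: "T \<in> \<T>" and v: "smooth_sym v"
  shows "discrete_form T v = (LINT x|lebesgue_on (interior T). F (0,0) T x * v x)
     + (\<Sum>i\<in>UNIV. LINT x|lebesgue_on (interior T). F1 T i x * partial i v x)
     + (\<Sum>i\<in>UNIV. \<Sum>j\<in>UNIV. LINT x|lebesgue_on (interior T). stress T i j x * partial i (partial j v) x)"
proof -
  have sv: "smooth v" and sym: "partial 2 (partial 1 v) = partial 1 (partial 2 v)" using v by (auto simp: smooth_sym_def)
  let ?I = "\<lambda>h. LINT x|lebesgue_on (interior T). h x"
  have st: "?I (\<lambda>x. stress T i j x * partial i (partial j v) x) = ?I (\<lambda>x. M2 T i j x * partial i (partial j v) x)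
     - ?I (\<lambda>x. partial i (partial j (uh T)) x * partial i (partial j v) x)" for i j
    unfolding stress_def
    using smooth_product_integrable[OF T tpoly_smooth[OF M2_tpoly[OF T]] smooth_partial[OF smooth_partial[OF sv]]]
      smooth_product_integrable[OF T smooth_partial[OF smooth_partial[OF uh_smooth(2)[OF T]]] smooth_partial[OF smooth_partial[OF sv]]]
    by (simp add: left_diff_distrib)
  have half: "?I (\<lambda>x. F (1,1) T x / 2 * w x) = ?I (\<lambda>x. F (1,1) T x * w x) / 2" for w
    by (simp add: algebra_simps)
  show ?thesis
    unfolding discrete_form_def st
    by (simp add: multi_upto_2 multi_partial_simps sum_UNIV_2 F1_simps M2_simps sym half algebra_simps del: times_divide_eq_left
      flip: One_nat_def)
qed

lemma discrete_form_interior: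
  assumes T: "T \<in> \<T>" and v: "smooth_sym v" "v \<in> test_funs (interior T)"
  shows "discrete_form T v = (LINT x|lebesgue_on (interior T). residual T x * v x)"
proof -
  have sv: "smooth v" using v by (auto simp: smooth_sym_def)
  let ?I = "\<lambda>h. LINT x|lebesgue_on (interior T). h x"
  note ibp = integral_by_parts[OF _ _ interior_sets(2)]
  have 1: "?I (\<lambda>x. F1 T i x * partial i v x) = - ?I (\<lambda>x. partial i (F1 T i) x * v x)" for i
    by (rule ibp[OF tpoly_smooth[OF F1_tpoly[OF T]] v(2)])
  have 2: "?I (\<lambda>x. stress T i j x * partial i (partial j v) x) = ?I (\<lambda>x. partial j (partial i (M2 T i j)) x * v x)" for i j
  proof -
    have "?I (\<lambda>x. stress T i j x * partial i (partial j v) x) = - ?I (\<lambda>x. partial i (stress T i j) x * partial j v x)"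
      by (rule ibp[OF stress_smooth[OF T] test_funs_partial[OF v(2)]])
    also have "?I (\<lambda>x. partial i (stress T i j) x * partial j v x) = - ?I (\<lambda>x. partial j (partial i (stress T i j)) x * v x)"
      by (rule ibp[OF smooth_partial[OF stress_smooth[OF T]] v(2)])
    finally show ?thesis by (simp add: stress_partial[OF T])
  qed
  have int: "integrable (lebesgue_on (interior T)) (\<lambda>x. p x * v x)" if "smooth p" for p
    by (rule smooth_product_integrable[OF T that sv])
  have "?I (\<lambda>x. residual T x * v x) = ?I (\<lambda>x. F (0,0) T x * v x) - (\<Sum>i\<in>UNIV. ?I (\<lambda>x. partial i (F1 T i) x * v x))
      + (\<Sum>i\<in>UNIV. \<Sum>j\<in>UNIV. ?I (\<lambda>x. partial j (partial i (M2 T i j)) x * v x))"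
    unfolding residual_eq[OF T]
    using int[OF F_smooth[OF _ T, of "(0,0)"]] int[OF smooth_partial[OF tpoly_smooth[OF F1_tpoly[OF T]]]]
      int[OF smooth_partial[OF smooth_partial[OF tpoly_smooth[OF M2_tpoly[OF T]]]]]
    by (simp add: distrib_right left_diff_distrib sum_distrib_right)
  then show ?thesis unfolding discrete_form_expand[OF T v(1)] 1 2 by (simp add: sum_negf)
qed

text \<open>With outer normal \<sigma> times \<nu>, the shear is linear in the normal and takes the
  sign \<sigma>. The moment is quadratic in the normal and takes none, but the outer normal
  derivative of \<open>v\<close> supplies it. The opposite signs on the two sides later combine into
  jumps.\<close>

lemma discrete_form_side:
  assumes E: "E \<in> interior_edges \<Omega> \<T>" and \<sigma>: "\<sigma> = 1 \<or> \<sigma> = (-1::real)"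
    and v: "mesh_edge.admissible (\<sigma> *\<^sub>R \<nu> E) (side_of E \<sigma>) E v"
  shows "discrete_form (side_of E \<sigma>) v = (LINT x|lebesgue_on (interior (side_of E \<sigma>)). residual (side_of E \<sigma>) x * v x)
     + \<sigma> * (LINT s|lborel. shear E (side_of E \<sigma>) (edge_mid E + s *\<^sub>R \<tau> E) * v (edge_mid E + s *\<^sub>R \<tau> E))
     + \<sigma> * (LINT s|lborel. moment E (side_of E \<sigma>) (edge_mid E + s *\<^sub>R \<tau> E) * dderiv (\<nu> E) v (edge_mid E + s *\<^sub>R \<tau> E))"
proof -
  let ?T = "side_of E \<sigma>"
  interpret mesh_edge "\<tau> E" "\<sigma> *\<^sub>R \<nu> E" "side_of E \<sigma>" E
    unfolding mesh_edge_def using side_of_oriented[OF E \<sigma>] .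
  have T: "?T \<in> \<T>" using side_of[OF E \<sigma>] by simp
  have sv: "smooth_sym v" using v by (simp add: admissible_def)
  have ss: "\<sigma> * \<sigma> = 1" using \<sigma> by auto
  have dd: "moment E ?T x * dderiv (\<sigma> *\<^sub>R \<nu> E) v x = \<sigma> * (moment E ?T x * dderiv (\<nu> E) v x)" for x
    by (simp add: dderiv_def algebra_simps)
  have res: "F (0,0) ?T x - (\<Sum>i\<in>UNIV. partial i (F1 ?T i) x) + (\<Sum>i\<in>UNIV. \<Sum>j\<in>UNIV. partial j (partial i (stress ?T i j)) x) = residual ?T x" for x
    by (simp add: residual_eq[OF T] stress_partial[OF T])
  have sh: "(\<Sum>i\<in>UNIV. (\<sigma> *\<^sub>R \<nu> E) $ i * F1 ?T i x) - (\<Sum>i\<in>UNIV. \<Sum>j\<in>UNIV. (\<sigma> *\<^sub>R \<nu> E) $ j * partial i (stress ?T i j) x)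
         - (\<Sum>i\<in>UNIV. \<Sum>j\<in>UNIV. (\<sigma> *\<^sub>R \<nu> E) $ i * \<tau> E $ j * dderiv (\<tau> E) (stress ?T i j) x) = \<sigma> * shear E ?T x" for x
    by (simp add: shear_eq[OF T] stress_partial[OF T] sum_UNIV_2 algebra_simps)
  have mo: "(\<Sum>i\<in>UNIV. \<Sum>j\<in>UNIV. (\<sigma> *\<^sub>R \<nu> E) $ i * (\<sigma> *\<^sub>R \<nu> E) $ j * stress ?T i j x) = moment E ?T x" for x
  proof -
    have "(\<Sum>i\<in>UNIV. \<Sum>j\<in>UNIV. (\<sigma> *\<^sub>R \<nu> E) $ i * (\<sigma> *\<^sub>R \<nu> E) $ j * stress ?T i j x) = (\<sigma> * \<sigma>) * moment E ?T x"
      unfolding moment_eq[OF T] by (simp add: sum_UNIV_2 algebra_simps)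
    then show ?thesis by (simp add: ss)
  qed
  show ?thesis
    unfolding discrete_form_expand[OF T sv]
    apply (subst green_second_order[OF F_smooth[OF _ T] tpoly_smooth[OF F1_tpoly[OF T]] stress_smooth[OF T] v], simp)
    apply (simp only: res sh mo dd edge_line_integral_def)
    apply (simp only: mult.assoc Bochner_Integration.integral_mult_right_zero)
    done
qed

end


section \<open>Bounds for the local residuals\<close>

lemma L2_nrm_cmult: "L2_nrm M (\<lambda>x. c * h x) = \<bar>c\<bar> * L2_nrm M h" for h :: "_ \<Rightarrow> real"
  by (simp add: L2_nrm_def power_mult_distrib real_sqrt_mult)

lemma L2_nrm_minus_commute: "L2_nrm M (\<lambda>x. h x - k x) = L2_nrm M (\<lambda>x. k x - h x)" for h k :: "_ \<Rightarrow> real"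
  by (simp add: L2_nrm_def power2_commute)

text \<open>Points of the triangle have scaled coordinates of modulus at most \<open>L\<close>, so
  the coefficients control a polynomial on the whole triangle and not only on the square in which it
  is tested.\<close>

lemma abs_double_sum_le:
  fixes c :: "nat \<Rightarrow> nat \<Rightarrow> real"
  assumes "\<bar>y\<bar> \<le> L" "\<bar>z\<bar> \<le> L" "1 \<le> L"
  shows "\<bar>\<Sum>i\<le>N. \<Sum>j\<le>N. c i j * y ^ i * z ^ j\<bar> \<le> (\<Sum>i\<le>N. \<Sum>j\<le>N. \<bar>c i j\<bar>) * L ^ (2 * N)"
proof -
  have pw: "\<bar>w\<bar> ^ i \<le> L ^ N" if "\<bar>w\<bar> \<le> L" "i \<le> N" for w i
    using power_mono[OF that(1), of i] power_increasing[OF that(2) assms(3)] by simp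
  have "\<bar>\<Sum>i\<le>N. \<Sum>j\<le>N. c i j * y ^ i * z ^ j\<bar> \<le> (\<Sum>i\<le>N. \<Sum>j\<le>N. \<bar>c i j * y ^ i * z ^ j\<bar>)"
    by (rule order_trans[OF sum_abs], intro sum_mono, rule sum_abs)
  also have "\<dots> \<le> (\<Sum>i\<le>N. \<Sum>j\<le>N. \<bar>c i j\<bar> * L ^ (2 * N))"
  proof (intro sum_mono)
    fix i j assume "i \<in> {..N}" "j \<in> {..N}"
    then have "\<bar>y\<bar> ^ i * \<bar>z\<bar> ^ j \<le> L ^ N * L ^ N" using pw assms by (intro mult_mono) auto
    also have "\<dots> = L ^ (2 * N)" by (simp add: mult_2 power_add)
    finally show "\<bar>c i j * y ^ i * z ^ j\<bar> \<le> \<bar>c i j\<bar> * L ^ (2 * N)"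
      by (simp add: abs_mult power_abs mult.assoc mult_left_mono)
  qed
  finally show ?thesis by (simp add: sum_distrib_right)
qed

lemma abs_sum_le:
  fixes c :: "nat \<Rightarrow> real"
  assumes "\<bar>y\<bar> \<le> L" "1 \<le> L"
  shows "\<bar>\<Sum>i\<le>N. c i * y ^ i\<bar> \<le> (\<Sum>i\<le>N. \<bar>c i\<bar>) * L ^ N"
proof -
  have "\<bar>\<Sum>i\<le>N. c i * y ^ i\<bar> \<le> (\<Sum>i\<le>N. \<bar>c i * y ^ i\<bar>)" by (rule sum_abs)
  also have "\<dots> \<le> (\<Sum>i\<le>N. \<bar>c i\<bar> * L ^ N)"
  proof (rule sum_mono)
    fix i assume "i \<in> {..N}"
    then have "\<bar>y\<bar> ^ i \<le> L ^ N"
      using power_mono[OF assms(1), of i] power_increasing[of i N L] assms(2) by simp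
    then show "\<bar>c i * y ^ i\<bar> \<le> \<bar>c i\<bar> * L ^ N" by (simp add: abs_mult power_abs mult_left_mono)
  qed
  finally show ?thesis by (simp add: sum_distrib_right)
qed

context plate_problem
begin

definition energy_error :: "plane set \<Rightarrow> real" where
  "energy_error T = L2_nrm (lebesgue_on (interior T)) (weak_hessian (interior T) (\<lambda>x. u x - uh T x))"

definition data_error :: "nat \<times> nat \<Rightarrow> plane set \<Rightarrow> real" where
  "data_error \<alpha> T = L2_nrm (lebesgue_on T) (\<lambda>x. diameter T ^ (2 - (fst \<alpha> + snd \<alpha>)) * (f \<alpha> x - F \<alpha> T x))"

definition local_error :: "plane set \<Rightarrow> real" where
  "local_error T = energy_error T + (\<Sum>\<alpha>\<in>multi_upto 2. data_error \<alpha> T)"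

lemma local_error_nonneg: "0 \<le> local_error T" "0 \<le> data_error \<alpha> T" "0 \<le> energy_error T"
  by (simp_all add: local_error_def energy_error_def data_error_def L2_nrm_nonneg sum_nonneg)

lemma weak_hessian_square:
  "(norm (weak_hessian U w x))\<^sup>2 = (\<Sum>i\<in>UNIV. \<Sum>j\<in>UNIV. (weak_deriv U (unit_multi i + unit_multi j) w x)\<^sup>2)"
  unfolding power2_norm_eq_inner by (simp add: inner_vec_def weak_hessian_def power2_eq_square)

lemma weak_hessian_error_integrable:
  assumes T: "T \<in> \<T>"
  shows "integrable (lebesgue_on (interior T)) (\<lambda>x. (norm (weak_hessian (interior T) (\<lambda>x. u x - uh T x) x))\<^sup>2)"
  unfolding weak_hessian_square
  by (intro Bochner_Integration.integrable_sum L2_integrable weak_hessian_error(2) T)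

lemma hessian_error_le:
  assumes T: "T \<in> \<T>"
  shows "L2_nrm (lebesgue_on (interior T)) (\<lambda>x. ddu i j x - partial i (partial j (uh T)) x) \<le> energy_error T"
proof -
  let ?w = "\<lambda>i j. weak_deriv (interior T) (unit_multi i + unit_multi j) (\<lambda>x. u x - uh T x)"
  have "L2_nrm (lebesgue_on (interior T)) (\<lambda>x. ddu i j x - partial i (partial j (uh T)) x) = L2_nrm (lebesgue_on (interior T)) (?w i j)"
    using weak_hessian_error(1)[OF T, of i j]
    by (intro L2_nrm_cong_AE L2_measurable weak_hessian_error(2,3) T) auto
  also have "\<dots> \<le> energy_error T"
    unfolding energy_error_def L2_nrm_def
  proof (intro real_sqrt_le_mono integral_mono weak_hessian_error_integrable T)
    show "integrable (lebesgue_on (interior T)) (\<lambda>x. (norm (?w i j x))\<^sup>2)"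
      using L2_integrable[OF weak_hessian_error(2)[OF T]] by simp
    fix x
    have "(?w i j x)\<^sup>2 \<le> (\<Sum>j\<in>UNIV. (?w i j x)\<^sup>2)" by (intro member_le_sum) auto
    also have "\<dots> \<le> (\<Sum>i\<in>UNIV. \<Sum>j\<in>UNIV. (?w i j x)\<^sup>2)"
      by (intro member_le_sum[where f = "\<lambda>i. \<Sum>j\<in>UNIV. (?w i j x)\<^sup>2"] sum_nonneg) auto
    finally show "(norm (?w i j x))\<^sup>2 \<le> (norm (weak_hessian (interior T) (\<lambda>x. u x - uh T x) x))\<^sup>2"
      by (simp add: weak_hessian_square)
  qed
  finally show ?thesis .
qed

text \<open>Cauchy-Schwarz on T, with the area bounded by the square of twice the diameter. In a
  data term of order n the factor \<rho>^(2 - n) is absorbed by the weight of the data error, as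
  \<rho> is at most the diameter. The four entries of the Hessian turn the factor 2 into 8.\<close>

lemma error_form_bound:
  assumes T: "T \<in> \<T>" and v: "smooth_sym v" and \<rho>: "0 < \<rho>" "\<rho> \<le> diameter T" and D: "0 \<le> D"
    and bd: "\<And>\<alpha> x. \<alpha> \<in> multi_upto 2 \<Longrightarrow> \<bar>multi_partial \<alpha> v x\<bar> \<le> D / \<rho> ^ (fst \<alpha> + snd \<alpha>)"
  shows "\<bar>error_form T v\<bar> \<le> (8 * diameter T * D / \<rho>\<^sup>2) * local_error T"
proof -
  let ?U = "lebesgue_on (interior T)" and ?h = "diameter T"
  define Q where "Q = 2 * ?h * D / \<rho>\<^sup>2"
  have Q: "0 \<le> Q" using \<rho> D by (simp add: Q_def)
  have sv: "smooth v" using v by (simp add: smooth_sym_def)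
  have vn: "L2_nrm ?U (multi_partial \<alpha> v) \<le> (D / \<rho> ^ (fst \<alpha> + snd \<alpha>)) * (2 * ?h)" if "\<alpha> \<in> multi_upto 2" for \<alpha>
    using bd[OF that] D \<rho> by (intro triangle_bounded_L2 triangles T smooth_multi_partial sv) auto
  have vL: "multi_partial \<alpha> v \<in> L2 ?U" for \<alpha>
    by (intro smooth_L2 smooth_multi_partial sv interior_sets T)
  have 1: "\<bar>LINT x|?U. (F \<alpha> T x - f \<alpha> x) * multi_partial \<alpha> v x\<bar> \<le> Q * data_error \<alpha> T" if \<alpha>: "\<alpha> \<in> multi_upto 2" for \<alpha>
  proof -
    let ?n = "fst \<alpha> + snd \<alpha>"
    have n: "?n \<le> 2" using \<alpha> by simp
    have FL: "(\<lambda>x. F \<alpha> T x - f \<alpha> x) \<in> L2 ?U"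
      by (intro L2_diff L2_triangle[OF T f_L2[OF \<alpha>]] smooth_L2 F_smooth \<alpha> T interior_sets)
    define e where "e = L2_nrm ?U (\<lambda>x. F \<alpha> T x - f \<alpha> x)"
    have e0: "0 \<le> e" by (simp add: e_def L2_nrm_nonneg)
    have de: "data_error \<alpha> T = ?h ^ (2 - ?n) * e"
    proof -
      have "data_error \<alpha> T = ?h ^ (2 - ?n) * L2_nrm (lebesgue_on T) (\<lambda>x. F \<alpha> T x - f \<alpha> x)"
        unfolding data_error_def L2_nrm_cmult using \<rho> by (simp add: L2_nrm_minus_commute)
      then show ?thesis unfolding e_def
        by (simp add: L2_nrm_triangle_interior[OF triangles[OF T] L2_measurable[OF FL]])
    qed
    have "\<bar>LINT x|?U. (F \<alpha> T x - f \<alpha> x) * multi_partial \<alpha> v x\<bar> \<le> e * L2_nrm ?U (multi_partial \<alpha> v)"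
      unfolding e_def by (rule L2_CS[OF FL vL])
    also have "\<dots> \<le> e * ((D / \<rho> ^ ?n) * (2 * ?h))" by (intro mult_left_mono vn \<alpha> e0)
    also have "\<dots> = Q * (\<rho> ^ (2 - ?n) * e)"
    proof -
      have "\<rho>\<^sup>2 = \<rho> ^ ?n * \<rho> ^ (2 - ?n)" using n by (simp flip: power_add)
      then show ?thesis using \<rho> by (simp add: Q_def field_simps)
    qed
    also have "\<dots> \<le> Q * (?h ^ (2 - ?n) * e)"
      using \<rho> Q e0 by (intro mult_left_mono mult_right_mono power_mono) auto
    finally show ?thesis by (simp add: de)
  qed
  have 2: "\<bar>LINT x|?U. (ddu i j x - partial i (partial j (uh T)) x) * partial i (partial j v) x\<bar> \<le> Q * energy_error T" for i j
  proof -
    have m: "multi_partial (unit_multi i + unit_multi j) v = partial i (partial j v)" by (rule unit_multi_sum[OF v])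
    have d: "fst (unit_multi i + unit_multi j) + snd (unit_multi i + unit_multi j) = 2" by (auto simp: unit_multi_def)
    have "\<bar>LINT x|?U. (ddu i j x - partial i (partial j (uh T)) x) * partial i (partial j v) x\<bar>
      \<le> L2_nrm ?U (\<lambda>x. ddu i j x - partial i (partial j (uh T)) x) * L2_nrm ?U (partial i (partial j v))"
      using vL[of "unit_multi i + unit_multi j"] by (intro L2_CS weak_hessian_error(3) T) (simp add: m)
    also have "\<dots> \<le> energy_error T * ((D / \<rho>\<^sup>2) * (2 * ?h))"
    proof (intro mult_mono hessian_error_le T local_error_nonneg L2_nrm_nonneg)
      show "L2_nrm ?U (partial i (partial j v)) \<le> (D / \<rho>\<^sup>2) * (2 * ?h)"
        using vn[OF unit_multi_upto(1)[of i j]] by (simp only: m d)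
    qed
    finally show ?thesis by (simp add: Q_def mult_ac)
  qed
  have "\<bar>error_form T v\<bar> \<le> (\<Sum>\<alpha>\<in>multi_upto 2. \<bar>LINT x|?U. (F \<alpha> T x - f \<alpha> x) * multi_partial \<alpha> v x\<bar>)
     + (\<Sum>i\<in>UNIV. \<Sum>j\<in>UNIV. \<bar>LINT x|?U. (ddu i j x - partial i (partial j (uh T)) x) * partial i (partial j v) x\<bar>)"
    unfolding error_form_def
    by (intro order_trans[OF abs_triangle_ineq] add_mono sum_abs) (rule order_trans[OF sum_abs], intro sum_mono, rule sum_abs)
  also have "\<dots> \<le> (\<Sum>\<alpha>\<in>multi_upto 2. Q * data_error \<alpha> T) + (\<Sum>i\<in>(UNIV::2 set). \<Sum>j\<in>(UNIV::2 set). Q * energy_error T)"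
    by (intro add_mono sum_mono 1 2) auto
  also have "\<dots> = Q * (\<Sum>\<alpha>\<in>multi_upto 2. data_error \<alpha> T) + 4 * Q * energy_error T"
    by (simp add: sum_distrib_left[symmetric] sum_UNIV_2)
  also have "\<dots> \<le> 4 * Q * (\<Sum>\<alpha>\<in>multi_upto 2. data_error \<alpha> T) + 4 * Q * energy_error T"
    using Q local_error_nonneg by (intro add_right_mono mult_right_mono sum_nonneg) auto
  also have "\<dots> = (8 * ?h * D / \<rho>\<^sup>2) * local_error T" by (simp add: Q_def local_error_def algebra_simps)
  finally show ?thesis .
qed

lemma forms_vanish:
  assumes "\<And>\<alpha> x. \<alpha> \<in> multi_upto 2 \<Longrightarrow> x \<in> interior T \<Longrightarrow> multi_partial \<alpha> v x = 0" "smooth_sym v"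
  shows "discrete_form T v = 0" "error_form T v = 0"
proof -
  have 1: "(LINT x|lebesgue_on (interior T). h x * multi_partial \<alpha> v x) = 0" if "\<alpha> \<in> multi_upto 2" for h \<alpha>
  proof -
    have "(LINT x|lebesgue_on (interior T). h x * multi_partial \<alpha> v x) = (LINT x|lebesgue_on (interior T). 0)"
      by (rule Bochner_Integration.integral_cong) (use assms(1)[OF that] in auto)
    then show ?thesis by simp
  qed
  have 2: "(LINT x|lebesgue_on (interior T). h x * partial i (partial j v) x) = 0" for h i j
    using 1[OF unit_multi_upto(1), of h i j] by (simp add: unit_multi_sum[OF assms(2)])
  show "discrete_form T v = 0" "error_form T v = 0"
    unfolding discrete_form_def error_form_def by (simp_all add: 1 2)
qed

lemma normal_partial_vanish:
  assumes "\<And>\<alpha>. \<alpha> \<in> multi_upto 2 \<Longrightarrow> multi_partial \<alpha> v x = 0"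
  shows "normal_partial j n v x = 0"
  using assms[of "(0,0)"] assms[of "(1,0)"] assms[of "(0,1)"]
  by (auto simp: normal_partial_def dderiv_def multi_partial_simps)

text \<open>With \<open>S\<close> the sum of the scaled coefficients in modulus, the tested integral
  is at least \<rho>^2 \<delta> S^2, and the error form is at most a constant times S / \<rho> times
  the local error, so \<rho>^3 S is controlled. The norm of the residual is at most a constant times
  S times the diameter h, and h \<le> L \<rho> closes the estimate.\<close>

theorem interior_residual_bound:
  assumes T: "T \<in> \<T>" and r: "r > 0" "cball x0 r \<subseteq> T" "diameter T \<le> K * r" and L: "1 \<le> L" "2 * K \<le> L"
    and N: "2 \<le> N" "k \<le> N" and B: "\<forall>i\<le>N. \<forall>n\<le>N. \<forall>y. \<bar>(deriv ^^ n) (bump_pow i) y\<bar> \<le> B"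
    and \<delta>: "\<delta> > 0" "\<And>c. \<delta> * (\<Sum>i\<le>N. \<Sum>j\<le>N. \<bar>c i j\<bar>)\<^sup>2
      \<le> (LINT s|lborel. LINT t|lborel. (\<Sum>i\<le>N. \<Sum>j\<le>N. c i j * s ^ i * t ^ j)\<^sup>2 * (bump s * bump t))"
  shows "(diameter T)\<^sup>2 * L2_nrm (lebesgue_on (interior T)) (residual T) \<le> (64 * L ^ (2 * N + 4) * B\<^sup>2 / \<delta>) * local_error T"
proof -
  let ?h = "diameter T" and ?U = "lebesgue_on (interior T)"
  \<comment> \<open>The square with half-side r / 2 lies inside the ball of radius r.\<close>
  define \<rho> where "\<rho> = r / 2"
  have \<rho>0: "\<rho> > 0" using r by (simp add: \<rho>_def)
  note Tp = triangle_props[OF triangles[OF T]]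
  have hL: "?h \<le> L * \<rho>"
  proof -
    have "?h \<le> (2 * K) * \<rho>" using r(3) by (simp add: \<rho>_def)
    also have "\<dots> \<le> L * \<rho>" using L \<rho>0 by (intro mult_right_mono) auto
    finally show ?thesis .
  qed
  have \<rho>h: "\<rho> \<le> ?h"
  proof -
    have "dist x0 (x0 + r *\<^sub>R axis 1 1) \<le> ?h"
      using r Tp(4) by (intro diameter_bounded_bound) (auto intro!: subsetD[OF r(2)] simp: dist_norm)
    then show ?thesis using r by (simp add: dist_norm \<rho>_def)
  qed
  have h0: "?h > 0" using \<rho>h \<rho>0 by linarith
  have xT: "x0 \<in> T" using r by auto
  obtain c where c: "\<And>x. residual T x = (\<Sum>i\<le>N. \<Sum>j\<le>N. c i j * ((x $ 1 - x0 $ 1) / \<rho>) ^ i * ((x $ 2 - x0 $ 2) / \<rho>) ^ j)"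
    using tpoly_scaled_coeffs[OF tpoly_mono[OF residual_tpoly[OF T] N(2)], of \<rho> x0] \<rho>0 by auto
  define S where "S = (\<Sum>i\<le>N. \<Sum>j\<le>N. \<bar>c i j\<bar>)"
  have S0: "0 \<le> S" by (simp add: S_def sum_nonneg)
  \<comment> \<open>With the coefficients of the residual itself, \<open>v\<close> is the residual
    times the product weight. No direction is distinguished inside a triangle, so the coordinate
    axes serve as the frame.\<close>
  define v where "v = standard_frame.test_fun x0 \<rho> N c 0 0"
  have co: "(x - x0) \<bullet> axis 1 1 = x $ 1 - x0 $ 1" "(x - x0) \<bullet> axis 2 1 = x $ 2 - x0 $ 2" for x :: plane
    by (simp_all add: inner_axis)
  have square: "x \<in> interior T" if "\<bar>(x - x0) \<bullet> axis 1 1\<bar> \<le> \<rho>" "\<bar>(x - x0) \<bullet> axis 2 1\<bar> \<le> \<rho>" for x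
  proof -
    have "(norm (x - x0))\<^sup>2 = ((x - x0) \<bullet> axis 1 1)\<^sup>2 + ((x - x0) \<bullet> axis 2 1)\<^sup>2"
      unfolding co power2_norm_eq_inner by (simp add: inner_plane power2_eq_square)
    also have "\<dots> \<le> \<rho>\<^sup>2 + \<rho>\<^sup>2" using that \<rho>0 by (intro add_mono) (auto simp: abs_le_square_iff[symmetric])
    also have "\<dots> < r\<^sup>2" using r(1) by (simp add: \<rho>_def power2_eq_square)
    finally have "norm (x - x0) < r" using r(1) by (simp add: power2_less_imp_less)
    then have "x \<in> ball x0 r" by (simp add: dist_norm norm_minus_commute)
    moreover have "ball x0 r \<subseteq> interior T" using r(2) ball_subset_cball by (intro interior_maximal) auto
    ultimately show ?thesis by blast
  qed
  have vT: "v \<in> test_funs (interior T)"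
    unfolding v_def using square by (intro standard_frame.test_fun_test_funs[OF \<rho>0]) auto
  then have v\<Omega>: "v \<in> test_funs \<Omega>" using interior_subset_domain[OF T] by (rule test_funs_mono)
  have vs: "smooth_sym v" unfolding v_def by (rule standard_frame.smooth_sym_test_fun)
  have sv: "smooth v" using vs by (simp add: smooth_sym_def)
  have out: "multi_partial \<alpha> v x = 0" if "\<alpha> \<in> multi_upto 2" "x \<notin> interior T" for \<alpha> x
    unfolding v_def using square[of x] that(2)
    by (intro standard_frame.multi_partial_test_fun_zero[OF \<rho>0 that(1)]) linarith
  have out0: "v x = 0" if "x \<notin> interior T" for x using out[OF _ that, of "(0,0)"] by (simp add: multi_partial_simps)
  \<comment> \<open>The support lies in the open triangle, so the sums over the mesh reduce to T and
    the edge sources contribute 0.\<close>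
  have eq: "discrete_form T v = error_form T v"
  proof -
    have "(\<Sum>T'\<in>\<T>. discrete_form T' v) = (\<Sum>T'\<in>\<T>. error_form T' v)
       - (\<Sum>j\<in>{0, 1}. \<Sum>E\<in>E\<Gamma> j. LINT x|edge_measure E. g j x * normal_partial j (\<nu> E) v x)"
      by (rule discrete_equation[OF v\<Omega> vs]) (use out0 vertex_not_in_interior[OF T] in blast)
    moreover have "(LINT x|edge_measure E. g j x * normal_partial j (\<nu> E) v x) = 0" if "j \<in> {0, 1}" "E \<in> E\<Gamma> j" for j E
    proof -
      have E: "E \<in> interior_edges \<Omega> \<T>" using that E\<Gamma> by blast
      interpret mesh_edge "\<tau> E" "1 *\<^sub>R \<nu> E" "side_of E 1" E
        unfolding mesh_edge_def by (rule side_of_oriented[OF E]) simp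
      have "normal_partial j (\<nu> E) v x = 0" if "x \<in> E" for x
      proof (rule normal_partial_vanish[OF out])
        show "x \<notin> interior T"
          using edge_disjoint_interior[OF T side_of(1)[OF E, of 1] side_of(2)[OF E, of 1]] that by auto
      qed auto
      then have "(LINT x|edge_measure E. g j x * normal_partial j (\<nu> E) v x) = (LINT x|edge_measure E. 0)"
        by (intro Bochner_Integration.integral_cong refl) (simp add: space_edge_measure)
      then show ?thesis by simp
    qed
    moreover have "(\<Sum>T'\<in>\<T>. discrete_form T' v) = (\<Sum>T'\<in>{T}. discrete_form T' v)"
      "(\<Sum>T'\<in>\<T>. error_form T' v) = (\<Sum>T'\<in>{T}. error_form T' v)"
    proof -
      have z: "discrete_form T' v = 0 \<and> error_form T' v = 0" if "T' \<in> \<T> - {T}" for T'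
      proof -
        have "x \<notin> interior T" if "x \<in> interior T'" for x
          using interiors_unique[OF T, of T' x] that \<open>T' \<in> \<T> - {T}\<close> by blast
        then show ?thesis using forms_vanish[OF out vs] by blast
      qed
      show "(\<Sum>T'\<in>\<T>. discrete_form T' v) = (\<Sum>T'\<in>{T}. discrete_form T' v)"
        "(\<Sum>T'\<in>\<T>. error_form T' v) = (\<Sum>T'\<in>{T}. error_form T' v)"
        using z T finite_mesh by (intro sum.mono_neutral_right; auto)+
    qed
    ultimately show ?thesis by simp
  qed
  have low: "\<rho>\<^sup>2 * (\<delta> * S\<^sup>2) \<le> discrete_form T v"
  proof -
    let ?q = "\<lambda>s t. (\<Sum>i\<le>N. \<Sum>j\<le>N. c i j * s ^ i * t ^ j)\<^sup>2 * (bump s * bump t)"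
    have rv: "residual T x * v x = ?q ((x $ 1 - x0 $ 1) / \<rho>) ((x $ 2 - x0 $ 2) / \<rho>)" for x
    proof -
      have "v x = (\<Sum>i\<le>N. \<Sum>j\<le>N. c i j * ((x $ 1 - x0 $ 1) / \<rho>) ^ i * ((x $ 2 - x0 $ 2) / \<rho>) ^ j)
          * (bump ((x $ 1 - x0 $ 1) / \<rho>) * bump ((x $ 2 - x0 $ 2) / \<rho>))"
        unfolding v_def standard_frame.test_fun_def co sum_distrib_right
        by (intro sum.cong refl) (simp add: bump_pow_def)
      then show ?thesis by (simp add: c power2_eq_square mult.assoc)
    qed
    have m: "(\<lambda>x. residual T x * v x) \<in> borel_measurable borel"
      by (intro smooth_measurable smooth_mult tpoly_smooth[OF residual_tpoly[OF T]] sv)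
    have "discrete_form T v = (LINT x|lborel. residual T x * v x)"
      unfolding discrete_form_interior[OF T vs vT]
      using out0 by (intro lebesgue_on_integral_lborel interior_sets T m) auto
    also have "\<dots> = (LINT s|lborel. LINT t|lborel. residual T (chart x0 (axis 1 1) (axis 2 1) (s, t)) * v (chart x0 (axis 1 1) (axis 2 1) (s, t)))"
    proof -
      obtain R where R: "\<And>x. norm x > R \<Longrightarrow> v x = 0" using test_funs_bounded_support[OF vT] by blast
      have z: "norm x > R \<Longrightarrow> residual T x * v x = 0" for x using R by simp
      obtain b where b: "\<And>x. \<bar>residual T x * v x\<bar> \<le> b"
        by (rule bounded_support_bounded[OF smooth_continuous[OF smooth_mult[OF tpoly_smooth[OF residual_tpoly[OF T]] sv]] z]) auto
      have z': "residual T x * v x = 0" if "norm (x - x0) > R + norm x0" for x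
        using that norm_triangle_ineq4[of x x0] by (intro z) linarith
      show ?thesis by (rule standard_frame.chart_integral_iterated(1)[OF m b z'])
    qed
    also have "\<dots> = (LINT s|lborel. LINT t|lborel. ?q (s / \<rho>) (t / \<rho>))"
      unfolding rv by (simp add: chart_def axis_def)
    also have "\<dots> = (LINT s|lborel. \<rho> * (LINT t|lborel. ?q (s / \<rho>) t))"
      using integral_scale[OF \<rho>0, of "\<lambda>t. ?q (_ / \<rho>) t"] by simp
    also have "\<dots> = \<rho> * (\<rho> * (LINT s|lborel. LINT t|lborel. ?q s t))"
      using integral_scale[OF \<rho>0, of "\<lambda>s. LINT t|lborel. ?q s t"] by simp
    also have "\<dots> \<ge> \<rho> * (\<rho> * (\<delta> * S\<^sup>2))"
      using \<delta>(2)[of c] \<rho>0 by (simp add: S_def)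
    finally show ?thesis by (simp add: power2_eq_square mult.assoc)
  qed
  have up: "\<bar>error_form T v\<bar> \<le> (8 * ?h * (4 * B\<^sup>2 * S) / \<rho>\<^sup>2) * local_error T"
    using standard_frame.test_fun_derivative_bound[OF B N(1) \<rho>0, of _ x0 c] S0
    by (intro error_form_bound T vs \<rho>0 \<rho>h) (auto simp: v_def S_def)
  have key: "\<rho> ^ 3 * S \<le> (32 * L * B\<^sup>2 / \<delta>) * local_error T"
  proof (cases "S = 0")
    case True
    then show ?thesis using local_error_nonneg(1)[of T] L \<delta>(1) by simp
  next
    case False
    then have Sp: "S > 0" using S0 by simp
    have "\<rho>\<^sup>2 * (\<delta> * S\<^sup>2) \<le> (8 * ?h * (4 * B\<^sup>2 * S) / \<rho>\<^sup>2) * local_error T" using low up eq by linarith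
    also have "\<dots> = ?h * (32 * B\<^sup>2 * S / \<rho>\<^sup>2 * local_error T)" by simp
    also have "\<dots> \<le> (L * \<rho>) * (32 * B\<^sup>2 * S / \<rho>\<^sup>2 * local_error T)"
      using hL S0 local_error_nonneg by (intro mult_right_mono) auto
    also have "\<dots> = (32 * L * B\<^sup>2 * local_error T) * (S / \<rho>)" using \<rho>0 by (simp add: power2_eq_square)
    finally have "(\<rho> ^ 3 * S * \<delta>) * (S / \<rho>) \<le> (32 * L * B\<^sup>2 * local_error T) * (S / \<rho>)"
      using \<rho>0 by (simp add: power2_eq_square power3_eq_cube mult_ac)
    then have "\<rho> ^ 3 * S * \<delta> \<le> 32 * L * B\<^sup>2 * local_error T"
      by (rule mult_right_le_imp_le) (use Sp \<rho>0 in simp)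
    then show ?thesis using \<delta>(1) by (simp add: field_simps)
  qed
  have rn: "L2_nrm ?U (residual T) \<le> (S * L ^ (2 * N)) * (2 * ?h)"
  proof (rule triangle_bounded_L2[OF triangles[OF T] tpoly_smooth[OF residual_tpoly[OF T]]])
    fix x assume "x \<in> interior T"
    then have "dist x x0 \<le> ?h" using xT Tp(4) interior_subset by (intro diameter_bounded_bound) auto
    then have "\<bar>x $ i - x0 $ i\<bar> \<le> L * \<rho>" for i
      using component_le_norm_cart[of "x - x0" i] hL by (simp add: dist_norm)
    then have "\<bar>(x $ i - x0 $ i) / \<rho>\<bar> \<le> L" for i using \<rho>0 by (simp add: field_simps)
    then show "\<bar>residual T x\<bar> \<le> S * L ^ (2 * N)" unfolding c S_def by (intro abs_double_sum_le L)
  qed (use S0 L in auto)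
  have "?h\<^sup>2 * L2_nrm ?U (residual T) \<le> ?h\<^sup>2 * ((S * L ^ (2 * N)) * (2 * ?h))" by (intro mult_left_mono rn) simp
  also have "\<dots> = ?h ^ 3 * (2 * S * L ^ (2 * N))" by (simp add: power2_eq_square power3_eq_cube)
  also have "\<dots> \<le> (L * \<rho>) ^ 3 * (2 * S * L ^ (2 * N))"
    using hL h0 S0 L by (intro mult_right_mono power_mono) auto
  also have "\<dots> = (2 * L ^ (2 * N + 3)) * (\<rho> ^ 3 * S)" by (simp add: power_mult_distrib power_add mult_ac)
  also have "\<dots> \<le> (2 * L ^ (2 * N + 3)) * ((32 * L * B\<^sup>2 / \<delta>) * local_error T)"
    using key L by (intro mult_left_mono) auto
  also have "\<dots> = (64 * L ^ (2 * N + 4) * B\<^sup>2 / \<delta>) * local_error T"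
    by (simp add: power_add eval_nat_numeral)
  finally show ?thesis .
qed

end


section \<open>Residuals on interior edges\<close>

context plate_problem
begin

text \<open>The index \<open>j\<close> is the order of the normal derivative with which the density
  is paired: the shear goes with the trace, the moment with the normal derivative. One argument then
  serves both edge residuals.\<close>

definition edge_density :: "nat \<Rightarrow> plane set \<Rightarrow> plane set \<Rightarrow> plane \<Rightarrow> real" where
  "edge_density j E T = (if j = 0 then shear E T else moment E T)"

definition edge_residual :: "nat \<Rightarrow> plane set \<Rightarrow> plane \<Rightarrow> real" where
  "edge_residual j E x = ext_zero (E\<Gamma> j) (G j) E x + (edge_density j E (side_of E 1) x - edge_density j E (side_of E (-1)) x)"

definition edge_data_error :: "nat \<Rightarrow> plane set \<Rightarrow> real" where
  "edge_data_error j E = (if E \<in> E\<Gamma> j then L2_nrm (edge_measure E) (\<lambda>x. diameter E powr (3/2 - real j) * (g j x - G j x)) else 0)"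

lemma edge_density_tpoly: "T \<in> \<T> \<Longrightarrow> edge_density j E T \<in> tpoly (k + 2)"
  unfolding edge_density_def by (cases "j = 0") (simp_all only: if_True if_False refl moment_tpoly tpoly_mono[OF shear_tpoly le_add1])

lemma edge_data_tpoly:
  assumes j: "j = 0 \<or> j = 1"
  obtains pG where "pG \<in> tpoly (k + 2)" "E \<in> E\<Gamma> j \<Longrightarrow> \<forall>x\<in>rel_interior E. G j x = pG x"
proof (cases "E \<in> E\<Gamma> j")
  case True
  then obtain p where "p \<in> poly_funs k" "\<forall>x\<in>rel_interior E. G j x = p x"
    using G[of j] j unfolding edgewise_poly_def by auto
  then show ?thesis using that[of p] poly_funs_tpoly by simp
next
  case False
  then show ?thesis using that[OF tpoly_zero] by simp
qed

lemma edge_density_form: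
  assumes E: "E \<in> interior_edges \<Omega> \<T>" and \<sigma>: "\<sigma> = 1 \<or> \<sigma> = (-1::real)" and j: "j = 0 \<or> j = 1"
    and v: "mesh_edge.admissible (\<sigma> *\<^sub>R \<nu> E) (side_of E \<sigma>) E v"
    and other: "\<And>l s. l \<noteq> j \<Longrightarrow> l = 0 \<or> l = 1 \<Longrightarrow> normal_partial l (\<nu> E) v (edge_mid E + s *\<^sub>R \<tau> E) = 0"
  shows "discrete_form (side_of E \<sigma>) v = (LINT x|lebesgue_on (interior (side_of E \<sigma>)). residual (side_of E \<sigma>) x * v x)
     + \<sigma> * (LINT s|lborel. edge_density j E (side_of E \<sigma>) (edge_mid E + s *\<^sub>R \<tau> E) * normal_partial j (\<nu> E) v (edge_mid E + s *\<^sub>R \<tau> E))"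
proof (cases "j = 0")
  case True
  have "dderiv (\<nu> E) v (edge_mid E + s *\<^sub>R \<tau> E) = 0" for s
    using other[of 1 s] True by (simp add: normal_partial_def)
  then show ?thesis using discrete_form_side[OF E \<sigma> v] True by (simp add: edge_density_def normal_partial_def)
next
  case False
  then have "v (edge_mid E + s *\<^sub>R \<tau> E) = 0" for s
    using other[of 0 s] by (simp add: normal_partial_def)
  then show ?thesis using discrete_form_side[OF E \<sigma> v] False j by (simp add: edge_density_def normal_partial_def)
qed

text \<open>Within the patch, and in the strip over the open edge, the half-plane decides the
  triangle. This gives \<open>admissible\<close> for either side.\<close>

lemma region_side:
  assumes E: "E \<in> interior_edges \<Omega> \<T>" and \<sigma>: "\<sigma> = 1 \<or> \<sigma> = (-1::real)" and x: "x \<in> edge_region E"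
    and h: "(x - edge_mid E) \<bullet> (\<sigma> *\<^sub>R \<nu> E) \<le> 0" "\<bar>(x - edge_mid E) \<bullet> \<tau> E\<bar> < diameter E / 2"
  shows "x \<in> side_of E \<sigma>"
proof (rule ccontr)
  assume nx: "x \<notin> side_of E \<sigma>"
  have m\<sigma>: "- \<sigma> = 1 \<or> - \<sigma> = (-1::real)" using \<sigma> by auto
  interpret A: oriented_edge "\<tau> E" "\<sigma> *\<^sub>R \<nu> E" "side_of E \<sigma>" E "edge_mid E" "diameter E" by (rule side_of_oriented[OF E \<sigma>])
  interpret B: oriented_edge "\<tau> E" "(- \<sigma>) *\<^sub>R \<nu> E" "side_of E (- \<sigma>)" E "edge_mid E" "diameter E" by (rule side_of_oriented[OF E m\<sigma>])
  have nE: "x \<notin> rel_interior E" using nx A.E_subset rel_interior_subset by blast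
  then have "(x - edge_mid E) \<bullet> (\<sigma> *\<^sub>R \<nu> E) \<noteq> 0" using A.mem_rel_interior_edge h(2) by blast
  then have neg: "(x - edge_mid E) \<bullet> (\<sigma> *\<^sub>R \<nu> E) < 0" using h(1) by (rule le_neq_trans[rotated])
  have "x \<in> interior (side_of E (- \<sigma>))"
    using x nE nx \<sigma> interior_subset by (auto simp: edge_region_def)
  then have "x \<in> half_plane ((- \<sigma>) *\<^sub>R \<nu> E) (edge_mid E)" using B.side interior_subset by blast
  then have "(x - edge_mid E) \<bullet> ((- \<sigma>) *\<^sub>R \<nu> E) \<le> 0" by (simp add: half_plane_def)
  then show False using neg by simp
qed

text \<open>On the edge, of the trace and the normal derivative of the test function only the one of
  order \<open>j\<close> survives, and it is the residual polynomial times a weight. With t =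
  \<rho>^(j - 1), testing bounds \<rho> S^2 by t S times the errors, where the volume residual is
  controlled through \<open>C1\<close>. The powers match because d^(2 - j) is comparable to \<rho> /
  t for the edge length d.\<close>

theorem edge_residual_bound:
  assumes E: "E \<in> interior_edges \<Omega> \<T>" and j: "j = 0 \<or> j = 1" and K: "1 \<le> K"
    and ball: "\<And>T. T \<in> \<T> \<Longrightarrow> \<exists>x r. r > 0 \<and> cball x r \<subseteq> T \<and> diameter T \<le> K * r"
    and L: "8 * K\<^sup>2 \<le> L"
    and N: "2 * k + 4 \<le> N" and B: "1 \<le> B" "\<forall>i\<le>N. \<forall>n\<le>N. \<forall>y. \<bar>(deriv ^^ n) (bump_pow i) y\<bar> \<le> B"
    and \<delta>: "\<delta> > 0" "\<And>c. \<delta> * (\<Sum>i\<le>N. \<bar>c i\<bar>)\<^sup>2 \<le> (LINT y|lborel. (\<Sum>i\<le>N. c i * y ^ i)\<^sup>2 * bump y)"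
    and C1: "0 \<le> C1" "\<And>T. T \<in> \<T> \<Longrightarrow> (diameter T)\<^sup>2 * L2_nrm (lebesgue_on (interior T)) (residual T) \<le> C1 * local_error T"
  shows "diameter E ^ (3 - 2 * j) * (L2_nrm (edge_measure E) (edge_residual j E))\<^sup>2
    \<le> (L ^ (N + 2) * (32 * L * B\<^sup>2 + 8 * C1 * B\<^sup>2 + B\<^sup>2) / (bump 0 * \<delta>)
        * (local_error (side_of E 1) + local_error (side_of E (-1)) + edge_data_error j E))\<^sup>2"
proof -

  \<comment> \<open>Length scales on the edge patch\<close>
  let ?d = "diameter E" and ?m = "edge_mid E" and ?n = "\<nu> E" and ?t = "\<tau> E"
  let ?\<mu> = "edge_measure E"
  have one: "(1::real) = 1 \<or> (1::real) = -1" "(-1::real) = 1 \<or> (-1::real) = -1" by auto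
  interpret P: mesh_edge "?t" "1 *\<^sub>R ?n" "side_of E 1" E
    unfolding mesh_edge_def by (rule side_of_oriented[OF E one(1)])
  interpret fr: frame ?t ?n using P.frame_axioms by simp
  have dpos: "?d > 0" by (rule P.length_pos)
  define \<rho> where "\<rho> = ?d / (8 * K)"
  have \<rho>0: "\<rho> > 0" using dpos K by (simp add: \<rho>_def)
  have L1: "1 \<le> L" and LK: "8 * K \<le> L" "4 * K\<^sup>2 \<le> L"
  proof -
    have "K * 1 \<le> K * K" using K by (intro mult_left_mono) auto
    then have "8 * K \<le> 8 * K\<^sup>2" by (simp add: power2_eq_square)
    then show "8 * K \<le> L" using L by linarith
    then show "1 \<le> L" using K by linarith
    show "4 * K\<^sup>2 \<le> L" using L by (simp add: order_trans[OF _ L])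
  qed
  have dL: "?d \<le> L * \<rho>" "?d = 8 * K * \<rho>"
  proof -
    show d: "?d = 8 * K * \<rho>" using K by (simp add: \<rho>_def)
    show "?d \<le> L * \<rho>" by (subst d, intro mult_right_mono LK) (use \<rho>0 in simp)
  qed
  have \<rho>d: "\<rho> \<le> ?d" "\<rho> < ?d / 2"
  proof -
    have "?d / (8 * K) \<le> ?d / (8 * 1)" using K dpos by (intro divide_left_mono) auto
    then have "\<rho> \<le> ?d / 8" by (simp add: \<rho>_def)
    then show "\<rho> \<le> ?d" "\<rho> < ?d / 2" using dpos by linarith+
  qed
  have sides: "side_of E \<sigma> \<in> \<T>" "?d \<le> diameter (side_of E \<sigma>)" "diameter (side_of E \<sigma>) \<le> L * \<rho>"
    if \<sigma>: "\<sigma> = 1 \<or> \<sigma> = (-1::real)" for \<sigma>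
  proof -
    interpret A: oriented_edge "?t" "\<sigma> *\<^sub>R ?n" "side_of E \<sigma>" E "?m" "?d" by (rule side_of_oriented[OF E \<sigma>])
    show T: "side_of E \<sigma> \<in> \<T>" by (rule side_of(1)[OF E \<sigma>])
    show "?d \<le> diameter (side_of E \<sigma>)" by (rule A.length_le_diameter)
    obtain x r where r: "r > 0" "cball x r \<subseteq> side_of E \<sigma>" "diameter (side_of E \<sigma>) \<le> K * r" using ball[OF T] by blast
    \<comment> \<open>The ball is no wider than the edge, so the diameter of either triangle is at
      most K d / 2 = 4 K^2 \<rho>.\<close>
    have "2 * r \<le> ?d" using A.inball_le_length[OF r(2)] r(1) by simp
    then have "K * r \<le> K * (?d / 2)" using K by (intro mult_left_mono) auto
    also have "\<dots> = 4 * K\<^sup>2 * \<rho>" by (simp add: dL(2) power2_eq_square)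
    also have "\<dots> \<le> L * \<rho>" using LK(2) \<rho>0 by (intro mult_right_mono) auto
    finally show "diameter (side_of E \<sigma>) \<le> L * \<rho>" using r(3) by linarith
  qed

  \<comment> \<open>The residual as a polynomial along the edge\<close>
  obtain pG where pG: "pG \<in> tpoly (k + 2)" "E \<in> E\<Gamma> j \<Longrightarrow> \<forall>x\<in>rel_interior E. G j x = pG x"
    using edge_data_tpoly[OF j] by blast
  define pR where "pR x = (if E \<in> E\<Gamma> j then pG x else 0) + (edge_density j E (side_of E 1) x - edge_density j E (side_of E (-1)) x)" for x
  have pRt: "pR \<in> tpoly (k + 2)"
  proof -
    have "(\<lambda>x. if E \<in> E\<Gamma> j then pG x else 0) \<in> tpoly (k + 2)"
      by (cases "E \<in> E\<Gamma> j") (simp_all only: if_True if_False pG(1) tpoly_zero)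
    then show ?thesis unfolding pR_def[abs_def]
      by (intro tpoly.add tpoly_diff edge_density_tpoly sides(1) one)
  qed
  have Rp: "AE x in ?\<mu>. edge_residual j E x = pR x" "edge_residual j E \<in> borel_measurable ?\<mu>"
  proof -
    have "edge_residual j E x = pR x" if "x \<in> rel_interior E" for x
      using pG(2) that by (auto simp: edge_residual_def ext_zero_def pR_def)
    from P.edge_measurable_if_eq[OF smooth_measurable[OF tpoly_smooth[OF pRt]] this]
    show "AE x in ?\<mu>. edge_residual j E x = pR x" "edge_residual j E \<in> borel_measurable ?\<mu>" by auto
  qed
  \<comment> \<open>On a line the degrees in the two coordinates add up; this accounts for the lower
    bound 2 k + 4 on \<open>N\<close>.\<close>
  obtain q where q: "degree q \<le> 2 * (k + 2)" "\<And>s. pR (?m + s *\<^sub>R ?t) = poly q s"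
    using tpoly_line[OF pRt, of ?m ?t] by blast
  define c where "c i = coeff q i * \<rho> ^ i" for i
  have pc: "pR (?m + s *\<^sub>R ?t) = (\<Sum>i\<le>N. c i * (s / \<rho>) ^ i)" for s
    unfolding q(2) c_def using q(1) N \<rho>0 by (intro poly_scaled_coeffs) auto
  define S where "S = (\<Sum>i\<le>N. \<bar>c i\<bar>)"
  have S0: "0 \<le> S" by (simp add: S_def sum_nonneg)

  \<comment> \<open>The test function and its values on the edge\<close>
  define c' where "c' i l = (if l = j then \<rho> ^ j * c i else 0)" for i l
  have jN: "j \<le> N" "2 \<le> N" using j N by auto
  have cS: "(\<Sum>i\<le>N. \<Sum>l\<le>N. \<bar>c' i l\<bar>) = \<rho> ^ j * S"
  proof -
    have "(\<Sum>l\<le>N. \<bar>c' i l\<bar>) = \<rho> ^ j * \<bar>c i\<bar>" for i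
      using jN \<rho>0 by (simp add: c'_def abs_mult if_distrib[of abs] cong: if_cong)
    then show ?thesis by (simp add: S_def sum_distrib_left)
  qed
  \<comment> \<open>Only the normal index \<open>j\<close> occurs, which by
    \<open>bump_pow_at_0\<close> selects the trace or the normal derivative. The factor \<rho>^j in
    \<open>c'\<close> offsets the 1 / \<rho> of a normal derivative, so that for either
    \<open>j\<close> the selected quantity on the edge is the same function
    \<open>w\<close>.\<close>
  define v where "v = fr.test_fun ?m \<rho> N c' 0 0"
  define D where "D = 4 * B\<^sup>2 * (\<rho> ^ j * S)"
  have D0: "0 \<le> D" using S0 \<rho>0 by (simp add: D_def)
  have vs: "smooth_sym v" unfolding v_def by (rule fr.smooth_sym_test_fun)
  have sv: "smooth v" using vs by (simp add: smooth_sym_def)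
  have region: "x \<in> edge_region E" if "\<bar>(x - ?m) \<bullet> ?t\<bar> \<le> \<rho>" "\<bar>(x - ?m) \<bullet> ?n\<bar> \<le> \<rho>" for x
    using that unfolding \<rho>_def by (intro square_subset_region[OF E K ball])
  have v\<Omega>: "v \<in> test_funs \<Omega>" unfolding v_def
    by (rule fr.test_fun_test_funs[OF \<rho>0]) (use region region_subset_domain[OF E] in blast)
  have out': "multi_partial \<alpha> v x = 0" if "\<alpha> \<in> multi_upto 2" "\<bar>(x - ?m) \<bullet> ?t\<bar> \<ge> \<rho> \<or> \<bar>(x - ?m) \<bullet> ?n\<bar> \<ge> \<rho>" for \<alpha> x
    unfolding v_def by (rule fr.multi_partial_test_fun_zero[OF \<rho>0 that])
  have out: "multi_partial \<alpha> v x = 0" if "\<alpha> \<in> multi_upto 2" "x \<notin> edge_region E" for \<alpha> x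
    using region[of x] that(2) by (intro out'[OF that(1)]) linarith
  have out0: "v x = 0" if "x \<notin> edge_region E" for x using out[OF _ that, of "(0,0)"] by (simp add: multi_partial_simps)
  have bd: "\<bar>multi_partial \<alpha> v x\<bar> \<le> D / \<rho> ^ (fst \<alpha> + snd \<alpha>)" if "\<alpha> \<in> multi_upto 2" for \<alpha> x
    using fr.test_fun_derivative_bound[OF B(2) jN(2) \<rho>0 that, of ?m c' x] by (simp add: v_def D_def cS)
  have adm: "mesh_edge.admissible (\<sigma> *\<^sub>R ?n) (side_of E \<sigma>) E v" if \<sigma>: "\<sigma> = 1 \<or> \<sigma> = (-1::real)" for \<sigma>
  proof -
    interpret A: mesh_edge "?t" "\<sigma> *\<^sub>R ?n" "side_of E \<sigma>" E
      unfolding mesh_edge_def by (rule side_of_oriented[OF E \<sigma>])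
    obtain R where R: "\<And>x. norm x > R \<Longrightarrow> v x = 0" using test_funs_bounded_support[OF v\<Omega>] by blast
    show ?thesis unfolding A.admissible_def
    proof (intro conjI vs ballI)
      show "\<exists>R. \<forall>x. norm x > R \<longrightarrow> v x = 0" using R by blast
      fix \<alpha> x assume \<alpha>: "\<alpha> \<in> multi_upto 2" and x: "x \<in> half_plane (\<sigma> *\<^sub>R ?n) ?m - side_of E \<sigma>"
      show "multi_partial \<alpha> v x = 0"
      proof (rule out'[OF \<alpha>], rule ccontr)
        assume "\<not> (\<rho> \<le> \<bar>(x - ?m) \<bullet> ?t\<bar> \<or> \<rho> \<le> \<bar>(x - ?m) \<bullet> ?n\<bar>)"
        then have "x \<in> edge_region E" "\<bar>(x - ?m) \<bullet> ?t\<bar> < ?d / 2" using region[of x] \<rho>d by linarith+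
        moreover have "(x - ?m) \<bullet> (\<sigma> *\<^sub>R ?n) \<le> 0" using x by (simp add: half_plane_def)
        ultimately have "x \<in> side_of E \<sigma>" by (intro region_side[OF E \<sigma>])
        then show False using x by simp
      qed
    qed
  qed
  define w where "w s = (\<Sum>i\<le>N. c i * (s / \<rho>) ^ i) * bump (s / \<rho>) * bump 0" for s
  have line: "(?m + s *\<^sub>R ?t - ?m) \<bullet> ?t = s" "(?m + s *\<^sub>R ?t - ?m) \<bullet> ?n = 0" for s by simp_all
  have test_line: "fr.test_fun ?m \<rho> N c' 0 b (?m + s *\<^sub>R ?t) = \<rho> ^ j * (\<Sum>i\<le>N. c i * (s / \<rho>) ^ i) * bump (s / \<rho>) * (deriv ^^ b) (bump_pow j) 0" for s b
  proof -
    have "fr.test_fun ?m \<rho> N c' 0 b (?m + s *\<^sub>R ?t) = (\<Sum>i\<le>N. \<Sum>l\<le>N. (if l = j then \<rho> ^ j * c i * (bump_pow i (s / \<rho>) * (deriv ^^ b) (bump_pow l) 0) else 0))"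
      unfolding fr.test_fun_def line by (intro sum.cong refl) (simp add: c'_def)
    also have "\<dots> = (\<Sum>i\<le>N. \<rho> ^ j * c i * (bump_pow i (s / \<rho>) * (deriv ^^ b) (bump_pow j) 0))"
      using jN by simp
    also have "\<dots> = \<rho> ^ j * (\<Sum>i\<le>N. c i * (s / \<rho>) ^ i) * bump (s / \<rho>) * (deriv ^^ b) (bump_pow j) 0"
      by (simp add: sum_distrib_left sum_distrib_right bump_pow_def mult_ac)
    finally show ?thesis .
  qed
  have dn: "dderiv ?n v x = fr.test_fun ?m \<rho> N c' 0 (Suc 0) x / \<rho>" for x
  proof -
    have tn: "?n $ 1 * ?t $ 1 + ?n $ 2 * ?t $ 2 = 0" "?n $ 1 * ?n $ 1 + ?n $ 2 * ?n $ 2 = 1"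
      using fr.inner_frame by (simp_all add: inner_plane)
    have "dderiv ?n v x = ((?n $ 1 * ?t $ 1 + ?n $ 2 * ?t $ 2) * fr.test_fun ?m \<rho> N c' (Suc 0) 0 x
        + (?n $ 1 * ?n $ 1 + ?n $ 2 * ?n $ 2) * fr.test_fun ?m \<rho> N c' 0 (Suc 0) x) / \<rho>"
      unfolding dderiv_def v_def fr.partial_test_fun by (simp add: add_divide_distrib algebra_simps)
    then show ?thesis by (simp add: tn)
  qed
  have npv: "normal_partial l ?n v (?m + s *\<^sub>R ?t) = (if l = j then w s else 0)" if "l = 0 \<or> l = 1" for l s
  proof -
    have j01: "j = 0 \<or> j = Suc 0" using j by simp
    show ?thesis
    proof (cases "l = 0")
      case True
      have "normal_partial l ?n v (?m + s *\<^sub>R ?t) = \<rho> ^ j * (\<Sum>i\<le>N. c i * (s / \<rho>) ^ i) * bump (s / \<rho>) * bump_pow j 0"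
        using test_line[of 0 s] True by (simp add: normal_partial_def v_def)
      then show ?thesis using j01 True by (elim disjE) (simp_all add: w_def bump_pow_at_0)
    next
      case False
      then have l: "l = 1" using that by simp
      have "normal_partial l ?n v (?m + s *\<^sub>R ?t) = \<rho> ^ j * (\<Sum>i\<le>N. c i * (s / \<rho>) ^ i) * bump (s / \<rho>) * deriv (bump_pow j) 0 / \<rho>"
        using test_line[of "Suc 0" s] l by (simp add: normal_partial_def dn)
      then show ?thesis using j01 l \<rho>0 by (elim disjE) (simp_all add: w_def bump_pow_at_0)
    qed
  qed
  have w0: "w s = 0" if "\<bar>s\<bar> \<ge> \<rho>" for s
  proof -
    have "\<bar>s / \<rho>\<bar> \<ge> 1" using that \<rho>0 by simp
    then show ?thesis by (simp add: w_def bump_zero)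
  qed
  have wbd: "\<bar>normal_partial j ?n v x\<bar> \<le> B\<^sup>2 * S" if "x \<in> E" for x
  proof -
    define s where "s = (x - ?m) \<bullet> ?t"
    have x: "x = ?m + s *\<^sub>R ?t" using P.edge_chart[OF that] by (simp add: s_def)
    have B0: "\<bar>bump_pow i y\<bar> \<le> B" if "i \<le> N" for i y using B(2)[rule_format, of i 0 y] that by simp
    have "normal_partial j ?n v x = (\<Sum>i\<le>N. c i * bump_pow i (s / \<rho>)) * bump_pow 0 0"
      using npv[OF j, of s] x by (simp add: w_def bump_pow_def sum_distrib_left sum_distrib_right mult_ac)
    then have "\<bar>normal_partial j ?n v x\<bar> = \<bar>\<Sum>i\<le>N. c i * bump_pow i (s / \<rho>)\<bar> * \<bar>bump_pow 0 0\<bar>" by (simp add: abs_mult)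
    also have "\<dots> \<le> (S * B) * B"
    proof (intro mult_mono B0)
      have "\<bar>\<Sum>i\<le>N. c i * bump_pow i (s / \<rho>)\<bar> \<le> (\<Sum>i\<le>N. \<bar>c i * bump_pow i (s / \<rho>)\<bar>)" by (rule sum_abs)
      also have "\<dots> \<le> (\<Sum>i\<le>N. \<bar>c i\<bar> * B)"
        by (intro sum_mono) (auto simp: abs_mult intro!: mult_left_mono B0)
      finally show "\<bar>\<Sum>i\<le>N. c i * bump_pow i (s / \<rho>)\<bar> \<le> S * B" by (simp add: S_def sum_distrib_right)
    qed (use S0 B(1) in auto)
    finally show ?thesis by (simp add: power2_eq_square mult_ac)
  qed

  \<comment> \<open>The tested equation on the patch\<close>
  let ?I = "\<lambda>T. LINT x|lebesgue_on (interior T). residual T x * v x"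
  let ?J = "\<lambda>h. LINT s|lborel. h (?m + s *\<^sub>R ?t) * w s"
  have df: "discrete_form (side_of E \<sigma>) v = ?I (side_of E \<sigma>) + \<sigma> * ?J (edge_density j E (side_of E \<sigma>))"
    if \<sigma>: "\<sigma> = 1 \<or> \<sigma> = (-1::real)" for \<sigma>
    using edge_density_form[OF E \<sigma> j adm[OF \<sigma>]] npv j by simp
  have vertex0: "v z = 0" if "z \<in> vertices \<T>" for z
    by (rule out0) (rule vertex_not_in_region[OF E that])
  \<comment> \<open>Other edges miss the patch, and on E itself the quantity of the order different
    from \<open>j\<close> vanishes.\<close>
  have edges0: "(LINT x|edge_measure E'. g l x * normal_partial l (\<nu> E') v x) = 0"
    if l: "l \<in> {0, 1}" and E': "E' \<in> E\<Gamma> l" "E' \<noteq> E \<or> l \<noteq> j" for l E'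
  proof -
    have Ei: "E' \<in> interior_edges \<Omega> \<T>" using E' l E\<Gamma> by blast
    interpret Q: mesh_edge "\<tau> E'" "1 *\<^sub>R \<nu> E'" "side_of E' 1" E'
      unfolding mesh_edge_def by (rule side_of_oriented[OF Ei]) simp
    have "normal_partial l (\<nu> E') v x = 0" if x: "x \<in> E'" for x
    proof (cases "E' = E")
      case True
      have "x = ?m + ((x - ?m) \<bullet> ?t) *\<^sub>R ?t" using P.edge_chart x True by blast
      then have "normal_partial l ?n v x = (if l = j then w ((x - ?m) \<bullet> ?t) else 0)"
        using npv[of l "(x - ?m) \<bullet> ?t"] l by auto
      then show ?thesis using E'(2) True by simp
    next
      case False
      have "x \<notin> edge_region E"
        using edge_disjoint_region[OF E side_of(1)[OF Ei, of 1] side_of(2)[OF Ei, of 1] False] x by auto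
      then show ?thesis by (intro normal_partial_vanish out)
    qed
    then have "(LINT x|edge_measure E'. g l x * normal_partial l (\<nu> E') v x) = (LINT x|edge_measure E'. 0)"
      by (intro Bochner_Integration.integral_cong refl) (simp add: Q.space_edge_measure)
    then show ?thesis by simp
  qed
  define gJ where "gJ = (if E \<in> E\<Gamma> j then LINT x|?\<mu>. g j x * normal_partial j ?n v x else 0)"
  have edge_sum: "(\<Sum>l\<in>{0, 1}. \<Sum>E'\<in>E\<Gamma> l. LINT x|edge_measure E'. g l x * normal_partial l (\<nu> E') v x) = gJ"
  proof -
    have inner: "(\<Sum>E'\<in>E\<Gamma> l. LINT x|edge_measure E'. g l x * normal_partial l (\<nu> E') v x) = (if l = j then gJ else 0)"
      if l: "l \<in> {0, 1}" for l
    proof (cases "l = j")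
      case False
      then show ?thesis using edges0[OF l] by simp
    next
      case True
      have "(\<Sum>E'\<in>E\<Gamma> l. LINT x|edge_measure E'. g l x * normal_partial l (\<nu> E') v x)
          = (\<Sum>E'\<in>E\<Gamma> l. if E' = E then (LINT x|edge_measure E. g l x * normal_partial l (\<nu> E) v x) else 0)"
        using edges0[OF l] by (intro sum.cong refl) auto
      then show ?thesis using finite_E\<Gamma>[OF l] True by (simp add: gJ_def)
    qed
    have "(\<Sum>l\<in>{0, 1}. \<Sum>E'\<in>E\<Gamma> l. LINT x|edge_measure E'. g l x * normal_partial l (\<nu> E') v x) = (\<Sum>l\<in>{0, 1}. if l = j then gJ else 0)"
      by (intro sum.cong refl inner)
    then show ?thesis using j by auto
  qed
  have two: "(\<Sum>T\<in>\<T>. h T) = h (side_of E 1) + h (side_of E (-1))"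
    if "\<And>T. T \<in> \<T> \<Longrightarrow> T \<noteq> side_of E 1 \<Longrightarrow> T \<noteq> side_of E (-1) \<Longrightarrow> h T = 0" for h :: "plane set \<Rightarrow> real"
  proof -
    have "(\<Sum>T\<in>\<T>. h T) = (\<Sum>T\<in>{side_of E 1, side_of E (-1)}. h T)"
      using sides(1)[OF one(1)] sides(1)[OF one(2)] that finite_mesh by (intro sum.mono_neutral_right) auto
    then show ?thesis using side_of_neq[OF E] by simp
  qed
  have vanish: "discrete_form T v = 0" "error_form T v = 0"
    if "T \<in> \<T>" "T \<noteq> side_of E 1" "T \<noteq> side_of E (-1)" for T
  proof -
    have "x \<notin> edge_region E" if "x \<in> interior T" for x
      using triangle_disjoint_region[OF E \<open>T \<in> \<T>\<close> \<open>T \<noteq> side_of E 1\<close> \<open>T \<noteq> side_of E (-1)\<close>] that interior_subset by blast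
    then show "discrete_form T v = 0" "error_form T v = 0" using forms_vanish[OF out vs] by blast+
  qed
  have main: "discrete_form (side_of E 1) v + discrete_form (side_of E (-1)) v
      = error_form (side_of E 1) v + error_form (side_of E (-1)) v - gJ"
    using discrete_equation[OF v\<Omega> vs vertex0] two[OF vanish(1)] two[OF vanish(2)] edge_sum by simp
  have npm: "normal_partial j ?n v \<in> borel_measurable borel"
    by (intro smooth_measurable smooth_normal_partial sv)
  have np_edge: "(LINT x|?\<mu>. h x * normal_partial j ?n v x) = ?J h" if h: "h \<in> borel_measurable borel" for h
  proof -
    have "(LINT x|?\<mu>. h x * normal_partial j ?n v x)
      = (LINT s|lborel. indicator {- (?d / 2)..?d / 2} s * (h (?m + s *\<^sub>R ?t) * normal_partial j ?n v (?m + s *\<^sub>R ?t)))"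
      using h npm by (intro P.edge_integral) simp
    also have "\<dots> = ?J h"
    proof (rule Bochner_Integration.integral_cong[OF refl])
      show "indicator {- (?d / 2)..?d / 2} s * (h (?m + s *\<^sub>R ?t) * normal_partial j ?n v (?m + s *\<^sub>R ?t)) = h (?m + s *\<^sub>R ?t) * w s" for s
        using w0[of s] npv[OF j, of s] \<rho>d by (cases "\<bar>s\<bar> \<ge> \<rho>") (auto simp: indicator_def abs_le_iff not_le abs_less_iff)
    qed
    finally show ?thesis .
  qed
  obtain R where R: "\<And>x. norm x > R \<Longrightarrow> v x = 0" using test_funs_bounded_support[OF v\<Omega>] by blast
  have Jint: "integrable lborel (\<lambda>s. h (?m + s *\<^sub>R ?t) * w s)" if h: "smooth h" for h
  proof -
    have "normal_partial j ?n v x = 0" if "norm x > R" for x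
      using R[OF that] dderiv_zero_outside(2)[of R v x ?n, OF R that] by (simp add: normal_partial_def)
    then have "integrable lborel (\<lambda>s. h (?m + s *\<^sub>R ?t) * normal_partial j ?n v (?m + s *\<^sub>R ?t))"
      by (intro P.smooth_line_integrable[of "\<lambda>x. h x * normal_partial j ?n v x" R] smooth_mult smooth_normal_partial h sv) simp
    then show ?thesis using npv[OF j] by simp
  qed
  define GJ where "GJ = (if E \<in> E\<Gamma> j then LINT x|?\<mu>. (G j x - g j x) * normal_partial j ?n v x else 0)"
  \<comment> \<open>The densities of the two sides enter with opposite signs and form the jump.
    Adding the approximated edge data and comparing them with the exact edge source leaves the data
    error \<open>GJ\<close>.\<close>
  have JR: "?J pR = error_form (side_of E 1) v + error_form (side_of E (-1)) v - ?I (side_of E 1) - ?I (side_of E (-1)) + GJ"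
  proof -
    have sd: "smooth (edge_density j E (side_of E \<sigma>))" if "\<sigma> = 1 \<or> \<sigma> = (-1::real)" for \<sigma>
      by (rule tpoly_smooth[OF edge_density_tpoly[OF sides(1)[OF that]]])
    have sG: "smooth (\<lambda>x. if E \<in> E\<Gamma> j then pG x else 0)"
      by (cases "E \<in> E\<Gamma> j") (simp_all only: if_True if_False tpoly_smooth[OF pG(1)] smooth_const)
    have "?J pR = ?J (\<lambda>x. if E \<in> E\<Gamma> j then pG x else 0) + (?J (edge_density j E (side_of E 1)) - ?J (edge_density j E (side_of E (-1))))"
      using Jint[OF sd[OF one(1)]] Jint[OF sd[OF one(2)]] Jint[OF sG] by (simp add: pR_def distrib_right left_diff_distrib)
    moreover have "?J (\<lambda>x. if E \<in> E\<Gamma> j then pG x else 0) - gJ = GJ"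
    proof (cases "E \<in> E\<Gamma> j")
      case True
      have j2: "j \<in> {0, 1}" using j by auto
      have gL: "g j \<in> L2 ?\<mu>" by (rule g_L2[OF j2 True])
      have nL: "normal_partial j ?n v \<in> L2 ?\<mu>" by (intro P.smooth_edge_L2 smooth_normal_partial sv)
      have pL: "pG \<in> L2 ?\<mu>" by (intro P.smooth_edge_L2 tpoly_smooth[OF pG(1)])
      have Gp: "AE x in ?\<mu>. G j x = pG x" "G j \<in> borel_measurable ?\<mu>"
        using P.edge_measurable_if_eq[OF smooth_measurable[OF tpoly_smooth[OF pG(1)]], of "G j"] pG(2)[OF True] by auto
      have "(LINT x|?\<mu>. (G j x - g j x) * normal_partial j ?n v x) = (LINT x|?\<mu>. (pG x - g j x) * normal_partial j ?n v x)"
      proof (rule integral_cong_AE)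
        show "AE x in ?\<mu>. (G j x - g j x) * normal_partial j ?n v x = (pG x - g j x) * normal_partial j ?n v x"
          using Gp(1) by eventually_elim simp
        show "(\<lambda>x. (G j x - g j x) * normal_partial j ?n v x) \<in> borel_measurable ?\<mu>"
          using Gp(2) L2_measurable[OF gL] L2_measurable[OF nL] by measurable
        show "(\<lambda>x. (pG x - g j x) * normal_partial j ?n v x) \<in> borel_measurable ?\<mu>"
          using L2_measurable[OF pL] L2_measurable[OF gL] L2_measurable[OF nL] by measurable
      qed
      also have "\<dots> = (LINT x|?\<mu>. pG x * normal_partial j ?n v x) - (LINT x|?\<mu>. g j x * normal_partial j ?n v x)"
        using L2_mult_integrable[OF pL nL] L2_mult_integrable[OF gL nL] by (simp add: left_diff_distrib)
      also have "(LINT x|?\<mu>. pG x * normal_partial j ?n v x) = ?J pG"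
        by (rule np_edge[OF smooth_measurable[OF tpoly_smooth[OF pG(1)]]])
      finally show ?thesis using True by (simp add: GJ_def gJ_def)
    qed (simp add: GJ_def gJ_def)
    ultimately show ?thesis using main df[OF one(1)] df[OF one(2)] by simp
  qed

  \<comment> \<open>Lower and upper bounds for the tested residual\<close>
  define b where "b = bump 0"
  have b0: "b > 0" by (simp add: b_def bump_pos)
  have low: "\<rho> * (b * (\<delta> * S\<^sup>2)) \<le> ?J pR"
  proof -
    have "?J pR = (LINT s|lborel. b * ((\<Sum>i\<le>N. c i * (s / \<rho>) ^ i)\<^sup>2 * bump (s / \<rho>)))"
      by (simp add: pc w_def b_def power2_eq_square mult_ac)
    also have "\<dots> = \<rho> * (LINT y|lborel. b * ((\<Sum>i\<le>N. c i * y ^ i)\<^sup>2 * bump y))"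
      by (rule integral_scale[OF \<rho>0])
    also have "\<dots> = \<rho> * (b * (LINT y|lborel. (\<Sum>i\<le>N. c i * y ^ i)\<^sup>2 * bump y))" by simp
    also have "\<dots> \<ge> \<rho> * (b * (\<delta> * S\<^sup>2))"
      unfolding S_def using \<rho>0 b0 \<delta>(2)[of c] by (intro mult_left_mono) auto
    finally show ?thesis .
  qed
  \<comment> \<open>This is \<rho>^(j - 1), the common scaling of all upper bounds; the quotient
    avoids a negative exponent.\<close>
  define t where "t = \<rho> ^ j / \<rho>"
  have t0: "t > 0" using \<rho>0 by (simp add: t_def)
  define Z where "Z = local_error (side_of E 1) + local_error (side_of E (-1))"
  have Z0: "0 \<le> Z" using local_error_nonneg by (simp add: Z_def)
  define \<gamma> where "\<gamma> = edge_data_error j E"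
  have \<gamma>0: "0 \<le> \<gamma>" by (simp add: \<gamma>_def edge_data_error_def L2_nrm_nonneg)
  have err: "\<bar>error_form (side_of E \<sigma>) v\<bar> \<le> 32 * L * B\<^sup>2 * (t * S) * local_error (side_of E \<sigma>)"
    if \<sigma>: "\<sigma> = 1 \<or> \<sigma> = (-1::real)" for \<sigma>
  proof -
    let ?h = "diameter (side_of E \<sigma>)"
    have "\<bar>error_form (side_of E \<sigma>) v\<bar> \<le> (8 * ?h * D / \<rho>\<^sup>2) * local_error (side_of E \<sigma>)"
      using \<rho>d(1) sides(2)[OF \<sigma>] by (intro error_form_bound sides(1)[OF \<sigma>] vs \<rho>0 D0 bd) auto
    also have "\<dots> = ?h * ((8 * D / \<rho>\<^sup>2) * local_error (side_of E \<sigma>))" by simp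
    also have "\<dots> \<le> (L * \<rho>) * ((8 * D / \<rho>\<^sup>2) * local_error (side_of E \<sigma>))"
      using D0 local_error_nonneg by (intro mult_right_mono sides(3)[OF \<sigma>]) auto
    also have "\<dots> = 32 * L * B\<^sup>2 * (t * S) * local_error (side_of E \<sigma>)"
      using \<rho>0 by (simp add: D_def t_def power2_eq_square)
    finally show ?thesis .
  qed
  have vol: "\<bar>?I (side_of E \<sigma>)\<bar> \<le> 8 * C1 * B\<^sup>2 * (t * S) * local_error (side_of E \<sigma>)"
    if \<sigma>: "\<sigma> = 1 \<or> \<sigma> = (-1::real)" for \<sigma>
  proof -
    let ?T = "side_of E \<sigma>"
    let ?h = "diameter ?T"
    define nr where "nr = L2_nrm (lebesgue_on (interior ?T)) (residual ?T)"
    have T: "?T \<in> \<T>" by (rule sides(1)[OF \<sigma>])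
    have h0: "?h > 0" using sides(2)[OF \<sigma>] dpos by linarith
    have nr0: "0 \<le> nr" by (simp add: nr_def L2_nrm_nonneg)
    have "\<bar>?I ?T\<bar> \<le> nr * L2_nrm (lebesgue_on (interior ?T)) v"
      unfolding nr_def by (intro L2_CS smooth_L2 tpoly_smooth[OF residual_tpoly[OF T]] sv interior_sets T)
    also have "\<dots> \<le> nr * (D * (2 * ?h))"
      using bd[of "(0,0)"] D0 by (intro mult_left_mono triangle_bounded_L2 triangles T sv nr0) (auto simp: multi_partial_simps)
    also have "\<dots> = (?h\<^sup>2 * nr) * (2 * D / ?h)" using h0 by (simp add: power2_eq_square)
    also have "\<dots> \<le> (C1 * local_error ?T) * (2 * D / ?h)"
      using C1(2)[OF T] D0 h0 by (intro mult_right_mono) (auto simp: nr_def)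
    also have "\<dots> \<le> (C1 * local_error ?T) * (2 * D / \<rho>)"
      using D0 \<rho>0 \<rho>d(1) sides(2)[OF \<sigma>] C1(1) local_error_nonneg by (intro mult_left_mono divide_left_mono) auto
    also have "\<dots> = 8 * C1 * B\<^sup>2 * (t * S) * local_error ?T" by (simp add: D_def t_def)
    finally show ?thesis .
  qed
  have edge: "\<bar>GJ\<bar> \<le> B\<^sup>2 * (t * S) * \<gamma>"
  proof (cases "E \<in> E\<Gamma> j")
    case True
    have j2: "j \<in> {0, 1}" using j by auto
    have nm: "normal_partial j ?n v \<in> borel_measurable ?\<mu>" by (rule P.edge_measurable_borel[OF npm])
    have gL: "g j \<in> L2 ?\<mu>" by (rule g_L2[OF j2 True])
    have Gp: "AE x in ?\<mu>. G j x = pG x" "G j \<in> borel_measurable ?\<mu>"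
      using P.edge_measurable_if_eq[OF smooth_measurable[OF tpoly_smooth[OF pG(1)]], of "G j"] pG(2)[OF True] by auto
    have GL: "G j \<in> L2 ?\<mu>"
      using L2_cong_AE[OF P.smooth_edge_L2[OF tpoly_smooth[OF pG(1)]] _ Gp(2)] Gp(1) by (auto simp: eq_commute)
    define e where "e = L2_nrm ?\<mu> (\<lambda>x. g j x - G j x)"
    have e0: "0 \<le> e" by (simp add: e_def L2_nrm_nonneg)
    have \<gamma>e: "\<gamma> = ?d powr (3/2 - real j) * e"
      using True by (simp add: \<gamma>_def edge_data_error_def L2_nrm_cmult e_def)
    have "\<bar>GJ\<bar> \<le> L2_nrm ?\<mu> (\<lambda>x. G j x - g j x) * L2_nrm ?\<mu> (normal_partial j ?n v)"
      using True by (simp add: GJ_def) (intro L2_CS L2_diff GL gL P.edge_bounded_L2(1)[OF nm wbd])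
    also have "\<dots> \<le> e * ((B\<^sup>2 * S) * sqrt ?d)"
      unfolding e_def L2_nrm_minus_commute[of ?\<mu> "G j"]
      by (intro mult_left_mono P.edge_bounded_L2(2)[OF nm wbd] L2_nrm_nonneg)
    also have "\<dots> = (B\<^sup>2 * S) * (e * sqrt ?d)" by simp
    also have "\<dots> \<le> (B\<^sup>2 * S) * (t * \<gamma>)"
    proof (rule mult_left_mono)
      have pw: "?d powr (3/2 - real j) = sqrt ?d * ?d powr (1 - real j)"
      proof -
        have "3/2 - real j = 1/2 + (1 - real j)" by simp
        then have "?d powr (3/2 - real j) = ?d powr (1/2) * ?d powr (1 - real j)" by (simp only: powr_add)
        then show ?thesis using dpos by (simp add: powr_half_sqrt)
      qed
      \<comment> \<open>For j = 0 this is \<rho> \<le> d, and for j = 1 both factors are 1.\<close>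
      have "1 \<le> t * ?d powr (1 - real j)"
      proof (cases "j = 0")
        case True
        then show ?thesis using dpos \<rho>0 \<rho>d(1) by (simp add: t_def)
      next
        case False
        then have "j = 1" using j by simp
        then show ?thesis using dpos \<rho>0 by (simp add: t_def)
      qed
      then have "(e * sqrt ?d) * 1 \<le> (e * sqrt ?d) * (t * ?d powr (1 - real j))"
        using e0 dpos by (intro mult_left_mono) auto
      then show "e * sqrt ?d \<le> t * \<gamma>" unfolding \<gamma>e pw by (simp add: mult_ac)
    qed (use S0 in simp)
    finally show ?thesis by (simp add: mult_ac)
  next
    case False
    then show ?thesis using S0 t0 \<gamma>0 by (simp add: GJ_def)
  qed
  \<comment> \<open>The summands belong to the error forms, to the volume residuals and to the data
    on the edge, in this order.\<close>
  define C2 where "C2 = 32 * L * B\<^sup>2 + 8 * C1 * B\<^sup>2 + B\<^sup>2"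
  have C2: "0 \<le> 32 * L * B\<^sup>2" "0 \<le> 8 * C1 * B\<^sup>2" "0 \<le> B\<^sup>2" using L1 C1(1) by auto
  have key: "\<rho> * S / t \<le> C2 / (b * \<delta>) * (Z + \<gamma>)"
  proof (cases "S = 0")
    case True
    then show ?thesis using C2 Z0 \<gamma>0 b0 \<delta>(1) by (simp add: C2_def)
  next
    case False
    then have Sp: "S > 0" using S0 by simp
    have "\<rho> * (b * (\<delta> * S\<^sup>2)) \<le> 32 * L * B\<^sup>2 * (t * S) * Z + 8 * C1 * B\<^sup>2 * (t * S) * Z + B\<^sup>2 * (t * S) * \<gamma>"
      using low JR err[OF one(1)] err[OF one(2)] vol[OF one(1)] vol[OF one(2)] edge
      unfolding Z_def by (simp add: distrib_left abs_le_iff)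
    also have "\<dots> \<le> C2 * (t * S) * Z + C2 * (t * S) * \<gamma>"
    proof -
      have "32 * L * B\<^sup>2 * (t * S) * Z + 8 * C1 * B\<^sup>2 * (t * S) * Z = (32 * L * B\<^sup>2 + 8 * C1 * B\<^sup>2) * ((t * S) * Z)"
        by (simp add: algebra_simps)
      also have "\<dots> \<le> C2 * ((t * S) * Z)" using C2 t0 S0 Z0 by (intro mult_right_mono) (auto simp: C2_def)
      finally have 1: "32 * L * B\<^sup>2 * (t * S) * Z + 8 * C1 * B\<^sup>2 * (t * S) * Z \<le> C2 * (t * S) * Z" by (simp add: mult.assoc)
      have "B\<^sup>2 * ((t * S) * \<gamma>) \<le> C2 * ((t * S) * \<gamma>)" using C2 t0 S0 \<gamma>0 by (intro mult_right_mono) (auto simp: C2_def)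
      with 1 show ?thesis by (simp add: mult.assoc)
    qed
    also have "\<dots> = (C2 * (Z + \<gamma>)) * (t * S)" by (simp add: algebra_simps)
    finally have "(\<rho> * S / t * (b * \<delta>)) * (t * S) \<le> (C2 * (Z + \<gamma>)) * (t * S)"
      using t0 by (simp add: power2_eq_square mult_ac)
    then have "\<rho> * S / t * (b * \<delta>) \<le> C2 * (Z + \<gamma>)"
      by (rule mult_right_le_imp_le) (use Sp t0 in simp)
    then show ?thesis using b0 \<delta>(1) by (simp add: pos_le_divide_eq)
  qed

  \<comment> \<open>From the coefficients to the norm of the residual\<close>
  have Rn: "L2_nrm ?\<mu> (edge_residual j E) \<le> (S * L ^ N) * sqrt ?d"
  proof -
    have pm: "pR \<in> borel_measurable ?\<mu>" by (intro P.edge_measurable_borel smooth_measurable tpoly_smooth[OF pRt])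
    have "L2_nrm ?\<mu> (edge_residual j E) = L2_nrm ?\<mu> pR" by (rule L2_nrm_cong_AE[OF Rp pm])
    also have "\<dots> \<le> (S * L ^ N) * sqrt ?d"
    proof (rule P.edge_bounded_L2(2)[OF pm])
      fix x assume x: "x \<in> E"
      define s where "s = (x - ?m) \<bullet> ?t"
      have xs: "x = ?m + s *\<^sub>R ?t" using P.edge_chart[OF x] by (simp add: s_def)
      have "\<bar>s\<bar> \<le> ?d / 2" using P.mem_edge[of s] x xs by simp
      then have "\<bar>s\<bar> \<le> L * \<rho>" using dL(1) dpos by linarith
      then have "\<bar>s / \<rho>\<bar> \<le> L" using \<rho>0 by (simp add: field_simps)
      then show "\<bar>pR x\<bar> \<le> S * L ^ N" unfolding xs pc S_def using L1 by (rule abs_sum_le)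
    qed
    finally show ?thesis .
  qed
  have "?d ^ (3 - 2 * j) * (L2_nrm ?\<mu> (edge_residual j E))\<^sup>2 \<le> ?d ^ (3 - 2 * j) * ((S * L ^ N) * sqrt ?d)\<^sup>2"
    using dpos Rn L2_nrm_nonneg by (intro mult_left_mono power_mono) auto
  also have "\<dots> = (?d ^ (2 - j) * (S * L ^ N))\<^sup>2"
  proof -
    have "((S * L ^ N) * sqrt ?d)\<^sup>2 = (S * L ^ N)\<^sup>2 * ?d" using dpos by (simp add: power_mult_distrib)
    moreover have "?d ^ (3 - 2 * j) * ?d = (?d ^ (2 - j))\<^sup>2"
      using j by (elim disjE) (simp_all add: eval_nat_numeral)
    ultimately have "?d ^ (3 - 2 * j) * ((S * L ^ N) * sqrt ?d)\<^sup>2 = (S * L ^ N)\<^sup>2 * (?d ^ (2 - j))\<^sup>2"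
      by (metis mult.left_commute)
    also have "\<dots> = (?d ^ (2 - j) * (S * L ^ N))\<^sup>2"
      by (simp only: power_mult_distrib[symmetric] mult.commute[of "S * L ^ N"])
    finally show ?thesis .
  qed
  also have "\<dots> \<le> (L ^ (N + 2) * C2 / (b * \<delta>) * (Z + \<gamma>))\<^sup>2"
  proof (rule power_mono)
    have d2: "?d ^ (2 - j) \<le> L\<^sup>2 * (\<rho> / t)"
    proof -
      have "?d ^ (2 - j) \<le> (L * \<rho>) ^ (2 - j)" using dL(1) dpos by (intro power_mono) auto
      also have "\<dots> = L ^ (2 - j) * \<rho> ^ (2 - j)" by (simp add: power_mult_distrib)
      also have "\<rho> ^ (2 - j) = \<rho> / t" using j \<rho>0 by (elim disjE) (simp_all add: t_def power2_eq_square)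
      also have "L ^ (2 - j) * (\<rho> / t) \<le> L\<^sup>2 * (\<rho> / t)"
        using L1 \<rho>0 t0 by (intro mult_right_mono power_increasing) auto
      finally show ?thesis .
    qed
    have "?d ^ (2 - j) * (S * L ^ N) \<le> L\<^sup>2 * (\<rho> / t) * (S * L ^ N)"
      using S0 L1 by (intro mult_right_mono d2) auto
    also have "\<dots> = L ^ (N + 2) * (\<rho> * S / t)" by (simp add: power_add power2_eq_square mult_ac)
    also have "\<dots> \<le> L ^ (N + 2) * (C2 / (b * \<delta>) * (Z + \<gamma>))" using key L1 by (intro mult_left_mono) auto
    finally show "?d ^ (2 - j) * (S * L ^ N) \<le> L ^ (N + 2) * C2 / (b * \<delta>) * (Z + \<gamma>)" by simp
    show "0 \<le> ?d ^ (2 - j) * (S * L ^ N)" using dpos S0 L1 by simp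
  qed
  finally show ?thesis unfolding C2_def b_def Z_def \<gamma>_def by (simp add: add.assoc)
qed

end


section \<open>Summation over the mesh\<close>

lemma card_multi_upto_2: "card (multi_upto 2) = 6"
  by (simp add: multi_upto_2)

lemma square_sum3_le: "(a + b + c)\<^sup>2 \<le> 3 * (a\<^sup>2 + b\<^sup>2 + c\<^sup>2)" for a b c :: real
proof -
  have "0 \<le> (a - b)\<^sup>2 + (b - c)\<^sup>2 + (a - c)\<^sup>2" by simp
  then show ?thesis by (simp add: power2_eq_square algebra_simps)
qed

context mesh_edge
begin

text \<open>By Pythagoras, the squared distance of \<open>w\<close> from a constant c exceeds that
  from its mean m by (m - c)^2 times the edge length, and the mean is the projection. The constant
  will be the contribution of \<open>uh\<close> to the moment jump.\<close>

lemma L2_nrm_minus_mean_le: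
  assumes w: "w \<in> L2 (edge_measure E)"
  shows "L2_nrm (edge_measure E) (\<lambda>x. w x - edge_proj0 E w) \<le> L2_nrm (edge_measure E) (\<lambda>x. w x - c)"
proof -
  let ?\<mu> = "edge_measure E" and ?d = "diameter E"
  have cL: "(\<lambda>x. c) \<in> L2 ?\<mu>" for c :: real
    by (rule edge_bounded_L2(1)[of _ "\<bar>c\<bar>"]) auto
  have ic: "integrable ?\<mu> (\<lambda>x. c)" for c :: real
    using L2_mult_integrable[OF cL[of c] cL[of 1]] by simp
  have iw: "integrable ?\<mu> w" "integrable ?\<mu> (\<lambda>x. (w x)\<^sup>2)"
    using L2_mult_integrable[OF w cL[of 1]] L2_integrable[OF w] by auto
  define m where "m = (LINT x|?\<mu>. w x) / ?d"
  have d: "?d > 0" by (rule length_pos)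
  have lin: "(LINT x|?\<mu>. (w x - c) * e) = (m - c) * ?d * e" for c e
  proof -
    have "(LINT x|?\<mu>. (w x - c) * e) = (LINT x|?\<mu>. w x - c) * e" by simp
    also have "(LINT x|?\<mu>. w x - c) = (LINT x|?\<mu>. w x) - c * ?d"
      using iw(1) ic[of c] by (simp add: edge_measure_total)
    also have "(LINT x|?\<mu>. w x) = m * ?d" using d by (simp add: m_def)
    finally show ?thesis by (simp add: left_diff_distrib)
  qed
  have "edge_proj0 E w = m"
    unfolding edge_proj0_def lin using d by (intro the_equality) (auto dest!: spec[of _ 1])
  moreover have sq: "(L2_nrm ?\<mu> (\<lambda>x. w x - c))\<^sup>2 = (LINT x|?\<mu>. (w x)\<^sup>2) - m\<^sup>2 * ?d + (m - c)\<^sup>2 * ?d" for c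
  proof -
    have "(L2_nrm ?\<mu> (\<lambda>x. w x - c))\<^sup>2 = (LINT x|?\<mu>. (w x)\<^sup>2 - (2 * c) * w x + c\<^sup>2)"
      unfolding L2_nrm_real_sq by (simp add: power2_diff algebra_simps)
    also have "\<dots> = (LINT x|?\<mu>. (w x)\<^sup>2) - (2 * c) * (LINT x|?\<mu>. w x) + c\<^sup>2 * ?d"
      using iw ic[of "c\<^sup>2"] by (simp add: edge_measure_total mult.commute)
    also have "(LINT x|?\<mu>. w x) = m * ?d" using d by (simp add: m_def)
    finally show ?thesis by (simp add: power2_eq_square algebra_simps)
  qed
  ultimately have "(L2_nrm ?\<mu> (\<lambda>x. w x - edge_proj0 E w))\<^sup>2 \<le> (L2_nrm ?\<mu> (\<lambda>x. w x - c))\<^sup>2"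
    using d by simp
  then show ?thesis by (rule power2_le_imp_le) (rule L2_nrm_nonneg)
qed

end

context plate_problem
begin

lemma interior_edges_finite: "finite (interior_edges \<Omega> \<T>)"
  using finite_edges by (simp add: interior_edges_def)

text \<open>After the sums are exchanged, a triangle is counted once for each of its interior edges,
  hence at most 8 times.\<close>

lemma sum_over_sides_le:
  fixes s :: "plane set \<Rightarrow> real"
  assumes s: "\<And>T. 0 \<le> s T"
  shows "(\<Sum>E\<in>interior_edges \<Omega> \<T>. s (side_of E 1) + s (side_of E (-1))) \<le> 8 * (\<Sum>T\<in>\<T>. s T)"
proof -
  let ?I = "interior_edges \<Omega> \<T>"
  have "(\<Sum>E\<in>?I. s (side_of E 1) + s (side_of E (-1))) \<le> (\<Sum>E\<in>?I. \<Sum>T\<in>\<T>. if E edge_of T then s T else 0)"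
  proof (rule sum_mono)
    fix E assume E: "E \<in> ?I"
    have sd: "side_of E \<sigma> \<in> \<T>" "E edge_of side_of E \<sigma>" if "\<sigma> = 1 \<or> \<sigma> = -1" for \<sigma>
      using side_of[OF E that] by auto
    have "s (side_of E 1) + s (side_of E (-1)) = (\<Sum>T\<in>{side_of E 1, side_of E (-1)}. if E edge_of T then s T else 0)"
      using sd side_of_neq[OF E] by simp
    also have "\<dots> \<le> (\<Sum>T\<in>\<T>. if E edge_of T then s T else 0)"
      using sd s finite_mesh by (intro sum_mono2) auto
    finally show "s (side_of E 1) + s (side_of E (-1)) \<le> (\<Sum>T\<in>\<T>. if E edge_of T then s T else 0)" .
  qed
  also have "\<dots> = (\<Sum>T\<in>\<T>. \<Sum>E\<in>?I. if E edge_of T then s T else 0)" by (rule sum.swap)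
  also have "\<dots> = (\<Sum>T\<in>\<T>. real (card {E \<in> ?I. E edge_of T}) * s T)"
    using interior_edges_finite by (intro sum.cong refl) (simp add: sum.If_cases Int_def)
  also have "\<dots> \<le> (\<Sum>T\<in>\<T>. 8 * s T)"
  proof (intro sum_mono mult_right_mono s)
    fix T assume "T \<in> \<T>"
    note c = edges_of_triangle_card[OF triangles[OF this]]
    have "card {E \<in> ?I. E edge_of T} \<le> card {E. E edge_of T}" using c(1) by (intro card_mono) auto
    then show "real (card {E \<in> ?I. E edge_of T}) \<le> 8" using c(2) by linarith
  qed
  finally show ?thesis by (simp add: sum_distrib_left)
qed

lemma mu1_sq_eq: "mu1_sq \<Omega> \<T> F = (\<Sum>T\<in>\<T>. ((diameter T)\<^sup>2 * L2_nrm (lebesgue_on (interior T)) (residual T))\<^sup>2)"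
proof -
  let ?q = "\<lambda>T x. (diameter T)\<^sup>2 * residual T x"
  have "mu1_sq \<Omega> \<T> F = (LINT x|lebesgue_on \<Omega>. (pw \<T> ?q x)\<^sup>2)"
    unfolding mu1_sq_def residual_def[symmetric] by (simp add: L2_nrm_real_sq)
  also have "\<dots> = (\<Sum>T\<in>\<T>. LINT x|lebesgue_on (interior T). (?q T x)\<^sup>2)"
    by (rule domain_integral)
       (auto simp: pw_in pw_out intro!: L2_integrable L2_cmult smooth_L2 tpoly_smooth[OF residual_tpoly] interior_sets)
  also have "\<dots> = (\<Sum>T\<in>\<T>. ((diameter T)\<^sup>2 * L2_nrm (lebesgue_on (interior T)) (residual T))\<^sup>2)"
    unfolding L2_nrm_real_sq[symmetric] L2_nrm_cmult by simp
  finally show ?thesis .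
qed

lemma energy_nrm_sq: "(energy_nrm \<Omega> \<T> (\<lambda>T x. u x - uh T x))\<^sup>2 = (\<Sum>T\<in>\<T>. (energy_error T)\<^sup>2)"
proof -
  let ?q = "\<lambda>T. weak_hessian (interior T) (\<lambda>x. u x - uh T x)"
  have "(energy_nrm \<Omega> \<T> (\<lambda>T x. u x - uh T x))\<^sup>2 = (LINT x|lebesgue_on \<Omega>. (norm (pw \<T> ?q x))\<^sup>2)"
    by (simp add: energy_nrm_def L2_nrm_def)
  also have "\<dots> = (\<Sum>T\<in>\<T>. LINT x|lebesgue_on (interior T). (norm (?q T x))\<^sup>2)"
    by (rule domain_integral) (auto simp: pw_in pw_out intro: weak_hessian_error_integrable)
  also have "\<dots> = (\<Sum>T\<in>\<T>. (energy_error T)\<^sup>2)"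
    by (simp add: energy_error_def L2_nrm_def)
  finally show ?thesis .
qed

lemma apx_sq_nonneg: "0 \<le> apx_sq f E\<Gamma> g F G T"
  by (auto simp: apx_sq_def intro!: add_nonneg_nonneg sum_nonneg)

definition local_square :: "plane set \<Rightarrow> real" where
  "local_square T = (energy_error T)\<^sup>2 + apx_sq f E\<Gamma> g F G T"

lemma local_square_nonneg: "0 \<le> local_square T"
  by (simp add: local_square_def apx_sq_nonneg)

lemma local_square_sum:
  "(\<Sum>T\<in>\<T>. local_square T) \<le> (energy_nrm \<Omega> \<T> (\<lambda>T x. u x - uh T x) + apx \<T> f E\<Gamma> g F G)\<^sup>2"
proof -
  let ?e = "energy_nrm \<Omega> \<T> (\<lambda>T x. u x - uh T x)" and ?a = "apx \<T> f E\<Gamma> g F G"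
  have "?a\<^sup>2 = (\<Sum>T\<in>\<T>. apx_sq f E\<Gamma> g F G T)" by (simp add: apx_def sum_nonneg apx_sq_nonneg)
  then have "(\<Sum>T\<in>\<T>. local_square T) = ?e\<^sup>2 + ?a\<^sup>2" by (simp add: local_square_def sum.distrib energy_nrm_sq)
  also have "\<dots> \<le> (?e + ?a)\<^sup>2"
    by (simp add: power2_sum energy_nrm_def apx_def L2_nrm_nonneg sum_nonneg apx_sq_nonneg)
  finally show ?thesis .
qed

lemma data_error_squares_le: "(\<Sum>\<alpha>\<in>multi_upto 2. (data_error \<alpha> T)\<^sup>2) \<le> apx_sq f E\<Gamma> g F G T"
  by (auto simp: apx_sq_def data_error_def intro!: add_nonneg_nonneg sum_nonneg)

text \<open>Six data errors give the factor 6 for the square of their sum, and splitting off the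
  energy part doubles it.\<close>

lemma local_error_sq_le: "(local_error T)\<^sup>2 \<le> 12 * local_square T"
proof -
  let ?d = "\<Sum>\<alpha>\<in>multi_upto 2. data_error \<alpha> T"
  have "?d\<^sup>2 \<le> 6 * apx_sq f E\<Gamma> g F G T"
    using sum_squared_le_sum_of_squares[of "\<lambda>\<alpha>. data_error \<alpha> T" "multi_upto 2"] data_error_squares_le[of T]
    unfolding card_multi_upto_2 by simp
  moreover have "(energy_error T + ?d)\<^sup>2 \<le> 2 * (energy_error T)\<^sup>2 + 2 * ?d\<^sup>2"
    using zero_le_power2[of "energy_error T - ?d"] by (simp add: power2_eq_square algebra_simps)
  ultimately have "(energy_error T + ?d)\<^sup>2 \<le> 12 * (energy_error T)\<^sup>2 + 12 * apx_sq f E\<Gamma> g F G T"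
    using zero_le_power2[of "energy_error T"] by linarith
  then show ?thesis unfolding local_error_def local_square_def by simp
qed

text \<open>The plus side has E among its edges, so its contribution to \<open>apx\<close> contains
  this term.\<close>

lemma edge_data_error_sq_le:
  assumes E: "E \<in> interior_edges \<Omega> \<T>" and j: "j = 0 \<or> j = 1"
  shows "(edge_data_error j E)\<^sup>2 \<le> local_square (side_of E 1)"
proof (cases "E \<in> E\<Gamma> j")
  case True
  let ?e = "\<lambda>j E. (L2_nrm (edge_measure E) (\<lambda>x. diameter E powr (3/2 - real j) * (g j x - G j x)))\<^sup>2"
  let ?T = "side_of E 1"
  have j2: "j \<in> {0, 1}" using j by auto
  have "?e j E \<le> (\<Sum>E\<in>{E \<in> E\<Gamma> j. E edge_of ?T}. ?e j E)"
    using True side_of(2)[OF E] finite_E\<Gamma>[OF j2] by (intro member_le_sum) auto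
  also have "\<dots> \<le> (\<Sum>j\<in>{0, 1}. \<Sum>E\<in>{E \<in> E\<Gamma> j. E edge_of ?T}. ?e j E)"
    using j2 by (intro member_le_sum[of j "{0, 1}" "\<lambda>j. \<Sum>E\<in>{E \<in> E\<Gamma> j. E edge_of ?T}. ?e j E"]) (auto intro: sum_nonneg)
  also have "\<dots> \<le> apx_sq f E\<Gamma> g F G ?T" unfolding apx_sq_def by (simp only: le_add_same_cancel2) (simp add: sum_nonneg)
  also have "\<dots> \<le> local_square ?T" by (simp add: local_square_def)
  finally show ?thesis using True by (simp add: edge_data_error_def)
next
  case False
  then show ?thesis by (simp add: edge_data_error_def local_square_nonneg)
qed

lemma edge_residual_L2:
  assumes E: "E \<in> interior_edges \<Omega> \<T>" and j: "j = 0 \<or> j = 1"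
  shows "edge_residual j E \<in> L2 (edge_measure E)"
proof -
  interpret mesh_edge "\<tau> E" "1 *\<^sub>R \<nu> E" "side_of E 1" E
    unfolding mesh_edge_def by (rule side_of_oriented[OF E]) simp
  obtain q where q: "q \<in> tpoly (k + 2)" "E \<in> E\<Gamma> j \<Longrightarrow> \<forall>x\<in>rel_interior E. G j x = q x"
    using edge_data_tpoly[OF j] by blast
  have sd: "side_of E 1 \<in> \<T>" "side_of E (-1) \<in> \<T>" using side_of(1)[OF E] by auto
  define p where "p x = (if E \<in> E\<Gamma> j then 1 else 0) * q x + (edge_density j E (side_of E 1) x - edge_density j E (side_of E (-1)) x)" for x
  have p: "smooth p" unfolding p_def[abs_def]
    by (intro tpoly_smooth[of _ "k + 2"] tpoly.add tpoly_cmult tpoly_diff edge_density_tpoly q sd)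
  have "edge_residual j E x = p x" if "x \<in> rel_interior E" for x
    using q(2) that by (auto simp: edge_residual_def ext_zero_def p_def)
  from edge_measurable_if_eq[OF smooth_measurable[OF p] this]
  show ?thesis using L2_cong_AE[OF smooth_edge_L2[OF p]] by (auto simp: eq_commute)
qed

lemma mu2_sq_eq: "mu2_sq \<Omega> \<T> \<nu> \<tau> E\<Gamma> F G
    = (\<Sum>E\<in>interior_edges \<Omega> \<T>. diameter E ^ 3 * (L2_nrm (edge_measure E) (edge_residual 0 E))\<^sup>2)"
proof -
  have "edge_residual 0 E = (\<lambda>x. ext_zero (E\<Gamma> 0) (G 0) E x +
        jump \<Omega> \<T> \<nu> E (\<lambda>T y. vec_F1 F T y - row_divergence (mat_F2 F T) y
          - frechet_derivative (\<lambda>y'. mat_F2 F T y' *v \<tau> E) (at y) (\<tau> E)) x \<bullet> \<nu> E)"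
    if "E \<in> interior_edges \<Omega> \<T>" for E
    using that by (simp add: fun_eq_iff edge_residual_def edge_density_def shear_def jump_def side_of_def inner_diff_left)
  then show ?thesis by (simp add: mu2_sq_def)
qed

text \<open>If \<open>Ih = id\<close>, the integrand before projection differs from the edge
  residual by a constant on E, the normal-normal component of the jump of the Hessians of
  \<open>uh\<close>, and the mean value is the best constant. Otherwise the two sums
  coincide.\<close>

lemma mu3_sq_le: "mu3_sq \<Omega> \<T> \<nu> E\<Gamma> F G Ih uh
    \<le> (\<Sum>E\<in>interior_edges \<Omega> \<T>. diameter E * (L2_nrm (edge_measure E) (edge_residual 1 E))\<^sup>2)"
proof -
  let ?I = "interior_edges \<Omega> \<T>"
  have eq: "edge_residual 1 E = (\<lambda>x. ext_zero (E\<Gamma> 1) (G 1) E x +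
      jump \<Omega> \<T> \<nu> E (\<lambda>T y. (mat_F2 F T y - hessian (uh T) y) *v \<nu> E) x \<bullet> \<nu> E)" if "E \<in> ?I" for E
    using that by (simp add: fun_eq_iff edge_residual_def edge_density_def moment_def jump_def side_of_def inner_diff_left)
  show ?thesis
  proof (cases "Ih = id")
    case False
    then show ?thesis by (simp add: mu3_sq_def eq del: One_nat_def)
  next
    case True
    define w where "w E = (\<lambda>x. ext_zero (E\<Gamma> 1) (G 1) E x + jump \<Omega> \<T> \<nu> E (\<lambda>T y. mat_F2 F T y *v \<nu> E) x \<bullet> \<nu> E)" for E
    have mean: "diameter E * (L2_nrm (edge_measure E) (\<lambda>x. w E x - edge_proj0 E (w E)))\<^sup>2 \<le> diameter E * (L2_nrm (edge_measure E) (edge_residual 1 E))\<^sup>2"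
      if E: "E \<in> ?I" for E
    proof -
      interpret mesh_edge "\<tau> E" "1 *\<^sub>R \<nu> E" "side_of E 1" E
        unfolding mesh_edge_def by (rule side_of_oriented[OF E]) simp
      have sd: "side_of E 1 \<in> \<T>" "side_of E (-1) \<in> \<T>" using side_of(1)[OF E] by auto
      have const: "\<exists>H. hessian (uh T) = (\<lambda>x. H)" if T: "T \<in> \<T>" for T
      proof -
        obtain h where "\<And>i j. partial i (partial j (uh T)) = (\<lambda>x. h i j)" using uh_hessian_const[OF T] by metis
        then show ?thesis by (auto simp: hessian_def fun_eq_iff)
      qed
      obtain h h' where h: "hessian (uh (side_of E 1)) = (\<lambda>x. h)" "hessian (uh (side_of E (-1))) = (\<lambda>x. h')"
        using const[OF sd(1)] const[OF sd(2)] by blast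
      define c where "c = ((h - h') *v \<nu> E) \<bullet> \<nu> E"
      have wc: "edge_residual 1 E = (\<lambda>x. w E x - c)"
        unfolding eq[OF E] w_def c_def using E h
        by (simp add: fun_eq_iff jump_def side_of_def matrix_vector_mult_diff_rdistrib inner_diff_left)
      have "(\<lambda>x. edge_residual 1 E x - (- c)) \<in> L2 (edge_measure E)"
        by (intro L2_diff edge_residual_L2 E edge_bounded_L2(1)[of _ "\<bar>c\<bar>"]) auto
      then have "w E \<in> L2 (edge_measure E)" unfolding wc by simp
      from L2_nrm_minus_mean_le[OF this, of c] show ?thesis
        unfolding wc by (intro mult_left_mono power_mono L2_nrm_nonneg less_imp_le[OF length_pos])
    qed
    have "mu3_sq \<Omega> \<T> \<nu> E\<Gamma> F G Ih uh = (\<Sum>E\<in>?I. diameter E * (L2_nrm (edge_measure E) (\<lambda>x. w E x - edge_proj0 E (w E)))\<^sup>2)"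
      using True by (simp add: mu3_sq_def Let_def w_def del: One_nat_def)
    also have "\<dots> \<le> (\<Sum>E\<in>?I. diameter E * (L2_nrm (edge_measure E) (edge_residual 1 E))\<^sup>2)"
      by (rule sum_mono[OF mean])
    finally show ?thesis .
  qed
qed

text \<open>The square of a sum of three terms costs the factor 3, and the plus side carries 12 for
  its local error and 1 for the edge data, which makes 39. The overlap 8 turns this into 312, and
  the two edge sums into 624.\<close>

lemma estimator_le:
  assumes C: "0 \<le> C1" "0 \<le> C3"
    and interior: "\<And>T. T \<in> \<T> \<Longrightarrow> (diameter T)\<^sup>2 * L2_nrm (lebesgue_on (interior T)) (residual T) \<le> C1 * local_error T"
    and edge: "\<And>E j. E \<in> interior_edges \<Omega> \<T> \<Longrightarrow> j = 0 \<or> j = 1 \<Longrightarrow>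
      diameter E ^ (3 - 2 * j) * (L2_nrm (edge_measure E) (edge_residual j E))\<^sup>2
        \<le> (C3 * (local_error (side_of E 1) + local_error (side_of E (-1)) + edge_data_error j E))\<^sup>2"
  shows "estimator \<Omega> \<T> \<nu> \<tau> E\<Gamma> F G Ih uh
    \<le> sqrt (12 * C1\<^sup>2 + 624 * C3\<^sup>2) * (energy_nrm \<Omega> \<T> (\<lambda>T x. u x - uh T x) + apx \<T> f E\<Gamma> g F G)"
proof -
  let ?I = "interior_edges \<Omega> \<T>" and ?s = local_square
  let ?S = "\<Sum>T\<in>\<T>. ?s T" and ?e = "energy_nrm \<Omega> \<T> (\<lambda>T x. u x - uh T x) + apx \<T> f E\<Gamma> g F G"
  have 1: "mu1_sq \<Omega> \<T> F \<le> 12 * C1\<^sup>2 * ?S"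
  proof -
    have "mu1_sq \<Omega> \<T> F \<le> (\<Sum>T\<in>\<T>. (C1 * local_error T)\<^sup>2)"
      unfolding mu1_sq_eq by (intro sum_mono power_mono interior) (simp_all add: L2_nrm_nonneg)
    also have "\<dots> \<le> (\<Sum>T\<in>\<T>. C1\<^sup>2 * (12 * ?s T))"
      unfolding power_mult_distrib by (intro sum_mono mult_left_mono local_error_sq_le) simp
    finally show ?thesis by (simp add: sum_distrib_left mult_ac)
  qed
  have 2: "(\<Sum>E\<in>?I. diameter E ^ (3 - 2 * j) * (L2_nrm (edge_measure E) (edge_residual j E))\<^sup>2) \<le> 312 * C3\<^sup>2 * ?S"
    if j: "j = 0 \<or> j = 1" for j
  proof -
    have "(\<Sum>E\<in>?I. diameter E ^ (3 - 2 * j) * (L2_nrm (edge_measure E) (edge_residual j E))\<^sup>2)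
      \<le> (\<Sum>E\<in>?I. C3\<^sup>2 * (39 * (?s (side_of E 1) + ?s (side_of E (-1)))))"
    proof (rule sum_mono)
      fix E assume E: "E \<in> ?I"
      let ?a = "local_error (side_of E 1)" and ?b = "local_error (side_of E (-1))" and ?c = "edge_data_error j E"
      have "(?a + ?b + ?c)\<^sup>2 \<le> 3 * (?a\<^sup>2 + ?b\<^sup>2 + ?c\<^sup>2)" by (rule square_sum3_le)
      also have "\<dots> \<le> 3 * (12 * ?s (side_of E 1) + 12 * ?s (side_of E (-1)) + ?s (side_of E 1))"
        by (intro mult_left_mono add_mono local_error_sq_le edge_data_error_sq_le[OF E j]) simp
      also have "\<dots> \<le> 39 * (?s (side_of E 1) + ?s (side_of E (-1)))"
        using local_square_nonneg[of "side_of E (-1)"] by simp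
      finally have "C3\<^sup>2 * (?a + ?b + ?c)\<^sup>2 \<le> C3\<^sup>2 * (39 * (?s (side_of E 1) + ?s (side_of E (-1))))"
        by (rule mult_left_mono) simp
      with edge[OF E j] show "diameter E ^ (3 - 2 * j) * (L2_nrm (edge_measure E) (edge_residual j E))\<^sup>2
        \<le> C3\<^sup>2 * (39 * (?s (side_of E 1) + ?s (side_of E (-1))))"
        unfolding power_mult_distrib by linarith
    qed
    also have "\<dots> = 39 * C3\<^sup>2 * (\<Sum>E\<in>?I. ?s (side_of E 1) + ?s (side_of E (-1)))"
      by (simp add: sum_distrib_left mult_ac)
    also have "\<dots> \<le> 39 * C3\<^sup>2 * (8 * ?S)"
      by (intro mult_left_mono sum_over_sides_le local_square_nonneg) simp
    finally show ?thesis by simp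
  qed
  have "mu1_sq \<Omega> \<T> F + mu2_sq \<Omega> \<T> \<nu> \<tau> E\<Gamma> F G + mu3_sq \<Omega> \<T> \<nu> E\<Gamma> F G Ih uh \<le> (12 * C1\<^sup>2 + 624 * C3\<^sup>2) * ?S"
    using 1 2[of 0] 2[of 1] mu3_sq_le[of Ih] by (simp add: mu2_sq_eq distrib_right)
  also have "\<dots> \<le> (12 * C1\<^sup>2 + 624 * C3\<^sup>2) * ?e\<^sup>2"
    by (intro mult_left_mono local_square_sum) simp
  finally have "estimator \<Omega> \<T> \<nu> \<tau> E\<Gamma> F G Ih uh \<le> sqrt ((12 * C1\<^sup>2 + 624 * C3\<^sup>2) * ?e\<^sup>2)"
    unfolding estimator_def by simp
  also have "\<dots> = sqrt (12 * C1\<^sup>2 + 624 * C3\<^sup>2) * ?e"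
    by (simp add: real_sqrt_mult energy_nrm_def apx_def L2_nrm_nonneg sum_nonneg apx_sq_nonneg)
  finally show ?thesis .
qed

end

section \<open>Choice of the constants and conclusion\<close>

theorem proposition7p4:
  fixes \<kappa> :: real and k :: nat
  shows "\<exists>C>0. \<forall>\<Omega> \<T> \<nu> \<tau> f E\<Gamma> g A \<beta> F G Vh Ih u uh.
    bounded \<Omega> \<and> polygonal \<Omega> \<and> Lipschitz_domain \<Omega> \<and>
    conforming_triangulation \<Omega> \<T> \<and> shape_regular \<kappa> \<T> \<and> edge_frames \<Omega> \<T> \<nu> \<tau> \<and>
    (\<forall>\<alpha>\<in>multi_upto 2. f \<alpha> \<in> L2 (lebesgue_on \<Omega>)) \<and>
    (\<forall>j\<in>{0, 1}. E\<Gamma> j \<subseteq> interior_edges \<Omega> \<T> \<and> (\<forall>E\<in>E\<Gamma> j. g j \<in> L2 (edge_measure E))) \<and>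
    finite A \<and> A \<subseteq> interior_vertices \<Omega> \<T> \<and>
    (Vh, Ih) \<in> {(Morley \<Omega> \<T> \<nu>, id), (pw_poly 2 \<T>, id), (S20 \<Omega> \<T>, I_C \<Omega> \<T> \<nu>)} \<and>
    u \<in> H0_space 2 \<Omega> \<and>
    (\<forall>v\<in>H0_space 2 \<Omega>. a_pw \<Omega> \<T> (\<lambda>T. u) (\<lambda>T. v) = F_hat \<Omega> \<T> \<nu> f E\<Gamma> g A \<beta> (\<lambda>T. v)) \<and>
    uh \<in> Vh \<and>
    (\<forall>j\<in>{0, 1}. edgewise_poly k (E\<Gamma> j) (G j)) \<and>
    (\<forall>\<alpha>\<in>multi_upto 2. F \<alpha> \<in> pw_poly k \<T>) \<longrightarrow>
    inverse C * estimator \<Omega> \<T> \<nu> \<tau> E\<Gamma> F G Ih uh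
      \<le> energy_nrm \<Omega> \<T> (\<lambda>T x. u x - uh T x) + apx \<T> f E\<Gamma> g F G"
proof -
  \<comment> \<open>\<open>K\<close> bounds the diameter by the radius of an inscribed ball, and
    \<open>L\<close> bounds lengths by the half-side of the test squares: triangles require 2 K,
    edges 8 K for their own length and 4 K^2 for the adjacent triangles. All of these are at most 8
    K^2, as K is at least 1.\<close>
  define K L where "K = max 1 (4 * \<kappa>)" and "L = 8 * K\<^sup>2"
  \<comment> \<open>Twice k + 2, the degree of the moment residual restricted to a line. It also
    covers the degree k of the volume residual and the two derivatives of the test
    functions.\<close>
  define N where "N = 2 * k + 4"
  have K: "1 \<le> K" by (simp add: K_def)
  have L: "1 \<le> L" "2 * K \<le> L"
  proof -
    have "K * 1 \<le> K * K" using K by (intro mult_left_mono) auto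
    then have "K \<le> K\<^sup>2" by (simp add: power2_eq_square)
    then show "1 \<le> L" "2 * K \<le> L" using K unfolding L_def by linarith+
  qed
  obtain B where B: "1 \<le> B" "\<forall>i\<le>N. \<forall>n\<le>N. \<forall>y. \<bar>(deriv ^^ n) (bump_pow i) y\<bar> \<le> B"
    using bump_pow_derivs_bounded[of N] by blast
  obtain \<delta>1 where \<delta>1: "\<delta>1 > 0" "\<And>c. \<delta>1 * (\<Sum>i\<le>N. \<bar>c i\<bar>)\<^sup>2 \<le> (LINT y|lborel. (\<Sum>i\<le>N. c i * y ^ i)\<^sup>2 * bump y)"
    using weighted_square_coercive[of N] by blast
  obtain \<delta>2 where \<delta>2: "\<delta>2 > 0" "\<And>c. \<delta>2 * (\<Sum>i\<le>N. \<Sum>j\<le>N. \<bar>c i j\<bar>)\<^sup>2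
      \<le> (LINT s|lborel. LINT t|lborel. (\<Sum>i\<le>N. \<Sum>j\<le>N. c i j * s ^ i * t ^ j)\<^sup>2 * (bump s * bump t))"
    using weighted_square_coercive_2[of N] by blast
  define C1 where "C1 = 64 * L ^ (2 * N + 4) * B\<^sup>2 / \<delta>2"
  define C3 where "C3 = L ^ (N + 2) * (32 * L * B\<^sup>2 + 8 * C1 * B\<^sup>2 + B\<^sup>2) / (bump 0 * \<delta>1)"
  have b0: "bump 0 > 0" by (simp add: bump_pos)
  have C1: "0 \<le> C1" using L \<delta>2(1) by (simp add: C1_def)
  have C3: "0 \<le> C3" using L \<delta>1(1) C1 b0 by (simp add: C3_def)
  \<comment> \<open>The summand 1 makes the constant positive without a lower bound for
    \<open>C1\<close> or \<open>C3\<close> beyond 0.\<close>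
  define C where "C = sqrt (12 * C1\<^sup>2 + 624 * C3\<^sup>2) + 1"
  have C0: "C > 0" by (simp add: C_def add_nonneg_pos)
  show ?thesis
  proof (intro exI[of _ C] conjI C0 allI impI, elim conjE)
    fix \<Omega> \<T> \<nu> \<tau> f E\<Gamma> g A \<beta> F G Vh Ih u uh
    assume h: "bounded \<Omega>" "Lipschitz_domain \<Omega>" "conforming_triangulation \<Omega> \<T>" "edge_frames \<Omega> \<T> \<nu> \<tau>"
      "\<forall>\<alpha>\<in>multi_upto 2. f \<alpha> \<in> L2 (lebesgue_on \<Omega>)"
      "\<forall>j\<in>{0, 1}. E\<Gamma> j \<subseteq> interior_edges \<Omega> \<T> \<and> (\<forall>E\<in>E\<Gamma> j. g j \<in> L2 (edge_measure E))"
      "A \<subseteq> interior_vertices \<Omega> \<T>" "u \<in> H0_space 2 \<Omega>"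
      "\<forall>v\<in>H0_space 2 \<Omega>. a_pw \<Omega> \<T> (\<lambda>T. u) (\<lambda>T. v) = F_hat \<Omega> \<T> \<nu> f E\<Gamma> g A \<beta> (\<lambda>T. v)"
      "\<forall>j\<in>{0, 1}. edgewise_poly k (E\<Gamma> j) (G j)" "\<forall>\<alpha>\<in>multi_upto 2. F \<alpha> \<in> pw_poly k \<T>"
      and sr: "shape_regular \<kappa> \<T>" and Vh: "uh \<in> Vh"
      "(Vh, Ih) \<in> {(Morley \<Omega> \<T> \<nu>, id), (pw_poly 2 \<T>, id), (S20 \<Omega> \<T>, I_C \<Omega> \<T> \<nu>)}"
    have uh: "uh \<in> pw_poly 2 \<T>" using Vh by (auto simp: Morley_def S20_def)
    interpret plate_problem \<Omega> \<T> \<nu> \<tau> f E\<Gamma> g A \<beta> F G u uh k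
      by unfold_locales (use h uh in blast)+
    have ball: "\<exists>x r. r > 0 \<and> cball x r \<subseteq> T \<and> diameter T \<le> K * r" if "T \<in> \<T>" for T
      using shape_regular_ball[OF triangles[OF that], of \<kappa>] sr that unfolding shape_regular_def K_def by metis
    let ?e = "energy_nrm \<Omega> \<T> (\<lambda>T x. u x - uh T x) + apx \<T> f E\<Gamma> g F G"
    have 1: "(diameter T)\<^sup>2 * L2_nrm (lebesgue_on (interior T)) (residual T) \<le> C1 * local_error T"
      if T: "T \<in> \<T>" for T
    proof -
      obtain x r where "r > 0" "cball x r \<subseteq> T" "diameter T \<le> K * r" using ball[OF T] by blast
      from interior_residual_bound[OF T this L _ _ B(2) \<delta>2] show ?thesis by (simp add: C1_def N_def)
    qed
    have 2: "diameter E ^ (3 - 2 * j) * (L2_nrm (edge_measure E) (edge_residual j E))\<^sup>2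
        \<le> (C3 * (local_error (side_of E 1) + local_error (side_of E (-1)) + edge_data_error j E))\<^sup>2"
      if "E \<in> interior_edges \<Omega> \<T>" "j = 0 \<or> j = 1" for E j
      unfolding C3_def
      by (rule edge_residual_bound[OF that K ball _ _ B \<delta>1 C1 1]) (simp_all add: L_def N_def)
    have e: "0 \<le> ?e"
      by (simp add: energy_nrm_def apx_def L2_nrm_nonneg sum_nonneg apx_sq_nonneg)
    have "estimator \<Omega> \<T> \<nu> \<tau> E\<Gamma> F G Ih uh \<le> (C - 1) * ?e"
      using estimator_le[OF C1 C3 1 2] by (simp add: C_def)
    also have "\<dots> \<le> C * ?e" using e by (intro mult_right_mono) auto
    finally show "inverse C * estimator \<Omega> \<T> \<nu> \<tau> E\<Gamma> F G Ih uh \<le> ?e"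
      using C0 by (simp add: field_simps)
  qed
qed

end
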